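(* Fix an o-minimal structure and let $M\subset\mathbb{R}^d$ be a constructible (i.e. compact definable) set. Then for every $1\le p\le\infty$ the map $\operatorname{PHT}(M):S^{d-1}\to\mathrm{Dgm}^d$ is continuous, where $S^{d-1}$ is given the Euclidean distance and $\mathrm{Dgm}$ is given the Wasserstein $p$-distance $W_p$.
   Context: An o-minimal structure $\mathcal{O}=\{\mathcal{O}_d\}_{d\ge 0}$ here means: for each $d$ a collection $\mathcal{O}_d$ of subsets of $\mathbb{R}^d$ closed under intersection and complement, such that $A\in\mathcal{O}_d$ implies $A\times\mathbb{R},\mathbb{R}\times A\in\mathcal{O}_{d+1}$; $A\in\mathcal{O}_{d+1}$ implies $\pi(A)\in\mathcal{O}_d$ for axis-aligned projections $\pi$; the order, addition and multiplication of $\mathbb{R}$ are in the structure, with real constants allowed (so all semialgebraic sets belong to it); and $\mathcal{O}_1$ consists exactly of the finite unions of points and open intervals. Elements are called definable sets. For $v\in S^{d-1}$, $t\in\mathbb{R}$ let $h_v(x)=\langle v,x\rangle$ on $M$ and $M_{v,t}=\{x\in M: x\cdot v\le t\}$. Homology $H_k$ is with coefficients in a fixed field. The degree-$k$ persistence diagram $PH_k(M,h_v)$ is the unique finite multiset of off-diagonal points $(b,e)$, $b\in\{-\infty\}\cup\mathbb{R}$, $e\in\mathbb{R}\cup\{\infty\}$, $b<e$, such that for all $s\le t$ the rank of the inclusion-induced map $H_k(M_{v,s})\to H_k(M_{v,t})$ equals the number of points (with multiplicity) in $[-\infty,s]\times(t,\infty]$. $\operatorname{PHT}(M)(v)=(PH_0(M,h_v),\dots,PH_{d-1}(M,h_v))$.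 $\mathrm{Dgm}$ is the set of countable multisets of points $(b,e)$, $b\in\{-\infty\}\cup\mathbb{R}$, $e\in\mathbb{R}\cup\{\infty\}$, $b\le e$, with finitely many points having an infinite coordinate and $\sum_{e-b<\infty}(e-b)<\infty$. A matching $\sigma$ between diagrams $\mathcal{B},\mathcal{B}'$ is a partial bijection (regarding multiset elements as distinct labelled points); it is completed to a bijection by matching every unmatched point $(b,e)$ of either diagram (which must have finite coordinates) to its diagonal image $(\frac{b+e}{2},\frac{b+e}{2})$. Points with an infinite coordinate must be matched to points with the same infinite coordinate, and that coordinate contributes $0$ to the distance. Then $W_p(\mathcal{B},\mathcal{B}')=\inf_\sigma\big(\sum\|I-\sigma(I)\|_\infty^p\big)^{1/p}$, the sum running over all matched pairs of the completed matching, and for $p=\infty$ the sum is replaced by the supremum (the bottleneck distance). $\mathrm{Dgm}^d$ carries the product topology. *)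

theory Defs
  imports
    "HOL-Analysis.Analysis"
    "HOL-Homology.Homology"
    "HOL-Library.Multiset"
    "Jordan_Normal_Form.Missing_VectorSpace"
begin

section \<open>O-minimal structures\<close>

text \<open>
  A point of \<open>\<real>\<^sup>d\<close> is represented by a list of length \<open>d\<close>, because the members \<open>\<O> d\<close> of an
  o-minimal structure have to be related for different \<open>d\<close>.  That the order, addition and
  multiplication belong to the structure is required in every dimension and for every choice of
  coordinates; this makes every semialgebraic set a member.  Real constants need no axiom of their
  own, as points belong to \<open>\<O> 1\<close>.
\<close>

locale o_minimal_structure =
  fixes \<O> :: "nat \<Rightarrow> real list set set"
  assumes dimension: "A \<in> \<O> d \<Longrightarrow> A \<subseteq> {xs. length xs = d}"
    and inter: "A \<in> \<O> d \<Longrightarrow> B \<in> \<O> d \<Longrightarrow> A \<inter> B \<in> \<O> d"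
    and complement: "A \<in> \<O> d \<Longrightarrow> {xs. length xs = d} - A \<in> \<O> d"
    and times_line: "A \<in> \<O> d \<Longrightarrow> {xs @ [t] | xs t. xs \<in> A} \<in> \<O> (Suc d)"
    and line_times: "A \<in> \<O> d \<Longrightarrow> {t # xs | xs t. xs \<in> A} \<in> \<O> (Suc d)"
    and projection: "A \<in> \<O> (Suc d) \<Longrightarrow> i \<le> d \<Longrightarrow> (\<lambda>xs. take i xs @ drop (Suc i) xs) ` A \<in> \<O> d"
    and order: "i < d \<Longrightarrow> j < d \<Longrightarrow> {xs. length xs = d \<and> xs ! i < xs ! j} \<in> \<O> d"
    and addition: "i < d \<Longrightarrow> j < d \<Longrightarrow> k < d \<Longrightarrow>
      {xs. length xs = d \<and> xs ! i + xs ! j = xs ! k} \<in> \<O> d"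
    and multiplication: "i < d \<Longrightarrow> j < d \<Longrightarrow> k < d \<Longrightarrow>
      {xs. length xs = d \<and> xs ! i * xs ! j = xs ! k} \<in> \<O> d"
    and line: "\<O> 1 = {(\<lambda>x. [x]) ` \<Union>\<F> | \<F>. finite \<F> \<and>
      (\<forall>I\<in>\<F>. (\<exists>x. I = {x}) \<or> (open I \<and> is_interval I))}"

text \<open>
  The coordinates of \<^typ>\<open>real ^ 'n\<close> carry no order, so \<open>\<real>\<^sup>d\<close> is identified with \<^typ>\<open>real ^ 'n\<close>
  through an enumeration of \<^typ>\<open>'n\<close>.  The choice is immaterial, since definable sets are closed
  under permutations of the coordinates.
\<close>

definition definable_set :: "(nat \<Rightarrow> real list set set) \<Rightarrow> (real ^ 'n) set \<Rightarrow> bool" where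
  "definable_set \<O> M \<longleftrightarrow> (\<exists>e. bij_betw e {..<CARD('n)} (UNIV :: 'n set) \<and>
     (\<lambda>x. map (\<lambda>i. x $ e i) [0..<CARD('n)]) ` M \<in> \<O> CARD('n))"

definition constructible_set :: "(nat \<Rightarrow> real list set set) \<Rightarrow> (real ^ 'n) set \<Rightarrow> bool" where
  "constructible_set \<O> M \<longleftrightarrow> compact M \<and> definable_set \<O> M"


section \<open>Singular homology with coefficients in a field\<close>

text \<open>HOL-Homology only has integer coefficients; singular simplices and their faces are taken
  from there.\<close>

type_synonym ('a, 'k) field_chain = "((nat \<Rightarrow> real) \<Rightarrow> 'a) \<Rightarrow>\<^sub>0 'k"

abbreviation field_ring :: "'k :: field ring" where
  "field_ring \<equiv> \<lparr>carrier = UNIV, mult = (*), one = 1, zero = 0, add = (+)\<rparr>"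

definition chain_scale :: "'k :: field \<Rightarrow> ('a, 'k) field_chain \<Rightarrow> ('a, 'k) field_chain" where
  "chain_scale a c = Poly_Mapping.map ((*) a) c"

definition field_chains :: "nat \<Rightarrow> 'a topology \<Rightarrow> ('a, 'k :: field) field_chain set" where
  "field_chains p X = {c. Poly_Mapping.keys c \<subseteq> singular_simplex_set p X}"

definition field_boundary :: "nat \<Rightarrow> ('a, 'k :: field) field_chain \<Rightarrow> ('a, 'k) field_chain" where
  "field_boundary p c = (if p = 0 then 0 else
     \<Sum>f\<in>Poly_Mapping.keys c. \<Sum>i\<le>p.
       Poly_Mapping.single (singular_face p i f) ((- 1) ^ i * Poly_Mapping.lookup c f))"

definition cycles :: "nat \<Rightarrow> 'a topology \<Rightarrow> ('a, 'k :: field) field_chain set" where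
  "cycles p X = {c \<in> field_chains p X. field_boundary p c = 0}"

definition boundaries :: "nat \<Rightarrow> 'a topology \<Rightarrow> ('a, 'k :: field) field_chain set" where
  "boundaries p X = field_boundary (Suc p) ` field_chains (Suc p) X"

definition homology_class ::
    "nat \<Rightarrow> 'a topology \<Rightarrow> ('a, 'k :: field) field_chain \<Rightarrow> ('a, 'k) field_chain set" where
  "homology_class p X c = {c'. c' - c \<in> boundaries p X}"

text \<open>The quotient space of cycles modulo boundaries.  The multiplicative part of the record plays
  no role.\<close>

definition homology_space ::
    "nat \<Rightarrow> 'a topology \<Rightarrow> ('k :: field, ('a, 'k) field_chain set) module" where
  "homology_space p X =
    \<lparr>carrier = homology_class p X ` cycles p X,
     mult = (\<lambda>_ _. homology_class p X 0),
     one = homology_class p X 0,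
     zero = homology_class p X 0,
     add = (\<lambda>C D. \<Union>c\<in>C. \<Union>d\<in>D. homology_class p X (c + d)),
     smult = (\<lambda>a C. \<Union>c\<in>C. homology_class p X (chain_scale a c))\<rparr>"

text \<open>The map induced by an inclusion into \<open>Y\<close>: it sends the class of a cycle to the class of that
  cycle in \<open>Y\<close>.\<close>

definition induced_by_inclusion ::
    "nat \<Rightarrow> 'a topology \<Rightarrow> ('a, 'k :: field) field_chain set \<Rightarrow> ('a, 'k) field_chain set" where
  "induced_by_inclusion p Y C = (\<Union>c\<in>C. homology_class p Y c)"

definition induced_image :: "nat \<Rightarrow> 'a topology \<Rightarrow> 'a topology \<Rightarrow>
    ('k :: field, ('a, 'k) field_chain set) module" where
  "induced_image p X Y = homology_space p Y
     \<lparr>carrier := induced_by_inclusion p Y ` carrier (homology_space p X)\<rparr>"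

lemma lookup_chain_scale [simp]:
  "Poly_Mapping.lookup (chain_scale a c) f = a * Poly_Mapping.lookup c f"
  by (simp add: chain_scale_def Poly_Mapping.map.rep_eq when_def)

lemma chain_scale_simps:
  "chain_scale a (c + d) = chain_scale a c + chain_scale a d"
  "chain_scale a (c - d) = chain_scale a c - chain_scale a d"
  "chain_scale (a + b) c = chain_scale a c + chain_scale b c"
  "chain_scale (a * b) c = chain_scale a (chain_scale b c)"
  "chain_scale 1 c = c"
  "chain_scale (- 1) c = - c"
  "chain_scale a 0 = 0"
  by (rule poly_mapping_eqI; simp add: lookup_add lookup_minus algebra_simps)+

lemma chain_scale_sum: "chain_scale a (sum g I) = (\<Sum>i\<in>I. chain_scale a (g i))"
  by (induction I rule: infinite_finite_induct) (simp_all add: chain_scale_simps)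

lemma chain_scale_single: "chain_scale a (Poly_Mapping.single x b) = Poly_Mapping.single x (a * b)"
  by (rule poly_mapping_eqI) (simp add: lookup_single when_def)

lemma field_chains_closed:
  "0 \<in> field_chains p X"
  "c \<in> field_chains p X \<Longrightarrow> d \<in> field_chains p X \<Longrightarrow> c + d \<in> field_chains p X"
  "c \<in> field_chains p X \<Longrightarrow> chain_scale a c \<in> field_chains p X"
proof -
  show "0 \<in> field_chains p X" by (simp add: field_chains_def)
  show "c + d \<in> field_chains p X" if "c \<in> field_chains p X" "d \<in> field_chains p X"
    using that Poly_Mapping.keys_add[of c d] unfolding field_chains_def by blast
  have "Poly_Mapping.keys (chain_scale a c) \<subseteq> Poly_Mapping.keys c"
    by (auto simp: in_keys_iff)
  then show "chain_scale a c \<in> field_chains p X" if "c \<in> field_chains p X"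
    using that unfolding field_chains_def by blast
qed

lemma field_boundary_superset:
  assumes "finite F" "Poly_Mapping.keys c \<subseteq> F"
  shows "field_boundary p c = (if p = 0 then 0 else
     \<Sum>f\<in>F. \<Sum>i\<le>p.
       Poly_Mapping.single (singular_face p i f) ((- 1) ^ i * Poly_Mapping.lookup c f))"
  unfolding field_boundary_def using assms
  by (auto intro!: sum.mono_neutral_left simp: in_keys_iff)

lemma field_boundary_simps:
  "field_boundary p 0 = 0"
  "field_boundary p (c + d) = field_boundary p c + field_boundary p d"
  "field_boundary p (chain_scale a c) = chain_scale a (field_boundary p c)"
proof -
  show "field_boundary p 0 = 0" by (simp add: field_boundary_def)
  let ?F = "Poly_Mapping.keys c \<union> Poly_Mapping.keys d"
  show "field_boundary p (c + d) = field_boundary p c + field_boundary p d"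
    using Poly_Mapping.keys_add[of c d]
    by (simp add: field_boundary_superset[of ?F] lookup_add distrib_left single_add sum.distrib)
  have sub: "Poly_Mapping.keys (chain_scale a c) \<subseteq> Poly_Mapping.keys c"
    by (auto simp: in_keys_iff)
  show "field_boundary p (chain_scale a c) = chain_scale a (field_boundary p c)"
    using sub by (simp add: field_boundary_superset[of "Poly_Mapping.keys c"] chain_scale_sum
        chain_scale_single chain_scale_simps(7) mult.left_commute)
qed

lemma boundaries_closed:
  "0 \<in> boundaries p X"
  "c \<in> boundaries p X \<Longrightarrow> d \<in> boundaries p X \<Longrightarrow> c + d \<in> boundaries p X"
  "c \<in> boundaries p X \<Longrightarrow> chain_scale a c \<in> boundaries p X"
proof -
  show "0 \<in> boundaries p X"
    unfolding boundaries_def by (rule image_eqI[of _ _ 0]) (simp_all add: field_chains_closed field_boundary_simps)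
  show "c + d \<in> boundaries p X" if cd: "c \<in> boundaries p X" "d \<in> boundaries p X"
  proof -
    obtain c' d' where "c = field_boundary (Suc p) c'" "c' \<in> field_chains (Suc p) X"
      "d = field_boundary (Suc p) d'" "d' \<in> field_chains (Suc p) X"
      using cd unfolding boundaries_def by blast
    then show ?thesis
      unfolding boundaries_def
      by (intro image_eqI[of _ _ "c' + d'"]) (simp_all add: field_chains_closed field_boundary_simps)
  qed
  show "chain_scale a c \<in> boundaries p X" if c: "c \<in> boundaries p X"
  proof -
    obtain c' where "c = field_boundary (Suc p) c'" "c' \<in> field_chains (Suc p) X"
      using c unfolding boundaries_def by blast
    then show ?thesis
      unfolding boundaries_def
      by (intro image_eqI[of _ _ "chain_scale a c'"])
        (simp_all add: field_chains_closed field_boundary_simps)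
  qed
qed

lemma boundaries_minus: "c \<in> boundaries p X \<Longrightarrow> - c \<in> boundaries p X"
  using boundaries_closed(3)[of c p X "- 1"] by (simp add: chain_scale_simps)

lemma cycles_closed:
  "0 \<in> cycles p X"
  "c \<in> cycles p X \<Longrightarrow> d \<in> cycles p X \<Longrightarrow> c + d \<in> cycles p X"
  "c \<in> cycles p X \<Longrightarrow> chain_scale a c \<in> cycles p X"
  by (auto simp: cycles_def field_chains_closed field_boundary_simps chain_scale_simps)

lemma homology_class_self: "c \<in> homology_class p X c"
  by (simp add: homology_class_def boundaries_closed)

lemma homology_class_nonempty: "homology_class p X c \<noteq> {}"
  using homology_class_self[of c p X] by (metis empty_iff)

lemma homology_class_eq_iff:
  "homology_class p X c = homology_class p X d \<longleftrightarrow> c - d \<in> boundaries p X"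
proof
  assume "homology_class p X c = homology_class p X d"
  then show "c - d \<in> boundaries p X"
    using homology_class_self[of c p X] by (simp add: homology_class_def)
next
  assume *: "c - d \<in> boundaries p X"
  have "x - d \<in> boundaries p X \<longleftrightarrow> x - c \<in> boundaries p X" for x
    using boundaries_closed(2)[OF _ *, of "x - c"]
      boundaries_closed(2)[OF _ boundaries_minus[OF *], of "x - d"] by auto
  then show "homology_class p X c = homology_class p X d"
    by (simp add: homology_class_def)
qed

lemma homology_space_carrier: "carrier (homology_space p X) = homology_class p X ` cycles p X"
  and homology_space_zero: "\<zero>\<^bsub>homology_space p X\<^esub> = homology_class p X 0"
  by (simp_all add: homology_space_def)

lemma homology_space_add:
  "homology_class p X c \<oplus>\<^bsub>homology_space p X\<^esub> homology_class p X d = homology_class p X (c + d)"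
proof -
  have *: "homology_class p X (c' + d') = homology_class p X (c + d)"
    if "c' \<in> homology_class p X c" "d' \<in> homology_class p X d" for c' d'
  proof -
    have "(c' - c) + (d' - d) \<in> boundaries p X"
      using that by (intro boundaries_closed(2)) (simp_all only: homology_class_def mem_Collect_eq)
    then show ?thesis by (simp only: homology_class_eq_iff add_diff_add)
  qed
  have "homology_class p X c \<oplus>\<^bsub>homology_space p X\<^esub> homology_class p X d =
      (\<Union>c'\<in>homology_class p X c. \<Union>d'\<in>homology_class p X d. homology_class p X (c' + d'))"
    unfolding homology_space_def by simp
  also have "\<dots> = (\<Union>c'\<in>homology_class p X c. \<Union>d'\<in>homology_class p X d. homology_class p X (c + d))"
    by (intro SUP_cong refl *)
  also have "\<dots> = homology_class p X (c + d)"
    by (simp only: UN_constant homology_class_nonempty if_False)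
  finally show ?thesis .
qed

lemma homology_space_smult:
  "a \<odot>\<^bsub>homology_space p X\<^esub> homology_class p X c = homology_class p X (chain_scale a c)"
proof -
  have *: "homology_class p X (chain_scale a c') = homology_class p X (chain_scale a c)"
    if "c' \<in> homology_class p X c" for c'
  proof -
    have "chain_scale a (c' - c) \<in> boundaries p X"
      using that by (intro boundaries_closed(3)) (simp only: homology_class_def mem_Collect_eq)
    then show ?thesis by (simp only: homology_class_eq_iff chain_scale_simps(2))
  qed
  have "a \<odot>\<^bsub>homology_space p X\<^esub> homology_class p X c =
      (\<Union>c'\<in>homology_class p X c. homology_class p X (chain_scale a c'))"
    unfolding homology_space_def by simp
  also have "\<dots> = (\<Union>c'\<in>homology_class p X c. homology_class p X (chain_scale a c))"
    by (intro SUP_cong refl *)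
  also have "\<dots> = homology_class p X (chain_scale a c)"
    by (simp only: UN_constant homology_class_nonempty if_False)
  finally show ?thesis .
qed

lemmas homology_space_simps =
  homology_space_carrier homology_space_zero homology_space_add homology_space_smult

lemma field_field_ring: "Ring.field (field_ring :: 'k :: field ring)"
proof -
  let ?R = "field_ring :: 'k ring"
  have "cring ?R"
  proof (rule cringI)
    show "abelian_group ?R"
    proof (rule abelian_groupI)
      show "\<exists>y\<in>carrier ?R. y \<oplus>\<^bsub>?R\<^esub> x = \<zero>\<^bsub>?R\<^esub>" for x
        by (rule bexI[of _ "- x"]) simp_all
    qed (simp_all add: add.assoc add.commute)
    show "Group.comm_monoid ?R"
      by (rule Group.comm_monoidI) (simp_all add: mult.assoc mult.commute)
  qed (simp add: distrib_right)
  then show ?thesis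
  proof (rule cring.cring_fieldI2)
    show "\<exists>b\<in>carrier ?R. a \<otimes>\<^bsub>?R\<^esub> b = \<one>\<^bsub>?R\<^esub>" if "a \<noteq> \<zero>\<^bsub>?R\<^esub>" for a
      using that by (intro bexI[of _ "inverse a"]) simp_all
  qed simp
qed

lemma vectorspace_homology_space:
  "vectorspace (field_ring :: 'k :: field ring) (homology_space p X)"
proof -
  let ?V = "homology_space p X :: ('k, ('a, 'k) field_chain set) module"
  have "abelian_group ?V"
  proof (rule abelian_groupI)
    fix C assume "C \<in> carrier ?V"
    then obtain c where c: "c \<in> cycles p X" "C = homology_class p X c"
      by (auto simp: homology_space_def)
    show "\<exists>D\<in>carrier ?V. D \<oplus>\<^bsub>?V\<^esub> C = \<zero>\<^bsub>?V\<^esub>"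
      using c cycles_closed(3)[OF c(1), of "- 1"]
      by (intro bexI[of _ "homology_class p X (- c)"])
        (auto simp: homology_space_simps chain_scale_simps)
  qed (auto simp: homology_space_simps cycles_closed ac_simps)
  then have "module (field_ring :: 'k ring) ?V"
    by (intro moduleI fieldE(1)[OF field_field_ring])
      (auto simp: homology_space_simps cycles_closed chain_scale_simps)
  then show ?thesis
    by (intro vectorspace.intro field_field_ring)
qed

lemma induced_by_inclusion_class:
  "induced_by_inclusion p Y (homology_class p (subtopology Y S) c) = homology_class p Y c"
proof -
  have "Collect (singular_simplex (Suc p) (subtopology Y S)) \<subseteq> Collect (singular_simplex (Suc p) Y)"
    by (simp add: Collect_mono_iff singular_simplex_subtopology)
  then have sub: "boundaries p (subtopology Y S) \<subseteq> boundaries p Y"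
    unfolding boundaries_def field_chains_def by (intro image_mono Collect_mono) (metis order_trans)
  have *: "homology_class p Y c' = homology_class p Y c"
    if "c' \<in> homology_class p (subtopology Y S) c" for c'
    unfolding homology_class_eq_iff using that sub by (auto simp: homology_class_def)
  have "induced_by_inclusion p Y (homology_class p (subtopology Y S) c) =
      (\<Union>c'\<in>homology_class p (subtopology Y S) c. homology_class p Y c)"
    unfolding induced_by_inclusion_def by (intro SUP_cong refl *)
  then show ?thesis
    by (simp only: UN_constant homology_class_nonempty if_False)
qed

text \<open>Finite dimensionality is stated explicitly because the constant \<open>vectorspace.dim\<close> is
  unspecified on infinite dimensional spaces.  The first argument fixes the coefficient field.\<close>

definition inclusion_rank_eq ::
    "'k :: field itself \<Rightarrow> nat \<Rightarrow> 'a topology \<Rightarrow> 'a topology \<Rightarrow> nat \<Rightarrow> bool" where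
  "inclusion_rank_eq _ p X Y n \<longleftrightarrow>
     vectorspace.fin_dim (field_ring :: 'k ring) (induced_image p X Y) \<and>
     vectorspace.dim (field_ring :: 'k ring) (induced_image p X Y) = n"


section \<open>Persistence diagrams and the persistent homology transform\<close>

definition sublevel_space :: "'a :: topological_space set \<Rightarrow> ('a \<Rightarrow> real) \<Rightarrow> real \<Rightarrow> 'a topology" where
  "sublevel_space M h t = top_of_set {x \<in> M. h x \<le> t}"

text \<open>\<open>b < e\<close> already excludes \<open>b = \<infinity>\<close> and \<open>e = -\<infinity>\<close>.\<close>

definition is_persistence_diagram :: "'k :: field itself \<Rightarrow> nat \<Rightarrow> 'a :: topological_space set \<Rightarrow>
    ('a \<Rightarrow> real) \<Rightarrow> (ereal \<times> ereal) multiset \<Rightarrow> bool" where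
  "is_persistence_diagram K k M h D \<longleftrightarrow>
     (\<forall>(b, e) \<in># D. b < e) \<and>
     (\<forall>s t. s \<le> t \<longrightarrow>
        inclusion_rank_eq K k (sublevel_space M h s) (sublevel_space M h t)
          (size {#(b, e) \<in># D. b \<le> ereal s \<and> ereal t < e#}))"

text \<open>Countable multisets of points; multiplicities may be infinite (this can only happen on the
  diagonal for members of \<open>Dgm\<close>).\<close>

type_synonym diagram = "ereal \<times> ereal \<Rightarrow> enat"

definition PH :: "'k :: field itself \<Rightarrow> nat \<Rightarrow> 'a :: topological_space set \<Rightarrow> ('a \<Rightarrow> real) \<Rightarrow> diagram"
  where "PH K k M h = (\<lambda>P. enat (count (THE D. is_persistence_diagram K k M h D) P))"

definition PHT :: "'k :: field itself \<Rightarrow> (real ^ 'n) set \<Rightarrow> real ^ 'n \<Rightarrow> nat \<Rightarrow> diagram" where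
  "PHT K M v = (\<lambda>k\<in>{..<CARD('n)}. PH K k M (\<lambda>x. v \<bullet> x))"


section \<open>The space of diagrams and the Wasserstein distances\<close>

text \<open>The elements of the multiset as distinct labelled points.\<close>

definition labelled_points :: "diagram \<Rightarrow> ((ereal \<times> ereal) \<times> nat) set" where
  "labelled_points D = {(P, i). enat i < D P}"

definition finite_point :: "ereal \<times> ereal \<Rightarrow> bool" where
  "finite_point P \<longleftrightarrow> \<bar>fst P\<bar> \<noteq> \<infinity> \<and> \<bar>snd P\<bar> \<noteq> \<infinity>"

definition Dgm :: "diagram set" where
  "Dgm = {D. countable {P. D P \<noteq> 0} \<and>
     (\<forall>(b, e) \<in> {P. D P \<noteq> 0}. b \<noteq> \<infinity> \<and> e \<noteq> - \<infinity> \<and> b \<le> e) \<and>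
     finite {(P, i) \<in> labelled_points D. \<not> finite_point P} \<and>
     (\<Sum>\<^sub>\<infinity>(P, i) \<in> {(P, i) \<in> labelled_points D. finite_point P}. e2ennreal (snd P - fst P)) < \<infinity>}"

text \<open>Equal infinite coordinates have distance \<open>0\<close>.\<close>

definition coordinate_dist :: "ereal \<Rightarrow> ereal \<Rightarrow> ennreal" where
  "coordinate_dist x y = (if x = y then 0 else e2ennreal \<bar>x - y\<bar>)"

definition point_dist :: "ereal \<times> ereal \<Rightarrow> ereal \<times> ereal \<Rightarrow> ennreal" where
  "point_dist P Q = max (coordinate_dist (fst P) (fst Q)) (coordinate_dist (snd P) (snd Q))"

definition diagonal_image :: "ereal \<times> ereal \<Rightarrow> ereal \<times> ereal" where
  "diagonal_image P = ((fst P + snd P) / 2, (fst P + snd P) / 2)"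

definition is_matching ::
    "diagram \<Rightarrow> diagram \<Rightarrow> (((ereal \<times> ereal) \<times> nat) \<times> ((ereal \<times> ereal) \<times> nat)) set \<Rightarrow> bool" where
  "is_matching B B' \<sigma> \<longleftrightarrow>
     \<sigma> \<subseteq> labelled_points B \<times> labelled_points B' \<and> inj_on fst \<sigma> \<and> inj_on snd \<sigma> \<and>
     (\<forall>((P, i), (Q, j)) \<in> \<sigma>.
        (fst P = - \<infinity> \<longleftrightarrow> fst Q = - \<infinity>) \<and> (snd P = \<infinity> \<longleftrightarrow> snd Q = \<infinity>)) \<and>
     (\<forall>(P, i) \<in> labelled_points B - fst ` \<sigma>. finite_point P) \<and>
     (\<forall>(Q, j) \<in> labelled_points B' - snd ` \<sigma>. finite_point Q)"

text \<open>In the completed matching, \<^const>\<open>None\<close> stands for the diagonal image of the partner.\<close>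

definition completed_matching ::
    "diagram \<Rightarrow> diagram \<Rightarrow> (((ereal \<times> ereal) \<times> nat) \<times> ((ereal \<times> ereal) \<times> nat)) set \<Rightarrow>
     (((ereal \<times> ereal) \<times> nat) option \<times> ((ereal \<times> ereal) \<times> nat) option) set" where
  "completed_matching B B' \<sigma> =
     map_prod Some Some ` \<sigma> \<union>
     (\<lambda>I. (Some I, None)) ` (labelled_points B - fst ` \<sigma>) \<union>
     (\<lambda>J. (None, Some J)) ` (labelled_points B' - snd ` \<sigma>)"

fun pair_dist ::
    "((ereal \<times> ereal) \<times> nat) option \<times> ((ereal \<times> ereal) \<times> nat) option \<Rightarrow> ennreal" where
  "pair_dist (Some (P, i), Some (Q, j)) = point_dist P Q"
| "pair_dist (Some (P, i), None) = point_dist P (diagonal_image P)"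
| "pair_dist (None, Some (Q, j)) = point_dist Q (diagonal_image Q)"
| "pair_dist (None, None) = 0"

text \<open>Powers with a positive real exponent.\<close>

definition ennreal_powr :: "ennreal \<Rightarrow> real \<Rightarrow> ennreal" where
  "ennreal_powr x r = (if x = \<infinity> then \<infinity> else ennreal (enn2real x powr r))"

definition lp_norm :: "ennreal \<Rightarrow> 'i set \<Rightarrow> ('i \<Rightarrow> ennreal) \<Rightarrow> ennreal" where
  "lp_norm p S c = (if p = \<infinity> then SUP x\<in>S. c x
     else ennreal_powr (\<Sum>\<^sub>\<infinity>x\<in>S. ennreal_powr (c x) (enn2real p)) (1 / enn2real p))"

definition wasserstein_dist :: "ennreal \<Rightarrow> diagram \<Rightarrow> diagram \<Rightarrow> ennreal" where
  "wasserstein_dist p B B' =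
     (INF \<sigma> \<in> {\<sigma>. is_matching B B' \<sigma>}. lp_norm p (completed_matching B B' \<sigma>) pair_dist)"

text \<open>\<open>wasserstein_dist p\<close> is an extended pseudometric on \<open>Dgm\<close> (it may be infinite, and it vanishes
  on diagrams differing only on the diagonal), so the library's metric spaces do not apply.\<close>

definition Dgm_topology :: "ennreal \<Rightarrow> diagram topology" where
  "Dgm_topology p = topology (\<lambda>U. U \<subseteq> Dgm \<and>
     (\<forall>B\<in>U. \<exists>\<epsilon>>0. \<forall>B'\<in>Dgm. wasserstein_dist p B B' < \<epsilon> \<longrightarrow> B' \<in> U))"

lemma openin_Dgm_topology:
  "openin (Dgm_topology p) U \<longleftrightarrow> U \<subseteq> Dgm \<and>
     (\<forall>B\<in>U. \<exists>\<epsilon>>0. \<forall>B'\<in>Dgm. wasserstein_dist p B B' < \<epsilon> \<longrightarrow> B' \<in> U)"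
proof -
  have "istopology (\<lambda>U. U \<subseteq> Dgm \<and>
     (\<forall>B\<in>U. \<exists>\<epsilon>>0. \<forall>B'\<in>Dgm. wasserstein_dist p B B' < \<epsilon> \<longrightarrow> B' \<in> U))" (is "istopology ?O")
    unfolding istopology_def
  proof (intro conjI allI impI)
    fix S T assume S: "?O S" and T: "?O T"
    have "\<exists>\<epsilon>>0. \<forall>B'\<in>Dgm. wasserstein_dist p B B' < \<epsilon> \<longrightarrow> B' \<in> S \<inter> T" if "B \<in> S \<inter> T" for B
    proof -
      obtain \<epsilon>1 where e1: "\<epsilon>1 > 0" "\<forall>B'\<in>Dgm. wasserstein_dist p B B' < \<epsilon>1 \<longrightarrow> B' \<in> S"
        using S \<open>B \<in> S \<inter> T\<close> by blast
      obtain \<epsilon>2 where e2: "\<epsilon>2 > 0" "\<forall>B'\<in>Dgm. wasserstein_dist p B B' < \<epsilon>2 \<longrightarrow> B' \<in> T"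
        using T \<open>B \<in> S \<inter> T\<close> by blast
      show ?thesis using e1 e2 by (intro exI[of _ "min \<epsilon>1 \<epsilon>2"]) auto
    qed
    then show "S \<inter> T \<subseteq> Dgm"
      and "\<forall>B\<in>S \<inter> T. \<exists>\<epsilon>>0. \<forall>B'\<in>Dgm. wasserstein_dist p B B' < \<epsilon> \<longrightarrow> B' \<in> S \<inter> T"
      using S by auto
  next
    fix \<K> assume "\<forall>K\<in>\<K>. ?O K"
    then show "\<Union>\<K> \<subseteq> Dgm"
      and "\<forall>B\<in>\<Union>\<K>. \<exists>\<epsilon>>0. \<forall>B'\<in>Dgm. wasserstein_dist p B B' < \<epsilon> \<longrightarrow> B' \<in> \<Union>\<K>"
      by (blast, metis UnionE UnionI)
  qed
  then show ?thesis by (simp add: Dgm_topology_def)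
qed

lemma topspace_Dgm_topology [simp]: "topspace (Dgm_topology p) = Dgm"
proof -
  have "openin (Dgm_topology p) Dgm"
    by (auto simp: openin_Dgm_topology intro: exI[of _ 1])
  then show ?thesis
    by (metis openin_Dgm_topology openin_subset openin_topspace subset_antisym)
qed

end

theory Submission
  imports Defs
begin

text \<open>
  For a compact definable set \<open>A\<close>, the Kurdyka-Lojasiewicz inequality allows one to push a
  neighbourhood of \<open>A\<close> down the distance function onto \<open>A\<close>, so that the inclusion of \<open>A\<close> into a small
  closed neighbourhood is an isomorphism in homology; this replaces triangulations.  In a definable
  one-parameter family, outside finitely many parameters, the size of these neighbourhoods is locally
  uniform and the fibres vary continuously in the Hausdorff distance.  Interleaving the neighbourhoods
  of nearby fibres shows that homology changes only at the exceptional parameters.  By uniform finiteness,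
  the number of exceptional heights, the Betti numbers of the sublevel sets, and hence the number of points
  of the diagrams are bounded independently of the direction.

  Now fix a direction \<open>v\<close> and a grid of mesh \<open>\<delta>\<close> that avoids the exceptional heights of \<open>v\<close>.  For \<open>w\<close>
  close to \<open>v\<close>, the sublevel sets are interleaved, so the ranks of the maps between different grid heights agree
  for \<open>v\<close> and \<open>w\<close>.  The two diagrams thus have equally many points in every grid cell away from the
  diagonal, and matching cell by cell moves each of the boundedly many points by at most \<open>\<delta>\<close>.
\<close>

section \<open>Definable sets and functions on Euclidean spaces\<close>

definition basis_list :: "'a::euclidean_space list" where
  "basis_list = (SOME bs. distinct bs \<and> set bs = Basis)"

lemma basis_list: "distinct (basis_list :: 'a::euclidean_space list)" "set (basis_list :: 'a list) = Basis"
  and length_basis_list: "length (basis_list :: 'a list) = DIM('a)"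
proof -
  obtain bs :: "'a list" where "distinct bs \<and> set bs = Basis"
    using finite_distinct_list[OF finite_Basis] by metis
  then have *: "distinct (basis_list :: 'a list) \<and> set (basis_list :: 'a list) = Basis"
    unfolding basis_list_def by (rule someI)
  then show "distinct (basis_list :: 'a list)" "set (basis_list :: 'a list) = Basis" by auto
  with * show "length (basis_list :: 'a list) = DIM('a)" by (metis distinct_card)
qed

lemma basis_list_nth: "i < DIM('a) \<Longrightarrow> (basis_list :: 'a::euclidean_space list) ! i \<in> Basis"
  using basis_list(2) length_basis_list nth_mem by metis

lemma Basis_eq_nth: "b \<in> Basis \<Longrightarrow> \<exists>i<DIM('a). b = (basis_list :: 'a::euclidean_space list) ! i"
  using basis_list(2)[where 'a='a] length_basis_list[where 'a='a] in_set_conv_nth[of b "basis_list :: 'a list"]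
  by auto

definition coords :: "'a::euclidean_space \<Rightarrow> real list" where
  "coords x = map (\<lambda>b. x \<bullet> b) basis_list"

lemma length_coords [simp]: "length (coords (x::'a::euclidean_space)) = DIM('a)"
  by (simp add: coords_def length_basis_list)

lemma coords_nth: "i < DIM('a) \<Longrightarrow> coords (x::'a::euclidean_space) ! i = x \<bullet> basis_list ! i"
  by (simp add: coords_def length_basis_list)

lemma coords_inj: "coords x = coords y \<longleftrightarrow> x = (y::'a::euclidean_space)"
proof
  assume "coords x = coords y"
  then have "\<forall>b\<in>Basis. x \<bullet> b = y \<bullet> b" by (simp add: coords_def basis_list(2))
  then show "x = y" by (auto intro: euclidean_eqI)
qed simp

lemma coords_surj:
  assumes "length xs = DIM('a)" shows "\<exists>x::'a::euclidean_space. coords x = xs"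
proof -
  define x :: 'a where "x = (\<Sum>i<DIM('a). xs ! i *\<^sub>R basis_list ! i)"
  have "x \<bullet> basis_list ! j = xs ! j" if "j < DIM('a)" for j
  proof -
    have "x \<bullet> basis_list ! j = (\<Sum>i<DIM('a). if i = j then xs ! i else 0)"
      unfolding x_def inner_sum_left
      using that by (intro sum.cong refl)
        (auto simp: inner_Basis basis_list_nth nth_eq_iff_index_eq basis_list(1) length_basis_list)
    then show ?thesis using that by simp
  qed
  then have "coords x = xs" using assms by (intro nth_equalityI) (auto simp: coords_nth)
  then show ?thesis by blast
qed

lemma coords_real: "coords (x::real) = [x]"
proof -
  have "length (basis_list :: real list) = 1" "(basis_list :: real list) ! 0 \<in> Basis"
    using length_basis_list[where 'a = real] basis_list_nth[of 0, where 'a = real] by simp_all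
  then have "(basis_list :: real list) = [1]" by (metis Basis_real_def length_0_conv length_Suc_conv nth_Cons_0 singletonD One_nat_def)
  then show ?thesis unfolding coords_def by (metis inner_real_def list.map mult.right_neutral)
qed

definition coord_map :: "('a::euclidean_space \<Rightarrow> 'b::euclidean_space) \<Rightarrow> bool" where
  "coord_map f \<longleftrightarrow> (\<exists>\<sigma>. (\<forall>i<DIM('b). \<sigma> i < DIM('a) \<and> (\<forall>x. coords (f x) ! i = coords x ! \<sigma> i)))"

lemma coord_mapI:
  assumes "\<And>b. b \<in> Basis \<Longrightarrow> \<exists>c\<in>Basis. \<forall>x. f x \<bullet> b = x \<bullet> c"
  shows "coord_map (f :: 'a::euclidean_space \<Rightarrow> 'b::euclidean_space)"
proof -
  have "\<exists>j. j < DIM('a) \<and> (\<forall>x. coords (f x) ! i = coords x ! j)" if i: "i < DIM('b)" for i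
  proof -
    obtain c where c: "c \<in> Basis" "\<forall>x. f x \<bullet> basis_list ! i = x \<bullet> c"
      using assms basis_list_nth[OF i] by blast
    then obtain j where "j < DIM('a)" "c = basis_list ! j"
      using Basis_eq_nth by blast
    with c i show ?thesis by (auto simp: coords_nth)
  qed
  then have "\<forall>i\<in>{..<DIM('b)}. \<exists>j. j < DIM('a) \<and> (\<forall>x. coords (f x) ! i = coords x ! j)" by blast
  from bchoice[OF this] show ?thesis unfolding coord_map_def by auto
qed

lemma coord_map_compose:
  fixes g :: "'b::euclidean_space \<Rightarrow> 'a::euclidean_space" and f :: "'c::euclidean_space \<Rightarrow> 'b"
  shows "coord_map g \<Longrightarrow> coord_map f \<Longrightarrow> coord_map (\<lambda>x. g (f x))"
proof -
  assume "coord_map g" "coord_map f"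
  then obtain \<sigma> \<tau> where "\<forall>i<DIM('a). \<sigma> i < DIM('b) \<and> (\<forall>x. coords (g x) ! i = coords x ! \<sigma> i)"
    "\<forall>i<DIM('b). \<tau> i < DIM('c) \<and> (\<forall>x. coords (f x) ! i = coords x ! \<tau> i)"
    unfolding coord_map_def by blast
  then show ?thesis unfolding coord_map_def by (intro exI[of _ "\<tau> \<circ> \<sigma>"]) simp
qed

lemma coord_map_id: "coord_map (\<lambda>x. x)"
  by (auto intro!: coord_mapI)

lemma coord_map_inner: "b \<in> Basis \<Longrightarrow> coord_map (\<lambda>x. x \<bullet> b)"
  by (auto intro!: coord_mapI)

lemma coord_map_fst: "coord_map f \<Longrightarrow> coord_map (\<lambda>x. fst (f x))"
  by (rule coord_map_compose[of fst])
    (auto simp: Basis_prod_def intro!: coord_mapI bexI[of _ "(b, 0)" for b])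

lemma coord_map_snd: "coord_map f \<Longrightarrow> coord_map (\<lambda>x. snd (f x))"
  by (rule coord_map_compose[of snd])
    (auto simp: Basis_prod_def intro!: coord_mapI bexI[of _ "(0, b)" for b])

lemma coord_mapD:
  assumes "coord_map f" "b \<in> Basis"
  shows "\<exists>c\<in>Basis. \<forall>x::'x::euclidean_space. f x \<bullet> (b::'y::euclidean_space) = x \<bullet> c"
proof -
  obtain i where "i < DIM('y)" "b = basis_list ! i"
    using Basis_eq_nth[OF assms(2)] by blast
  with assms(1) show ?thesis unfolding coord_map_def by (metis basis_list_nth coords_nth)
qed

lemma coord_map_Pair: "coord_map f \<Longrightarrow> coord_map g \<Longrightarrow> coord_map (\<lambda>x. (f x, g x))"
  by (intro coord_mapI) (auto simp: Basis_prod_def dest: coord_mapD)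

lemmas coord_map_intros = coord_map_id coord_map_fst coord_map_snd coord_map_Pair coord_map_inner


context o_minimal_structure
begin

lemma empty_mem: "{} \<in> \<O> d"
proof -
  have *: "{} \<in> \<O> (Suc d)" for d
    using order[of 0 "Suc d" 0] by simp
  show ?thesis
  proof (cases d)
    case 0
    then show ?thesis using projection[OF *[of 0], of 0] by simp
  next
    case (Suc d')
    then show ?thesis using * by simp
  qed
qed

lemma univ_mem: "{xs. length xs = d} \<in> \<O> d"
  using complement[OF empty_mem] by simp

lemma union: "A \<in> \<O> d \<Longrightarrow> B \<in> \<O> d \<Longrightarrow> A \<union> B \<in> \<O> d"
proof -
  assume A: "A \<in> \<O> d" and B: "B \<in> \<O> d"
  have "A \<union> B = {xs. length xs = d} - ({xs. length xs = d} - A) \<inter> ({xs. length xs = d} - B)"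
    using dimension[OF A] dimension[OF B] by blast
  then show ?thesis using complement[OF inter[OF complement[OF A] complement[OF B]]] by simp
qed

lemma equal_coords: "i < d \<Longrightarrow> j < d \<Longrightarrow> {xs. length xs = d \<and> xs ! i = xs ! j} \<in> \<O> d"
proof -
  assume ij: "i < d" "j < d"
  have "{xs :: real list. length xs = d \<and> xs ! i = xs ! j} = {xs. length xs = d} -
      ({xs. length xs = d \<and> xs ! i < xs ! j} \<union> {xs. length xs = d \<and> xs ! j < xs ! i})"
    by auto
  then show ?thesis using complement[OF union[OF order[OF ij] order[OF ij(2,1)]]] by simp
qed

lemma finite_inter_mem:
  assumes "finite I" "\<And>i. i \<in> I \<Longrightarrow> S i \<in> \<O> d"
  shows "{xs. length xs = d \<and> (\<forall>i\<in>I. xs \<in> S i)} \<in> \<O> d"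
  using assms
proof (induction I)
  case (insert i I)
  have "{xs. length xs = d \<and> (\<forall>j\<in>insert i I. xs \<in> S j)} = S i \<inter> {xs. length xs = d \<and> (\<forall>i\<in>I. xs \<in> S i)}"
    using dimension[of "S i" d] insert.prems by auto
  then show ?case using inter insert by simp
qed (simp add: univ_mem)

lemma drop_mem: "A \<in> \<O> d \<Longrightarrow> {zs. length zs = e + d \<and> drop e zs \<in> A} \<in> \<O> (e + d)"
proof (induction e)
  case 0
  then show ?case using dimension[OF 0] by (simp add: Collect_conj_eq Int_absorb1)
next
  case (Suc e)
  have "{zs. length zs = Suc e + d \<and> drop (Suc e) zs \<in> A} =
      {t # xs | xs t. xs \<in> {zs. length zs = e + d \<and> drop e zs \<in> A}}" (is "?L = ?R")
  proof
    show "?L \<subseteq> ?R"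
    proof
      fix zs assume "zs \<in> ?L"
      then show "zs \<in> ?R" by (cases zs) auto
    qed
  qed auto
  then show ?case using line_times[OF Suc.IH[OF Suc.prems]] by simp
qed

lemma take_mem: "A \<in> \<O> (e + d) \<Longrightarrow> take e ` A \<in> \<O> e"
proof (induction d arbitrary: A)
  case 0
  have "take e ` A = A" using dimension[OF 0] by force
  then show ?case using 0 by simp
next
  case (Suc d)
  let ?f = "\<lambda>xs::real list. take (e + d) xs @ drop (Suc (e + d)) xs"
  have "?f ` A \<in> \<O> (e + d)" using Suc.prems by (intro projection) auto
  from Suc.IH[OF this] have "take e ` ?f ` A \<in> \<O> e" .
  moreover have "take e ` ?f ` A = take e ` A"
    unfolding image_image using dimension[OF Suc.prems] by (intro image_cong) (auto simp: min_def)
  ultimately show ?case by simp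
qed

lemma reindex_mem:
  assumes A: "A \<in> \<O> d" and \<sigma>: "\<And>i. i < d \<Longrightarrow> \<sigma> i < e"
  shows "{xs. length xs = e \<and> map (\<lambda>i. xs ! \<sigma> i) [0..<d] \<in> A} \<in> \<O> e" (is "?T \<in> _")
proof -
  let ?E = "{zs. length zs = e + d \<and> (\<forall>i\<in>{..<d}. zs \<in> {zs. length zs = e + d \<and> zs ! (e + i) = zs ! \<sigma> i})}"
  let ?C = "{zs. length zs = e + d \<and> drop e zs \<in> A} \<inter> ?E"
  have "?E \<in> \<O> (e + d)"
    using \<sigma> by (intro finite_inter_mem equal_coords) (auto simp: trans_less_add1)
  from take_mem[OF inter[OF drop_mem[OF A] this]] have "take e ` ?C \<in> \<O> e" .
  also have "take e ` ?C = ?T"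
  proof (intro Set.set_eqI iffI)
    fix xs assume "xs \<in> take e ` ?C"
    then obtain zs where zs: "zs \<in> ?C" "xs = take e zs" by blast
    have "map (\<lambda>i. xs ! \<sigma> i) [0..<d] = drop e zs"
      using zs \<sigma> by (intro nth_equalityI) auto
    with zs show "xs \<in> ?T" by auto
  next
    fix xs assume xs: "xs \<in> ?T"
    let ?z = "xs @ map (\<lambda>i. xs ! \<sigma> i) [0..<d]"
    have "?z \<in> ?C" using xs \<sigma> by (auto simp: nth_append)
    moreover have "xs = take e ?z" using xs by simp
    ultimately show "xs \<in> take e ` ?C" by blast
  qed
  finally show ?thesis .
qed

definition definable :: "('a::euclidean_space \<Rightarrow> bool) \<Rightarrow> bool" where
  "definable P \<longleftrightarrow> coords ` Collect P \<in> \<O> DIM('a)"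

definition definable_fun :: "('a::euclidean_space \<Rightarrow> 'b::euclidean_space) \<Rightarrow> bool" where
  "definable_fun f \<longleftrightarrow> definable (\<lambda>z. snd z = f (fst z))"

lemma coords_image_inter: "coords ` (A \<inter> B) = coords ` A \<inter> coords ` (B :: 'a::euclidean_space set)"
  by (auto simp: coords_inj)

lemma coords_image_UNIV: "range (coords :: 'a::euclidean_space \<Rightarrow> _) = {xs. length xs = DIM('a)}"
proof (intro Set.set_eqI iffI)
  fix xs :: "real list" assume "xs \<in> {xs. length xs = DIM('a)}"
  then obtain x :: 'a where "coords x = xs" using coords_surj by blast
  then show "xs \<in> range (coords :: 'a \<Rightarrow> _)" by blast
qed auto

lemma definable_conj: "definable P \<Longrightarrow> definable Q \<Longrightarrow> definable (\<lambda>x. P x \<and> Q x)"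
  unfolding definable_def by (simp add: Collect_conj_eq coords_image_inter inter)

lemma definable_not: "definable (P :: 'a::euclidean_space \<Rightarrow> bool) \<Longrightarrow> definable (\<lambda>x. \<not> P x)"
proof -
  assume P: "definable P"
  have "coords ` {x. \<not> P x} = range (coords :: 'a \<Rightarrow> _) - coords ` Collect P"
    by (auto simp: coords_inj image_iff)
  with P show "definable (\<lambda>x. \<not> P x)"
    unfolding definable_def by (simp add: coords_image_UNIV complement)
qed

lemma definable_const: "definable (\<lambda>x. c)"
  by (cases c) (auto simp: definable_def coords_image_UNIV univ_mem empty_mem)

lemma definable_disj: "definable P \<Longrightarrow> definable Q \<Longrightarrow> definable (\<lambda>x. P x \<or> Q x)"
  using definable_not[OF definable_conj[OF definable_not definable_not]] by simp

lemma definable_imp: "definable P \<Longrightarrow> definable Q \<Longrightarrow> definable (\<lambda>x. P x \<longrightarrow> Q x)"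
proof -
  have "(\<lambda>x. P x \<longrightarrow> Q x) = (\<lambda>x. \<not> P x \<or> Q x)" by auto
  then show "definable P \<Longrightarrow> definable Q \<Longrightarrow> definable (\<lambda>x. P x \<longrightarrow> Q x)"
    using definable_disj[OF definable_not] by simp
qed

lemma definable_iff: "definable P \<Longrightarrow> definable Q \<Longrightarrow> definable (\<lambda>x. P x \<longleftrightarrow> Q x)"
proof -
  have "(\<lambda>x. P x \<longleftrightarrow> Q x) = (\<lambda>x. (P x \<longrightarrow> Q x) \<and> (Q x \<longrightarrow> P x))" by auto
  then show "definable P \<Longrightarrow> definable Q \<Longrightarrow> definable (\<lambda>x. P x \<longleftrightarrow> Q x)"
    using definable_conj[OF definable_imp definable_imp] by simp
qed

lemma definable_coord_map:
  fixes f :: "'a::euclidean_space \<Rightarrow> 'b::euclidean_space"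
  assumes "definable P" "coord_map f"
  shows "definable (\<lambda>x. P (f x))"
proof -
  obtain \<sigma> where \<sigma>: "\<And>i. i < DIM('b) \<Longrightarrow> \<sigma> i < DIM('a)"
    "\<And>i x. i < DIM('b) \<Longrightarrow> coords (f x) ! i = coords x ! \<sigma> i"
    using assms(2) unfolding coord_map_def by blast
  have eq: "map (\<lambda>i. coords x ! \<sigma> i) [0..<DIM('b)] = coords (f x)" for x
    by (intro nth_equalityI) (auto simp: \<sigma>)
  have "{xs. length xs = DIM('a) \<and> map (\<lambda>i. xs ! \<sigma> i) [0..<DIM('b)] \<in> coords ` Collect P} \<in> \<O> DIM('a)"
    using assms(1) \<sigma>(1) by (intro reindex_mem) (simp_all add: definable_def)
  also have "{xs. length xs = DIM('a) \<and> map (\<lambda>i. xs ! \<sigma> i) [0..<DIM('b)] \<in> coords ` Collect P} = coords ` {x. P (f x)}"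
  proof (rule Set.set_eqI, rule iffI)
    fix xs assume xs: "xs \<in> {xs. length xs = DIM('a) \<and> map (\<lambda>i. xs ! \<sigma> i) [0..<DIM('b)] \<in> coords ` Collect P}"
    then obtain x :: 'a where "xs = coords x" using coords_surj by blast
    with xs show "xs \<in> coords ` {x. P (f x)}" by (auto simp: eq coords_inj)
  next
    fix xs assume "xs \<in> coords ` {x. P (f x)}"
    then show "xs \<in> {xs. length xs = DIM('a) \<and> map (\<lambda>i. xs ! \<sigma> i) [0..<DIM('b)] \<in> coords ` Collect P}"
      by (auto simp: eq)
  qed
  finally show ?thesis unfolding definable_def .
qed

lemma definable_ex_aux:
  fixes P :: "'a::euclidean_space \<times> 'b::euclidean_space \<Rightarrow> bool"
  assumes "definable P"
  shows "definable (\<lambda>x. \<exists>y. P (x, y))"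
proof -
  have "coord_map (fst :: 'a \<times> 'b \<Rightarrow> 'a)"
    using coord_map_fst[OF coord_map_id] .
  then obtain \<sigma> where \<sigma>: "\<And>i. i < DIM('a) \<Longrightarrow> \<sigma> i < DIM('a) + DIM('b)"
      "\<And>i z. i < DIM('a) \<Longrightarrow> coords (fst (z :: 'a \<times> 'b)) ! i = coords z ! \<sigma> i"
    unfolding coord_map_def DIM_prod by blast
  let ?Q = "{zs. length zs = DIM('a) + (DIM('a) + DIM('b)) \<and> drop DIM('a) zs \<in> coords ` Collect P}"
  let ?E = "{zs. length zs = DIM('a) + (DIM('a) + DIM('b)) \<and> (\<forall>i\<in>{..<DIM('a)}. zs \<in>
     {zs. length zs = DIM('a) + (DIM('a) + DIM('b)) \<and> zs ! i = zs ! (DIM('a) + \<sigma> i)})}"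
  have "?E \<in> \<O> (DIM('a) + (DIM('a) + DIM('b)))"
    using \<sigma>(1) by (intro finite_inter_mem equal_coords) auto
  moreover have "?Q \<in> \<O> (DIM('a) + (DIM('a) + DIM('b)))"
    using assms by (intro drop_mem) (simp add: definable_def)
  ultimately have "take DIM('a) ` (?Q \<inter> ?E) \<in> \<O> DIM('a)"
    by (intro take_mem inter)
  also have "take DIM('a) ` (?Q \<inter> ?E) = coords ` {x. \<exists>y. P (x, y)}"
  proof (intro Set.set_eqI iffI)
    fix xs assume "xs \<in> take DIM('a) ` (?Q \<inter> ?E)"
    then obtain zs where zs: "zs \<in> ?Q" "zs \<in> ?E" "xs = take DIM('a) zs" by blast
    then obtain z where z: "P z" "drop DIM('a) zs = coords z" by auto
    have "zs ! (DIM('a) + \<sigma> i) = coords (fst z) ! i" if "i < DIM('a)" for i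
      using zs(1) nth_drop[of "DIM('a)" zs "\<sigma> i"] by (simp add: \<sigma>(2)[OF that] z(2))
    then have "xs = coords (fst z)"
      using zs by (intro nth_equalityI) auto
    with z show "xs \<in> coords ` {x. \<exists>y. P (x, y)}" by (metis (mono_tags) image_eqI mem_Collect_eq prod.collapse)
  next
    fix xs assume "xs \<in> coords ` {x. \<exists>y. P (x, y)}"
    then obtain x y where xy: "P (x, y)" "xs = coords x" by blast
    have "coords x @ coords (x, y) \<in> ?Q \<inter> ?E"
      using xy(1) \<sigma>(2)[of _ "(x, y)"] by (auto simp: nth_append)
    moreover have "xs = take DIM('a) (coords x @ coords (x, y))" using xy(2) by simp
    ultimately show "xs \<in> take DIM('a) ` (?Q \<inter> ?E)" by blast
  qed
  finally show ?thesis unfolding definable_def .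
qed

lemma definable_ex: "definable (\<lambda>z. P (fst z) (snd z)) \<Longrightarrow> definable (\<lambda>x. \<exists>y. P x y)"
  using definable_ex_aux[of "\<lambda>z. P (fst z) (snd z)"] by simp

lemma definable_all: "definable (\<lambda>z. P (fst z) (snd z)) \<Longrightarrow> definable (\<lambda>x. \<forall>y. P x y)"
  using definable_not[OF definable_ex[of "\<lambda>x y. \<not> P x y"]] definable_not[of "\<lambda>z. P (fst z) (snd z)"] by simp

lemma definable_finite_ball:
  "finite I \<Longrightarrow> (\<And>i. i \<in> I \<Longrightarrow> definable (P i)) \<Longrightarrow> definable (\<lambda>x. \<forall>i\<in>I. P i x)"
  by (induction I rule: finite_induct) (simp_all add: definable_const definable_conj)

lemma definable_coord_eq:
  assumes "b \<in> Basis" "c \<in> Basis"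
  shows "definable (\<lambda>x::'a::euclidean_space. x \<bullet> b = x \<bullet> c)"
proof -
  obtain i j where ij: "i < DIM('a)" "b = basis_list ! i" "j < DIM('a)" "c = basis_list ! j"
    using Basis_eq_nth[OF assms(1)] Basis_eq_nth[OF assms(2)] by blast
  have "coords ` {x::'a. x \<bullet> b = x \<bullet> c} = {xs. length xs = DIM('a) \<and> xs ! i = xs ! j}"
  proof (rule Set.set_eqI, rule iffI)
    fix xs :: "real list" assume xs: "xs \<in> {xs. length xs = DIM('a) \<and> xs ! i = xs ! j}"
    then obtain x :: 'a where "coords x = xs" using coords_surj by blast
    with xs ij show "xs \<in> coords ` {x::'a. x \<bullet> b = x \<bullet> c}" by (auto simp: coords_nth)
  qed (use ij in \<open>auto simp: coords_nth\<close>)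
  then show ?thesis using equal_coords ij by (simp add: definable_def)
qed

lemma definable_fun_coord_map:
  fixes f :: "'a::euclidean_space \<Rightarrow> 'b::euclidean_space"
  assumes "coord_map f" shows "definable_fun f"
proof -
  have "definable (\<lambda>z::'a\<times>'b. snd z \<bullet> b = f (fst z) \<bullet> b)" if b: "b \<in> Basis" for b
  proof -
    obtain c where c: "c \<in> Basis" "\<And>x. f x \<bullet> b = x \<bullet> c"
      using coord_mapD[OF assms b] by blast
    have "(0, b) \<in> (Basis :: ('a \<times> 'b) set)" "(c, 0) \<in> (Basis :: ('a \<times> 'b) set)"
      using c(1) b by (auto simp: Basis_prod_def)
    from definable_coord_eq[OF this] show ?thesis using c by (simp add: inner_prod_def)
  qed
  then have "definable (\<lambda>z::'a\<times>'b. \<forall>b\<in>Basis. snd z \<bullet> b = f (fst z) \<bullet> b)"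
    by (intro definable_finite_ball) auto
  then show ?thesis unfolding definable_fun_def euclidean_eq_iff[where 'a='b] .
qed

lemma definable_fun_id: "definable_fun (\<lambda>x. x)"
  by (intro definable_fun_coord_map coord_map_intros)

lemma definable_compose:
  assumes "definable P" "definable_fun f" shows "definable (\<lambda>x. P (f x))"
proof -
  have "definable (\<lambda>z. P (snd z))"
    by (rule definable_coord_map[OF assms(1) coord_map_snd[OF coord_map_id]])
  from definable_ex_aux[OF definable_conj[OF assms(2)[unfolded definable_fun_def] this]]
  show ?thesis by simp
qed

lemma definable_fun_compose:
  fixes f :: "'a::euclidean_space \<Rightarrow> 'b::euclidean_space" and g :: "'b \<Rightarrow> 'c::euclidean_space"
  assumes "definable_fun g" "definable_fun f" shows "definable_fun (\<lambda>x. g (f x))"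
proof -
  have "coord_map (\<lambda>z::('a \<times> 'c) \<times> 'b. (fst (fst z), snd z))"
    "coord_map (\<lambda>z::('a \<times> 'c) \<times> 'b. (snd z, snd (fst z)))"
    by (intro coord_map_intros)+
  from definable_conj[OF definable_coord_map[OF assms(2)[unfolded definable_fun_def] this(1)]
      definable_coord_map[OF assms(1)[unfolded definable_fun_def] this(2)]]
  have "definable (\<lambda>z. snd z = f (fst (fst z)) \<and> snd (fst z) = g (snd z))" by simp
  from definable_ex_aux[OF this] show ?thesis unfolding definable_fun_def by simp
qed

lemma definable_fun_Pair:
  fixes f :: "'a::euclidean_space \<Rightarrow> 'b::euclidean_space" and g :: "'a \<Rightarrow> 'c::euclidean_space"
  assumes "definable_fun f" "definable_fun g" shows "definable_fun (\<lambda>x. (f x, g x))"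
proof -
  have "coord_map (\<lambda>z::'a \<times> 'b \<times> 'c. (fst z, fst (snd z)))"
    "coord_map (\<lambda>z::'a \<times> 'b \<times> 'c. (fst z, snd (snd z)))"
    by (intro coord_map_intros)+
  from definable_conj[OF definable_coord_map[OF assms(1)[unfolded definable_fun_def] this(1)]
      definable_coord_map[OF assms(2)[unfolded definable_fun_def] this(2)]]
  show ?thesis unfolding definable_fun_def by (simp add: prod_eq_iff)
qed

lemma definable_fun_fst: "definable_fun f \<Longrightarrow> definable_fun (\<lambda>x. fst (f x))"
  by (rule definable_fun_compose[OF definable_fun_coord_map[OF coord_map_fst[OF coord_map_id]]])

lemma definable_fun_snd: "definable_fun f \<Longrightarrow> definable_fun (\<lambda>x. snd (f x))"
  by (rule definable_fun_compose[OF definable_fun_coord_map[OF coord_map_snd[OF coord_map_id]]])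

lemma definable_eq:
  assumes "definable_fun f" "definable_fun g" shows "definable (\<lambda>x. f x = g x)"
proof -
  from definable_compose[OF definable_fun_id[unfolded definable_fun_def] definable_fun_Pair[OF assms(2,1)]]
  show ?thesis by simp
qed

lemma definable_fun_componentwise:
  fixes f :: "'a::euclidean_space \<Rightarrow> 'b::euclidean_space"
  assumes "\<And>b. b \<in> Basis \<Longrightarrow> definable_fun (\<lambda>x. f x \<bullet> b)" shows "definable_fun f"
proof -
  have "definable (\<lambda>z::'a\<times>'b. \<forall>b\<in>Basis. snd z \<bullet> b = f (fst z) \<bullet> b)"
  proof (intro definable_finite_ball finite_Basis definable_eq)
    fix b :: 'b assume b: "b \<in> Basis"
    show "definable_fun (\<lambda>z::'a\<times>'b. snd z \<bullet> b)"
      by (rule definable_fun_coord_map[OF coord_map_compose[OF coord_map_inner[OF b] coord_map_snd[OF coord_map_id]]])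
    show "definable_fun (\<lambda>z::'a\<times>'b. f (fst z) \<bullet> b)"
      by (rule definable_fun_compose[OF assms[OF b] definable_fun_fst[OF definable_fun_id]])
  qed
  then show ?thesis unfolding definable_fun_def euclidean_eq_iff[where 'a='b] .
qed

lemma definable_fun_inner_Basis: "b \<in> Basis \<Longrightarrow> definable_fun f \<Longrightarrow> definable_fun (\<lambda>x. f x \<bullet> b)"
  by (rule definable_fun_compose[OF definable_fun_coord_map[OF coord_map_inner]])

lemma definable_real_iff: "definable (P :: real \<Rightarrow> bool) \<longleftrightarrow> (\<lambda>x. [x]) ` Collect P \<in> \<O> 1"
  by (simp add: definable_def coords_real[abs_def])

lemma definable_real_is: "definable (\<lambda>x::real. x = c)"
proof -
  have "(\<lambda>x. [x]) ` {c} \<in> \<O> 1"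
    unfolding line by (rule CollectI, rule exI[of _ "{{c}}"]) auto
  then show ?thesis by (simp add: definable_real_iff)
qed

lemma definable_fun_const: "definable_fun (\<lambda>x. c)"
proof (rule definable_fun_componentwise)
  fix b :: 'b assume "b \<in> Basis"
  show "definable_fun (\<lambda>x::'a. c \<bullet> b)"
    unfolding definable_fun_def
    by (rule definable_compose[OF definable_real_is definable_fun_snd[OF definable_fun_id]])
qed

lemma definable_real_triple_aux:
  assumes "\<And>d i j k. i < d \<Longrightarrow> j < d \<Longrightarrow> k < d \<Longrightarrow> {xs. length xs = d \<and> R (xs ! i) (xs ! j) (xs ! k)} \<in> \<O> d"
  shows "definable (\<lambda>z::(real\<times>real)\<times>real. R (fst (fst z)) (snd (fst z)) (snd z))"
proof -
  have *: "\<exists>i<3. \<forall>z. f z = coords z ! i" if f: "coord_map f" for f :: "(real\<times>real)\<times>real \<Rightarrow> real"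
  proof -
    obtain \<sigma> where "\<sigma> 0 < 3" "\<forall>z. f z = coords z ! \<sigma> (0::nat)"
      using f unfolding coord_map_def coords_real by (auto simp: numeral_3_eq_3 simp del: split_paired_All)
    then show ?thesis by blast
  qed
  obtain i j k where ijk: "i < 3" "j < 3" "k < 3" "\<And>z::(real\<times>real)\<times>real. fst (fst z) = coords z ! i"
    "\<And>z::(real\<times>real)\<times>real. snd (fst z) = coords z ! j" "\<And>z::(real\<times>real)\<times>real. snd z = coords z ! k"
    using *[of "\<lambda>z. fst (fst z)"] *[of "\<lambda>z. snd (fst z)"] *[of "\<lambda>z. snd z"] coord_map_fst[OF coord_map_fst[OF coord_map_id]] coord_map_snd[OF coord_map_fst[OF coord_map_id]]
      coord_map_snd[OF coord_map_id] by blast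
  have dim: "DIM((real\<times>real)\<times>real) = 3" by simp
  have "coords ` {z::(real\<times>real)\<times>real. R (fst (fst z)) (snd (fst z)) (snd z)} =
      {xs. length xs = 3 \<and> R (xs ! i) (xs ! j) (xs ! k)}"
  proof (rule Set.set_eqI, rule iffI)
    fix xs :: "real list" assume xs: "xs \<in> {xs. length xs = 3 \<and> R (xs ! i) (xs ! j) (xs ! k)}"
    then obtain z :: "(real\<times>real)\<times>real" where z: "coords z = xs" using coords_surj[of xs, where 'a = "(real\<times>real)\<times>real"] dim by auto
    with xs have "R (coords z ! i) (coords z ! j) (coords z ! k)" by simp
    then have "R (fst (fst z)) (snd (fst z)) (snd z)" by (simp only: ijk(4-6))
    with z show "xs \<in> coords ` {z::(real\<times>real)\<times>real. R (fst (fst z)) (snd (fst z)) (snd z)}" by blast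
  next
    fix xs assume "xs \<in> coords ` {z::(real\<times>real)\<times>real. R (fst (fst z)) (snd (fst z)) (snd z)}"
    then obtain z :: "(real\<times>real)\<times>real" where z: "coords z = xs" "R (fst (fst z)) (snd (fst z)) (snd z)" by blast
    from z(2) have "R (coords z ! i) (coords z ! j) (coords z ! k)" by (simp only: ijk(4-6))
    with z(1) show "xs \<in> {xs. length xs = 3 \<and> R (xs ! i) (xs ! j) (xs ! k)}" using length_coords[of z] dim by auto
  qed
  then show ?thesis using assms[OF ijk(1-3)] by (simp add: definable_def numeral_3_eq_3)
qed

lemma definable_less:
  assumes "definable_fun f" "definable_fun g" shows "definable (\<lambda>x. f x < (g x :: real))"
proof -
  have "definable (\<lambda>z::(real\<times>real)\<times>real. fst (fst z) < snd (fst z))"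
    by (rule definable_real_triple_aux) (auto intro: order)
  from definable_compose[OF this definable_fun_Pair[OF definable_fun_Pair[OF assms] assms(1)]]
  show ?thesis by simp
qed

lemma definable_le:
  assumes "definable_fun f" "definable_fun g" shows "definable (\<lambda>x. f x \<le> (g x :: real))"
  using definable_not[OF definable_less[OF assms(2,1)]] by (simp add: not_less)

lemma definable_fun_add_real:
  assumes "definable_fun f" "definable_fun g" shows "definable_fun (\<lambda>x. f x + (g x :: real))"
proof -
  have "definable_fun (\<lambda>z::real\<times>real. fst z + snd z)"
    using definable_real_triple_aux[of "\<lambda>x y z. x + y = z"] addition
    by (simp add: definable_fun_def eq_commute)
  from definable_fun_compose[OF this definable_fun_Pair[OF assms]] show ?thesis by simp
qed

lemma definable_fun_mult:
  assumes "definable_fun f" "definable_fun g" shows "definable_fun (\<lambda>x. f x * (g x :: real))"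
proof -
  have "definable_fun (\<lambda>z::real\<times>real. fst z * snd z)"
    using definable_real_triple_aux[of "\<lambda>x y z. x * y = z"] multiplication
    by (simp add: definable_fun_def eq_commute)
  from definable_fun_compose[OF this definable_fun_Pair[OF assms]] show ?thesis by simp
qed

lemma definable_fun_sum:
  "finite I \<Longrightarrow> (\<And>i. i \<in> I \<Longrightarrow> definable_fun (f i)) \<Longrightarrow> definable_fun (\<lambda>x. \<Sum>i\<in>I. f i x :: real)"
  by (induction I rule: finite_induct) (auto intro: definable_fun_const definable_fun_add_real)

lemma definable_fun_add:
  "definable_fun f \<Longrightarrow> definable_fun g \<Longrightarrow> definable_fun (\<lambda>x. f x + g x)"
  by (rule definable_fun_componentwise) (simp add: inner_add_left definable_fun_add_real definable_fun_inner_Basis)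

lemma definable_fun_scaleR:
  "definable_fun f \<Longrightarrow> definable_fun g \<Longrightarrow> definable_fun (\<lambda>x. f x *\<^sub>R g x)"
  by (rule definable_fun_componentwise) (simp add: definable_fun_mult definable_fun_inner_Basis)

lemma definable_fun_diff:
  assumes "definable_fun f" "definable_fun g" shows "definable_fun (\<lambda>x. f x - g x)"
  using definable_fun_add[OF assms(1) definable_fun_scaleR[OF definable_fun_const[of "-1"] assms(2)]] by simp

lemma definable_fun_inner:
  "definable_fun f \<Longrightarrow> definable_fun g \<Longrightarrow> definable_fun (\<lambda>x. f x \<bullet> g x)"
  by (subst euclidean_inner) (intro definable_fun_sum definable_fun_mult definable_fun_inner_Basis finite_Basis)

lemma definable_fun_norm:
  assumes "definable_fun f" shows "definable_fun (\<lambda>x. norm (f x))"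
proof -
  have "definable (\<lambda>z. 0 \<le> snd z \<and> snd z * snd z = f (fst z) \<bullet> f (fst z))"
    by (intro definable_conj definable_le definable_eq definable_fun_mult definable_fun_inner
        definable_fun_compose[OF assms] definable_fun_const definable_fun_fst definable_fun_snd definable_fun_id)
  moreover have "0 \<le> r \<and> r * r = x \<bullet> x \<longleftrightarrow> r = norm x" for r :: real and x :: 'b
  proof
    assume "0 \<le> r \<and> r * r = x \<bullet> x"
    then show "r = norm x" by (metis norm_eq_sqrt_inner real_sqrt_abs2 abs_of_nonneg)
  next
    assume "r = norm x"
    then show "0 \<le> r \<and> r * r = x \<bullet> x" by (simp add: dot_square_norm power2_eq_square)
  qed
  ultimately show ?thesis by (simp add: definable_fun_def)
qed

lemma definable_fun_dist: "definable_fun f \<Longrightarrow> definable_fun g \<Longrightarrow> definable_fun (\<lambda>x. dist (f x) (g x))"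
  unfolding dist_norm by (intro definable_fun_norm definable_fun_diff)

lemma definable_mem: "definable (\<lambda>x. x \<in> A) \<Longrightarrow> definable_fun f \<Longrightarrow> definable (\<lambda>x. f x \<in> A)"
  by (rule definable_compose)

lemmas definable_intros =
  definable_conj definable_disj definable_not definable_imp definable_iff definable_ex definable_all
  definable_eq definable_less definable_le definable_const
  definable_fun_id definable_fun_const definable_fun_fst definable_fun_snd definable_fun_Pair
  definable_fun_add definable_fun_diff definable_fun_mult definable_fun_scaleR definable_fun_inner
  definable_fun_norm definable_fun_dist

end


section \<open>Definable functions of one real variable\<close>

lemma right_growth:
  fixes f :: "real \<Rightarrow> real"
  assumes ab: "a \<le> b" and cont: "continuous_on {a..b} f"
    and ev: "\<And>x. a \<le> x \<Longrightarrow> x < b \<Longrightarrow> \<forall>\<^sub>F y in at_right x. K * (y - x) \<le> f y - f x"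
  shows "K * (b - a) \<le> f b - f a"
proof -
  define \<phi> where "\<phi> = (\<lambda>x. f x - K * x)"
  have c: "continuous_on {a..b} \<phi>" unfolding \<phi>_def by (intro continuous_intros cont)
  let ?S = "{x \<in> {a..b}. \<phi> a \<le> \<phi> x}"
  have "closed ?S" by (intro continuous_on_closed_Collect_le[of "{a..b}" "\<lambda>_. \<phi> a" \<phi>]) (auto intro: c)
  moreover have "a \<in> ?S" "bdd_above ?S" using ab by (auto intro!: bdd_aboveI[of _ b])
  ultimately have z: "Sup ?S \<in> ?S" by (intro closed_contains_Sup) auto
  have "Sup ?S = b"
  proof (rule ccontr)
    assume "Sup ?S \<noteq> b"
    with z have "Sup ?S < b" by auto
    with z have "\<forall>\<^sub>F y in at_right (Sup ?S). K * (y - Sup ?S) \<le> f y - f (Sup ?S)" by (intro ev) auto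
    moreover have "\<forall>\<^sub>F y in at_right (Sup ?S). y \<in> {Sup ?S<..<b}"
      using \<open>Sup ?S < b\<close> by (rule eventually_at_right_real)
    ultimately have "\<forall>\<^sub>F y in at_right (Sup ?S). Sup ?S < y \<and> y < b \<and> K * (y - Sup ?S) \<le> f y - f (Sup ?S)"
      by eventually_elim auto
    then obtain y where y: "Sup ?S < y" "y < b" "K * (y - Sup ?S) \<le> f y - f (Sup ?S)"
      using eventually_happens by fastforce
    with z have "y \<in> ?S" by (auto simp: \<phi>_def algebra_simps)
    then have "y \<le> Sup ?S" using \<open>bdd_above ?S\<close> by (rule cSup_upper)
    with y(1) show False by simp
  qed
  with z show ?thesis by (auto simp: \<phi>_def algebra_simps)
qed

lemma strict_mono_on_Bolzano:
  fixes f :: "real \<Rightarrow> real"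
  assumes "\<And>x. c < x \<Longrightarrow> x < d \<Longrightarrow> \<exists>\<delta>>0. \<forall>y. (x < y \<and> y < x + \<delta> \<longrightarrow> f x < f y) \<and> (x - \<delta> < y \<and> y < x \<longrightarrow> f y < f x)"
  shows "strict_mono_on {c<..<d} f"
proof (rule strict_mono_onI)
  fix u v assume uv: "u \<in> {c<..<d}" "v \<in> {c<..<d}" "u < v"
  have "u \<le> v" using uv by simp
  then have "u < v \<longrightarrow> f u < f v"
  proof (rule Bolzano)
    show "(a < b \<longrightarrow> f a < f b) \<Longrightarrow> (b < e \<longrightarrow> f b < f e) \<Longrightarrow> a \<le> b \<Longrightarrow> b \<le> e \<Longrightarrow> a < e \<longrightarrow> f a < f e" for a b e
      by (cases "a = b"; cases "b = e") auto
    fix x assume x: "u \<le> x" "x \<le> v"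
    then obtain \<delta> where \<delta>: "\<delta> > 0" "\<forall>y. (x < y \<and> y < x + \<delta> \<longrightarrow> f x < f y) \<and> (x - \<delta> < y \<and> y < x \<longrightarrow> f y < f x)"
      using assms[of x] uv by auto
    show "\<exists>d>0. \<forall>a b. a \<le> x \<and> x \<le> b \<and> b - a < d \<longrightarrow> a < b \<longrightarrow> f a < f b"
    proof (intro exI[of _ \<delta>] conjI allI impI \<delta>(1))
      fix a b assume ab: "a \<le> x \<and> x \<le> b \<and> b - a < \<delta>" "a < b"
      have "a < x \<Longrightarrow> f a < f x" "x < b \<Longrightarrow> f x < f b" using ab \<delta>(2) by auto
      then show "f a < f b" using ab by (cases "a = x"; cases "x = b") auto
    qed
  qed
  with uv show "f u < f v" by simp
qed

lemma strict_local_max_countable: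
  fixes f :: "real \<Rightarrow> real"
  assumes "\<And>x. x \<in> S \<Longrightarrow> \<exists>\<delta>>0. \<forall>y. y \<noteq> x \<and> \<bar>y - x\<bar> < \<delta> \<longrightarrow> f y < f x"
  shows "countable S"
proof -
  have "\<exists>p::rat \<times> rat. real_of_rat (fst p) < x \<and> x < real_of_rat (snd p) \<and>
     (\<forall>y. y \<noteq> x \<and> real_of_rat (fst p) < y \<and> y < real_of_rat (snd p) \<longrightarrow> f y < f x)" if "x \<in> S" for x
  proof -
    obtain \<delta> where \<delta>: "\<delta> > 0" "\<forall>y. y \<noteq> x \<and> \<bar>y - x\<bar> < \<delta> \<longrightarrow> f y < f x" using assms[OF \<open>x \<in> S\<close>] by blast
    obtain p q where "x - \<delta> < of_rat p" "of_rat p < x" "x < of_rat q" "of_rat q < x + \<delta>"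
      using \<delta>(1) of_rat_dense[of "x - \<delta>" x] of_rat_dense[of x "x + \<delta>"] by auto
    with \<delta>(2) show ?thesis by (intro exI[of _ "(p, q)"]) auto
  qed
  then obtain r :: "real \<Rightarrow> rat \<times> rat" where r: "\<And>x. x \<in> S \<Longrightarrow> real_of_rat (fst (r x)) < x \<and> x < real_of_rat (snd (r x)) \<and>
     (\<forall>y. y \<noteq> x \<and> real_of_rat (fst (r x)) < y \<and> y < real_of_rat (snd (r x)) \<longrightarrow> f y < f x)" by metis
  have "inj_on r S"
  proof (rule inj_onI, rule ccontr)
    fix x y assume "x \<in> S" "y \<in> S" "r x = r y" "x \<noteq> y"
    then have "f y < f x" "f x < f y" using r[of x] r[of y] by auto
    then show False by simp
  qed
  then show ?thesis by (rule countable_image_inj_on[rotated]) simp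
qed

context o_minimal_structure
begin

lemma definable_real_cases:
  assumes "definable (P :: real \<Rightarrow> bool)"
  obtains \<F> where "finite \<F>" "\<And>I. I \<in> \<F> \<Longrightarrow> (\<exists>x. I = {x}) \<or> (open I \<and> is_interval I)" "Collect P = \<Union>\<F>"
proof -
  have "(\<lambda>x. [x]) ` Collect P \<in> \<O> 1" using assms by (simp add: definable_real_iff)
  then obtain \<F> where F: "(\<lambda>x. [x]) ` Collect P = (\<lambda>x. [x]) ` \<Union>\<F>" "finite \<F>" "\<forall>I\<in>\<F>. (\<exists>x. I = {x}) \<or> (open I \<and> is_interval I)"
    unfolding line by blast
  have "inj (\<lambda>x::real. [x])" by (simp add: inj_def)
  with F(1) have "Collect P = \<Union>\<F>" by (simp add: inj_image_eq_iff)
  with F(2,3) show thesis by (intro that[of \<F>]) auto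
qed

lemma definable_infinite_interval:
  assumes "definable (P :: real \<Rightarrow> bool)" "infinite {x. P x}"
  obtains a b where "a < b" "\<And>x. a < x \<Longrightarrow> x < b \<Longrightarrow> P x"
proof -
  obtain \<F> where F: "finite \<F>" "\<And>I. I \<in> \<F> \<Longrightarrow> (\<exists>x. I = {x}) \<or> (open I \<and> is_interval I)" "Collect P = \<Union>\<F>"
    using definable_real_cases[OF assms(1)] by blast
  with assms(2) obtain I where I: "I \<in> \<F>" "infinite I" using finite_Union[of \<F>] by (metis Collect_cong)
  then have "open I" using F(2)[of I] by auto
  from I obtain x where "x \<in> I" by (metis finite.emptyI ex_in_conv)
  with \<open>open I\<close> obtain e where "e > 0" "ball x e \<subseteq> I" by (auto simp: open_contains_ball)
  moreover have "P y" if "y \<in> I" for y using F(3) I(1) that by blast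
  ultimately show thesis using that[of x "x + e"] by (auto simp: dist_real_def subset_eq)
qed

lemma definable_eventually_right:
  assumes "definable (P :: real \<Rightarrow> bool)"
  shows "(\<forall>\<^sub>F x in at_right a. P x) \<or> (\<forall>\<^sub>F x in at_right a. \<not> P x)"
proof -
  obtain \<F> where F: "finite \<F>" "\<And>I. I \<in> \<F> \<Longrightarrow> (\<exists>x. I = {x}) \<or> (open I \<and> is_interval I)" "Collect P = \<Union>\<F>"
    using definable_real_cases[OF assms(1)] by blast
  have 1: "(\<forall>\<^sub>F x in at_right a. x \<in> I) \<or> (\<forall>\<^sub>F x in at_right a. x \<notin> I)" if "I \<in> \<F>" for I
  proof (cases "\<exists>e>a. \<forall>x. a < x \<and> x < e \<longrightarrow> x \<notin> I")
    case True
    then show ?thesis by (auto simp: eventually_at_right_field)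
  next
    case False
    then obtain x where x: "x > a" "x \<in> I" "x < a + 1" by (metis less_add_one)
    obtain y where y: "a < y" "y < x" "y \<in> I" using False x(1) by blast
    then have "is_interval I" using F(2)[OF that] x by auto
    have "z \<in> I" if z: "a < z" "z < x" for z
    proof -
      obtain u where "a < u" "u < z" "u \<in> I" using False z(1) by blast
      then show ?thesis using \<open>is_interval I\<close> x z unfolding is_interval_1 by (metis less_imp_le)
    qed
    then show ?thesis using x by (auto simp: eventually_at_right_field)
  qed
  show ?thesis
  proof (cases "\<exists>I\<in>\<F>. \<forall>\<^sub>F x in at_right a. x \<in> I")
    case True
    then obtain I where "I \<in> \<F>" "\<forall>\<^sub>F x in at_right a. x \<in> I" by blast
    then have "\<forall>\<^sub>F x in at_right a. P x" using F(3) by (auto elim!: eventually_mono)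
    then show ?thesis ..
  next
    case False
    with 1 have "\<forall>\<^sub>F x in at_right a. \<forall>I\<in>\<F>. x \<notin> I" by (auto simp: eventually_ball_finite_distrib F(1))
    then have "\<forall>\<^sub>F x in at_right a. \<not> P x" using F(3) by (auto elim!: eventually_mono)
    then show ?thesis ..
  qed
qed

lemma definable_fun_uminus: "definable_fun f \<Longrightarrow> definable_fun (\<lambda>x. - f x)"
  using definable_fun_scaleR[OF definable_fun_const[of "-1"]] by simp

lemma definable_eventually_left:
  assumes "definable (P :: real \<Rightarrow> bool)"
  shows "(\<forall>\<^sub>F x in at_left a. P x) \<or> (\<forall>\<^sub>F x in at_left a. \<not> P x)"
proof -
  have "definable (\<lambda>x. P (- x))" by (rule definable_compose[OF assms definable_fun_uminus[OF definable_fun_id]])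
  from definable_eventually_right[OF this, of "-a"] show ?thesis by (simp add: at_left_minus[of a] eventually_filtermap)
qed

lemma definable_dense_eventually_right:
  assumes "definable (P :: real \<Rightarrow> bool)" "\<And>a b. a < b \<Longrightarrow> \<exists>x. a < x \<and> x < b \<and> P x"
  shows "\<forall>\<^sub>F x in at_right a. P x"
  using definable_eventually_right[OF assms(1), of a]
proof
  assume "\<forall>\<^sub>F x in at_right a. \<not> P x"
  then obtain e where "e > a" "\<And>x. a < x \<Longrightarrow> x < e \<Longrightarrow> \<not> P x" by (auto simp: eventually_at_right_field)
  with assms(2)[of a e] show ?thesis by blast
qed

lemma definable_dense_cofinite:
  assumes "definable (P :: real \<Rightarrow> bool)" "\<And>a b. a < b \<Longrightarrow> \<exists>x. a < x \<and> x < b \<and> P x"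
  shows "finite {x. \<not> P x}"
proof (rule ccontr)
  assume "infinite {x. \<not> P x}"
  from definable_infinite_interval[OF definable_not[OF assms(1)] this] show False using assms(2) by metis
qed

lemma definable_countable_union:
  assumes "a < b" "\<And>x. a < x \<Longrightarrow> x < b \<Longrightarrow> \<exists>n::nat. P n x" "\<And>n. definable (P n :: real \<Rightarrow> bool)"
  obtains n c d where "a \<le> c" "c < d" "d \<le> b" "\<And>x. c < x \<Longrightarrow> x < d \<Longrightarrow> P n x"
proof -
  have "\<exists>n. infinite {x. (a < x \<and> x < b) \<and> P n x}"
  proof (rule ccontr)
    assume "\<nexists>n. infinite {x. (a < x \<and> x < b) \<and> P n x}"
    then have "countable (\<Union>n. {x. (a < x \<and> x < b) \<and> P n x})" by (intro countable_UN) (auto intro: countable_finite)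
    moreover have "{a<..<b} \<subseteq> (\<Union>n. {x. (a < x \<and> x < b) \<and> P n x})" using assms(2) by auto
    ultimately have "countable {a<..<b}" by (rule countable_subset[rotated])
    with assms(1) show False using uncountable_open_interval by blast
  qed
  then obtain n where n: "infinite {x. (a < x \<and> x < b) \<and> P n x}" by blast
  have "definable (\<lambda>x. (a < x \<and> x < b) \<and> P n x)" by (intro definable_intros assms(3))
  from definable_infinite_interval[OF this n] obtain c d where
    cd: "c < d" "\<And>x. c < x \<Longrightarrow> x < d \<Longrightarrow> (a < x \<and> x < b) \<and> P n x" by metis
  have "a \<le> c" by (rule dense_ge_bounded[OF cd(1)]) (use cd(2) less_imp_le in blast)
  moreover have "d \<le> b" by (rule dense_le_bounded[OF cd(1)]) (use cd(2) less_imp_le in blast)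
  ultimately show thesis using cd that by metis
qed

lemma definable_less_eq_greater_right:
  assumes "definable_fun (f :: real \<Rightarrow> real)"
  shows "(\<forall>\<^sub>F y in at_right a. f y < c) \<or> (\<forall>\<^sub>F y in at_right a. f y = c) \<or> (\<forall>\<^sub>F y in at_right a. c < f y)"
proof -
  have "definable (\<lambda>y. f y < c)" "definable (\<lambda>y. f y = c)"
    by (intro definable_intros assms)+
  from this[THEN definable_eventually_right, of a] show ?thesis
  proof (elim disjE)
    assume "\<forall>\<^sub>F x in at_right a. \<not> f x < c" "\<forall>\<^sub>F x in at_right a. f x \<noteq> c"
    then have "\<forall>\<^sub>F y in at_right a. c < f y" by eventually_elim simp
    then show ?thesis by blast
  qed auto
qed

lemma definable_less_eq_greater_left:
  assumes "definable_fun (f :: real \<Rightarrow> real)"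
  shows "(\<forall>\<^sub>F y in at_left a. f y < c) \<or> (\<forall>\<^sub>F y in at_left a. f y = c) \<or> (\<forall>\<^sub>F y in at_left a. c < f y)"
proof -
  have "definable (\<lambda>y. f y < c)" "definable (\<lambda>y. f y = c)"
    by (intro definable_intros assms)+
  from this[THEN definable_eventually_left, of a] show ?thesis
  proof (elim disjE)
    assume "\<forall>\<^sub>F x in at_left a. \<not> f x < c" "\<forall>\<^sub>F x in at_left a. f x \<noteq> c"
    then have "\<forall>\<^sub>F y in at_left a. c < f y" by eventually_elim simp
    then show ?thesis by blast
  qed auto
qed

lemma eventually_at_right_iff: "(\<forall>\<^sub>F y in at_right (x::real). P y) \<longleftrightarrow> (\<exists>\<delta>>0. \<forall>y. x < y \<and> y < x + \<delta> \<longrightarrow> P y)"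
proof
  assume "\<forall>\<^sub>F y in at_right x. P y"
  then obtain b where "b > x" "\<forall>y>x. y < b \<longrightarrow> P y" by (auto simp: eventually_at_right_field)
  then show "\<exists>\<delta>>0. \<forall>y. x < y \<and> y < x + \<delta> \<longrightarrow> P y" by (intro exI[of _ "b - x"]) auto
next
  assume "\<exists>\<delta>>0. \<forall>y. x < y \<and> y < x + \<delta> \<longrightarrow> P y"
  then obtain \<delta> where "\<delta> > 0" "\<forall>y. x < y \<and> y < x + \<delta> \<longrightarrow> P y" by blast
  then show "\<forall>\<^sub>F y in at_right x. P y"
    unfolding eventually_at_right_field by (intro exI[of _ "x + \<delta>"]) auto
qed

lemma eventually_at_left_iff: "(\<forall>\<^sub>F y in at_left (x::real). P y) \<longleftrightarrow> (\<exists>\<delta>>0. \<forall>y. x - \<delta> < y \<and> y < x \<longrightarrow> P y)"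
proof
  assume "\<forall>\<^sub>F y in at_left x. P y"
  then obtain b where "b < x" "\<forall>y>b. y < x \<longrightarrow> P y" by (auto simp: eventually_at_left_field)
  then show "\<exists>\<delta>>0. \<forall>y. x - \<delta> < y \<and> y < x \<longrightarrow> P y" by (intro exI[of _ "x - b"]) auto
next
  assume "\<exists>\<delta>>0. \<forall>y. x - \<delta> < y \<and> y < x \<longrightarrow> P y"
  then obtain \<delta> where "\<delta> > 0" "\<forall>y. x - \<delta> < y \<and> y < x \<longrightarrow> P y" by blast
  then show "\<forall>\<^sub>F y in at_left x. P y"
    unfolding eventually_at_left_field by (intro exI[of _ "x - \<delta>"]) auto
qed

lemma definable_eventually_at_right:
  assumes "definable (\<lambda>z::'a::euclidean_space\<times>real. P (fst z) (snd z))" "definable_fun g"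
  shows "definable (\<lambda>x. \<forall>\<^sub>F y in at_right (g x). P x y)"
  unfolding eventually_at_right_iff
  by (intro definable_intros definable_fun_compose[OF assms(2)]
    definable_compose[OF assms(1), of "\<lambda>z. (fst (fst z), snd z)", unfolded fst_conv snd_conv])

lemma definable_eventually_at_left:
  assumes "definable (\<lambda>z::'a::euclidean_space\<times>real. P (fst z) (snd z))" "definable_fun g"
  shows "definable (\<lambda>x. \<forall>\<^sub>F y in at_left (g x). P x y)"
  unfolding eventually_at_left_iff
  by (intro definable_intros definable_fun_compose[OF assms(2)]
    definable_compose[OF assms(1), of "\<lambda>z. (fst (fst z), snd z)", unfolded fst_conv snd_conv])


lemma definable_locally_monotone:
  assumes f: "definable_fun (f :: real \<Rightarrow> real)" and ab: "a < b"
  obtains c d where "a \<le> c" "c < d" "d \<le> b"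
    "strict_mono_on {c<..<d} f \<or> strict_mono_on {c<..<d} (\<lambda>x. - f x) \<or> (\<exists>k. \<forall>x\<in>{c<..<d}. f x = k)"
proof -
  define rel where "rel = (\<lambda>i u v::real. if i = (0::nat) then u < v else if i = 1 then u = v else v < u)"
  define r where "r = (\<lambda>i x. \<forall>\<^sub>F y in at_right x. rel i (f y) (f x))"
  define l where "l = (\<lambda>i x. \<forall>\<^sub>F y in at_left x. rel i (f y) (f x))"
  have "definable (\<lambda>z. rel i (f (snd z)) (f (fst z)))" for i
  proof -
    have "definable (\<lambda>z. f (snd z) < f (fst z))" "definable (\<lambda>z. f (snd z) = f (fst z))" "definable (\<lambda>z. f (fst z) < f (snd z))"
      by (intro definable_less definable_eq definable_fun_compose[OF f] definable_fun_fst definable_fun_snd definable_fun_id)+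
    then show ?thesis by (cases "i = 0"; cases "i = 1") (simp_all add: rel_def)
  qed
  then have dr: "definable (r i)" "definable (l i)" for i
    unfolding r_def l_def
    using definable_eventually_at_right[OF _ definable_fun_id, of "\<lambda>x y. rel i (f y) (f x)"]
      definable_eventually_at_left[OF _ definable_fun_id, of "\<lambda>x y. rel i (f y) (f x)"] by simp_all
  have ex: "\<exists>i. r i x" "\<exists>i. l i x" for x
  proof -
    have "rel 0 = (<)" "rel 1 = (=)" "rel 2 = (>)" by (auto simp: rel_def fun_eq_iff)
    then have "r 0 x \<or> r 1 x \<or> r 2 x" "l 0 x \<or> l 1 x \<or> l 2 x"
      unfolding r_def l_def
      using definable_less_eq_greater_right[OF f, where a = x and c = "f x"] definable_less_eq_greater_left[OF f, where a = x and c = "f x"] by simp_all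
    then show "\<exists>i. r i x" "\<exists>i. l i x" by blast+
  qed
  obtain i c1 d1 where 1: "a \<le> c1" "c1 < d1" "d1 \<le> b" "\<And>x. c1 < x \<Longrightarrow> x < d1 \<Longrightarrow> r i x"
    by (rule definable_countable_union[OF ab ex(1) dr(1)]) (rule that)
  obtain j c d where 2: "c1 \<le> c" "c < d" "d \<le> d1" "\<And>x. c < x \<Longrightarrow> x < d \<Longrightarrow> l j x"
    by (rule definable_countable_union[OF 1(2) ex(2) dr(2)]) (rule that)
  have both: "\<exists>\<delta>>0. \<forall>y. (x < y \<and> y < x + \<delta> \<longrightarrow> rel i (f y) (f x)) \<and> (x - \<delta> < y \<and> y < x \<longrightarrow> rel j (f y) (f x))"
    if cd: "c < x" "x < d" for x
  proof -
    have "r i x" "l j x" using 1(4)[of x] 2(1,3) 2(4)[of x] cd by auto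
    then obtain \<delta> \<delta>' where \<delta>: "\<delta> > 0" "\<delta>' > 0"
      "\<And>y. x < y \<and> y < x + \<delta> \<Longrightarrow> rel i (f y) (f x)"
      "\<And>y. x - \<delta>' < y \<and> y < x \<Longrightarrow> rel j (f y) (f x)"
      unfolding r_def l_def eventually_at_right_iff eventually_at_left_iff by blast
    have "rel i (f y) (f x)" if "x < y \<and> y < x + min \<delta> \<delta>'" for y
      using \<delta>(3)[of y] that min.cobounded1[of \<delta> \<delta>'] by linarith
    moreover have "rel j (f y) (f x)" if "x - min \<delta> \<delta>' < y \<and> y < x" for y
      using \<delta>(4)[of y] that min.cobounded2[of \<delta> \<delta>'] by linarith
    ultimately show ?thesis using \<delta>(1,2) by (intro exI[of _ "min \<delta> \<delta>'"]) simp
  qed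
  have ac: "a \<le> c" "d \<le> b" using 1 2 by auto
  define m where "m = (c + d) / 2"
  have m: "c < m" "m < d" using 2(2) by (auto simp: m_def)
  have unc: "\<not> countable {c<..<d}" using 2(2) uncountable_open_interval by blast
  consider "i = 1" | "j = 1" | "i = 0" "j \<noteq> 0" "j \<noteq> 1" | "j = 0" "i \<noteq> 0" "i \<noteq> 1" | "i = 0" "j = 0" | "i \<noteq> 0" "i \<noteq> 1" "j \<noteq> 0" "j \<noteq> 1"
    by blast
  then show thesis
  proof cases
    case 1
    then obtain \<delta> where "\<delta> > 0" "\<forall>y. m < y \<and> y < m + \<delta> \<longrightarrow> f y = f m" using both[OF m] by (auto simp: rel_def)
    then show thesis using ac m by (intro that[of m "min d (m + \<delta>)"]) auto
  next
    case 2
    then obtain \<delta> where "\<delta> > 0" "\<forall>y. m - \<delta> < y \<and> y < m \<longrightarrow> f y = f m" using both[OF m] by (auto simp: rel_def)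
    then show thesis using ac m by (intro that[of "max c (m - \<delta>)" m]) auto
  next
    case 3
    have "strict_mono_on {c<..<d} (\<lambda>x. - f x)"
    proof (rule strict_mono_on_Bolzano)
      fix x assume "c < x" "x < d"
      from both[OF this] 3 show "\<exists>\<delta>>0. \<forall>y. (x < y \<and> y < x + \<delta> \<longrightarrow> - f x < - f y) \<and> (x - \<delta> < y \<and> y < x \<longrightarrow> - f y < - f x)"
        by (simp add: rel_def)
    qed
    then show thesis using that[OF ac(1) 2(2) ac(2)] by blast
  next
    case 4
    have "strict_mono_on {c<..<d} f"
    proof (rule strict_mono_on_Bolzano)
      fix x assume "c < x" "x < d"
      from both[OF this] 4 show "\<exists>\<delta>>0. \<forall>y. (x < y \<and> y < x + \<delta> \<longrightarrow> f x < f y) \<and> (x - \<delta> < y \<and> y < x \<longrightarrow> f y < f x)"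
        by (simp add: rel_def)
    qed
    then show thesis using that[OF ac(1) 2(2) ac(2)] by blast
  next
    case 5
    have "countable {c<..<d}"
    proof (rule strict_local_max_countable[of _ f])
      fix x assume "x \<in> {c<..<d}"
      then obtain \<delta> where "\<delta> > 0" "\<forall>y. (x < y \<and> y < x + \<delta> \<longrightarrow> f y < f x) \<and> (x - \<delta> < y \<and> y < x \<longrightarrow> f y < f x)"
        using both[of x] 5 by (auto simp: rel_def)
      then show "\<exists>\<delta>>0. \<forall>y. y \<noteq> x \<and> \<bar>y - x\<bar> < \<delta> \<longrightarrow> f y < f x"
        by (intro exI[of _ \<delta>]) (auto simp: abs_if split: if_splits)
    qed
    with unc show thesis by blast
  next
    case 6
    have "countable {c<..<d}"
    proof (rule strict_local_max_countable[of _ "\<lambda>x. - f x"])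
      fix x assume "x \<in> {c<..<d}"
      then obtain \<delta> where "\<delta> > 0" "\<forall>y. (x < y \<and> y < x + \<delta> \<longrightarrow> f x < f y) \<and> (x - \<delta> < y \<and> y < x \<longrightarrow> f x < f y)"
        using both[of x] 6 by (auto simp: rel_def)
      then show "\<exists>\<delta>>0. \<forall>y. y \<noteq> x \<and> \<bar>y - x\<bar> < \<delta> \<longrightarrow> - f y < - f x"
        by (intro exI[of _ \<delta>]) (auto simp: abs_if split: if_splits)
    qed
    with unc show thesis by blast
  qed
qed

lemma definable_locally_continuous:
  assumes f: "definable_fun (f :: real \<Rightarrow> real)" and ab: "a < b"
  obtains c d where "a \<le> c" "c < d" "d \<le> b" "continuous_on {c<..<d} f" "mono_on {c<..<d} f \<or> mono_on {c<..<d} (\<lambda>x. - f x)"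
proof -
  have main: "\<exists>c d. a \<le> c \<and> c < d \<and> d \<le> b \<and> continuous_on {c<..<d} f \<and> mono_on {c<..<d} f"
    if f: "definable_fun f" and c: "a \<le> c" "c < d" "d \<le> b" and sm: "strict_mono_on {c<..<d} f" for f :: "real \<Rightarrow> real" and c d :: real
  proof -
    have less: "f x < f y \<longleftrightarrow> x < y" if "x \<in> {c<..<d}" "y \<in> {c<..<d}" for x y
      using strict_mono_onD[OF sm that] strict_mono_onD[OF sm that(2,1)]
      by (cases x y rule: linorder_cases) auto
    let ?P = "\<lambda>y. \<exists>x. (c < x \<and> x < d) \<and> y = f x"
    have "definable ?P"
      by (intro definable_ex definable_conj definable_less definable_eq definable_fun_compose[OF f]
          definable_fun_const definable_fun_fst definable_fun_snd definable_fun_id)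
    moreover have "{y. ?P y} = f ` {c<..<d}" by auto
    then have "infinite {y. ?P y}"
      using strict_mono_on_imp_inj_on[OF sm] c(2) by (simp add: finite_image_iff infinite_Ioo)
    ultimately obtain u v where uv: "u < v" "\<And>y. u < y \<Longrightarrow> y < v \<Longrightarrow> ?P y"
      by (rule definable_infinite_interval) (rule that)
    define p where "p = (2 * u + v) / 3"
    define q where "q = (u + 2 * v) / 3"
    have pq: "u < p" "p < q" "q < v" using uv(1) by (auto simp: p_def q_def field_simps)
    obtain c' d' where cd': "c < c'" "c' < d" "p = f c'" "c < d'" "d' < d" "q = f d'"
      using uv(2)[of p] uv(2)[of q] pq by auto
    then have "c' < d'" using pq less[of c' d'] by auto
    have sub: "{c'<..<d'} \<subseteq> {c<..<d}" using cd' by auto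
    have im: "f ` {c'<..<d'} = {p<..<q}"
    proof
      show "f ` {c'<..<d'} \<subseteq> {p<..<q}" using cd' less by auto
      show "{p<..<q} \<subseteq> f ` {c'<..<d'}"
      proof
        fix y assume y: "y \<in> {p<..<q}"
        then obtain x where x: "c < x" "x < d" "y = f x" using uv(2)[of y] pq by auto
        then have "x \<in> {c'<..<d'}" using y cd' less[of c' x] less[of x d'] by auto
        with x show "y \<in> f ` {c'<..<d'}" by blast
      qed
    qed
    have mono: "mono_on {c'<..<d'} f"
      using monotone_on_subset[OF strict_mono_on_imp_mono_on[OF sm] sub] .
    have "continuous_on {c'<..<d'} f"
      by (rule continuous_onI_mono) (use im mono in \<open>auto simp: mono_on_def\<close>)
    with mono \<open>c' < d'\<close> cd' c show ?thesis by (intro exI[of _ c'] exI[of _ d']) auto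
  qed
  obtain c d where cd: "a \<le> c" "c < d" "d \<le> b"
    and "strict_mono_on {c<..<d} f \<or> strict_mono_on {c<..<d} (\<lambda>x. - f x) \<or> (\<exists>k. \<forall>x\<in>{c<..<d}. f x = k)"
    using definable_locally_monotone[OF f ab] by blast
  then consider "strict_mono_on {c<..<d} f" | "strict_mono_on {c<..<d} (\<lambda>x. - f x)" | k where "\<forall>x\<in>{c<..<d}. f x = k" by blast
  then show thesis
  proof cases
    case 1
    from main[OF f cd 1] that show thesis by blast
  next
    case 2
    obtain c' d' where "a \<le> c'" "c' < d'" "d' \<le> b" "continuous_on {c'<..<d'} (\<lambda>x. - f x)" "mono_on {c'<..<d'} (\<lambda>x. - f x)"
      using main[OF definable_fun_uminus[OF f] cd 2] by blast
    then show thesis using continuous_on_minus[of "{c'<..<d'}" "\<lambda>x. - f x"] by (intro that[of c' d']) auto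
  next
    case 3
    have "continuous_on {c<..<d} f"
      using continuous_on_cong[of "{c<..<d}" "{c<..<d}" f "\<lambda>_. k"] 3 by simp
    moreover have "mono_on {c<..<d} f" using 3 by (auto simp: mono_on_def)
    ultimately show thesis using cd that by blast
  qed
qed


lemma definable_isCont_pred:
  fixes f :: "real \<Rightarrow> 'b::euclidean_space"
  assumes f: "definable_fun f"
  shows "definable (\<lambda>x. isCont f x)"
proof -
  have eq: "(\<lambda>x. isCont f x) = (\<lambda>x. \<forall>e. 0 < e \<longrightarrow> (\<exists>d. 0 < d \<and> (\<forall>y. dist y x < d \<longrightarrow> dist (f y) (f x) < e)))"
    by (simp add: continuous_at_eps_delta fun_eq_iff Bex_def)
  show ?thesis unfolding eq
    by (intro definable_intros definable_fun_compose[OF f])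
qed

lemma definable_cofinite_isCont:
  assumes f: "definable_fun (f :: real \<Rightarrow> real)"
  shows "finite {x. \<not> isCont f x}"
proof (rule definable_dense_cofinite[OF definable_isCont_pred[OF f]])
  fix a b :: real assume "a < b"
  obtain c d where cd: "a \<le> c" "c < d" "d \<le> b" "continuous_on {c<..<d} f"
    by (rule definable_locally_continuous[OF f \<open>a < b\<close>])
  have "isCont f ((c + d) / 2)"
    using cd(2,4) by (simp add: continuous_on_eq_continuous_at)
  with cd show "\<exists>x>a. x < b \<and> isCont f x" by (intro exI[of _ "(c + d) / 2"]) auto
qed

lemma definable_quotient_pred:
  assumes f: "definable_fun (f :: real \<Rightarrow> real)"
  shows "definable (\<lambda>z. \<forall>\<^sub>F y in at_right (fst z). snd z * (y - fst z) \<le> f y - f (fst z))"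
  by (rule definable_eventually_at_right)
    (intro definable_le definable_fun_mult definable_fun_diff definable_fun_compose[OF f] definable_fun_fst definable_fun_snd definable_fun_id)+

lemma mono_has_derivative_somewhere:
  assumes f: "definable_fun (f :: real \<Rightarrow> real)" and ab: "a < b"
    and cont: "continuous_on {a<..<b} f" and mono: "mono_on {a<..<b} f"
  shows "\<exists>x l. a < x \<and> x < b \<and> (f has_real_derivative l) (at x)"
proof -
  define G where "G = (\<lambda>x K. \<forall>\<^sub>F y in at_right x. K * (y - x) \<le> f y - f x)"
  have dG: "definable (\<lambda>z. G (fst z) (snd z))"
    unfolding G_def by (rule definable_quotient_pred[OF f])
  have G_anti: "G x K'" if "G x K" "K' \<le> K" for x K K'
  proof -
    have "\<forall>\<^sub>F y in at_right x. x < y" by (rule eventually_at_right_less)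
    with that(1) show ?thesis unfolding G_def
    proof eventually_elim
      case (elim y)
      have "K' * (y - x) \<le> K * (y - x)" using that(2) elim by (intro mult_right_mono) auto
      with elim show ?case by linarith
    qed
  qed
  have G0: "G x 0" if "a < x" "x < b" for x
  proof -
    have "\<forall>\<^sub>F y in at_right x. y \<in> {x<..<b}" using that by (intro eventually_at_right_real)
    then show ?thesis unfolding G_def
      by eventually_elim (use mono that in \<open>auto simp: mono_on_def\<close>)
  qed
  have notG: "\<forall>\<^sub>F y in at_right x. (- K) * (y - x) \<le> - f y - - f x" if "\<not> G x K" for x K
  proof -
    have "definable (\<lambda>y. K * (y - x) \<le> f y - f x)"
      by (intro definable_intros definable_fun_compose[OF f])
    from definable_eventually_right[OF this, of x] that show ?thesis
      unfolding G_def by (auto elim!: eventually_mono)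
  qed
  have growG: "K * (v - u) \<le> f v - f u" if "a < u" "u \<le> v" "v < b" "\<And>x. u \<le> x \<Longrightarrow> x < v \<Longrightarrow> G x K" for u v K
    using that by (intro right_growth continuous_on_subset[OF cont]) (auto simp: G_def)
  have grownG: "f v - f u \<le> K * (v - u)" if "a < u" "u \<le> v" "v < b" "\<And>x. u \<le> x \<Longrightarrow> x < v \<Longrightarrow> \<not> G x K" for u v K
  proof -
    have "(- K) * (v - u) \<le> - f v - - f u"
      using that notG by (intro right_growth continuous_on_minus continuous_on_subset[OF cont]) auto
    then show ?thesis by simp
  qed
  let ?I = "\<lambda>x. (a < x \<and> x < b) \<and> (\<forall>K. G x K)"
  have dI: "definable ?I" by (intro definable_intros dG)
  have "\<exists>c d. a \<le> c \<and> c < d \<and> d \<le> b \<and> (\<forall>x. c < x \<and> x < d \<longrightarrow> (\<exists>K. \<not> G x K))"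
  proof -
    have "\<exists>n::nat. \<not> ?I x \<and> n = 0 \<or> ?I x \<and> n = 1" for x by auto
    then have ex: "\<exists>n::nat. if n = 0 then \<not> ?I x else ?I x" for x by (metis zero_neq_one)
    obtain n and c d :: real where cd: "a \<le> c" "c < d" "d \<le> b" "\<And>x. c < x \<Longrightarrow> x < d \<Longrightarrow> if n = (0::nat) then \<not> ?I x else ?I x"
    proof (atomize_elim, goal_cases)
      case 1
      have dif: "definable (\<lambda>x. if n = 0 then \<not> ?I x else ?I x)" for n :: nat
        using dI definable_not[OF dI] by (cases "n = 0") simp_all
      show ?case by (rule definable_countable_union[OF ab ex dif]) blast
    qed
    show ?thesis
    proof (cases "n = 0")
      case True
      with cd(4) have "\<exists>K. \<not> G x K" if "c < x" "x < d" for x using that cd(1,3) by fastforce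
      with cd(1-3) show ?thesis by blast
    next
      case False
      obtain u where u: "c < u" "u < d" using cd(2) dense by blast
      obtain v where v: "u < v" "v < d" using u(2) dense by blast
      note uv = u(1) v
      define K where "K = (f v - f u) / (v - u) + 1"
      have "K * (v - u) \<le> f v - f u" using cd False uv by (intro growG) auto
      moreover have "K * (v - u) = f v - f u + (v - u)" using uv by (simp add: K_def field_simps)
      ultimately show ?thesis using uv by simp
    qed
  qed
  then obtain c d where cd: "a \<le> c" "c < d" "d \<le> b" "\<And>x. c < x \<Longrightarrow> x < d \<Longrightarrow> \<exists>K. \<not> G x K" by blast
  define ok where "ok = (\<lambda>x. (a < x \<and> x < b) \<and> (\<exists>K. \<not> G x K))"
  define g where "g = (\<lambda>x. if ok x then Sup {K. G x K} else 0)"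
  have g_props: "K < g x \<Longrightarrow> G x K" "g x < K \<Longrightarrow> \<not> G x K" if okx: "ok x" for x K
  proof -
    have ne: "{K. G x K} \<noteq> {}" using G0 okx by (auto simp: ok_def)
    obtain K0 where K0: "\<not> G x K0" using okx unfolding ok_def by blast
    have bdd: "bdd_above {K. G x K}"
    proof (rule bdd_aboveI[of _ K0])
      fix K assume "K \<in> {K. G x K}"
      then show "K \<le> K0" using K0 G_anti[of x K K0] by (cases "K \<le> K0") auto
    qed
    show "K < g x \<Longrightarrow> G x K" using less_cSup_iff[OF ne bdd, of K] okx G_anti[of x _ K] unfolding g_def by (auto dest: less_imp_le)
    show "g x < K \<Longrightarrow> \<not> G x K" using cSup_upper[OF _ bdd, of K] okx by (auto simp: g_def)
  qed
  have d_ok: "definable ok" unfolding ok_def by (intro definable_intros dG)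
  have graph: "(\<lambda>z. snd z = g (fst z)) = (\<lambda>z. ok (fst z) \<and> (\<forall>K. (K < snd z \<longrightarrow> G (fst z) K) \<and> (snd z < K \<longrightarrow> \<not> G (fst z) K)) \<or> \<not> ok (fst z) \<and> snd z = 0)"
  proof (intro ext iffI)
    fix z assume "snd z = g (fst z)"
    then show "ok (fst z) \<and> (\<forall>K. (K < snd z \<longrightarrow> G (fst z) K) \<and> (snd z < K \<longrightarrow> \<not> G (fst z) K)) \<or> \<not> ok (fst z) \<and> snd z = 0"
      using g_props[of "fst z"] by (auto simp: g_def)
  next
    fix z assume *: "ok (fst z) \<and> (\<forall>K. (K < snd z \<longrightarrow> G (fst z) K) \<and> (snd z < K \<longrightarrow> \<not> G (fst z) K)) \<or> \<not> ok (fst z) \<and> snd z = 0"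
    show "snd z = g (fst z)"
    proof (cases "ok (fst z)")
      case True
      show ?thesis
      proof (cases "snd z" "g (fst z)" rule: linorder_cases)
        case less
        then obtain K where "snd z < K" "K < g (fst z)" using dense by blast
        with * True g_props(1)[OF True, of K] show ?thesis by auto
      next
        case greater
        then obtain K where "g (fst z) < K" "K < snd z" using dense by blast
        with * True g_props(2)[OF True, of K] show ?thesis by auto
      qed
    qed (use * in \<open>simp add: g_def\<close>)
  qed
  have dg: "definable_fun g"
    unfolding definable_fun_def graph
    by (intro definable_intros definable_compose[OF d_ok]
      definable_compose[OF dG, of "\<lambda>z. (fst (fst z), snd z)", unfolded fst_conv snd_conv])
  obtain p q where pq: "c \<le> p" "p < q" "q \<le> d" "continuous_on {p<..<q} g"
    by (rule definable_locally_continuous[OF dg cd(2)])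
  have okpq: "ok x" if "p < x" "x < q" for x
    using cd pq that by (auto simp: ok_def)
  define x where "x = (p + q) / 2"
  have x: "p < x" "x < q" using pq by (auto simp: x_def)
  have "(f has_real_derivative g x) (at x)"
    unfolding has_field_derivative_iff
  proof -
    show "(\<lambda>y. (f y - f x) / (y - x)) \<midarrow>x\<rightarrow> g x"
      unfolding LIM_eq
    proof (intro allI impI)
      fix e :: real assume e: "0 < e"
      have "isCont g x" using pq(4) x by (simp add: continuous_on_eq_continuous_at)
      then obtain \<delta> where \<delta>: "\<delta> > 0" "\<And>y. dist y x < \<delta> \<Longrightarrow> dist (g y) (g x) < e / 2"
        unfolding continuous_at_eps_delta using e by (metis half_gt_zero)
      let ?d = "min \<delta> (min (x - p) (q - x))"
      have bound: "\<bar>f v - f u - g x * (v - u)\<bar> \<le> e / 2 * (v - u)" if "u \<le> v" "\<bar>u - x\<bar> < ?d" "\<bar>v - x\<bar> < ?d" for u v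
      proof -
        have w: "ok w \<and> g x - e / 2 < g w \<and> g w < g x + e / 2" if "u \<le> w" "w < v" for w
        proof -
          have "\<bar>w - x\<bar> < ?d" using that \<open>\<bar>u - x\<bar> < ?d\<close> \<open>\<bar>v - x\<bar> < ?d\<close> by (auto simp: abs_less_iff)
          then have "dist (g w) (g x) < e / 2" "ok w"
            using \<delta>(2)[of w] okpq[of w] by (auto simp: dist_real_def abs_less_iff)
          then show ?thesis unfolding dist_real_def abs_less_iff by linarith
        qed
        have ab': "a < u" "v < b" using that(2,3) cd(1,3) pq(1,3) by (auto simp: abs_less_iff)
        have "(g x - e / 2) * (v - u) \<le> f v - f u" using w g_props(1) by (intro growG ab' that(1)) blast
        moreover have "f v - f u \<le> (g x + e / 2) * (v - u)" using w g_props(2) by (intro grownG ab' that(1)) blast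
        ultimately show ?thesis unfolding abs_le_iff left_diff_distrib distrib_right by linarith
      qed
      show "\<exists>s>0. \<forall>y. y \<noteq> x \<and> norm (y - x) < s \<longrightarrow> norm ((f y - f x) / (y - x) - g x) < e"
      proof (intro exI[of _ ?d] conjI allI impI)
        show "0 < ?d" using \<delta>(1) x by simp
        fix y assume y: "y \<noteq> x \<and> norm (y - x) < ?d"
        have "\<bar>f y - f x - g x * (y - x)\<bar> \<le> e / 2 * \<bar>y - x\<bar>"
        proof (cases "x \<le> y")
          case True
          then show ?thesis using bound[of x y] y \<delta>(1) x by simp
        next
          case False
          then have "\<bar>f x - f y - g x * (x - y)\<bar> \<le> e / 2 * (x - y)" using bound[of y x] y \<delta>(1) x by simp
          moreover have "g x * (x - y) = - (g x * (y - x))" by (simp add: algebra_simps)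
          moreover have "\<bar>y - x\<bar> = x - y" using False by simp
          ultimately show ?thesis by (simp only: abs_le_iff) linarith
        qed
        then have "\<bar>f y - f x - g x * (y - x)\<bar> / \<bar>y - x\<bar> \<le> e / 2" using y by (simp add: divide_le_eq)
        moreover have "(f y - f x) / (y - x) - g x = (f y - f x - g x * (y - x)) / (y - x)" using y by (simp add: diff_divide_distrib)
        ultimately show "norm ((f y - f x) / (y - x) - g x) < e" using e by (simp only: real_norm_def abs_divide)
      qed
    qed
  qed
  moreover have "a < x" "x < b" using x pq cd by auto
  ultimately show ?thesis by blast
qed

lemma definable_locally_differentiable:
  assumes f: "definable_fun (f :: real \<Rightarrow> real)" and ab: "a < b"
  shows "\<exists>x l. a < x \<and> x < b \<and> (f has_real_derivative l) (at x)"
proof -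
  obtain c d where cd: "a \<le> c" "c < d" "d \<le> b" "continuous_on {c<..<d} f" "mono_on {c<..<d} f \<or> mono_on {c<..<d} (\<lambda>x. - f x)"
    by (rule definable_locally_continuous[OF f ab])
  from cd(5) show ?thesis
  proof
    assume "mono_on {c<..<d} f"
    from mono_has_derivative_somewhere[OF f cd(2,4) this] cd show ?thesis by (meson le_less_trans less_le_trans)
  next
    assume "mono_on {c<..<d} (\<lambda>x. - f x)"
    from mono_has_derivative_somewhere[OF definable_fun_uminus[OF f] cd(2) continuous_on_minus[OF cd(4)] this]
    obtain x l where x: "c < x" "x < d" "((\<lambda>x. - f x) has_real_derivative l) (at x)" by blast
    from DERIV_minus[OF x(3)] have "(f has_real_derivative - l) (at x)" by simp
    with x cd show ?thesis by (meson le_less_trans less_le_trans)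
  qed
qed


lemma definable_has_derivative_pred:
  assumes f: "definable_fun (f :: real \<Rightarrow> real)"
  shows "definable (\<lambda>z. (f has_real_derivative snd z) (at (fst z)))"
proof -
  have eq: "(f has_real_derivative l) (at x) \<longleftrightarrow>
    (\<forall>e. 0 < e \<longrightarrow> (\<exists>d. 0 < d \<and> (\<forall>y. dist y x < d \<longrightarrow> \<bar>f y - f x - l * (y - x)\<bar> \<le> e * dist y x)))" for l x
    unfolding has_field_derivative_def has_derivative_within_alt
    by (simp add: bounded_linear_mult_right dist_norm)
  have "(\<lambda>z. (f has_real_derivative snd z) (at (fst z))) = (\<lambda>z. \<forall>e. 0 < e \<longrightarrow> (\<exists>d. 0 < d \<and> (\<forall>y. dist y (fst z) < d \<longrightarrow>
     norm (f y - f (fst z) - snd z * (y - fst z)) \<le> e * dist y (fst z))))"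
    unfolding eq by simp
  then show ?thesis
    by (simp only:) (intro definable_intros definable_fun_compose[OF f])
qed

lemma definable_fun_if:
  assumes "definable P" "definable_fun f" "definable_fun g"
  shows "definable_fun (\<lambda>x. if P x then f x else g x)"
proof -
  have eq: "(\<lambda>z. snd z = (if P (fst z) then f (fst z) else g (fst z))) =
      (\<lambda>z. P (fst z) \<and> snd z = f (fst z) \<or> \<not> P (fst z) \<and> snd z = g (fst z))" by (auto simp: fun_eq_iff)
  show ?thesis unfolding definable_fun_def eq
    by (intro definable_intros definable_compose[OF assms(1)] definable_fun_compose[OF assms(2)] definable_fun_compose[OF assms(3)])
qed

lemma definable_fun_the:
  assumes P: "definable (\<lambda>z. P (fst z) (snd z))" and uniq: "\<And>x y z. P x y \<Longrightarrow> P x z \<Longrightarrow> y = z"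
  shows "definable_fun (\<lambda>x. if \<exists>y. P x y then THE y. P x y else c)"
proof -
  have the: "P x y \<Longrightarrow> (THE y. P x y) = y" for x y using uniq by blast
  have eq: "(\<lambda>z. snd z = (if \<exists>y. P (fst z) y then THE y. P (fst z) y else c)) =
      (\<lambda>z. P (fst z) (snd z) \<or> (\<not> (\<exists>y. P (fst z) y)) \<and> snd z = c)"
  proof
    fix z
    show "(snd z = (if \<exists>y. P (fst z) y then THE y. P (fst z) y else c)) =
        (P (fst z) (snd z) \<or> (\<not> (\<exists>y. P (fst z) y)) \<and> snd z = c)"
    proof (cases "\<exists>y. P (fst z) y")
      case True
      then obtain y where y: "P (fst z) y" by blast
      then have "(THE y. P (fst z) y) = y" by (rule the)
      then have v: "(if \<exists>y. P (fst z) y then THE y. P (fst z) y else c) = y" using True by (simp only: if_True)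
      show ?thesis unfolding v using y uniq[OF y] by blast
    next
      case False
      then show ?thesis by (simp only: if_False) blast
    qed
  qed
  show ?thesis unfolding definable_fun_def eq
    by (intro definable_intros P definable_compose[OF P, of "\<lambda>z. (fst (fst z), snd z)", unfolded fst_conv snd_conv])
qed

lemma definable_piecewise_C1_monotone:
  assumes f: "definable_fun (f :: real \<Rightarrow> real)"
  obtains \<delta> f' where "\<delta> > 0"
    "\<And>x. a < x \<Longrightarrow> x < a + \<delta> \<Longrightarrow> (f has_real_derivative f' x) (at x) \<and> isCont f' x"
    "mono_on {a<..<a + \<delta>} f \<or> mono_on {a<..<a + \<delta>} (\<lambda>x. - f x)"
proof -
  let ?D = "\<lambda>x l. (f has_real_derivative l) (at x)"
  have dD: "definable (\<lambda>z. ?D (fst z) (snd z))" by (rule definable_has_derivative_pred[OF f])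
  define f' where "f' = (\<lambda>x. if \<exists>l. ?D x l then THE l. ?D x l else 0)"
  have df': "definable_fun f'"
    unfolding f'_def by (rule definable_fun_the[OF dD]) (rule DERIV_unique)
  have f': "?D x (f' x)" if "?D x l" for x l
  proof -
    have "(THE l. ?D x l) = l" using that DERIV_unique by blast
    with that show ?thesis by (auto simp: f'_def)
  qed
  have 1: "\<forall>\<^sub>F x in at_right a. \<exists>l. ?D x l"
    by (rule definable_dense_eventually_right)
      (intro definable_ex dD, use definable_locally_differentiable[OF f] in blast)
  have 2: "\<forall>\<^sub>F x in at_right a. isCont f' x"
  proof (rule definable_dense_eventually_right[OF definable_isCont_pred[OF df']])
    fix c d :: real assume "c < d"
    then have "infinite {c<..<d}" by (rule infinite_Ioo)
    then have "infinite ({c<..<d} - {x. \<not> isCont f' x})"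
      using definable_cofinite_isCont[OF df'] by (rule Diff_infinite_finite[rotated])
    then obtain x where "x \<in> {c<..<d} - {x. \<not> isCont f' x}" by (metis finite.emptyI ex_in_conv)
    then show "\<exists>x>c. x < d \<and> isCont f' x" by auto
  qed
  have dc: "definable (\<lambda>x. f' x \<ge> 0)" by (intro definable_intros definable_fun_compose[OF df'])
  have 3: "(\<forall>\<^sub>F x in at_right a. f' x \<ge> 0) \<or> (\<forall>\<^sub>F x in at_right a. f' x \<le> 0)"
    using definable_eventually_right[OF dc, of a]
  proof
    assume "\<forall>\<^sub>F x in at_right a. \<not> 0 \<le> f' x"
    then have "\<forall>\<^sub>F x in at_right a. f' x \<le> 0" by eventually_elim simp
    then show ?thesis ..
  qed blast
  have "\<forall>\<^sub>F x in at_right a. ?D x (f' x) \<and> isCont f' x"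
    using 1 2 by eventually_elim (use f' in blast)
  then obtain \<delta>1 where d1: "\<delta>1 > 0" "\<And>x. a < x \<Longrightarrow> x < a + \<delta>1 \<Longrightarrow> ?D x (f' x) \<and> isCont f' x"
    unfolding eventually_at_right_iff by blast
  from 3 obtain \<delta>2 where d2: "\<delta>2 > 0"
    "(\<forall>x. a < x \<and> x < a + \<delta>2 \<longrightarrow> f' x \<ge> 0) \<or> (\<forall>x. a < x \<and> x < a + \<delta>2 \<longrightarrow> f' x \<le> 0)"
    unfolding eventually_at_right_iff by blast
  let ?d = "min \<delta>1 \<delta>2"
  from d2(2) have "mono_on {a<..<a + ?d} f \<or> mono_on {a<..<a + ?d} (\<lambda>x. - f x)"
  proof
    assume *: "\<forall>x. a < x \<and> x < a + \<delta>2 \<longrightarrow> f' x \<ge> 0"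
    have "mono_on {a<..<a + ?d} f"
    proof (rule mono_onI)
      fix x y assume xy: "x \<in> {a<..<a + ?d}" "y \<in> {a<..<a + ?d}" "x \<le> y"
      show "f x \<le> f y"
      proof (rule DERIV_nonneg_imp_nondecreasing[OF xy(3)])
        fix z assume "x \<le> z" "z \<le> y"
        then have "a < z" "z < a + \<delta>1" "z < a + \<delta>2" using xy by auto
        then show "\<exists>l. ?D z l \<and> 0 \<le> l" using d1(2) * by blast
      qed
    qed
    then show ?thesis ..
  next
    assume *: "\<forall>x. a < x \<and> x < a + \<delta>2 \<longrightarrow> f' x \<le> 0"
    have "mono_on {a<..<a + ?d} (\<lambda>x. - f x)"
    proof (rule mono_onI)
      fix x y assume xy: "x \<in> {a<..<a + ?d}" "y \<in> {a<..<a + ?d}" "x \<le> y"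
      have "f y \<le> f x"
      proof (rule DERIV_nonpos_imp_nonincreasing[OF xy(3)])
        fix z assume "x \<le> z" "z \<le> y"
        then have "a < z" "z < a + \<delta>1" "z < a + \<delta>2" using xy by auto
        then show "\<exists>l. ?D z l \<and> l \<le> 0" using d1(2) * by blast
      qed
      then show "- f x \<le> - f y" by simp
    qed
    then show ?thesis ..
  qed
  then show thesis using d1 d2(1) by (intro that[of ?d f']) auto
qed

end


section \<open>Uniform finiteness\<close>

text \<open>Near \<open>t\<close> the fibres of \<open>B\<close> are the values of finitely many continuous functions with
  distinct values.\<close>

definition good_fibre :: "(real \<Rightarrow> real \<Rightarrow> bool) \<Rightarrow> real \<Rightarrow> bool" where
  "good_fibre B t \<longleftrightarrow>
     (\<forall>b e. B t b \<and> 0 < e \<longrightarrow> (\<exists>d. 0 < d \<and> (\<forall>u. dist u t < d \<longrightarrow> (\<exists>c. B u c \<and> dist c b < e)))) \<and>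
     (\<exists>e d. 0 < e \<and> 0 < d \<and> (\<forall>u b c. dist u t < d \<and> B u b \<and> B u c \<and> b \<noteq> c \<longrightarrow> e \<le> dist b c)) \<and>
     (\<forall>e. 0 < e \<longrightarrow> (\<exists>d. 0 < d \<and> (\<forall>u c. dist u t < d \<and> B u c \<longrightarrow> (\<exists>b. B t b \<and> dist c b < e))))"

lemma good_fibre_card:
  assumes good: "good_fibre B t" and fin: "\<And>u. finite {y. B u y}"
  shows "\<exists>d>0. \<forall>u. dist u t < d \<longrightarrow> card {y. B u y} = card {y. B t y}"
proof -
  obtain e d where ed: "0 < e \<and> 0 < d \<and> (\<forall>u b c. dist u t < d \<and> B u b \<and> B u c \<and> b \<noteq> c \<longrightarrow> e \<le> dist b c)"
    using good[unfolded good_fibre_def, THEN conjunct2, THEN conjunct1] by (elim exE) (rule that)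
  then have e: "0 < e" and d: "0 < d"
    and sep: "\<And>u b c. dist u t < d \<Longrightarrow> B u b \<Longrightarrow> B u c \<Longrightarrow> b \<noteq> c \<Longrightarrow> e \<le> dist b c" by simp_all
  have lsc: "\<exists>d>0. \<forall>u. dist u t < d \<longrightarrow> (\<exists>c. B u c \<and> dist c b < x)" if "B t b" "0 < x" for b x
    using good that unfolding good_fibre_def by blast
  have usc: "\<exists>d>0. \<forall>u c. dist u t < d \<and> B u c \<longrightarrow> (\<exists>b. B t b \<and> dist c b < x)" if "0 < x" for x
    using good that unfolding good_fibre_def by blast
  have "\<forall>b\<in>{y. B t y}. \<exists>d>0. \<forall>u. dist u t < d \<longrightarrow> (\<exists>c. B u c \<and> dist c b < e / 2)"
    using e by (intro ballI lsc) auto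
  from bchoice[OF this] obtain D where "\<forall>b\<in>{y. B t y}. D b > 0 \<and> (\<forall>u. dist u t < D b \<longrightarrow> (\<exists>c. B u c \<and> dist c b < e / 2))"
    by blast
  then have D: "\<And>b. B t b \<Longrightarrow> D b > 0 \<and> (\<forall>u. dist u t < D b \<longrightarrow> (\<exists>c. B u c \<and> dist c b < e / 2))" by simp
  obtain d' where d': "d' > 0" "\<And>u c. dist u t < d' \<Longrightarrow> B u c \<Longrightarrow> \<exists>b. B t b \<and> dist c b < e / 2"
    using usc[of "e / 2"] e by auto
  define \<delta> where "\<delta> = Min (insert d (insert d' (D ` {y. B t y})))"
  have \<delta>: "\<delta> > 0" "\<delta> \<le> d" "\<delta> \<le> d'" "\<And>b. B t b \<Longrightarrow> \<delta> \<le> D b"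
  proof -
    have *: "finite (insert d (insert d' (D ` {y. B t y})))" using fin by simp
    show "\<delta> \<le> d" "\<delta> \<le> d'" "\<And>b. B t b \<Longrightarrow> \<delta> \<le> D b" unfolding \<delta>_def by (rule Min_le[OF *]; simp)+
    show "\<delta> > 0" unfolding \<delta>_def using * d d'(1) D by (subst Min_gr_iff) auto
  qed
  have "card {y. B u y} = card {y. B t y}" if u: "dist u t < \<delta>" for u
  proof (rule antisym)
    have ud: "dist u t < d" "dist u t < d'" using u \<delta> by auto
    obtain f where f: "\<And>c. B u c \<Longrightarrow> B t (f c) \<and> dist c (f c) < e / 2" using d'(2)[OF ud(2)] by metis
    have "inj_on f {y. B u y}"
    proof (rule inj_onI, rule ccontr)
      fix b c assume *: "b \<in> {y. B u y}" "c \<in> {y. B u y}" "f b = f c" "b \<noteq> c"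
      then have "dist b c < e" using f[of b] f[of c] by (simp add: dist_real_def abs_if split: if_splits)
      with sep[OF ud(1), of b c] * show False by auto
    qed
    moreover have "f ` {y. B u y} \<subseteq> {y. B t y}" using f by auto
    ultimately show "card {y. B u y} \<le> card {y. B t y}" using fin card_inj_on_le by metis
    have "\<exists>c. B u c \<and> dist c b < e / 2" if "B t b" for b
      using D[OF that] \<delta>(4)[OF that] u by auto
    then obtain g where g: "\<And>b. B t b \<Longrightarrow> B u (g b) \<and> dist (g b) b < e / 2" by metis
    have "inj_on g {y. B t y}"
    proof (rule inj_onI, rule ccontr)
      fix b c assume *: "b \<in> {y. B t y}" "c \<in> {y. B t y}" "g b = g c" "b \<noteq> c"
      then have "dist b c < e" using g[of b] g[of c] by (simp add: dist_real_def abs_if split: if_splits)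
      with sep[of t b c] d * show False by auto
    qed
    moreover have "g ` {y. B t y} \<subseteq> {y. B u y}" using g by auto
    ultimately show "card {y. B t y} \<le> card {y. B u y}" using fin card_inj_on_le by metis
  qed
  with \<delta>(1) show ?thesis by blast
qed

lemma good_fibre_continuous:
  fixes e :: "nat \<Rightarrow> real \<Rightarrow> real"
  assumes J: "a < t" "t < b" and eq: "\<And>u. a < u \<Longrightarrow> u < b \<Longrightarrow> {y. B u y} = (\<lambda>i. e i u) ` {..<n}"
    and card: "card {y. B t y} = n" and cont: "\<And>i. i < n \<Longrightarrow> isCont (e i) t"
  shows "good_fibre B t"
proof -
  define r where "r = min (t - a) (b - t)"
  have r: "r > 0" "\<And>u. dist u t < r \<Longrightarrow> a < u \<and> u < b" using J by (auto simp: r_def dist_real_def)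
  have unif: "\<exists>d>0. \<forall>u. dist u t < d \<longrightarrow> (\<forall>i<n. dist (e i u) (e i t) < x)" if x: "0 < x" for x
  proof -
    have "\<forall>i\<in>{..<n}. \<forall>\<^sub>F u in nhds t. dist (e i u) (e i t) < x"
      using tendstoD[OF cont[unfolded isCont_def tendsto_at_iff_tendsto_nhds] x] by simp
    then have "\<forall>\<^sub>F u in nhds t. \<forall>i\<in>{..<n}. dist (e i u) (e i t) < x" by (simp add: eventually_ball_finite)
    then show ?thesis by (auto simp: eventually_nhds_metric)
  qed
  have inj: "inj_on (\<lambda>i. e i t) {..<n}"
    using eq[OF J] card by (intro eq_card_imp_inj_on) auto
  have "\<exists>x>0. \<forall>i<n. \<forall>j<n. i \<noteq> j \<longrightarrow> x \<le> dist (e i t) (e j t)"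
  proof -
    let ?S = "{dist (e i t) (e j t) | i j. i < n \<and> j < n \<and> i \<noteq> j}"
    have "?S \<subseteq> (\<lambda>(i, j). dist (e i t) (e j t)) ` ({..<n} \<times> {..<n})" by auto
    then have "finite ?S" by (rule finite_subset) simp
    moreover have "\<forall>x\<in>?S. 0 < x" using inj by (auto simp: inj_on_def)
    ultimately have "0 < Min (insert 1 ?S)" "\<forall>x\<in>?S. Min (insert 1 ?S) \<le> x" by auto
    then show ?thesis by (intro exI[of _ "Min (insert 1 ?S)"]) blast
  qed
  then obtain x where x: "x > 0" "\<And>i j. i < n \<Longrightarrow> j < n \<Longrightarrow> i \<noteq> j \<Longrightarrow> x \<le> dist (e i t) (e j t)" by blast
  have B_iff: "B u y \<longleftrightarrow> (\<exists>i<n. y = e i u)" if "dist u t < r" for u y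
    using eq[of u] r(2)[OF that] by (auto simp: set_eq_iff)
  show ?thesis unfolding good_fibre_def
  proof (intro conjI allI impI)
    fix b e' :: real assume b: "B t b \<and> 0 < e'"
    obtain i where i: "i < n" "b = e i t" using b B_iff[of t] r(1) by auto
    obtain d where "d > 0" "\<forall>u. dist u t < d \<longrightarrow> (\<forall>i<n. dist (e i u) (e i t) < e')" using unif b by blast
    then show "\<exists>d>0. \<forall>u. dist u t < d \<longrightarrow> (\<exists>c. B u c \<and> dist c b < e')"
      using i B_iff r(1) by (intro exI[of _ "min d r"]) auto
  next
    obtain d where d: "d > 0" "\<And>u i. dist u t < d \<Longrightarrow> i < n \<Longrightarrow> dist (e i u) (e i t) < x / 4" using unif[of "x / 4"] x by auto
    have "x / 2 \<le> dist b c" if bc: "dist u t < min d r" "B u b" "B u c" "b \<noteq> c" for u b c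
    proof -
      obtain i j where ij: "i < n" "b = e i u" "j < n" "c = e j u" using bc B_iff[of u] by auto
      then have "x \<le> dist (e i t) (e j t)" using x(2) bc(4) by blast
      moreover have "dist (e i u) (e i t) < x / 4" "dist (e j u) (e j t) < x / 4" using d(2) ij bc(1) by auto
      ultimately show ?thesis unfolding ij by (simp add: dist_real_def abs_if split: if_splits)
    qed
    then show "\<exists>e d. 0 < e \<and> 0 < d \<and> (\<forall>u b c. dist u t < d \<and> B u b \<and> B u c \<and> b \<noteq> c \<longrightarrow> e \<le> dist b c)"
      using x(1) d(1) r(1) by (intro exI[of _ "x / 2"] exI[of _ "min d r"]) auto
  next
    fix e' :: real assume e': "0 < e'"
    obtain d where "d > 0" "\<forall>u. dist u t < d \<longrightarrow> (\<forall>i<n. dist (e i u) (e i t) < e')" using unif e' by blast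
    then show "\<exists>d>0. \<forall>u c. dist u t < d \<and> B u c \<longrightarrow> (\<exists>b. B t b \<and> dist c b < e')"
      using B_iff r(1) by (intro exI[of _ "min d r"]) (simp, metis dist_self)
  qed
qed

lemma locally_constant_imp_constant:
  fixes N :: "real \<Rightarrow> 'b"
  assumes "a \<le> b" "\<And>t. a \<le> t \<Longrightarrow> t \<le> b \<Longrightarrow> \<exists>d>0. \<forall>u. dist u t < d \<longrightarrow> N u = N t"
  shows "N a = N b"
  using assms(1)
proof (rule Bolzano)
  fix x assume "a \<le> x" "x \<le> b"
  then obtain d where d: "d > 0" "\<forall>u. dist u x < d \<longrightarrow> N u = N x" using assms(2) by blast
  show "\<exists>d>0. \<forall>a b. a \<le> x \<and> x \<le> b \<and> b - a < d \<longrightarrow> N a = N b"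
  proof (intro exI[of _ d] conjI allI impI d(1))
    fix u v assume "u \<le> x \<and> x \<le> v \<and> v - u < d"
    then have "N u = N x" "N v = N x" by (intro d(2)[rule_format]; simp add: dist_real_def)+
    then show "N u = N v" by simp
  qed
qed auto

definition coord_subspace :: "'a::euclidean_space set \<Rightarrow> 'a set" where
  "coord_subspace Bs = {x. \<forall>b\<in>Basis - Bs. x \<bullet> b = 0}"

context o_minimal_structure
begin

definition finite_family :: "('a::euclidean_space \<Rightarrow> real \<Rightarrow> bool) \<Rightarrow> bool" where
  "finite_family A \<longleftrightarrow> definable (\<lambda>z. A (fst z) (snd z)) \<and> (\<forall>x. finite {y. A x y})"

lemma finite_family_min:
  assumes "finite_family A"
  obtains e where "definable_fun e" "\<And>x y. A x y \<Longrightarrow> A x (e x) \<and> e x \<le> y"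
    "finite_family (\<lambda>x y. A x y \<and> y \<noteq> e x)"
    "\<And>x. card {y. A x y \<and> y \<noteq> e x} = card {y. A x y} - 1"
proof
  define e where "e = (\<lambda>x. if \<exists>y. A x y \<and> (\<forall>y'. A x y' \<longrightarrow> y \<le> y') then THE y. A x y \<and> (\<forall>y'. A x y' \<longrightarrow> y \<le> y') else 0)"
  have dA: "definable (\<lambda>z. A (fst z) (snd z))" and fin: "\<And>x. finite {y. A x y}"
    using assms(1) by (auto simp: finite_family_def)
  show de: "definable_fun e" unfolding e_def
    by (rule definable_fun_the) (intro definable_intros dA
        definable_compose[OF dA, of "\<lambda>z. (fst (fst z), snd z)", unfolded fst_conv snd_conv], auto intro: antisym)
  have e: "A x (e x) \<and> e x \<le> y" if "A x y" for x y
  proof -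
    let ?S = "{y. A x y}"
    have m: "A x (Min ?S) \<and> (\<forall>y'. A x y' \<longrightarrow> Min ?S \<le> y')" using fin[of x] Min_in[of ?S] that by auto
    have "(THE y. A x y \<and> (\<forall>y'. A x y' \<longrightarrow> y \<le> y')) = Min ?S"
      by (rule the_equality[where P = "\<lambda>y. A x y \<and> (\<forall>y'. A x y' \<longrightarrow> y \<le> y')", OF m]) (use m in \<open>auto intro: antisym\<close>)
    then have "e x = Min ?S" using m by (auto simp: e_def)
    with m that show ?thesis by simp
  qed
  show "\<And>x y. A x y \<Longrightarrow> A x (e x) \<and> e x \<le> y" by (rule e)
  show "finite_family (\<lambda>x y. A x y \<and> y \<noteq> e x)"
    unfolding finite_family_def using fin
    by (auto intro!: definable_intros dA definable_fun_compose[OF de])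
  fix x
  have "{y. A x y \<and> y \<noteq> e x} = {y. A x y} - {e x}" by auto
  then show "card {y. A x y \<and> y \<noteq> e x} = card {y. A x y} - 1"
    using e fin[of x] by (cases "{y. A x y} = {}") auto
qed

lemma definable_card_le: "finite_family A \<Longrightarrow> definable (\<lambda>x. card {y. A x y} \<le> n)"
proof (induction n arbitrary: A)
  case 0
  then have "definable (\<lambda>x. \<not> (\<exists>y. A x y))" unfolding finite_family_def by (intro definable_intros) auto
  moreover have "card {y. A x y} \<le> 0 \<longleftrightarrow> \<not> (\<exists>y. A x y)" for x
    using 0 by (auto simp: finite_family_def)
  ultimately show ?case by simp
next
  case (Suc n)
  obtain e where "finite_family (\<lambda>x y. A x y \<and> y \<noteq> e x)" "\<And>x. card {y. A x y \<and> y \<noteq> e x} = card {y. A x y} - 1"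
    by (rule finite_family_min[OF Suc.prems]) (rule that)
  with Suc.IH[of "\<lambda>x y. A x y \<and> y \<noteq> e x"] have "definable (\<lambda>x. card {y. A x y} - 1 \<le> n)" by simp
  then show ?case by (simp add: le_diff_conv)
qed

lemma finite_family_enumeration:
  "finite_family A \<Longrightarrow> \<exists>e. (\<forall>i. definable_fun (e i)) \<and> (\<forall>x. card {y. A x y} \<le> n \<longrightarrow> {y. A x y} \<subseteq> (\<lambda>i. e i x) ` {..<n})"
proof (induction n arbitrary: A)
  case 0
  then show ?case by (intro exI[of _ "\<lambda>_ _. 0"]) (auto simp: finite_family_def definable_fun_const)
next
  case (Suc n)
  obtain m where m: "definable_fun m" "finite_family (\<lambda>x y. A x y \<and> y \<noteq> m x)"
    "\<And>x. card {y. A x y \<and> y \<noteq> m x} = card {y. A x y} - 1"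
    by (rule finite_family_min[OF Suc.prems]) (rule that)
  obtain e where e: "\<And>i. definable_fun (e i)"
    "\<And>x. card {y. A x y \<and> y \<noteq> m x} \<le> n \<Longrightarrow> {y. A x y \<and> y \<noteq> m x} \<subseteq> (\<lambda>i. e i x) ` {..<n}"
    using Suc.IH[OF m(2)] by blast
  have "{y. A x y} \<subseteq> (\<lambda>i. (if i < n then e i else m) x) ` {..<Suc n}" if card: "card {y. A x y} \<le> Suc n" for x
  proof
    fix y assume y: "y \<in> {y. A x y}"
    show "y \<in> (\<lambda>i. (if i < n then e i else m) x) ` {..<Suc n}"
    proof (cases "y = m x")
      case True
      then show ?thesis by (intro image_eqI[of _ _ n]) simp_all
    next
      case False
      have "card {y. A x y \<and> y \<noteq> m x} \<le> n" using card m(3)[of x] by simp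
      from e(2)[OF this] have "y \<in> (\<lambda>i. e i x) ` {..<n}" using y False by blast
      then obtain i where "i < n" "y = e i x" by blast
      then show ?thesis by (intro image_eqI[of _ _ i]) simp_all
    qed
  qed
  then show ?case using e(1) m(1) by (intro exI[of _ "\<lambda>i. if i < n then e i else m"]) simp
qed

lemma definable_good_fibre:
  assumes "definable (\<lambda>z. A (fst (fst z)) (snd (fst z)) (snd z))"
  shows "definable (\<lambda>z. good_fibre (A (fst z)) (snd z))"
  unfolding good_fibre_def
  by (intro definable_intros
    definable_compose[OF assms, of "\<lambda>z. ((f z, g z), h z)" for f g h, unfolded fst_conv snd_conv])

lemma good_fibre_cofinite:
  assumes A: "finite_family (B :: real \<Rightarrow> real \<Rightarrow> bool)"
  shows "finite {t. \<not> good_fibre B t}"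
proof (rule definable_dense_cofinite)
  have dB: "definable (\<lambda>z. B (fst z) (snd z))" and fin: "\<And>x. finite {y. B x y}"
    using A by (auto simp: finite_family_def)
  have "definable (\<lambda>z::(real\<times>real)\<times>real. B (snd (fst z)) (snd z))"
    using definable_compose[OF dB, of "\<lambda>z::(real\<times>real)\<times>real. (snd (fst z), snd z)"] by (simp add: definable_intros)
  from definable_good_fibre[of "\<lambda>_. B", OF this]
  have "definable (\<lambda>t. good_fibre B (snd (t, t)))"
    using definable_compose[of "\<lambda>z::real\<times>real. good_fibre B (snd z)" "\<lambda>t. (t, t)"] by (simp add: definable_intros)
  then show "definable (good_fibre B)" by simp
  fix a b :: real assume ab: "a < b"
  have "definable (\<lambda>t. card {y. B t y} = n)" for n
  proof (cases n)
    case 0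
    then show ?thesis using definable_card_le[OF A, of 0] by simp
  next
    case (Suc m)
    have "(\<lambda>t. card {y. B t y} = n) = (\<lambda>t. card {y. B t y} \<le> Suc m \<and> \<not> card {y. B t y} \<le> m)" using Suc by auto
    then show ?thesis using definable_conj[OF definable_card_le[OF A, of "Suc m"] definable_not[OF definable_card_le[OF A, of m]]] by simp
  qed
  moreover have "\<exists>n. card {y. B t y} = n" for t by blast
  ultimately obtain n c d where cd: "a \<le> c" "c < d" "d \<le> b" "\<And>t. c < t \<Longrightarrow> t < d \<Longrightarrow> card {y. B t y} = n"
    by (atomize_elim, rule_tac definable_countable_union[OF ab, of "\<lambda>n t. card {y. B t y} = n"]) blast+
  obtain e where e: "\<And>i. definable_fun (e i)" "\<And>x. card {y. B x y} \<le> n \<Longrightarrow> {y. B x y} \<subseteq> (\<lambda>i. e i x) ` {..<n}"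
    using finite_family_enumeration[OF A, of n] by blast
  have "finite (\<Union>i<n. {t. \<not> isCont (e i) t})" using definable_cofinite_isCont[OF e(1)] by auto
  then have "infinite ({c<..<d} - (\<Union>i<n. {t. \<not> isCont (e i) t}))"
    using infinite_Ioo[OF cd(2)] by (rule Diff_infinite_finite)
  then obtain t where t: "t \<in> {c<..<d} - (\<Union>i<n. {t. \<not> isCont (e i) t})" by (metis finite.emptyI ex_in_conv)
  have "good_fibre B t"
  proof (rule good_fibre_continuous[of c t d B e n])
    fix u assume "c < u" "u < d"
    then have "card {y. B u y} = n" by (rule cd(4))
    moreover have "card ((\<lambda>i. e i u) ` {..<n}) \<le> n" using card_image_le[of "{..<n}" "\<lambda>i. e i u"] by simp
    ultimately show "{y. B u y} = (\<lambda>i. e i u) ` {..<n}" by (intro card_seteq e(2)) auto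
  qed (use t cd in auto)
  then show "\<exists>x>a. x < b \<and> good_fibre B x" using t cd by (intro exI[of _ t]) auto
qed

lemma definable_sections:
  "finite_family D \<Longrightarrow> \<exists>C. finite C \<and> (\<forall>c\<in>C. definable_fun c) \<and>
     (\<forall>x t. card {y. D x y} \<le> K \<longrightarrow> (\<exists>c\<in>C. c x = t \<or> (\<forall>u. min t (c x) \<le> u \<and> u \<le> max t (c x) \<longrightarrow> \<not> D x u)))"
proof (induction K arbitrary: D)
  case 0
  then show ?case by (intro exI[of _ "{\<lambda>_. 0}"]) (auto simp: finite_family_def definable_fun_const)
next
  case (Suc K)
  obtain e where m: "definable_fun e" "\<And>x y. D x y \<Longrightarrow> D x (e x) \<and> e x \<le> y"
    "finite_family (\<lambda>x y. D x y \<and> y \<noteq> e x)" "\<And>x. card {y. D x y \<and> y \<noteq> e x} = card {y. D x y} - 1"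
    by (rule finite_family_min[OF Suc.prems]) (rule that)
  define D' where "D' = (\<lambda>x y. D x y \<and> y \<noteq> e x)"
  have D': "finite_family D'" using m(3) by (simp add: D'_def)
  obtain e' where m': "definable_fun e'" "\<And>x y. D' x y \<Longrightarrow> D' x (e' x) \<and> e' x \<le> y"
    by (rule finite_family_min[OF D']) (rule that)
  have "definable (\<lambda>z. D' (fst z) (snd z))" using D' unfolding finite_family_def by blast
  then have "definable (\<lambda>x. \<exists>y. D' x y)" by (rule definable_ex)
  then have dm: "definable_fun (\<lambda>x. if \<exists>y. D' x y then (1/2) * (e x + e' x) else e x + 1)"
    by (rule definable_fun_if) (intro definable_intros m(1) m'(1))+
  obtain C where C: "finite C" "\<And>c. c \<in> C \<Longrightarrow> definable_fun c"
    "\<And>x t. card {y. D' x y} \<le> K \<Longrightarrow> \<exists>c\<in>C. c x = t \<or> (\<forall>u. min t (c x) \<le> u \<and> u \<le> max t (c x) \<longrightarrow> \<not> D' x u)"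
    using Suc.IH[OF D'] by blast
  let ?mid = "\<lambda>x. if \<exists>y. D' x y then (1/2) * (e x + e' x) else e x + 1"
  let ?C = "{e, \<lambda>x. e x - 1, ?mid} \<union> C"
  have "\<exists>c\<in>?C. c x = t \<or> (\<forall>u. min t (c x) \<le> u \<and> u \<le> max t (c x) \<longrightarrow> \<not> D x u)" if card: "card {y. D x y} \<le> Suc K" for x t
  proof -
    have D_iff: "D x y \<Longrightarrow> y = e x \<or> D' x y" for y by (auto simp: D'_def)
    have e_le: "D x y \<Longrightarrow> e x \<le> y" for y using m(2) by blast
    have D'_gt: "D' x y \<Longrightarrow> e x < y" for y using e_le[of y] by (auto simp: D'_def)
    have D'_ge: "D' x y \<Longrightarrow> e' x \<le> y" and D'_e': "D' x y \<Longrightarrow> D' x (e' x)" for y using m'(2) by blast+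
    consider "t < e x" | "t = e x" | "e x < t" "\<And>y. D' x y \<Longrightarrow> t < y" | y where "D' x y" "y \<le> t"
      by (metis linorder_neqE_linordered_idom not_less)
    then show ?thesis
    proof cases
      case 1
      have "\<not> D x u" if "u \<le> max t (e x - 1)" for u using e_le[of u] that 1 by auto
      then show ?thesis by (intro bexI[of _ "\<lambda>x. e x - 1"]) auto
    next
      case 2
      then show ?thesis by (intro bexI[of _ e]) auto
    next
      case 3
      have gt: "e x < ?mid x" using D'_gt D'_e' by auto
      have lt: "?mid x < y" if "D' x y" for y using that D'_ge[OF that] D'_gt[OF that] by auto
      have "\<not> D x u" if u: "min t (?mid x) \<le> u" "u \<le> max t (?mid x)" for u
      proof
        assume "D x u"
        then consider "u = e x" | "D' x u" using D_iff by blast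
        then show False
        proof cases
          case 1
          with u(1) gt 3(1) show False by linarith
        next
          case 2
          with u(2) lt[OF 2] 3(2)[OF 2] show False by linarith
        qed
      qed
      then show ?thesis by (intro bexI[of _ ?mid]) auto
    next
      case 4
      have "card {y. D' x y} \<le> K" using card m(4)[of x] by (simp add: D'_def)
      then obtain c where c: "c \<in> C" "c x = t \<or> (\<forall>u. min t (c x) \<le> u \<and> u \<le> max t (c x) \<longrightarrow> \<not> D' x u)"
        using C(3) by blast
      have "\<not> D x u" if ne: "c x \<noteq> t" and u: "min t (c x) \<le> u" "u \<le> max t (c x)" for u
      proof
        assume "D x u"
        moreover have "\<not> D' x u" using c(2) ne u by blast
        ultimately have "u = e x" using D_iff by blast
        then have "min t (c x) \<le> y \<and> y \<le> max t (c x)" using u D'_gt[OF 4(1)] 4(2) by linarith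
        then show False using c(2) ne 4(1) by blast
      qed
      with c(1) show ?thesis by (intro bexI[of _ c]) auto
    qed
  qed
  moreover have "finite ?C" using C(1) by simp
  moreover have "\<forall>c\<in>?C. definable_fun c" using C(2) m(1) dm by (auto intro!: definable_intros)
  ultimately show ?case by blast
qed

definition bounded_fibres :: "'a::euclidean_space set \<Rightarrow> bool" where
  "bounded_fibres V \<longleftrightarrow> (\<forall>A. finite_family A \<longrightarrow> (\<exists>K. \<forall>x\<in>V. card {y. A x y} \<le> K))"

text \<open>A function of several parameters which, along each coordinate direction, only jumps at a
  definable finite set is bounded: on the coordinate subspaces it is determined by its restriction to
  finitely many definable sections of the projection that forgets one coordinate.\<close>

lemma bounded_insert_direction:
  fixes Q :: "('a::euclidean_space \<Rightarrow> nat) \<Rightarrow> bool"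
  assumes sub: "\<And>N g. Q N \<Longrightarrow> definable_fun g \<Longrightarrow> Q (\<lambda>x. N (g x))"
    and bad: "\<And>N. Q N \<Longrightarrow> \<exists>D. finite_family D \<and> (\<forall>w t t'. t \<le> t' \<and> (\<forall>u. t \<le> u \<and> u \<le> t' \<longrightarrow> \<not> D w u) \<longrightarrow>
        N (w + t *\<^sub>R b) = N (w + t' *\<^sub>R b))"
    and uf: "bounded_fibres (coord_subspace Bs)"
    and IH: "\<And>N. Q N \<Longrightarrow> \<exists>K. \<forall>x\<in>coord_subspace Bs. N x \<le> K"
    and b: "b \<in> Basis" and N: "Q N"
  shows "\<exists>K. \<forall>x\<in>coord_subspace (insert b Bs). N x \<le> K"
proof -
  obtain D where D: "finite_family D"
    "\<And>w t t'. t \<le> t' \<Longrightarrow> (\<And>u. t \<le> u \<Longrightarrow> u \<le> t' \<Longrightarrow> \<not> D w u) \<Longrightarrow> N (w + t *\<^sub>R b) = N (w + t' *\<^sub>R b)"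
    using bad[OF N] by blast
  obtain K where K: "\<And>x. x \<in> coord_subspace Bs \<Longrightarrow> card {y. D x y} \<le> K"
    using uf D(1) unfolding bounded_fibres_def by blast
  obtain C where C: "finite C" "\<And>c. c \<in> C \<Longrightarrow> definable_fun c"
    "\<And>x t. card {y. D x y} \<le> K \<Longrightarrow> \<exists>c\<in>C. c x = t \<or> (\<forall>u. min t (c x) \<le> u \<and> u \<le> max t (c x) \<longrightarrow> \<not> D x u)"
    using definable_sections[OF D(1), of K] by blast
  have "\<exists>L. \<forall>x\<in>coord_subspace Bs. N (x + c x *\<^sub>R b) \<le> L" if "c \<in> C" for c
  proof -
    have "definable_fun (\<lambda>x. x + c x *\<^sub>R b)" by (intro definable_intros C(2)[OF that])
    from IH[OF sub[OF N this]] show ?thesis .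
  qed
  then obtain L where L: "\<And>c x. c \<in> C \<Longrightarrow> x \<in> coord_subspace Bs \<Longrightarrow> N (x + c x *\<^sub>R b) \<le> L c" by metis
  have "N x \<le> Max (L ` C)" if x: "x \<in> coord_subspace (insert b Bs)" for x
  proof -
    define w where "w = x - (x \<bullet> b) *\<^sub>R b"
    have w: "w \<in> coord_subspace Bs"
    proof -
      have "w \<bullet> b' = 0" if "b' \<in> Basis - Bs" for b'
        using that x b by (cases "b' = b") (auto simp: coord_subspace_def w_def inner_diff_left inner_Basis)
      then show ?thesis by (simp add: coord_subspace_def)
    qed
    obtain c where c: "c \<in> C" "c w = x \<bullet> b \<or> (\<forall>u. min (x \<bullet> b) (c w) \<le> u \<and> u \<le> max (x \<bullet> b) (c w) \<longrightarrow> \<not> D w u)"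
      using C(3)[OF K[OF w]] by blast
    have "N (w + (x \<bullet> b) *\<^sub>R b) = N (w + c w *\<^sub>R b)"
    proof (cases "c w = x \<bullet> b")
      case False
      then have *: "\<And>u. min (x \<bullet> b) (c w) \<le> u \<Longrightarrow> u \<le> max (x \<bullet> b) (c w) \<Longrightarrow> \<not> D w u" using c(2) by blast
      show ?thesis
      proof (cases "x \<bullet> b \<le> c w")
        case True
        then show ?thesis using * by (intro D(2)) auto
      next
        case False
        then show ?thesis using * by (intro D(2)[symmetric]) auto
      qed
    qed simp
    also have "\<dots> \<le> L c" by (rule L[OF c(1) w])
    also have "\<dots> \<le> Max (L ` C)" using C(1) c(1) by simp
    finally show ?thesis by (simp add: w_def)
  qed
  then show ?thesis by blast
qed

lemma bounded_fibres_coord_subspace: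
  fixes Bs :: "'a::euclidean_space set"
  shows "finite Bs \<Longrightarrow> Bs \<subseteq> Basis \<Longrightarrow> bounded_fibres (coord_subspace Bs)"
proof (induction Bs rule: finite_induct)
  case empty
  have "x \<in> coord_subspace {} \<Longrightarrow> x = (0::'a)" for x by (auto simp: coord_subspace_def intro: euclidean_eqI)
  then show ?case unfolding bounded_fibres_def by (metis order_refl)
next
  case (insert b Bs)
  let ?Q = "\<lambda>N :: 'a \<Rightarrow> nat. \<exists>A. finite_family A \<and> N = (\<lambda>x. card {y. A x y})"
  have "\<exists>K. \<forall>x\<in>coord_subspace (insert b Bs). card {y. A x y} \<le> K" if A: "finite_family A" for A
  proof (rule bounded_insert_direction[of ?Q b Bs "\<lambda>x. card {y. A x y}"])
    fix N :: "'a \<Rightarrow> nat" and g :: "'a \<Rightarrow> 'a" assume "?Q N" "definable_fun g"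
    then obtain A :: "'a \<Rightarrow> real \<Rightarrow> bool" where A: "definable (\<lambda>z. A (fst z) (snd z))" "\<And>x. finite {y. A x y}" "N = (\<lambda>x. card {y. A x y})"
      unfolding finite_family_def by blast
    have "definable (\<lambda>z. A (g (fst z)) (snd z))"
      by (rule definable_compose[OF A(1), of "\<lambda>z. (g (fst z), snd z)", unfolded fst_conv snd_conv])
        (intro definable_intros definable_fun_compose[OF \<open>definable_fun g\<close>])
    then show "?Q (\<lambda>x. N (g x))"
      using A(2,3) unfolding finite_family_def by (intro exI[of _ "\<lambda>x. A (g x)"]) auto
  next
    fix N :: "'a \<Rightarrow> nat" assume "?Q N"
    then obtain A :: "'a \<Rightarrow> real \<Rightarrow> bool" where A: "definable (\<lambda>z. A (fst z) (snd z))" "\<And>x. finite {y. A x y}" "N = (\<lambda>x. card {y. A x y})"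
      unfolding finite_family_def by blast
    define B where "B = (\<lambda>w t y. A (w + t *\<^sub>R b) y)"
    have dB: "definable (\<lambda>z. B (fst (fst z)) (snd (fst z)) (snd z))"
      unfolding B_def
      by (rule definable_compose[OF A(1), of "\<lambda>z. (fst (fst z) + snd (fst z) *\<^sub>R b, snd z)", unfolded fst_conv snd_conv])
        (intro definable_intros)
    have "definable (\<lambda>z. B w (fst z) (snd z))" for w
      by (rule definable_compose[OF dB, of "\<lambda>z. ((w, fst z), snd z)", unfolded fst_conv snd_conv])
        (intro definable_intros)
    then have "finite_family (B w)" for w
      using A(2) by (simp add: finite_family_def B_def)
    then have "finite_family (\<lambda>w t. \<not> good_fibre (B w) t)"
      unfolding finite_family_def[of "\<lambda>w t. \<not> good_fibre (B w) t"]
      using good_fibre_cofinite by (auto intro!: definable_not definable_good_fibre[OF dB])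
    moreover have "N (w + t *\<^sub>R b) = N (w + t' *\<^sub>R b)" if "t \<le> t'" "\<And>u. t \<le> u \<Longrightarrow> u \<le> t' \<Longrightarrow> good_fibre (B w) u" for w t t'
    proof -
      have "card {y. B w t y} = card {y. B w t' y}"
        using that A(2) by (intro locally_constant_imp_constant[of t t' "\<lambda>t. card {y. B w t y}"] good_fibre_card) (auto simp: B_def)
      then show ?thesis by (simp add: B_def A(3))
    qed
    ultimately show "\<exists>D. finite_family D \<and> (\<forall>w t t'. t \<le> t' \<and> (\<forall>u. t \<le> u \<and> u \<le> t' \<longrightarrow> \<not> D w u) \<longrightarrow>
        N (w + t *\<^sub>R b) = N (w + t' *\<^sub>R b))"
      by (intro exI[of _ "\<lambda>w t. \<not> good_fibre (B w) t"]) simp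
  qed (use insert A in \<open>auto simp: bounded_fibres_def\<close>)
  then show ?case unfolding bounded_fibres_def by blast
qed

lemma bounded_fibres_UNIV: "bounded_fibres (UNIV :: 'a::euclidean_space set)"
  using bounded_fibres_coord_subspace[of "Basis :: 'a set"] by (simp add: coord_subspace_def)

lemma definable_imp_bounded:
  fixes Q :: "('a::euclidean_space \<Rightarrow> nat) \<Rightarrow> bool"
  assumes sub: "\<And>N g. Q N \<Longrightarrow> definable_fun g \<Longrightarrow> Q (\<lambda>x. N (g x))"
    and bad: "\<And>N b. Q N \<Longrightarrow> b \<in> Basis \<Longrightarrow> \<exists>D. finite_family D \<and> (\<forall>w t t'. t \<le> t' \<and> (\<forall>u. t \<le> u \<and> u \<le> t' \<longrightarrow> \<not> D w u) \<longrightarrow>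
        N (w + t *\<^sub>R b) = N (w + t' *\<^sub>R b))"
    and N: "Q N"
  shows "\<exists>K. \<forall>x. N x \<le> K"
proof -
  have "\<forall>N. Q N \<longrightarrow> (\<exists>K. \<forall>x\<in>coord_subspace Bs. N x \<le> K)" if "finite Bs" "Bs \<subseteq> Basis" for Bs :: "'a set"
    using that
  proof (induction Bs rule: finite_induct)
    case empty
    have "x \<in> coord_subspace {} \<Longrightarrow> x = (0::'a)" for x by (auto simp: coord_subspace_def intro: euclidean_eqI)
    then show ?case by (metis order_refl)
  next
    case (insert b Bs)
    have b: "b \<in> Basis" and Bs: "Bs \<subseteq> Basis" using insert.prems by auto
    show ?case
    proof (intro allI impI)
      fix N assume N: "Q N"
      show "\<exists>K. \<forall>x\<in>coord_subspace (insert b Bs). N x \<le> K"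
      proof (rule bounded_insert_direction[where Q = Q])
        show "bounded_fibres (coord_subspace Bs)" using insert.hyps Bs by (intro bounded_fibres_coord_subspace)
        show "\<And>N. Q N \<Longrightarrow> \<exists>K. \<forall>x\<in>coord_subspace Bs. N x \<le> K" using insert.IH[OF Bs] by blast
      qed (use sub bad b N in blast)+
    qed
  qed
  from this[of Basis] N show ?thesis by (simp add: coord_subspace_def)
qed

end


section \<open>The distance function of a compact set\<close>

text \<open>\<open>descends A x c\<close> says that some direction \<open>w\<close> of norm at most 1 makes the distance to \<open>A\<close>
  decrease at \<open>x\<close>, with speed at least \<open>c\<close> divided by the distance.\<close>

definition descends :: "'a::euclidean_space set \<Rightarrow> 'a \<Rightarrow> real \<Rightarrow> bool" where
  "descends A x c \<longleftrightarrow> (\<exists>w. norm w \<le> 1 \<and> (\<forall>p\<in>A. dist x p = infdist x A \<longrightarrow> w \<bullet> (x - p) \<le> - c))"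

lemma descends_mono: "descends A x c \<Longrightarrow> c' \<le> c \<Longrightarrow> descends A x c'"
  unfolding descends_def by force

lemma nearest_point:
  assumes "compact A" "A \<noteq> {}" obtains p where "p \<in> A" "dist x p = infdist x A"
proof -
  obtain p where p: "p \<in> A" "\<forall>q\<in>A. dist x p \<le> dist x q"
    using continuous_attains_inf[OF assms, of "dist x"] continuous_on_dist[OF continuous_on_const continuous_on_id] by blast
  then have "dist x p \<le> infdist x A" using assms(2) by (auto simp: infdist_notempty intro!: cINF_greatest)
  with infdist_le[OF p(1), of x] p(1) show thesis by (intro that[of p]) auto
qed

lemma infdist_eq_iff:
  assumes "compact A" "A \<noteq> {}"
  shows "infdist x A = s \<longleftrightarrow> (\<exists>p. p \<in> A \<and> dist x p = s) \<and> (\<forall>p. p \<in> A \<longrightarrow> s \<le> dist x p)"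
proof
  assume "infdist x A = s"
  then show "(\<exists>p. p \<in> A \<and> dist x p = s) \<and> (\<forall>p. p \<in> A \<longrightarrow> s \<le> dist x p)"
    using nearest_point[OF assms, of x] infdist_le[of _ A x] by (intro conjI allI impI) (metis, metis)
next
  assume *: "(\<exists>p. p \<in> A \<and> dist x p = s) \<and> (\<forall>p. p \<in> A \<longrightarrow> s \<le> dist x p)"
  obtain q where "q \<in> A" "dist x q = infdist x A" using nearest_point[OF assms, of x] by blast
  with * infdist_le[of _ A x] show "infdist x A = s" by force
qed

lemma nearest_upper_semicontinuous:
  fixes A :: "'a::euclidean_space set"
  assumes A: "compact A" "A \<noteq> {}" and w: "\<And>p. p \<in> A \<Longrightarrow> dist x p = infdist x A \<Longrightarrow> w \<bullet> (x - p) \<le> c" and cc': "c < c'"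
  shows "\<exists>r>0. \<forall>y\<in>ball x r. \<forall>p\<in>A. dist y p = infdist y A \<longrightarrow> w \<bullet> (y - p) \<le> c'"
proof (rule ccontr)
  assume *: "\<not> ?thesis"
  have "\<exists>y p. y \<in> ball x (inverse (real (Suc n))) \<and> p \<in> A \<and> dist y p = infdist y A \<and> c' < w \<bullet> (y - p)" for n
    using * by (meson inverse_positive_iff_positive not_less of_nat_0_less_iff zero_less_Suc)
  then obtain y p where yp: "\<And>n. y n \<in> ball x (inverse (real (Suc n)))" "\<And>n. p n \<in> A"
    "\<And>n. dist (y n) (p n) = infdist (y n) A" "\<And>n. c' < w \<bullet> (y n - p n)"
    by metis
  have "y \<longlonglongrightarrow> x"
  proof (rule metric_LIMSEQ_I)
    fix e :: real assume "0 < e"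
    then obtain N where "inverse (real (Suc N)) < e" using reals_Archimedean by blast
    moreover have "dist (y n) x < inverse (real (Suc n))" for n using yp(1)[of n] by (simp add: dist_commute)
    moreover have "inverse (real (Suc n)) \<le> inverse (real (Suc N))" if "n \<ge> N" for n using that by (intro le_imp_inverse_le) auto
    ultimately show "\<exists>no. \<forall>n\<ge>no. dist (y n) x < e" by (meson less_le_trans less_trans)
  qed
  obtain q f where q: "q \<in> A" "strict_mono f" "(p \<circ> f) \<longlonglongrightarrow> q"
    using A(1) yp(2) unfolding compact_def by (metis (no_types, lifting))
  have yf: "(\<lambda>n. y (f n)) \<longlonglongrightarrow> x" using LIMSEQ_subseq_LIMSEQ[OF \<open>y \<longlonglongrightarrow> x\<close> q(2)] by (simp add: o_def)
  have pf: "(\<lambda>n. p (f n)) \<longlonglongrightarrow> q" using q(3) by (simp add: o_def)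
  have "(\<lambda>n. dist (y (f n)) (p (f n))) \<longlonglongrightarrow> dist x q" by (intro tendsto_intros yf pf)
  moreover have "(\<lambda>n. infdist (y (f n)) A) \<longlonglongrightarrow> infdist x A" by (intro tendsto_intros yf)
  ultimately have "dist x q = infdist x A" using yp(3) by (auto intro: LIMSEQ_unique)
  then have "w \<bullet> (x - q) \<le> c" using w q(1) by blast
  moreover have "(\<lambda>n. w \<bullet> (y (f n) - p (f n))) \<longlonglongrightarrow> w \<bullet> (x - q)" by (intro tendsto_intros yf pf)
  then have "c' \<le> w \<bullet> (x - q)" using yp(4) by (intro LIMSEQ_le_const) (auto intro: less_imp_le)
  ultimately show False using cc' by simp
qed

lemma descends_open:
  fixes A :: "'a::euclidean_space set"
  assumes "compact A" "A \<noteq> {}" "descends A x c" "c' < c"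
  shows "\<exists>r>0. \<forall>y\<in>ball x r. descends A y c'"
proof -
  obtain w where "norm w \<le> 1" "\<And>p. p \<in> A \<Longrightarrow> dist x p = infdist x A \<Longrightarrow> w \<bullet> (x - p) \<le> - c"
    using assms(3) unfolding descends_def by blast
  with nearest_upper_semicontinuous[OF assms(1,2), of x w "- c" "- c'"] assms(4)
  show ?thesis unfolding descends_def by fastforce
qed

lemma norm_le_first_order:
  fixes z z0 :: "'a::real_inner"
  assumes "norm z0 = r" "r > 0" shows "norm z \<le> r + (z \<bullet> z - r\<^sup>2) / (2 * r)"
proof -
  have "0 \<le> (norm z - r)\<^sup>2" by simp
  then have "2 * r * norm z \<le> z \<bullet> z + r\<^sup>2" by (simp add: power2_diff dot_square_norm algebra_simps)
  then show ?thesis using assms(2) by (simp add: field_simps power2_eq_square)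
qed

lemma infdist_descent:
  fixes A :: "'a::euclidean_space set"
  assumes A: "compact A" "A \<noteq> {}" and x: "infdist x A = s" "0 < s"
    and w: "norm w \<le> 1" "\<And>p. p \<in> A \<Longrightarrow> dist x p = infdist x A \<Longrightarrow> w \<bullet> (x - p) \<le> - c" and k: "k < c / s"
  shows "\<exists>r>0. \<forall>y t. dist y x < r \<and> 0 \<le> t \<and> t < r \<longrightarrow> infdist (y + t *\<^sub>R w) A \<le> infdist y A - t * k"
proof -
  have "k * s < c" using k x(2) by (simp add: field_simps)
  then obtain c' where c': "k * s < c'" "c' < c" using dense by blast
  obtain c'' where c'': "k * s < c''" "c'' < c'" using c'(1) dense by blast
  obtain r1 where r1: "r1 > 0" "\<And>y p. y \<in> ball x r1 \<Longrightarrow> p \<in> A \<Longrightarrow> dist y p = infdist y A \<Longrightarrow> w \<bullet> (y - p) \<le> - c'"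
    using nearest_upper_semicontinuous[OF A w(2), of "- c'"] c'(2) by fastforce
  have "((\<lambda>y. k * infdist y A) \<longlongrightarrow> k * infdist x A) (nhds x)" "((\<lambda>y. infdist y A) \<longlongrightarrow> infdist x A) (nhds x)"
    by (intro tendsto_intros filterlim_ident)+
  then have "\<forall>\<^sub>F y in nhds x. k * infdist y A < c'' \<and> 0 < infdist y A"
    using c''(1) x by (intro eventually_conj order_tendstoD) (auto simp: mult.commute)
  then obtain r2 where r2: "r2 > 0" "\<And>y. dist y x < r2 \<Longrightarrow> k * infdist y A < c'' \<and> 0 < infdist y A"
    by (auto simp: eventually_nhds_metric)
  let ?r = "min r1 (min r2 (2 * (c' - c'')))"
  have "infdist (y + t *\<^sub>R w) A \<le> infdist y A - t * k" if y: "dist y x < ?r" and t: "0 \<le> t" "t < ?r" for y t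
  proof -
    obtain p where p: "p \<in> A" "dist y p = infdist y A" using nearest_point[OF A] by blast
    let ?R = "infdist y A"
    have R: "0 < ?R" "k * ?R < c''" using r2(2) y by auto
    have wp: "w \<bullet> (y - p) \<le> - c'" using r1(2)[of y p] y p by (auto simp: dist_commute)
    have "w \<bullet> w \<le> 1" using w(1) by (simp add: dot_square_norm power_le_one)
    have zz: "(y + t *\<^sub>R w - p) \<bullet> (y + t *\<^sub>R w - p) = ?R\<^sup>2 + 2 * t * (w \<bullet> (y - p)) + t\<^sup>2 * (w \<bullet> w)"
    proof -
      have "(y - p) \<bullet> (y - p) = ?R\<^sup>2" using p(2) by (simp add: dot_square_norm dist_norm)
      moreover have "y + t *\<^sub>R w - p = (y - p) + t *\<^sub>R w" by simp
      ultimately show ?thesis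
        by (simp only: inner_add_left inner_add_right inner_scaleR_left inner_scaleR_right inner_commute[of "y - p" w])
          (simp add: power2_eq_square algebra_simps)
    qed
    have "infdist (y + t *\<^sub>R w) A \<le> norm (y + t *\<^sub>R w - p)" using infdist_le[OF p(1)] by (simp add: dist_norm)
    also have "\<dots> \<le> ?R + ((y + t *\<^sub>R w - p) \<bullet> (y + t *\<^sub>R w - p) - ?R\<^sup>2) / (2 * ?R)"
      by (rule norm_le_first_order[of "y - p"]) (use p(2) R in \<open>auto simp: dist_norm\<close>)
    also have "\<dots> \<le> ?R + (2 * t * (- c') + t * (2 * (c' - c''))) / (2 * ?R)"
    proof -
      have "t\<^sup>2 * (w \<bullet> w) \<le> t\<^sup>2 * 1" using \<open>w \<bullet> w \<le> 1\<close> by (intro mult_left_mono) auto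
      also have "\<dots> \<le> t * (2 * (c' - c''))" using t by (simp add: power2_eq_square mult_left_mono)
      finally have "t\<^sup>2 * (w \<bullet> w) \<le> t * (2 * (c' - c''))" .
      moreover have "2 * t * (w \<bullet> (y - p)) \<le> 2 * t * (- c')" using wp t(1) by (intro mult_left_mono) auto
      ultimately show ?thesis unfolding zz using R(1) by (intro add_left_mono divide_right_mono) (linarith, simp)
    qed
    also have "(2 * t * (- c') + t * (2 * (c' - c''))) / (2 * ?R) = - (t * (c'' / ?R))" using R(1) by (simp add: field_simps)
    finally have "infdist (y + t *\<^sub>R w) A \<le> ?R + - (t * (c'' / ?R))" .
    moreover have "t * k \<le> t * (c'' / ?R)" using R t(1) by (intro mult_left_mono) (auto simp: field_simps)
    ultimately show ?thesis by linarith
  qed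
  then show ?thesis using r1(1) r2(1) c''(2) by (intro exI[of _ ?r]) auto
qed

text \<open>\<open>slope_le A x y\<close>: the best descent speed at \<open>x\<close> is at most the one at \<open>y\<close>.\<close>

definition slope_le :: "'a::euclidean_space set \<Rightarrow> 'a \<Rightarrow> 'a \<Rightarrow> bool" where
  "slope_le A x y \<longleftrightarrow> (\<forall>c c'. descends A x c \<and> c' < c \<longrightarrow> descends A y c')"

lemma slope_le_total: "slope_le A x y \<or> slope_le A y x"
  unfolding slope_le_def by (meson descends_mono less_imp_le less_trans linorder_le_less_linear)

lemma slope_le_trans: "slope_le A x y \<Longrightarrow> slope_le A y z \<Longrightarrow> slope_le A x z"
  unfolding slope_le_def by (meson dense)

lemma slope_le_finite_min:
  assumes "finite Y" "Y \<noteq> {}" shows "\<exists>x\<in>Y. \<forall>y\<in>Y. slope_le A x y"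
  using assms
proof (induction rule: finite_ne_induct)
  case (singleton x)
  then show ?case using slope_le_total by blast
next
  case (insert x Y)
  then obtain m where m: "m \<in> Y" "\<forall>y\<in>Y. slope_le A m y" by blast
  show ?case
  proof (cases "slope_le A m x")
    case True
    with m show ?thesis by blast
  next
    case False
    then have "slope_le A x m" using slope_le_total by blast
    moreover have "slope_le A x x" using slope_le_total by blast
    ultimately show ?thesis using m slope_le_trans by blast
  qed
qed

lemma closed_slope_le:
  fixes A :: "'a::euclidean_space set"
  assumes A: "compact A" "A \<noteq> {}" shows "closed {x. slope_le A x y}"
proof -
  have "open {x. \<not> slope_le A x y}"
  proof (rule openI)
    fix x assume "x \<in> {x. \<not> slope_le A x y}"
    then obtain c c' where c: "descends A x c" "c' < c" "\<not> descends A y c'" unfolding slope_le_def by blast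
    obtain d where d: "c' < d" "d < c" using c(2) dense by blast
    obtain r where "r > 0" "\<forall>z\<in>ball x r. descends A z d" using descends_open[OF A c(1) d(2)] by blast
    then show "\<exists>e>0. ball x e \<subseteq> {x. \<not> slope_le A x y}" using d(1) c(3) unfolding slope_le_def by blast
  qed
  moreover have "- {x. slope_le A x y} = {x. \<not> slope_le A x y}" by blast
  ultimately show ?thesis by (simp add: closed_def)
qed

definition flattest :: "'a::euclidean_space set \<Rightarrow> real \<Rightarrow> 'a set" where
  "flattest A s = {x. infdist x A = s \<and> (\<forall>y. infdist y A = s \<longrightarrow> slope_le A x y)}"

lemma compact_infdist_level:
  fixes A :: "'a::euclidean_space set"
  assumes A: "compact A" "A \<noteq> {}" shows "compact {x. infdist x A \<le> s}" "compact {x. infdist x A = s}"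
proof -
  have "compact {x. infdist x A \<le> max s 1}" by (rule compact_infdist_le[OF assms(2,1)]) simp
  moreover have "{x. infdist x A \<le> s} = {x. infdist x A \<le> max s 1} \<inter> {x. infdist x A \<le> s}" by auto
  moreover have "closed {x. infdist x A \<le> s}" by (intro closed_Collect_le continuous_intros)
  ultimately show le: "compact {x. infdist x A \<le> s}" using compact_Int_closed by metis
  have "closed {x. infdist x A = s}" by (intro closed_Collect_eq continuous_intros)
  moreover have "{x. infdist x A = s} = {x. infdist x A \<le> s} \<inter> {x. infdist x A = s}" by auto
  ultimately show "compact {x. infdist x A = s}" using le compact_Int_closed by metis
qed

lemma infdist_level_nonempty:
  fixes A :: "'a::euclidean_space set"
  assumes A: "compact A" "A \<noteq> {}" and s: "0 \<le> s" shows "\<exists>x. infdist x A = s"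
proof -
  obtain B where B: "\<And>p. p \<in> A \<Longrightarrow> norm p \<le> B" using compact_imp_bounded[OF A(1)] by (auto simp: bounded_iff)
  obtain b :: 'a where b: "b \<in> Basis" using nonempty_Basis by blast
  obtain a where a: "a \<in> A" using A(2) by blast
  let ?x = "(\<bar>B\<bar> + s) *\<^sub>R b"
  obtain p where p: "p \<in> A" "dist ?x p = infdist ?x A" using nearest_point[OF A] by blast
  have "\<bar>B\<bar> + s - norm p \<le> norm (?x - p)" using norm_triangle_ineq2[of ?x p] b s by simp
  then have 1: "s \<le> infdist ?x A" using B[OF p(1)] p(2) by (simp add: dist_norm)
  have 0: "infdist a A = 0" using a by simp
  have "connected (range (\<lambda>x. infdist x A))" by (intro connected_continuous_image continuous_intros connected_UNIV)
  then have "s \<in> range (\<lambda>x. infdist x A)" using connectedD_interval[of "range (\<lambda>x. infdist x A)" "infdist a A" "infdist ?x A" s] 0 1 s by simp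
  then show ?thesis by auto
qed

lemma flattest_compact_nonempty:
  fixes A :: "'a::euclidean_space set"
  assumes A: "compact A" "A \<noteq> {}" and s: "0 \<le> s"
  shows "compact (flattest A s)" "flattest A s \<noteq> {}"
proof -
  let ?L = "{x. infdist x A = s}"
  have eq: "flattest A s = ?L \<inter> \<Inter>((\<lambda>y. {x. slope_le A x y}) ` ?L)"
    unfolding flattest_def by auto
  have cl: "closed T" if "T \<in> (\<lambda>y. {x. slope_le A x y}) ` ?L" for T
    using that closed_slope_le[OF A] by auto
  show "compact (flattest A s)" unfolding eq using compact_infdist_level(2)[OF A] cl by (intro compact_Int_closed closed_Inter) auto
  show "flattest A s \<noteq> {}" unfolding eq
  proof (rule compact_imp_fip[OF compact_infdist_level(2)[OF A] cl])
    fix \<F> assume "finite \<F>" "\<F> \<subseteq> (\<lambda>y. {x. slope_le A x y}) ` ?L"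
    then obtain Y where Y: "Y \<subseteq> ?L" "finite Y" "\<F> = (\<lambda>y. {x. slope_le A x y}) ` Y" by (metis finite_subset_image)
    show "?L \<inter> \<Inter>\<F> \<noteq> {}"
    proof (cases "Y = {}")
      case True
      then show ?thesis using Y infdist_level_nonempty[OF A s] by auto
    next
      case False
      then obtain x where "x \<in> Y" "\<forall>y\<in>Y. slope_le A x y" using slope_le_finite_min[OF Y(2)] by blast
      then show ?thesis using Y by auto
    qed
  qed auto
qed

text \<open>If \<open>p\<close> is nearest to \<open>\<gamma> s\<close>, then \<open>dist (\<gamma> u) p - u\<close> is nonnegative and vanishes at \<open>u = s\<close>, so its
  derivative there is 0.\<close>

lemma curve_descends:
  fixes A :: "'a::euclidean_space set" and \<gamma> :: "real \<Rightarrow> 'a"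
  assumes A: "compact A" "A \<noteq> {}" and s: "0 < s" "s < \<delta>"
    and \<gamma>: "\<And>u. 0 < u \<Longrightarrow> u < \<delta> \<Longrightarrow> infdist (\<gamma> u) A = u"
    and der: "(\<gamma> has_vector_derivative v) (at s)" and v: "norm v \<le> k" "0 < k"
  shows "descends A (\<gamma> s) (s / k)"
  unfolding descends_def
proof (intro exI[of _ "- (inverse k *\<^sub>R v)"] conjI ballI impI)
  show "norm (- (inverse k *\<^sub>R v)) \<le> 1" using v by (simp add: field_simps)
  fix p assume p: "p \<in> A" "dist (\<gamma> s) p = infdist (\<gamma> s) A"
  let ?f = "\<lambda>u. (\<gamma> u - p) \<bullet> (\<gamma> u - p) - u\<^sup>2"
  have d\<gamma>: "((\<lambda>u. \<gamma> u - p) has_derivative (\<lambda>h. h *\<^sub>R v)) (at s)"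
    using der by (auto simp: has_vector_derivative_def intro!: derivative_eq_intros)
  have "(?f has_real_derivative (2 * ((\<gamma> s - p) \<bullet> v) - 2 * s)) (at s)"
    unfolding has_field_derivative_def
    by (rule derivative_eq_intros d\<gamma> refl)+ (auto simp: fun_eq_iff inner_commute algebra_simps)
  moreover have "?f s = 0" using p(2) \<gamma>[OF s] by (simp add: dist_norm dot_square_norm)
  moreover have "0 \<le> ?f u" if "0 < u" "u < \<delta>" for u
  proof -
    have "u \<le> dist (\<gamma> u) p" using infdist_le[OF p(1), of "\<gamma> u"] \<gamma>[OF that] by simp
    then have "u\<^sup>2 \<le> (dist (\<gamma> u) p)\<^sup>2" using that(1) by (intro power_mono) auto
    then show ?thesis by (simp add: dist_norm dot_square_norm)
  qed
  ultimately have "2 * ((\<gamma> s - p) \<bullet> v) - 2 * s = 0"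
    by (intro DERIV_local_min[of ?f _ s "min s (\<delta> - s)"]) (use s in auto)
  then have "(\<gamma> s - p) \<bullet> v = s" by simp
  then show "- (inverse k *\<^sub>R v) \<bullet> (\<gamma> s - p) \<le> - (s / k)" using v(2) by (simp add: inner_commute field_simps)
qed

lemma mono_bounded_limit_at_right:
  fixes f :: "real \<Rightarrow> real"
  assumes "a < b" "mono_on {a<..<b} f" "\<And>x. a < x \<Longrightarrow> x < b \<Longrightarrow> B \<le> f x"
  shows "\<exists>l. (f \<longlongrightarrow> l) (at_right a)"
proof
  let ?l = "Inf (f ` {a<..<b})"
  have bdd: "bdd_below (f ` {a<..<b})" using assms(3) by (intro bdd_belowI2[of _ B]) auto
  show "(f \<longlongrightarrow> ?l) (at_right a)"
  proof (rule order_tendstoI)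
    fix y assume y: "y < ?l"
    have "\<forall>\<^sub>F x in at_right a. x \<in> {a<..<b}" using assms(1) by (rule eventually_at_right_real)
    then show "\<forall>\<^sub>F x in at_right a. y < f x"
    proof eventually_elim
      case (elim x)
      then have "?l \<le> f x" by (intro cInf_lower bdd) auto
      with y show ?case by simp
    qed
  next
    fix y assume "?l < y"
    then obtain z where z: "z \<in> {a<..<b}" "f z < y" using cInf_less_iff[OF _ bdd] assms(1) by auto
    have "\<forall>\<^sub>F x in at_right a. x \<in> {a<..<z}" using z by (intro eventually_at_right_real) auto
    then show "\<forall>\<^sub>F x in at_right a. f x < y"
    proof eventually_elim
      case (elim x)
      then have "f x \<le> f z" using z by (intro mono_onD[OF assms(2)]) auto
      with z show ?case by simp
    qed
  qed
qed

context o_minimal_structure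
begin

lemma definable_compact_selection:
  fixes K :: "'p::euclidean_space \<Rightarrow> 'a::euclidean_space \<Rightarrow> bool"
  assumes dK: "definable (\<lambda>z. K (fst z) (snd z))"
    and K: "\<And>p. p \<in> S \<Longrightarrow> compact {x. K p x}" "\<And>p. p \<in> S \<Longrightarrow> \<exists>x. K p x"
  obtains f where "definable_fun f" "\<And>p. p \<in> S \<Longrightarrow> K p (f p)"
proof -
  have "\<exists>L. definable (\<lambda>z. L (fst z) (snd z)) \<and> (\<forall>p x. L p x \<longrightarrow> K p x) \<and>
     (\<forall>p\<in>S. compact {x. L p x} \<and> (\<exists>x. L p x)) \<and> (\<forall>p x y. \<forall>b\<in>Bs. L p x \<and> L p y \<longrightarrow> x \<bullet> b = y \<bullet> b)"
    if "finite Bs" "Bs \<subseteq> Basis" for Bs :: "'a set"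
    using that
  proof (induction Bs rule: finite_induct)
    case empty
    then show ?case using assms by (intro exI[of _ K]) auto
  next
    case (insert b Bs)
    have "Bs \<subseteq> Basis" using insert.prems by simp
    from insert.IH[OF this] obtain L where L': "definable (\<lambda>z. L (fst z) (snd z)) \<and> (\<forall>p x. L p x \<longrightarrow> K p x) \<and>
     (\<forall>p\<in>S. compact {x. L p x} \<and> (\<exists>x. L p x)) \<and> (\<forall>p x y. \<forall>b\<in>Bs. L p x \<and> L p y \<longrightarrow> x \<bullet> b = y \<bullet> b)"
      by (elim exE) (rule that)
    then have dL: "definable (\<lambda>z. L (fst z) (snd z))" and LK: "\<And>p x. L p x \<Longrightarrow> K p x"
      and L: "\<And>p. p \<in> S \<Longrightarrow> compact {x. L p x}" "\<And>p. p \<in> S \<Longrightarrow> \<exists>x. L p x"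
      and eq: "\<And>p x y b. b \<in> Bs \<Longrightarrow> L p x \<Longrightarrow> L p y \<Longrightarrow> x \<bullet> b = y \<bullet> b"
      by blast+
    define L' where "L' = (\<lambda>p x. L p x \<and> (\<forall>y. L p y \<longrightarrow> x \<bullet> b \<le> y \<bullet> b))"
    have dL2: "definable (\<lambda>z::('p \<times> 'a) \<times> 'a. L (fst (fst z)) (snd z))"
      by (rule definable_compose[OF dL, of "\<lambda>z. (fst (fst z), snd z)", unfolded fst_conv snd_conv]) (intro definable_intros)
    have "definable (\<lambda>z. L' (fst z) (snd z))" unfolding L'_def
      by (intro definable_conj[OF dL] definable_all definable_imp[OF dL2] definable_le definable_fun_inner definable_fun_const
          definable_fun_fst definable_fun_snd definable_fun_id)
    moreover have "compact {x. L' p x}" "\<exists>x. L' p x" if p: "p \<in> S" for p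
    proof -
      obtain x where "x \<in> {x. L p x}" "\<forall>y\<in>{x. L p x}. x \<bullet> b \<le> y \<bullet> b"
        using continuous_attains_inf[OF L(1)[OF p], of "\<lambda>x. x \<bullet> b"] L(2)[OF p] continuous_on_inner[OF continuous_on_id continuous_on_const]
        by blast
      then show "\<exists>x. L' p x" by (auto simp: L'_def)
      have "{x. L' p x} = {x. L p x} \<inter> (\<Inter>y\<in>{y. L p y}. {x. x \<bullet> b \<le> y \<bullet> b})" by (auto simp: L'_def)
      moreover have "closed (\<Inter>y\<in>{y. L p y}. {x. x \<bullet> b \<le> y \<bullet> b})"
        by (intro closed_INT ballI closed_Collect_le continuous_intros)
      ultimately show "compact {x. L' p x}" using L(1)[OF p] by (simp add: compact_Int_closed)
    qed
    moreover have "x \<bullet> b' = y \<bullet> b'" if "b' \<in> insert b Bs" "L' p x" "L' p y" for p x y b'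
    proof (cases "b' = b")
      case True
      have "x \<bullet> b \<le> y \<bullet> b" "y \<bullet> b \<le> x \<bullet> b" using that by (simp_all add: L'_def)
      with True show ?thesis by simp
    next
      case False
      then show ?thesis using that eq[of b' p x y] by (simp add: L'_def)
    qed
    moreover have "K p x" if "L' p x" for p x using LK that by (simp add: L'_def)
    ultimately show ?case by (intro exI[of _ L'] conjI) blast+
  qed
  from this[OF finite_Basis order_refl] obtain L where L': "definable (\<lambda>z. L (fst z) (snd z)) \<and> (\<forall>p x. L p x \<longrightarrow> K p x) \<and>
     (\<forall>p\<in>S. compact {x. L p x} \<and> (\<exists>x. L p x)) \<and> (\<forall>p x y. \<forall>b\<in>Basis. L p x \<and> L p y \<longrightarrow> x \<bullet> b = y \<bullet> b)"
    by (elim exE) (rule that)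
  then have dL: "definable (\<lambda>z. L (fst z) (snd z))" and LK: "\<And>p x. L p x \<Longrightarrow> K p x"
      and L: "\<And>p. p \<in> S \<Longrightarrow> \<exists>x. L p x" and eq: "\<And>p x y b. b \<in> Basis \<Longrightarrow> L p x \<Longrightarrow> L p y \<Longrightarrow> x \<bullet> b = y \<bullet> b"
    by blast+
  have uniq: "x = y" if "L p x" "L p y" for p x y using eq[OF _ that] by (rule euclidean_eqI)
  let ?f = "\<lambda>p. if \<exists>x. L p x then THE x. L p x else 0"
  have "K p (?f p)" if p: "p \<in> S" for p
  proof -
    obtain x where x: "L p x" using L[OF p] by blast
    then have "(THE x. L p x) = x" using uniq by blast
    with x LK show ?thesis by auto
  qed
  moreover have "definable_fun ?f" by (rule definable_fun_the[OF dL]) (rule uniq)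
  ultimately show thesis using that by blast
qed

lemma definable_infdist_eq:
  assumes A: "definable (\<lambda>x. x \<in> A)" "compact A" "A \<noteq> {}" and f: "definable_fun f" and g: "definable_fun g"
  shows "definable (\<lambda>x. infdist (f x) A = g x)"
  unfolding infdist_eq_iff[OF A(2,3)]
  by (intro definable_intros definable_mem[OF A(1)] definable_fun_compose[OF f] definable_fun_compose[OF g])

lemma definable_descends:
  assumes A: "definable (\<lambda>x. x \<in> A)" "compact A" "A \<noteq> {}"
  shows "definable (\<lambda>z. descends A (fst z) (snd z))"
  unfolding descends_def Ball_def eq_commute[of "dist _ _"]
  by (intro definable_intros definable_mem[OF A(1)] definable_infdist_eq[OF A] definable_fun_uminus)

lemma definable_flattest:
  assumes A: "definable (\<lambda>x. x \<in> A)" "compact A" "A \<noteq> {}"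
  shows "definable (\<lambda>z. snd z \<in> flattest A (fst z))"
  unfolding flattest_def slope_le_def mem_Collect_eq
  by (intro definable_intros definable_infdist_eq[OF A]
      definable_compose[OF definable_descends[OF A], of "\<lambda>z. (f z, g z)" for f g, unfolded fst_conv snd_conv])

lemma definable_flattest_curve:
  fixes A :: "'a::euclidean_space set"
  assumes A: "definable (\<lambda>x. x \<in> A)" "compact A" "A \<noteq> {}"
  obtains \<gamma> where "definable_fun \<gamma>" "\<And>s. 0 < s \<Longrightarrow> \<gamma> s \<in> flattest A s"
proof -
  have "compact {x. x \<in> flattest A p}" "\<exists>x. x \<in> flattest A p" if "p \<in> {0<..}" for p
    using flattest_compact_nonempty[OF A(2,3), of p] that by auto
  from definable_compact_selection[OF definable_flattest[OF A] this]
  obtain f where "definable_fun f" "\<And>p. p \<in> {0<..} \<Longrightarrow> f p \<in> flattest A p" by blast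
  then show thesis using that[of f] by simp
qed

text \<open>Kurdyka-Lojasiewicz: near \<open>A\<close> the reparametrised distance \<open>l (infdist y A)\<close> descends at a rate
  arbitrarily close to 1.  The slowest points of each level form a definable curve, which has finite
  length near \<open>A\<close>; \<open>l\<close> bounds its arc length.\<close>

lemma distance_KL:
  fixes A :: "'a::euclidean_space set"
  assumes A: "definable (\<lambda>x. x \<in> A)" "compact A" "A \<noteq> {}"
  obtains e l l' where "0 < e" "\<And>s. 0 < s \<Longrightarrow> s < e \<Longrightarrow> (l has_real_derivative l' s) (at s) \<and> isCont l' s \<and> 1 \<le> l' s"
    "(l \<longlongrightarrow> 0) (at_right 0)"
    "\<And>y s c. 0 < s \<Longrightarrow> s < e \<Longrightarrow> infdist y A = s \<Longrightarrow> c < s / l' s \<Longrightarrow> descends A y c"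
proof -
  obtain \<gamma> where \<gamma>: "definable_fun \<gamma>" "\<And>s. 0 < s \<Longrightarrow> \<gamma> s \<in> flattest A s"
    by (rule definable_flattest_curve[OF A]) blast
  have "\<exists>d f'. d > 0 \<and> (\<forall>x. 0 < x \<and> x < d \<longrightarrow> ((\<lambda>s. \<gamma> s \<bullet> b) has_real_derivative f' x) (at x) \<and> isCont f' x) \<and>
     (mono_on {0<..<d} (\<lambda>s. \<gamma> s \<bullet> b) \<or> mono_on {0<..<d} (\<lambda>s. - (\<gamma> s \<bullet> b)))" if "b \<in> Basis" for b
    by (rule definable_piecewise_C1_monotone[OF definable_fun_inner_Basis[OF that \<gamma>(1)], of 0]) auto
  then obtain d f' where d: "\<And>b. b \<in> Basis \<Longrightarrow> d b > 0"
    and f': "\<And>b x. b \<in> Basis \<Longrightarrow> 0 < x \<Longrightarrow> x < d b \<Longrightarrow> ((\<lambda>s. \<gamma> s \<bullet> b) has_real_derivative f' b x) (at x) \<and> isCont (f' b) x"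
    and mono: "\<And>b. b \<in> Basis \<Longrightarrow> mono_on {0<..<d b} (\<lambda>s. \<gamma> s \<bullet> b) \<or> mono_on {0<..<d b} (\<lambda>s. - (\<gamma> s \<bullet> b))"
    by metis
  define e where "e = Min (insert 1 (d ` Basis))"
  have e: "e > 0" "\<And>b. b \<in> Basis \<Longrightarrow> e \<le> d b" "e \<le> 1"
  proof -
    have *: "finite (insert 1 (d ` Basis))" by simp
    show "e \<le> 1" "\<And>b. b \<in> Basis \<Longrightarrow> e \<le> d b" unfolding e_def by (rule Min_le[OF *]; simp)+
    show "e > 0" unfolding e_def using d by (subst Min_gr_iff[OF *]) auto
  qed
  define \<sigma> where "\<sigma> = (\<lambda>b. if mono_on {0<..<d b} (\<lambda>s. \<gamma> s \<bullet> b) then 1 else - 1 :: real)"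
  have \<sigma>: "mono_on {0<..<e} (\<lambda>s. \<sigma> b * (\<gamma> s \<bullet> b))" if "b \<in> Basis" for b
  proof -
    have "mono_on {0<..<d b} (\<lambda>s. \<sigma> b * (\<gamma> s \<bullet> b))" using mono[OF that] by (auto simp: \<sigma>_def)
    then show ?thesis by (rule monotone_on_subset) (use e(2)[OF that] in auto)
  qed
  have \<sigma>_abs: "\<bar>\<sigma> b\<bar> = 1" for b by (simp add: \<sigma>_def)
  define l where "l = (\<lambda>s. s + (\<Sum>b\<in>Basis. \<sigma> b * (\<gamma> s \<bullet> b)))"
  define l' where "l' = (\<lambda>s. 1 + (\<Sum>b\<in>Basis. \<sigma> b * f' b s))"
  have l_der: "(l has_real_derivative l' s) (at s)" "isCont l' s" if s: "0 < s" "s < e" for s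
  proof -
    have f: "((\<lambda>s. \<gamma> s \<bullet> b) has_real_derivative f' b s) (at s)" "isCont (f' b) s" if "b \<in> Basis" for b
      using f'[OF that s(1)] s(2) e(2)[OF that] by auto
    show "(l has_real_derivative l' s) (at s)" unfolding l_def l'_def
      by (intro DERIV_add DERIV_ident DERIV_sum DERIV_cmult f)
    show "isCont l' s" unfolding l'_def by (intro continuous_intros f(2))
  qed
  have f'_nonneg: "0 \<le> \<sigma> b * f' b s" if b: "b \<in> Basis" and s: "0 < s" "s < e" for b s
  proof -
    have "((\<lambda>s. \<sigma> b * (\<gamma> s \<bullet> b)) has_real_derivative \<sigma> b * f' b s) (at s)"
      using f'[OF b s(1)] s(2) e(2)[OF b] by (intro DERIV_cmult) auto
    from mono_on_imp_deriv_nonneg[OF \<sigma>[OF b] this] s show ?thesis by (simp add: interior_open)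
  qed
  have l'_ge: "1 \<le> l' s" if "0 < s" "s < e" for s
    unfolding l'_def using sum_nonneg[of Basis "\<lambda>b. \<sigma> b * f' b s"] f'_nonneg that by auto
  have mono_l: "mono_on {0<..<e} l"
    unfolding l_def by (intro mono_onI add_mono sum_mono) (use \<sigma> in \<open>auto simp: mono_on_def\<close>)
  obtain R where R: "\<And>x. infdist x A \<le> 1 \<Longrightarrow> norm x \<le> R"
    using compact_imp_bounded[OF compact_infdist_level(1)[OF A(2,3), of 1]] by (auto simp: bounded_iff)
  have \<gamma>_dist: "infdist (\<gamma> s) A = s" if "0 < s" for s using \<gamma>(2)[OF that] by (simp add: flattest_def)
  have "- (\<Sum>b\<in>(Basis::'a set). R) \<le> l s" if s: "0 < s" "s < e" for s
  proof -
    have "norm (\<gamma> s) \<le> R" using R \<gamma>_dist[OF s(1)] s(2) e(3) by simp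
    have "- R \<le> \<sigma> b * (\<gamma> s \<bullet> b)" if "b \<in> Basis" for b
    proof -
      have "\<bar>\<sigma> b * (\<gamma> s \<bullet> b)\<bar> \<le> R" using Basis_le_norm[OF that, of "\<gamma> s"] \<open>norm (\<gamma> s) \<le> R\<close> by (simp add: abs_mult \<sigma>_abs)
      then show ?thesis by (simp add: abs_le_iff)
    qed
    then have "(\<Sum>b\<in>(Basis::'a set). - R) \<le> (\<Sum>b\<in>Basis. \<sigma> b * (\<gamma> s \<bullet> b))" by (intro sum_mono) auto
    then show ?thesis using s(1) by (simp add: l_def)
  qed
  from mono_bounded_limit_at_right[OF e(1) mono_l this] obtain l0 where l0: "(l \<longlongrightarrow> l0) (at_right 0)" by blast
  show thesis
  proof (rule that[of e "\<lambda>s. l s - l0" l'])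
    show "0 < e" by (rule e(1))
    show "((\<lambda>s. l s - l0) has_real_derivative l' s) (at s) \<and> isCont l' s \<and> 1 \<le> l' s" if "0 < s" "s < e" for s
      using DERIV_diff[OF l_der(1)[OF that] DERIV_const[of l0]] l_der(2)[OF that] l'_ge[OF that] by simp
    show "((\<lambda>s. l s - l0) \<longlongrightarrow> 0) (at_right 0)" using tendsto_diff[OF l0 tendsto_const[of l0]] by simp
    fix y s c assume s: "0 < s" "s < e" and y: "infdist y A = s" and c: "c < s / l' s"
    define v where "v = (\<Sum>b\<in>Basis. f' b s *\<^sub>R b)"
    have "(\<gamma> has_vector_derivative v) (at s)"
    proof -
      have "((\<lambda>u. \<Sum>b\<in>Basis. (\<gamma> u \<bullet> b) *\<^sub>R b) has_vector_derivative (\<Sum>b\<in>Basis. f' b s *\<^sub>R b)) (at s)"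
      proof (rule has_vector_derivative_sum)
        fix b :: 'a assume b: "b \<in> Basis"
        have "((\<lambda>s. \<gamma> s \<bullet> b) has_real_derivative f' b s) (at s)" using f'[OF b s(1)] s(2) e(2)[OF b] by auto
        then show "((\<lambda>u. (\<gamma> u \<bullet> b) *\<^sub>R b) has_vector_derivative f' b s *\<^sub>R b) (at s)"
          using has_vector_derivative_scaleR[OF _ has_vector_derivative_const[of b]] by fastforce
      qed
      then show ?thesis by (simp add: euclidean_representation v_def)
    qed
    moreover have "norm v \<le> l' s"
    proof -
      have "norm v \<le> (\<Sum>b\<in>Basis. norm (f' b s *\<^sub>R b))" unfolding v_def by (rule norm_sum)
      also have "\<dots> = (\<Sum>b\<in>Basis. \<sigma> b * f' b s)"
      proof (rule sum.cong[OF refl])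
        fix b :: 'a assume b: "b \<in> Basis"
        have "\<bar>f' b s\<bar> = \<bar>\<sigma> b * f' b s\<bar>" by (simp add: abs_mult \<sigma>_abs)
        then show "norm (f' b s *\<^sub>R b) = \<sigma> b * f' b s" using b f'_nonneg[OF b s] by simp
      qed
      finally show ?thesis by (simp add: l'_def)
    qed
    ultimately have "descends A (\<gamma> s) (s / l' s)"
      using l'_ge[OF s] by (intro curve_descends[OF A(2,3) s \<gamma>_dist]) auto
    then show "descends A y c" using \<gamma>(2)[OF s(1)] y c unfolding flattest_def slope_le_def by blast
  qed
qed

end


section \<open>Singular homology with field coefficients\<close>

definition chain_extend :: "(((nat \<Rightarrow> real) \<Rightarrow> 'a) \<Rightarrow> ('b, 'k :: field) field_chain) \<Rightarrow> ('a, 'k) field_chain \<Rightarrow> ('b, 'k) field_chain" where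
  "chain_extend \<Phi> c = (\<Sum>f\<in>Poly_Mapping.keys c. chain_scale (Poly_Mapping.lookup c f) (\<Phi> f))"

lemma chain_scale_zero [simp]: "chain_scale 0 c = 0"
  by (rule poly_mapping_eqI) simp

lemma chain_extend_superset:
  "finite F \<Longrightarrow> Poly_Mapping.keys c \<subseteq> F \<Longrightarrow> chain_extend \<Phi> c = (\<Sum>f\<in>F. chain_scale (Poly_Mapping.lookup c f) (\<Phi> f))"
  unfolding chain_extend_def by (intro sum.mono_neutral_left) (auto simp: in_keys_iff)

lemma chain_extend_zero [simp]: "chain_extend \<Phi> 0 = 0"
  by (simp add: chain_extend_def)

lemma chain_extend_add: "chain_extend \<Phi> (c + d) = chain_extend \<Phi> c + chain_extend \<Phi> d"
proof -
  let ?F = "Poly_Mapping.keys c \<union> Poly_Mapping.keys d"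
  show ?thesis
    using Poly_Mapping.keys_add[of c d]
    by (simp add: chain_extend_superset[of ?F] lookup_add chain_scale_simps sum.distrib)
qed

lemma chain_extend_scale: "chain_extend \<Phi> (chain_scale a c) = chain_scale a (chain_extend \<Phi> c)"
proof -
  have "Poly_Mapping.keys (chain_scale a c) \<subseteq> Poly_Mapping.keys c" by (auto simp: in_keys_iff)
  then show ?thesis
    by (simp add: chain_extend_superset[of "Poly_Mapping.keys c"] chain_scale_sum chain_scale_simps)
qed

lemma chain_extend_diff: "chain_extend \<Phi> (c - d) = chain_extend \<Phi> c - chain_extend \<Phi> d"
proof -
  have "c - d = c + chain_scale (- 1) d" by (simp add: chain_scale_simps)
  then show ?thesis by (simp only: chain_extend_add chain_extend_scale) (simp add: chain_scale_simps)
qed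

lemma chain_extend_sum: "chain_extend \<Phi> (sum g I) = (\<Sum>i\<in>I. chain_extend \<Phi> (g i))"
  by (induction I rule: infinite_finite_induct) (simp_all add: chain_extend_add)

lemma chain_extend_single [simp]: "chain_extend \<Phi> (Poly_Mapping.single f a) = chain_scale a (\<Phi> f)"
  by (cases "a = 0") (simp_all add: chain_extend_def)

lemma chain_extend_cong:
  "(\<And>f. f \<in> Poly_Mapping.keys c \<Longrightarrow> \<Phi> f = \<Psi> f) \<Longrightarrow> chain_extend \<Phi> c = chain_extend \<Psi> c"
  unfolding chain_extend_def by (intro sum.cong) auto

lemma chain_extend_fun_diff: "chain_extend (\<lambda>f. \<Phi> f - \<Psi> f) c = chain_extend \<Phi> c - chain_extend \<Psi> c"
  unfolding chain_extend_def by (simp add: chain_scale_simps sum_subtractf)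

lemma chain_extend_extend: "chain_extend \<Phi> (chain_extend \<Psi> c) = chain_extend (\<lambda>f. chain_extend \<Phi> (\<Psi> f)) c"
  unfolding chain_extend_def[of \<Psi>] chain_extend_def[of "\<lambda>f. chain_extend \<Phi> (\<Psi> f)"]
  by (simp add: chain_extend_sum chain_extend_scale)

lemma chain_extend_id [simp]: "chain_extend (\<lambda>f. Poly_Mapping.single f 1) c = c"
proof (rule poly_mapping_eqI)
  fix g
  have "Poly_Mapping.lookup (chain_extend (\<lambda>f. Poly_Mapping.single f 1) c) g =
      (\<Sum>f\<in>Poly_Mapping.keys c. if f = g then Poly_Mapping.lookup c f else 0)"
    unfolding chain_extend_def lookup_sum by (intro sum.cong) (auto simp: lookup_single when_def)
  then show "Poly_Mapping.lookup (chain_extend (\<lambda>f. Poly_Mapping.single f 1) c) g = Poly_Mapping.lookup c g"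
    by (simp add: in_keys_iff)
qed

lemma keys_chain_scale: "Poly_Mapping.keys (chain_scale a c) \<subseteq> Poly_Mapping.keys c"
  by (auto simp: in_keys_iff)

lemma keys_chain_extend: "Poly_Mapping.keys (chain_extend \<Phi> c) \<subseteq> (\<Union>f\<in>Poly_Mapping.keys c. Poly_Mapping.keys (\<Phi> f))"
  unfolding chain_extend_def using keys_chain_scale by (fastforce dest: subsetD[OF keys_sum])

lemma field_chains_sum: "(\<And>i. i \<in> I \<Longrightarrow> g i \<in> field_chains p X) \<Longrightarrow> sum g I \<in> field_chains p X"
  by (induction I rule: infinite_finite_induct) (simp_all add: field_chains_closed)

lemma field_chains_diff: "c \<in> field_chains p X \<Longrightarrow> d \<in> field_chains p X \<Longrightarrow> c - d \<in> field_chains p X"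
  using field_chains_closed(2)[of c p X "chain_scale (- 1) d"] field_chains_closed(3)[of d p X "- 1"] by (simp add: chain_scale_simps)

lemma field_chains_extend:
  "(\<And>f. f \<in> Poly_Mapping.keys c \<Longrightarrow> \<Phi> f \<in> field_chains p X) \<Longrightarrow> chain_extend \<Phi> c \<in> field_chains p X"
  unfolding chain_extend_def by (intro field_chains_sum field_chains_closed(3))

lemma field_chains_single: "singular_simplex p X f \<Longrightarrow> Poly_Mapping.single f a \<in> field_chains p X"
  by (auto simp: field_chains_def)

lemma field_boundary_sum: "field_boundary p (sum g I) = (\<Sum>i\<in>I. field_boundary p (g i))"
  by (induction I rule: infinite_finite_induct) (simp_all add: field_boundary_simps)

lemma field_boundary_eq_extend:
  "field_boundary p = chain_extend (\<lambda>f. field_boundary p (Poly_Mapping.single f 1))"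
proof
  fix c
  have "field_boundary p (chain_extend (\<lambda>f. Poly_Mapping.single f 1) c) = chain_extend (\<lambda>f. field_boundary p (Poly_Mapping.single f 1)) c"
    unfolding chain_extend_def by (simp only: field_boundary_simps field_boundary_sum)
  then show "field_boundary p c = chain_extend (\<lambda>f. field_boundary p (Poly_Mapping.single f 1)) c" by simp
qed

lemma field_boundary_single:
  "field_boundary (Suc p) (Poly_Mapping.single f a) =
    (\<Sum>i\<le>Suc p. Poly_Mapping.single (singular_face (Suc p) i f) ((- 1) ^ i * a))"
  by (cases "a = 0") (simp_all add: field_boundary_def)

lemma field_boundary_0 [simp]: "field_boundary 0 c = 0"
  by (simp add: field_boundary_def)

lemma field_boundary_diff: "field_boundary p (c - d) = field_boundary p c - field_boundary p d"
proof -
  have "c - d = c + chain_scale (- 1) d" by (simp add: chain_scale_simps)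
  then show ?thesis by (simp only: field_boundary_simps) (simp add: chain_scale_simps)
qed

lemma field_boundary_extend: "field_boundary p (chain_extend \<Phi> c) = chain_extend (\<lambda>f. field_boundary p (\<Phi> f)) c"
  by (subst (1 2) field_boundary_eq_extend) (simp add: chain_extend_extend)

lemma chain_extend_boundary:
  "chain_extend \<Psi> (field_boundary p c) = chain_extend (\<lambda>f. chain_extend \<Psi> (field_boundary p (Poly_Mapping.single f 1))) c"
proof -
  have "field_boundary p c = chain_extend (\<lambda>f. field_boundary p (Poly_Mapping.single f 1)) c"
    by (rule fun_cong[OF field_boundary_eq_extend])
  then show ?thesis by (simp only: chain_extend_extend)
qed

definition of_int_chain :: "'a chain \<Rightarrow> ('a, 'k :: field) field_chain" where
  "of_int_chain c = Poly_Mapping.map of_int c"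

lemma lookup_of_int_chain [simp]: "Poly_Mapping.lookup (of_int_chain c) f = of_int (Poly_Mapping.lookup c f)"
  by (simp add: of_int_chain_def Poly_Mapping.map.rep_eq when_def)

lemma of_int_chain_simps:
  "of_int_chain 0 = 0"
  "of_int_chain (c + d) = of_int_chain c + of_int_chain d"
  "of_int_chain (c - d) = of_int_chain c - of_int_chain d"
  "of_int_chain (frag_cmul a c) = chain_scale (of_int a) (of_int_chain c)"
  "of_int_chain (frag_of f) = Poly_Mapping.single f 1"
  by (rule poly_mapping_eqI; simp add: lookup_add lookup_minus lookup_single when_def)+

lemma of_int_chain_sum: "of_int_chain (sum g I) = (\<Sum>i\<in>I. of_int_chain (g i))"
  by (induction I rule: infinite_finite_induct) (simp_all add: of_int_chain_simps)

lemma keys_of_int_chain: "Poly_Mapping.keys (of_int_chain c) \<subseteq> Poly_Mapping.keys c"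
  by (auto simp: in_keys_iff)

lemma of_int_chain_in: "singular_chain p X c \<Longrightarrow> of_int_chain c \<in> field_chains p X"
  using keys_of_int_chain unfolding singular_chain_def field_chains_def by blast

lemma chain_extend_of_int_chain:
  assumes "singular_chain p X c" "\<And>c d. h (c - d) = h c - h d" "h 0 = 0"
  shows "chain_extend (\<lambda>f. of_int_chain (h (frag_of f))) (of_int_chain c) = of_int_chain (h c)"
  using assms(1) unfolding singular_chain_def
proof (induction c rule: frag_induction)
  case zero
  then show ?case by (simp add: assms(3) of_int_chain_simps)
next
  case (one f)
  then show ?case by (simp add: of_int_chain_simps chain_scale_simps)
next
  case (diff a b)
  then show ?case by (simp add: assms(2) of_int_chain_simps chain_extend_diff)
qed

lemma field_boundary_of_int_single:
  "field_boundary p (Poly_Mapping.single f 1) = of_int_chain (chain_boundary p (frag_of f))"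
proof (cases p)
  case (Suc q)
  then show ?thesis
    by (simp add: field_boundary_single chain_boundary_of of_int_chain_sum of_int_chain_simps chain_scale_single
        del: sum.atMost_Suc)
qed (simp add: of_int_chain_simps chain_boundary_of)

lemma field_boundary_of_int_chain:
  "singular_chain p X c \<Longrightarrow> field_boundary p (of_int_chain c) = of_int_chain (chain_boundary p c)"
  by (subst field_boundary_eq_extend)
    (simp add: field_boundary_of_int_single chain_extend_of_int_chain[where h = "chain_boundary p"] chain_boundary_diff)

lemma field_boundary_boundary:
  assumes "c \<in> field_chains (Suc p) X" shows "field_boundary p (field_boundary (Suc p) c) = 0"
proof -
  have "field_boundary p (field_boundary (Suc p) (Poly_Mapping.single f 1)) = (0 :: ('a, 'b) field_chain)" if "f \<in> Poly_Mapping.keys c" for f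
  proof -
    have f: "singular_chain (Suc p) X (frag_of f)" using that assms by (auto simp: field_chains_def singular_chain_of)
    then have "singular_chain p X (chain_boundary (Suc p) (frag_of f))" using singular_chain_boundary_alt by blast
    then show ?thesis
      using chain_boundary_boundary_alt[OF f]
      by (simp add: field_boundary_of_int_single field_boundary_of_int_chain of_int_chain_simps)
  qed
  then have "chain_extend (\<lambda>f. field_boundary p (field_boundary (Suc p) (Poly_Mapping.single f 1))) c = chain_extend (\<lambda>f. 0) c"
    by (intro chain_extend_cong)
  also have "\<dots> = 0" by (simp add: chain_extend_def chain_scale_simps)
  finally show ?thesis by (subst (2) field_boundary_eq_extend) (simp add: field_boundary_extend)
qed

lemma field_boundary_in: "c \<in> field_chains (Suc p) X \<Longrightarrow> field_boundary (Suc p) c \<in> field_chains p X"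
proof -
  assume c: "c \<in> field_chains (Suc p) X"
  have "singular_simplex p X (singular_face (Suc p) i f)" if "f \<in> Poly_Mapping.keys c" "i \<le> Suc p" for f i
    using singular_simplex_singular_face[of "Suc p" X f i] that c by (auto simp: field_chains_def)
  then show ?thesis unfolding field_boundary_def if_not_P[OF nat.discI[OF refl]]
    by (intro field_chains_sum field_chains_single) auto
qed

lemma boundaries_subset_cycles: "boundaries p X \<subseteq> cycles p X"
  unfolding boundaries_def cycles_def by (auto simp: field_boundary_boundary field_boundary_in)

lemma field_chains_mono: "S \<subseteq> T \<Longrightarrow> field_chains p (top_of_set S) \<subseteq> field_chains p (top_of_set T)"
  unfolding field_chains_def using singular_simplex_mono by blast

lemma cycles_mono: "S \<subseteq> T \<Longrightarrow> cycles p (top_of_set S) \<subseteq> cycles p (top_of_set T)"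
  unfolding cycles_def using field_chains_mono by blast

lemma boundaries_mono: "S \<subseteq> T \<Longrightarrow> boundaries p (top_of_set S) \<subseteq> boundaries p (top_of_set T)"
  unfolding boundaries_def using field_chains_mono by blast

lemma cycles_diff: "c \<in> cycles p X \<Longrightarrow> d \<in> cycles p X \<Longrightarrow> c - d \<in> cycles p X"
  by (auto simp: cycles_def field_chains_diff field_boundary_diff)

lemma boundaries_diff: "c \<in> boundaries p X \<Longrightarrow> d \<in> boundaries p X \<Longrightarrow> c - d \<in> boundaries p X"
  using boundaries_closed(2)[OF _ boundaries_minus] by fastforce


subsection \<open>Induced maps and subdivision\<close>

definition push_chain :: "nat \<Rightarrow> ('a \<Rightarrow> 'b) \<Rightarrow> ('a, 'k :: field) field_chain \<Rightarrow> ('b, 'k) field_chain" where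
  "push_chain p g = chain_extend (\<lambda>f. Poly_Mapping.single (simplex_map p g f) 1)"

lemma singular_face_simplex_map':
  "1 \<le> p \<Longrightarrow> k \<le> p \<Longrightarrow> singular_face p k (simplex_map p g f) = simplex_map (p - 1) g (singular_face p k f)"
  by (simp add: singular_face_simplex_map) (auto simp: simplex_map_def singular_face_def)

lemma push_chain_boundary:
  fixes c :: "('a, 'k :: field) field_chain" and g :: "'a \<Rightarrow> 'b"
  shows "field_boundary p (push_chain p g c) = push_chain (p - 1) g (field_boundary p c)"
proof (cases p)
  case (Suc q)
  have "field_boundary p (Poly_Mapping.single (simplex_map p g f) 1) = push_chain q g (field_boundary p (Poly_Mapping.single f (1 :: 'k)))" for f :: "(nat \<Rightarrow> real) \<Rightarrow> 'a"
    unfolding Suc push_chain_def field_boundary_single chain_extend_sum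
    by (intro sum.cong refl) (simp add: chain_scale_single singular_face_simplex_map')
  then show ?thesis
    unfolding push_chain_def field_boundary_extend chain_extend_boundary[of _ p c] using Suc by simp
qed (simp add: push_chain_def)

lemma push_chain_in: "continuous_map X Y g \<Longrightarrow> c \<in> field_chains p X \<Longrightarrow> push_chain p g c \<in> field_chains p Y"
  unfolding push_chain_def
  by (intro field_chains_extend field_chains_single singular_simplex_simplex_map) (auto simp: field_chains_def)

lemma push_chain_zero [simp]: "push_chain p g 0 = 0"
  by (simp add: push_chain_def)

lemma push_chain_cycle: "continuous_map X Y g \<Longrightarrow> c \<in> cycles p X \<Longrightarrow> push_chain p g c \<in> cycles p Y"
  by (auto simp: cycles_def push_chain_in push_chain_boundary)

lemma push_chain_boundaries: "continuous_map X Y g \<Longrightarrow> c \<in> boundaries p X \<Longrightarrow> push_chain p g c \<in> boundaries p Y"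
proof -
  assume g: "continuous_map X Y g" and "c \<in> boundaries p X"
  then obtain d where d: "d \<in> field_chains (Suc p) X" "c = field_boundary (Suc p) d" unfolding boundaries_def by blast
  have "push_chain p g c = field_boundary (Suc p) (push_chain (Suc p) g d)" by (simp add: push_chain_boundary d(2))
  then show ?thesis unfolding boundaries_def using push_chain_in[OF g d(1)] by blast
qed

lemma push_chain_ident:
  assumes "c \<in> field_chains p X" "\<And>x. x \<in> topspace X \<Longrightarrow> g x = x" shows "push_chain p g c = c"
proof -
  have "simplex_map p g f = f" if "f \<in> Poly_Mapping.keys c" for f
    using that assms by (intro simplex_map_id_gen[of p X]) (auto simp: field_chains_def)
  then have "push_chain p g c = chain_extend (\<lambda>f. Poly_Mapping.single f 1) c"
    unfolding push_chain_def by (intro chain_extend_cong) simp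
  then show ?thesis by simp
qed

lemma push_chain_compose: "push_chain p (\<lambda>x. h (g x)) c = push_chain p h (push_chain p g c)"
proof -
  have "simplex_map p (\<lambda>x. h (g x)) f = simplex_map p h (simplex_map p g f)" for f
    using fun_cong[OF simplex_map_compose[of p h g], of f] by (simp add: o_def)
  then show ?thesis unfolding push_chain_def chain_extend_extend by (simp add: chain_scale_simps)
qed

lemma small_cycle_exists:
  assumes z: "z \<in> cycles k X" and \<C>: "\<And>U. U \<in> \<C> \<Longrightarrow> openin X U" "topspace X \<subseteq> \<Union>\<C>"
  obtains z' where "z' \<in> cycles k X" "z' - z \<in> boundaries k X"
    "\<And>f. f \<in> Poly_Mapping.keys z' \<Longrightarrow> \<exists>V\<in>\<C>. f \<in> standard_simplex k \<rightarrow> V"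
proof -
  have simp_f: "singular_chain k X (frag_of f)" if "f \<in> Poly_Mapping.keys z" for f
    using that z by (auto simp: cycles_def field_chains_def singular_chain_of)
  have "\<exists>n. \<forall>m g. n \<le> m \<and> g \<in> Poly_Mapping.keys ((singular_subdivision k ^^ m) (frag_of f)) \<longrightarrow> (\<exists>V\<in>\<C>. g \<in> standard_simplex k \<rightarrow> V)"
    if "f \<in> Poly_Mapping.keys z" for f
    using sufficient_iterated_singular_subdivision_exists[OF \<C> simp_f[OF that]] by metis
  then obtain N where N: "\<And>f m g. f \<in> Poly_Mapping.keys z \<Longrightarrow> N f \<le> m \<Longrightarrow> g \<in> Poly_Mapping.keys ((singular_subdivision k ^^ m) (frag_of f)) \<Longrightarrow> \<exists>V\<in>\<C>. g \<in> standard_simplex k \<rightarrow> V"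
    by metis
  define n where "n = Max (insert 0 (N ` Poly_Mapping.keys z))"
  have n: "N f \<le> n" if "f \<in> Poly_Mapping.keys z" for f using that by (auto simp: n_def)
  obtain h :: "nat \<Rightarrow> 'a chain \<Rightarrow> 'a chain" where h: "\<And>p. h p 0 = 0" "\<And>p c1 c2. h p (c1 - c2) = h p c1 - h p c2"
    "\<And>p X c. singular_chain p X c \<Longrightarrow> singular_chain (Suc p) X (h p c)"
    "\<And>p X c. singular_chain p X c \<Longrightarrow> chain_boundary (Suc p) (h p c) + h (p - Suc 0) (chain_boundary p c) = (singular_subdivision p ^^ n) c - c"
    by (rule chain_homotopic_iterated_singular_subdivision[of n]) (rule that)
  let ?H = "\<lambda>f. of_int_chain (h k (frag_of f)) :: ('a, 'b) field_chain"
  let ?S = "\<lambda>f. of_int_chain ((singular_subdivision k ^^ n) (frag_of f)) :: ('a, 'b) field_chain"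
  let ?H' = "\<lambda>f. of_int_chain (h (k - 1) (frag_of f)) :: ('a, 'b) field_chain"
  have gen: "field_boundary (Suc k) (?H f) = ?S f - Poly_Mapping.single f 1 - chain_extend ?H' (field_boundary k (Poly_Mapping.single f 1))"
    if "f \<in> Poly_Mapping.keys z" for f
  proof -
    note f = simp_f[OF that]
    have "chain_extend ?H' (field_boundary k (Poly_Mapping.single f 1)) = of_int_chain (h (k - 1) (chain_boundary k (frag_of f)))"
      unfolding field_boundary_of_int_single
      by (rule chain_extend_of_int_chain[OF singular_chain_boundary[OF f]]) (simp_all add: h)
    moreover have "field_boundary (Suc k) (?H f) = of_int_chain (chain_boundary (Suc k) (h k (frag_of f)))"
      by (rule field_boundary_of_int_chain[OF h(3)[OF f]])
    moreover have "chain_boundary (Suc k) (h k (frag_of f)) = (singular_subdivision k ^^ n) (frag_of f) - frag_of f - h (k - 1) (chain_boundary k (frag_of f))"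
      using h(4)[OF f] by (simp add: algebra_simps)
    ultimately show ?thesis by (simp add: of_int_chain_simps)
  qed
  define z' where "z' = chain_extend ?S z"
  have "field_boundary (Suc k) (chain_extend ?H z) = chain_extend (\<lambda>f. ?S f - Poly_Mapping.single f 1 - chain_extend ?H' (field_boundary k (Poly_Mapping.single f 1))) z"
    unfolding field_boundary_extend by (intro chain_extend_cong gen)
  also have "\<dots> = z' - z - chain_extend ?H' (field_boundary k z)"
    unfolding chain_extend_fun_diff chain_extend_boundary[symmetric] by (simp add: z'_def)
  also have "\<dots> = z' - z" using z by (simp add: cycles_def)
  finally have eq: "field_boundary (Suc k) (chain_extend ?H z) = z' - z" .
  moreover have "chain_extend ?H z \<in> field_chains (Suc k) X"
    using simp_f h(3) by (intro field_chains_extend of_int_chain_in) auto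
  ultimately have bd: "z' - z \<in> boundaries k X" unfolding boundaries_def by (metis image_eqI)
  show thesis
  proof (rule that[OF _ bd])
    have "z' = (z' - z) + z" by simp
    then show "z' \<in> cycles k X" using bd boundaries_subset_cycles cycles_closed(2)[OF _ z, of "z' - z"] by (metis subsetD)
    fix g assume "g \<in> Poly_Mapping.keys z'"
    then obtain f where "f \<in> Poly_Mapping.keys z" "g \<in> Poly_Mapping.keys (?S f)"
      using keys_chain_extend[of ?S z] unfolding z'_def by blast
    then show "\<exists>V\<in>\<C>. g \<in> standard_simplex k \<rightarrow> V"
      using N[OF _ n] keys_of_int_chain by blast
  qed
qed


subsection \<open>The prism operator of straight-line homotopies\<close>

definition collapse :: "nat \<Rightarrow> (nat \<Rightarrow> real) \<Rightarrow> nat \<Rightarrow> real" where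
  "collapse i y = (\<lambda>j. if j < i then y j else if j = i then y i + y (Suc i) else y (Suc j))"

definition prism :: "nat \<Rightarrow> nat \<Rightarrow> ((nat \<Rightarrow> real) \<Rightarrow> 'a::real_vector) \<Rightarrow> ((nat \<Rightarrow> real) \<Rightarrow> 'a) \<Rightarrow> (nat \<Rightarrow> real) \<Rightarrow> 'a" where
  "prism p i f g = restrict (\<lambda>y. let t = (\<Sum>l\<in>{i<..Suc p}. y l) in
     (1 - t) *\<^sub>R f (collapse i y) + t *\<^sub>R g (collapse i y)) (standard_simplex (Suc p))"

definition prism_slice :: "nat \<Rightarrow> nat \<Rightarrow> ((nat \<Rightarrow> real) \<Rightarrow> 'a::real_vector) \<Rightarrow> ((nat \<Rightarrow> real) \<Rightarrow> 'a) \<Rightarrow> (nat \<Rightarrow> real) \<Rightarrow> 'a" where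
  "prism_slice p i f g = restrict (\<lambda>y. let t = (\<Sum>l\<in>{i..p}. y l) in
     (1 - t) *\<^sub>R f y + t *\<^sub>R g y) (standard_simplex p)"

lemma sum_collapse:
  assumes "i \<le> p" shows "(\<Sum>j\<le>p. collapse i y j) = (\<Sum>j\<le>Suc p. y j)"
proof -
  have "(\<Sum>j\<le>p. collapse i y j) = (\<Sum>j<i. y j) + (\<Sum>j=i..p. collapse i y j)"
    using assms sum.union_disjoint[of "{..<i}" "{i..p}" "collapse i y"]
    by (auto simp: collapse_def ivl_disj_un ivl_disj_int atLeast0AtMost)
  also have "(\<Sum>j=i..p. collapse i y j) = y i + y (Suc i) + (\<Sum>j=Suc i..p. y (Suc j))"
    using assms by (subst sum.atLeast_Suc_atMost) (auto simp: collapse_def)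
  also have "(\<Sum>j=Suc i..p. y (Suc j)) = (\<Sum>j=Suc (Suc i)..Suc p. y j)" by (rule sum.shift_bounds_cl_Suc_ivl[symmetric])
  also have "(\<Sum>j<i. y j) + (y i + y (Suc i) + (\<Sum>j=Suc (Suc i)..Suc p. y j)) = (\<Sum>j<i. y j) + (\<Sum>j=i..Suc p. y j)"
    using assms by (simp add: sum.atLeast_Suc_atMost[of i] sum.atLeast_Suc_atMost[of "Suc i"] del: sum.cl_ivl_Suc)
  also have "\<dots> = (\<Sum>j\<le>Suc p. y j)"
    using assms sum.union_disjoint[of "{..<i}" "{i..Suc p}" y] by (simp add: ivl_disj_un ivl_disj_int del: sum.cl_ivl_Suc sum.atMost_Suc)
  finally show ?thesis .
qed

lemma collapse_in:
  assumes "i \<le> p" "y \<in> standard_simplex (Suc p)" shows "collapse i y \<in> standard_simplex p"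
proof -
  have y: "\<And>j. 0 \<le> y j" "\<And>j. j > Suc p \<Longrightarrow> y j = 0" "(\<Sum>j\<le>Suc p. y j) = 1"
    using assms(2) by (auto simp: standard_simplex_def)
  have s: "(\<Sum>j\<le>p. collapse i y j) = 1" using sum_collapse[OF assms(1), of y] y(3) by simp
  have nn: "0 \<le> collapse i y j" for j using y(1) by (auto simp: collapse_def)
  have z: "collapse i y j = 0" if "j > p" for j using that assms(1) y(2) by (auto simp: collapse_def)
  have "collapse i y j \<le> 1" for j
  proof (cases "j \<le> p")
    case True
    then have "collapse i y j \<le> (\<Sum>j\<le>p. collapse i y j)" by (intro member_le_sum) (auto intro: nn)
    with s show ?thesis by simp
  qed (use z in simp)
  with s nn z show ?thesis by (simp add: standard_simplex_def)
qed

lemma partial_sum_01: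
  assumes "y \<in> standard_simplex p" "L \<subseteq> {..p}" shows "0 \<le> sum y L" "sum y L \<le> 1"
proof -
  have y: "\<And>j. 0 \<le> y j" "sum y {..p} = 1" using assms(1) by (auto simp: standard_simplex_def)
  then show "0 \<le> sum y L" by (simp add: sum_nonneg)
  show "sum y L \<le> 1" using sum_mono2[of "{..p}" L y] assms(2) y by auto
qed

lemma sum_face: "(\<Sum>l\<in>{i..Suc p}. simplical_face j y l) = (\<Sum>l\<in>(if j < i then {i - 1..p} else {i..p}). y l)" if "j \<le> Suc p" "i \<le> Suc p" for y :: "nat \<Rightarrow> real"
proof (cases "j < i")
  case True
  then obtain i' where i': "i = Suc i'" by (cases i) auto
  have "(\<Sum>l\<in>{i..Suc p}. simplical_face j y l) = (\<Sum>l\<in>{i'..p}. simplical_face j y (Suc l))"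
    unfolding i' by (rule sum.shift_bounds_cl_Suc_ivl)
  also have "\<dots> = (\<Sum>l\<in>{i'..p}. y l)" using True i' by (intro sum.cong) (auto simp: simplical_face_def)
  finally show ?thesis using True i' by simp
next
  case False
  have "{i..Suc p} = {i..<j} \<union> {j} \<union> {Suc j..Suc p}" using False that by auto
  then have "(\<Sum>l\<in>{i..Suc p}. simplical_face j y l) = (\<Sum>l\<in>{i..<j} \<union> {j} \<union> {Suc j..Suc p}. simplical_face j y l)" by (rule arg_cong)
  also have "\<dots> = (\<Sum>l\<in>{i..<j}. simplical_face j y l) + (\<Sum>l\<in>{Suc j..Suc p}. simplical_face j y l)"
  proof -
    have "{i..<j} \<inter> {Suc j..Suc p} = {}" by auto
    then show ?thesis by (simp add: sum.union_disjoint simplical_face_def del: sum.cl_ivl_Suc)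
  qed
  also have "(\<Sum>l\<in>{Suc j..Suc p}. simplical_face j y l) = (\<Sum>l\<in>{j..p}. simplical_face j y (Suc l))" by (rule sum.shift_bounds_cl_Suc_ivl)
  also have "\<dots> = (\<Sum>l\<in>{j..p}. y l)" by (intro sum.cong) (auto simp: simplical_face_def)
  also have "(\<Sum>l\<in>{i..<j}. simplical_face j y l) = (\<Sum>l\<in>{i..<j}. y l)" by (intro sum.cong) (auto simp: simplical_face_def)
  also have "(\<Sum>l\<in>{i..<j}. y l) + (\<Sum>l\<in>{j..p}. y l) = (\<Sum>l\<in>{i..p}. y l)"
  proof (cases "j \<le> p")
    case True
    have "{i..p} = {i..<j} \<union> {j..p}" using False True by auto
    then show ?thesis by (simp add: sum.union_disjoint ivl_disj_int)
  next
    case f: False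
    then have "j = Suc p" using that by simp
    then show ?thesis by (simp add: atLeastLessThanSuc_atLeastAtMost)
  qed
  finally show ?thesis using False by simp
qed

lemma prism_face_low:
  assumes "j < i" "i \<le> p"
  shows "singular_face (Suc p) j (prism p i f g) = prism (p - 1) (i - 1) (singular_face p j f) (singular_face p j g)"
proof
  fix y
  obtain q where q: "p = Suc q" using assms by (cases p) auto
  show "singular_face (Suc p) j (prism p i f g) y = prism (p - 1) (i - 1) (singular_face p j f) (singular_face p j g) y"
  proof (cases "y \<in> standard_simplex p")
    case True
    have fy: "simplical_face j y \<in> standard_simplex (Suc p)"
      using simplical_face_in_standard_simplex[of "Suc p" j y] True assms by simp
    have c: "collapse i (simplical_face j y) = simplical_face j (collapse (i - 1) y)"
      using assms by (auto simp: collapse_def simplical_face_def fun_eq_iff)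
    have "collapse (i - 1) y \<in> standard_simplex q" using assms True q by (intro collapse_in) auto
    moreover have "(\<Sum>l\<in>{i<..Suc p}. simplical_face j y l) = (\<Sum>l\<in>{i - 1<..Suc q}. y l)"
      using sum_face[of j p "Suc i" y] assms q by (cases i) (simp_all add: atLeastSucAtMost_greaterThanAtMost del: sum.cl_ivl_Suc)
    ultimately show ?thesis using True fy q by (simp add: singular_face_def prism_def c Let_def)
  qed (use q in \<open>simp add: singular_face_def prism_def\<close>)
qed

lemma prism_face_high:
  assumes "Suc i < j" "j \<le> Suc p"
  shows "singular_face (Suc p) j (prism p i f g) = prism (p - 1) i (singular_face p (j - 1) f) (singular_face p (j - 1) g)"
proof
  fix y
  obtain q where q: "p = Suc q" using assms by (cases p) auto
  show "singular_face (Suc p) j (prism p i f g) y = prism (p - 1) i (singular_face p (j - 1) f) (singular_face p (j - 1) g) y"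
  proof (cases "y \<in> standard_simplex p")
    case True
    have fy: "simplical_face j y \<in> standard_simplex (Suc p)"
      using simplical_face_in_standard_simplex[of "Suc p" j y] True assms by simp
    have c: "collapse i (simplical_face j y) = simplical_face (j - 1) (collapse i y)"
    proof
      fix m
      obtain j' where j': "j = Suc j'" "i < j'" using assms(1) by (cases j) auto
      consider "m < i" | "m = i" | "i < m" "m < j'" | "m = j'" | "j' < m" by linarith
      then show "collapse i (simplical_face j y) m = simplical_face (j - 1) (collapse i y) m"
        by cases (use j' in \<open>auto simp: collapse_def simplical_face_def\<close>)
    qed
    have "collapse i y \<in> standard_simplex q" using assms True q by (intro collapse_in) auto
    moreover have "(\<Sum>l\<in>{i<..Suc p}. simplical_face j y l) = (\<Sum>l\<in>{i<..Suc q}. y l)"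
      using sum_face[of j p "Suc i" y] assms q by (simp add: atLeastSucAtMost_greaterThanAtMost del: sum.cl_ivl_Suc)
    ultimately show ?thesis using True fy q by (simp add: singular_face_def prism_def c Let_def)
  qed (use q in \<open>simp add: singular_face_def prism_def\<close>)
qed

lemma prism_face_mid:
  assumes "i \<le> p" "j = i \<or> j = Suc i"
  shows "singular_face (Suc p) j (prism p i f g) = prism_slice p j f g"
proof
  fix y
  show "singular_face (Suc p) j (prism p i f g) y = prism_slice p j f g y"
  proof (cases "y \<in> standard_simplex p")
    case True
    have fy: "simplical_face j y \<in> standard_simplex (Suc p)"
      using simplical_face_in_standard_simplex[of "Suc p" j y] True assms by auto
    have c: "collapse i (simplical_face j y) = y"
      using assms by (auto simp: collapse_def simplical_face_def fun_eq_iff)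
    have "(\<Sum>l\<in>{i<..Suc p}. simplical_face j y l) = (\<Sum>l\<in>{j..p}. y l)"
      using sum_face[of j p "Suc i" y] assms by (auto simp: atLeastSucAtMost_greaterThanAtMost simp del: sum.cl_ivl_Suc)
    then show ?thesis using True fy by (simp add: singular_face_def prism_def prism_slice_def c Let_def)
  qed (simp add: singular_face_def prism_slice_def)
qed

lemma prism_slice_ends:
  assumes "f \<in> extensional (standard_simplex p)" "g \<in> extensional (standard_simplex p)"
  shows "prism_slice p 0 f g = g" "prism_slice p (Suc p) f g = f"
proof -
  have "(\<Sum>l\<in>{0..p}. y l) = 1" if "y \<in> standard_simplex p" for y
    using that by (simp add: standard_simplex_def atLeast0AtMost)
  then show "prism_slice p 0 f g = g" "prism_slice p (Suc p) f g = f"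
    using assms by (auto simp: prism_slice_def fun_eq_iff extensional_def Let_def)
qed

definition prism_chain :: "nat \<Rightarrow> ((nat \<Rightarrow> real) \<Rightarrow> 'a::real_vector) \<Rightarrow> ((nat \<Rightarrow> real) \<Rightarrow> 'a) \<Rightarrow> ('a, 'k :: field) field_chain" where
  "prism_chain p f g = (\<Sum>i\<le>p. Poly_Mapping.single (prism p i f g) ((- 1) ^ i))"

lemma boundary_prism_chain:
  assumes ext: "f \<in> extensional (standard_simplex p)" "g \<in> extensional (standard_simplex p)"
  shows "field_boundary (Suc p) (prism_chain p f g) = Poly_Mapping.single g 1 - Poly_Mapping.single f (1 :: 'k :: field) -
     (if p = 0 then 0 else \<Sum>j\<le>p. chain_scale ((- 1) ^ j) (prism_chain (p - 1) (singular_face p j f) (singular_face p j g)))"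
proof -
  let ?s = "\<lambda>i j. Poly_Mapping.single (singular_face (Suc p) j (prism p i f g)) ((- 1) ^ (i + j) :: 'k)"
  let ?S = "\<lambda>i j. Poly_Mapping.single (prism (p - 1) i (singular_face p j f) (singular_face p j g)) ((- 1) ^ (i + j) :: 'k)"
  let ?M = "\<lambda>i. Poly_Mapping.single (prism_slice p i f g) (1 :: 'k)"
  have minus: "Poly_Mapping.single x (- a) = - Poly_Mapping.single x (a :: 'k)" for x :: "(nat \<Rightarrow> real) \<Rightarrow> 'a" and a
    by (simp add: single_uminus)
  have "field_boundary (Suc p) (sum h I) = (\<Sum>i\<in>I. field_boundary (Suc p) (h i))" for h :: "nat \<Rightarrow> ('a, 'k) field_chain" and I
    by (induction I rule: infinite_finite_induct) (simp_all add: field_boundary_simps)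
  then have "field_boundary (Suc p) (prism_chain p f g :: ('a, 'k) field_chain) = (\<Sum>i\<le>p. \<Sum>j\<le>Suc p. ?s i j)"
    unfolding prism_chain_def field_boundary_single by (simp add: power_add mult.commute field_boundary_single del: sum.atMost_Suc)
  also have "\<dots> = (\<Sum>i\<le>p. (?M i - ?M (Suc i)) + ((\<Sum>j<i. ?s i j) + (\<Sum>j=Suc i..p. ?s i (Suc j))))"
  proof (rule sum.cong[OF refl])
    fix i assume "i \<in> {..p}"
    then have i: "i \<le> p" by simp
    have "{..Suc p} = {..<i} \<union> {i, Suc i} \<union> {Suc (Suc i)..Suc p}" using i by auto
    then have "(\<Sum>j\<le>Suc p. ?s i j) = (\<Sum>j\<in>{..<i} \<union> {i, Suc i} \<union> {Suc (Suc i)..Suc p}. ?s i j)" by (rule arg_cong)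
    also have "\<dots> = (\<Sum>j<i. ?s i j) + (?s i i + ?s i (Suc i)) + (\<Sum>j=Suc (Suc i)..Suc p. ?s i j)"
      by (subst sum.union_disjoint; auto)+
    also have "(\<Sum>j=Suc (Suc i)..Suc p. ?s i j) = (\<Sum>j=Suc i..p. ?s i (Suc j))" by (rule sum.shift_bounds_cl_Suc_ivl)
    also have "?s i i = ?M i"
    proof -
      have "(- 1) ^ (i + i) = (1 :: 'k)" by (simp add: power_add flip: power_mult_distrib)
      then show ?thesis by (simp only: prism_face_mid[OF i disjI1[OF refl]])
    qed
    also have "?s i (Suc i) = - ?M (Suc i)"
    proof -
      have "(- 1) ^ (i + Suc i) = (- 1 :: 'k)" by (simp add: power_add flip: power_mult_distrib)
      then show ?thesis by (simp only: prism_face_mid[OF i disjI2[OF refl]] minus)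
    qed
    finally show "(\<Sum>j\<le>Suc p. ?s i j) = (?M i - ?M (Suc i)) + ((\<Sum>j<i. ?s i j) + (\<Sum>j=Suc i..p. ?s i (Suc j)))" by simp
  qed
  also have "\<dots> = (\<Sum>i\<le>p. ?M i - ?M (Suc i)) + (\<Sum>i\<le>p. (\<Sum>j<i. ?s i j) + (\<Sum>j=Suc i..p. ?s i (Suc j)))"
    by (simp add: sum.distrib)
  also have "(\<Sum>i\<le>p. ?M i - ?M (Suc i)) = Poly_Mapping.single g 1 - Poly_Mapping.single f 1"
    using sum_telescope[of ?M p] by (simp add: prism_slice_ends[OF ext])
  also have "(\<Sum>i\<le>p. (\<Sum>j<i. ?s i j) + (\<Sum>j=Suc i..p. ?s i (Suc j))) =
     - (if p = 0 then 0 else \<Sum>j\<le>p. chain_scale ((- 1) ^ j) (prism_chain (p - 1) (singular_face p j f) (singular_face p j g)))"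
  proof (cases p)
    case 0
    then show ?thesis by simp
  next
    case (Suc q)
    have low: "(\<Sum>j<Suc i. ?s (Suc i) j) = - (\<Sum>j\<le>i. ?S i j)" if "i \<le> q" for i
      unfolding sum_negf[symmetric] using that Suc
      by (intro sum.cong) (auto simp: prism_face_low minus)
    have high: "(\<Sum>j=Suc i..p. ?s i (Suc j)) = - (\<Sum>j=Suc i..p. ?S i j)" for i
      unfolding sum_negf[symmetric]
      by (intro sum.cong) (auto simp: prism_face_high minus)
    have "(\<Sum>i\<le>p. \<Sum>j<i. ?s i j) = (\<Sum>i\<le>q. \<Sum>j<Suc i. ?s (Suc i) j)"
      unfolding Suc by (subst sum.atMost_Suc_shift) simp
    also have "\<dots> = - (\<Sum>i\<le>q. \<Sum>j\<le>i. ?S i j)" using low by (simp add: sum_negf)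
    finally have 1: "(\<Sum>i\<le>p. \<Sum>j<i. ?s i j) = - (\<Sum>i\<le>q. \<Sum>j\<le>i. ?S i j)" .
    have 2: "(\<Sum>i\<le>p. \<Sum>j=Suc i..p. ?s i (Suc j)) = - (\<Sum>i\<le>q. \<Sum>j=Suc i..p. ?S i j)"
      unfolding high by (simp add: sum_negf Suc)
    have "(\<Sum>j\<le>i. ?S i j) + (\<Sum>j=Suc i..p. ?S i j) = (\<Sum>j\<le>p. ?S i j)" if "i \<le> q" for i
    proof -
      have "{..p} = {..i} \<union> {Suc i..p}" using that Suc by auto
      then show ?thesis by (simp add: sum.union_disjoint ivl_disj_int)
    qed
    then have "(\<Sum>i\<le>q. \<Sum>j\<le>i. ?S i j) + (\<Sum>i\<le>q. \<Sum>j=Suc i..p. ?S i j) = (\<Sum>i\<le>q. \<Sum>j\<le>p. ?S i j)"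
      by (simp flip: sum.distrib)
    also have "\<dots> = (\<Sum>j\<le>p. \<Sum>i\<le>q. ?S i j)" by (rule sum.swap)
    also have "\<dots> = (\<Sum>j\<le>p. chain_scale ((- 1) ^ j) (prism_chain (p - 1) (singular_face p j f) (singular_face p j g)))"
      by (simp add: prism_chain_def chain_scale_sum chain_scale_single Suc power_add mult.commute)
    finally have "- (\<Sum>i\<le>q. \<Sum>j\<le>i. ?S i j) + - (\<Sum>i\<le>q. \<Sum>j=Suc i..p. ?S i j) =
      - (\<Sum>j\<le>p. chain_scale ((- 1) ^ j) (prism_chain (p - 1) (singular_face p j f) (singular_face p j g)))"
      by (simp only: flip: minus_add_distrib)
    then show ?thesis unfolding sum.distrib 1 2 using Suc by (simp only: nat.distinct if_False)
  qed
  finally show ?thesis by (simp only: diff_conv_add_uminus)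
qed

lemma continuous_on_simplex_iff:
  "singular_simplex p (top_of_set S) f \<longleftrightarrow>
    continuous_on (standard_simplex p) f \<and> f ` standard_simplex p \<subseteq> S \<and> f \<in> extensional (standard_simplex p)"
  unfolding singular_simplex_def euclidean_product_topology
  by (auto simp: continuous_map_in_subtopology)

lemma singular_simplex_prism:
  fixes f g :: "(nat \<Rightarrow> real) \<Rightarrow> 'a::real_normed_vector"
  assumes "continuous_on (standard_simplex p) f" "continuous_on (standard_simplex p) g" "i \<le> p"
    and seg: "\<And>x. x \<in> standard_simplex p \<Longrightarrow> closed_segment (f x) (g x) \<subseteq> Y"
  shows "singular_simplex (Suc p) (top_of_set Y) (prism p i f g)"
  unfolding continuous_on_simplex_iff
proof (intro conjI)
  have c: "continuous_on (standard_simplex (Suc p)) (collapse i)"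
  proof (rule continuous_on_coordinatewise_then_product)
    fix j
    have "continuous_on (standard_simplex (Suc p)) (\<lambda>y::nat \<Rightarrow> real. y k)" for k
      by (rule continuous_on_subset[OF continuous_on_product_coordinates subset_UNIV])
    then show "continuous_on (standard_simplex (Suc p)) (\<lambda>y. collapse i y j)"
      unfolding collapse_def by (cases "j < i"; cases "j = i") (auto intro!: continuous_on_add)
  qed
  have c2: "collapse i ` standard_simplex (Suc p) \<subseteq> standard_simplex p" using collapse_in[OF assms(3)] by blast
  have "continuous_on (standard_simplex (Suc p)) (\<lambda>y. let t = (\<Sum>l\<in>{i<..Suc p}. y l) in
     (1 - t) *\<^sub>R f (collapse i y) + t *\<^sub>R g (collapse i y))"
    unfolding Let_def
    by (intro continuous_intros continuous_on_subset[OF continuous_on_product_coordinates subset_UNIV] continuous_on_compose2[OF assms(1) c c2] continuous_on_compose2[OF assms(2) c c2])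
  then show "continuous_on (standard_simplex (Suc p)) (prism p i f g)"
    unfolding prism_def by (subst continuous_on_cong[OF refl]) auto
  show "prism p i f g \<in> extensional (standard_simplex (Suc p))" by (simp add: prism_def)
  show "prism p i f g ` standard_simplex (Suc p) \<subseteq> Y"
  proof
    fix z assume "z \<in> prism p i f g ` standard_simplex (Suc p)"
    then obtain y where y: "y \<in> standard_simplex (Suc p)" "z = prism p i f g y" by blast
    have "0 \<le> (\<Sum>l\<in>{i<..Suc p}. y l)" "(\<Sum>l\<in>{i<..Suc p}. y l) \<le> 1"
      using partial_sum_01[OF y(1)] by (metis atMost_iff greaterThanAtMost_iff subsetI)+
    then have "z \<in> closed_segment (f (collapse i y)) (g (collapse i y))"
      using y by (auto simp: prism_def closed_segment_def Let_def)
    then show "z \<in> Y" using seg[OF collapse_in[OF assms(3) y(1)]] by blast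
  qed
qed

text \<open>Two transformations of simplices that commute with faces agree on homology if the images of
  every simplex are joined by segments inside \<open>Y\<close>.\<close>

lemma simplexwise_homotopy:
  fixes z :: "('b, 'k :: field) field_chain"
    and a b :: "nat \<Rightarrow> ((nat \<Rightarrow> real) \<Rightarrow> 'b) \<Rightarrow> (nat \<Rightarrow> real) \<Rightarrow> 'a::real_normed_vector"
  assumes z: "field_boundary k z = 0"
    and cont: "\<And>f. f \<in> Poly_Mapping.keys z \<Longrightarrow> continuous_on (standard_simplex k) (a k f) \<and> a k f \<in> extensional (standard_simplex k)"
      "\<And>f. f \<in> Poly_Mapping.keys z \<Longrightarrow> continuous_on (standard_simplex k) (b k f) \<and> b k f \<in> extensional (standard_simplex k)"
    and face: "\<And>f j. f \<in> Poly_Mapping.keys z \<Longrightarrow> j \<le> k \<Longrightarrow> 0 < k \<Longrightarrow> singular_face k j (a k f) = a (k - 1) (singular_face k j f)"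
      "\<And>f j. f \<in> Poly_Mapping.keys z \<Longrightarrow> j \<le> k \<Longrightarrow> 0 < k \<Longrightarrow> singular_face k j (b k f) = b (k - 1) (singular_face k j f)"
    and seg: "\<And>f x. f \<in> Poly_Mapping.keys z \<Longrightarrow> x \<in> standard_simplex k \<Longrightarrow> closed_segment (a k f x) (b k f x) \<subseteq> Y"
  shows "chain_extend (\<lambda>f. Poly_Mapping.single (b k f) 1) z - chain_extend (\<lambda>f. Poly_Mapping.single (a k f) 1) z
    \<in> boundaries k (top_of_set Y)"
proof -
  let ?P = "\<lambda>f. prism_chain k (a k f) (b k f) :: ('a, 'k) field_chain"
  let ?Q = "\<lambda>f. prism_chain (k - 1) (a (k - 1) f) (b (k - 1) f) :: ('a, 'k) field_chain"
  have gen: "field_boundary (Suc k) (?P f) = Poly_Mapping.single (b k f) 1 - Poly_Mapping.single (a k f) 1 -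
      chain_extend ?Q (field_boundary k (Poly_Mapping.single f 1))" if f: "f \<in> Poly_Mapping.keys z" for f
  proof (cases k)
    case 0
    have e: "a k f \<in> extensional (standard_simplex k)" "b k f \<in> extensional (standard_simplex k)" using cont f by auto
    show ?thesis unfolding boundary_prism_chain[OF e] using 0 by simp
  next
    case (Suc q)
    have e: "a k f \<in> extensional (standard_simplex k)" "b k f \<in> extensional (standard_simplex k)" using cont f by auto
    have "chain_extend ?Q (field_boundary k (Poly_Mapping.single f 1)) = (\<Sum>j\<le>k. chain_scale ((- 1) ^ j) (?Q (singular_face k j f)))"
      unfolding Suc field_boundary_single chain_extend_sum by simp
    also have "\<dots> = (\<Sum>j\<le>k. chain_scale ((- 1) ^ j) (prism_chain (k - 1) (singular_face k j (a k f)) (singular_face k j (b k f))))"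
      using face(1)[OF f] face(2)[OF f] Suc by (intro sum.cong) auto
    finally show ?thesis unfolding boundary_prism_chain[OF e] using Suc by simp
  qed
  have "field_boundary (Suc k) (chain_extend ?P z) = chain_extend (\<lambda>f. Poly_Mapping.single (b k f) 1 - Poly_Mapping.single (a k f) 1 -
      chain_extend ?Q (field_boundary k (Poly_Mapping.single f 1))) z"
    unfolding field_boundary_extend by (intro chain_extend_cong gen)
  also have "\<dots> = chain_extend (\<lambda>f. Poly_Mapping.single (b k f) 1) z - chain_extend (\<lambda>f. Poly_Mapping.single (a k f) 1) z -
      chain_extend ?Q (field_boundary k z)"
    unfolding chain_extend_fun_diff chain_extend_boundary[symmetric] by simp
  also have "\<dots> = chain_extend (\<lambda>f. Poly_Mapping.single (b k f) 1) z - chain_extend (\<lambda>f. Poly_Mapping.single (a k f) 1) z"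
    using z by simp
  finally have eq: "field_boundary (Suc k) (chain_extend ?P z) = chain_extend (\<lambda>f. Poly_Mapping.single (b k f) 1) z - chain_extend (\<lambda>f. Poly_Mapping.single (a k f) 1) z" .
  have "chain_extend ?P z \<in> field_chains (Suc k) (top_of_set Y)"
  proof (rule field_chains_extend)
    fix f assume f: "f \<in> Poly_Mapping.keys z"
    have "singular_simplex (Suc k) (top_of_set Y) (prism k i (a k f) (b k f))" if "i \<le> k" for i
      using cont(1)[OF f] cont(2)[OF f] that seg[OF f] by (intro singular_simplex_prism) simp_all
    then show "?P f \<in> field_chains (Suc k) (top_of_set Y)"
      unfolding prism_chain_def by (intro field_chains_sum field_chains_single) auto
  qed
  then show ?thesis unfolding boundaries_def eq[symmetric] by (rule imageI)
qed

lemma straight_line_homologous: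
  fixes g h :: "'b::topological_space \<Rightarrow> 'a::real_normed_vector"
  assumes z: "z \<in> cycles k (top_of_set X)" and g: "continuous_on X g" and h: "continuous_on X h"
    and seg: "\<And>x. x \<in> X \<Longrightarrow> closed_segment (g x) (h x) \<subseteq> Y"
  shows "push_chain k h z - push_chain k g z \<in> boundaries k (top_of_set Y)"
proof -
  have key: "continuous_on (standard_simplex k) f" "f ` standard_simplex k \<subseteq> X"
    if "f \<in> Poly_Mapping.keys z" for f
    using z that by (auto simp: cycles_def field_chains_def continuous_on_simplex_iff dest!: subsetD)
  have cont: "continuous_on (standard_simplex k) (simplex_map k g f)" if g: "continuous_on X g" and f: "f \<in> Poly_Mapping.keys z"
    for f and g :: "'b \<Rightarrow> 'a"
  proof -
    have "continuous_on (standard_simplex k) (\<lambda>x. g (f x))" using key[OF f] by (intro continuous_on_compose2[OF g])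
    then show ?thesis unfolding simplex_map_def by (subst continuous_on_cong[OF refl]) auto
  qed
  have face: "singular_face k j (simplex_map k g f) = simplex_map (k - 1) g (singular_face k j f)" if "j \<le> k" "0 < k" for j f and g :: "'b \<Rightarrow> 'a"
    using that by (intro singular_face_simplex_map') auto
  show ?thesis unfolding push_chain_def
  proof (rule simplexwise_homotopy[where a = "\<lambda>k f. simplex_map k g f" and b = "\<lambda>k f. simplex_map k h f"])
    show "field_boundary k z = 0" using z by (simp add: cycles_def)
    fix f assume f: "f \<in> Poly_Mapping.keys z"
    show "continuous_on (standard_simplex k) (simplex_map k g f) \<and> simplex_map k g f \<in> extensional (standard_simplex k)"
      "continuous_on (standard_simplex k) (simplex_map k h f) \<and> simplex_map k h f \<in> extensional (standard_simplex k)"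
      using cont[OF g f] cont[OF h f] by (simp_all add: simplex_map_def)
    show "singular_face k j (simplex_map k g f) = simplex_map (k - 1) g (singular_face k j f)"
      "singular_face k j (simplex_map k h f) = simplex_map (k - 1) h (singular_face k j f)" if "j \<le> k" "0 < k" for j
      by (rule face[OF that])+
    fix x assume "x \<in> standard_simplex k"
    then show "closed_segment (simplex_map k g f x) (simplex_map k h f x) \<subseteq> Y" using seg[of "f x"] key(2)[OF f] by (auto simp: simplex_map_def)
  qed
qed


subsection \<open>Finitely many classes survive in a neighbourhood\<close>

definition vertex :: "nat \<Rightarrow> nat \<Rightarrow> real" where
  "vertex i = (\<lambda>j. if j = i then 1 else 0)"

definition affine_simplex :: "nat \<Rightarrow> (nat \<Rightarrow> 'a::real_vector) \<Rightarrow> (nat \<Rightarrow> real) \<Rightarrow> 'a" where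
  "affine_simplex p v = restrict (\<lambda>x. \<Sum>i\<le>p. x i *\<^sub>R v i) (standard_simplex p)"

lemma singular_face_affine:
  fixes f :: "(nat \<Rightarrow> real) \<Rightarrow> 'b" and \<gamma> :: "'b \<Rightarrow> 'a::real_vector"
  assumes "j \<le> Suc p"
  shows "singular_face (Suc p) j (affine_simplex (Suc p) (\<lambda>i. \<gamma> (f (vertex i)))) =
    affine_simplex p (\<lambda>i. \<gamma> (singular_face (Suc p) j f (vertex i)))"
proof
  fix x
  show "singular_face (Suc p) j (affine_simplex (Suc p) (\<lambda>i. \<gamma> (f (vertex i)))) x =
    affine_simplex p (\<lambda>i. \<gamma> (singular_face (Suc p) j f (vertex i))) x"
  proof (cases "x \<in> standard_simplex p")
    case True
    have fx: "simplical_face j x \<in> standard_simplex (Suc p)"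
      using simplical_face_in_standard_simplex[of "Suc p" j x] True assms by simp
    let ?h = "\<lambda>i. \<gamma> (f (vertex i))"
    have v: "singular_face (Suc p) j f (vertex i) = f (vertex (if i < j then i else Suc i))" if "i \<le> p" for i
    proof -
      have "vertex i \<in> standard_simplex p" using that by (simp add: vertex_def)
      moreover have "simplical_face j (vertex i) = vertex (if i < j then i else Suc i)"
        by (auto simp: simplical_face_def vertex_def fun_eq_iff)
      ultimately show ?thesis by (simp add: singular_face_def)
    qed
    have "(\<Sum>i\<le>Suc p. simplical_face j x i *\<^sub>R ?h i) = (\<Sum>i\<in>{..Suc p} - {j}. simplical_face j x i *\<^sub>R ?h i)"
      by (rule sum.mono_neutral_right) (auto simp: simplical_face_def)
    also have "\<dots> = (\<Sum>i\<le>p. x i *\<^sub>R ?h (if i < j then i else Suc i))"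
    proof (rule sum.reindex_cong[of "\<lambda>i. if i < j then i else Suc i", symmetric, THEN sym])
      show "inj_on (\<lambda>i. if i < j then i else Suc i) {..p}" by (auto simp: inj_on_def split: if_splits)
      show "{..Suc p} - {j} = (\<lambda>i. if i < j then i else Suc i) ` {..p}"
      proof (intro equalityI subsetI)
        fix i assume i: "i \<in> {..Suc p} - {j}"
        show "i \<in> (\<lambda>i. if i < j then i else Suc i) ` {..p}"
        proof (cases "i < j")
          case True
          then show ?thesis using assms by (intro image_eqI[of _ _ i]) auto
        next
          case False
          then show ?thesis using i by (intro image_eqI[of _ _ "i - 1"]) auto
        qed
      qed (use assms in \<open>auto split: if_splits\<close>)
      show "simplical_face j x (if i < j then i else Suc i) *\<^sub>R ?h (if i < j then i else Suc i) = x i *\<^sub>R ?h (if i < j then i else Suc i)"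
        if "i \<in> {..p}" for i by (simp add: simplical_face_def)
    qed
    finally have "(\<Sum>i\<le>Suc p. simplical_face j x i *\<^sub>R ?h i) = (\<Sum>i\<le>p. x i *\<^sub>R ?h (if i < j then i else Suc i))" .
    moreover have "singular_face (Suc p) j (affine_simplex (Suc p) ?h) x = (\<Sum>i\<le>Suc p. simplical_face j x i *\<^sub>R ?h i)"
      unfolding singular_face_def affine_simplex_def using True fx by (simp del: sum.atMost_Suc)
    moreover have "affine_simplex p (\<lambda>i. ?h (if i < j then i else Suc i)) x = (\<Sum>i\<le>p. x i *\<^sub>R ?h (if i < j then i else Suc i))"
      unfolding affine_simplex_def using True by simp
    moreover have "affine_simplex p (\<lambda>i. \<gamma> (singular_face (Suc p) j f (vertex i))) x = affine_simplex p (\<lambda>i. ?h (if i < j then i else Suc i)) x"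
      unfolding affine_simplex_def using True v by (auto intro!: sum.cong)
    ultimately show ?thesis by simp
  qed (simp add: singular_face_def affine_simplex_def)
qed

lemma continuous_on_affine_simplex:
  fixes v :: "nat \<Rightarrow> 'a::real_normed_vector"
  shows "continuous_on (standard_simplex p) (affine_simplex p v)"
proof -
  have "continuous_on (standard_simplex p) (\<lambda>x. \<Sum>i\<le>p. x i *\<^sub>R v i)"
    by (intro continuous_intros continuous_on_subset[OF continuous_on_product_coordinates subset_UNIV])
  then show ?thesis unfolding affine_simplex_def by (subst continuous_on_cong[OF refl]) auto
qed

lemma dist_affine_simplex:
  fixes v :: "nat \<Rightarrow> 'a::real_normed_vector"
  assumes x: "x \<in> standard_simplex p" and d: "\<And>i. i \<le> p \<Longrightarrow> dist (v i) c \<le> d"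
  shows "dist (affine_simplex p v x) c \<le> d"
proof -
  have x': "\<And>i. 0 \<le> x i" "(\<Sum>i\<le>p. x i) = 1" using x by (auto simp: standard_simplex_def)
  have eq: "affine_simplex p v x - c = (\<Sum>i\<le>p. x i *\<^sub>R (v i - c))"
    using x x'(2) by (simp add: affine_simplex_def scaleR_diff_right sum_subtractf flip: scaleR_sum_left)
  have "dist (affine_simplex p v x) c \<le> (\<Sum>i\<le>p. norm (x i *\<^sub>R (v i - c)))"
    unfolding dist_norm eq by (rule norm_sum)
  also have "\<dots> \<le> (\<Sum>i\<le>p. x i * d)"
    using d x'(1) by (intro sum_mono) (auto simp: dist_norm mult_left_mono)
  also have "\<dots> = d" using x'(2) by (simp flip: sum_distrib_right)
  finally show ?thesis .
qed

lemma finitely_many_simplices_suffice: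
  fixes A :: "'a::euclidean_space set"
  assumes A: "compact A" and e: "0 < e"
  obtains F :: "((nat \<Rightarrow> real) \<Rightarrow> 'a) set" where "finite F"
    "\<And>z :: ('a, 'k :: field) field_chain. z \<in> cycles k (top_of_set A) \<Longrightarrow>
      \<exists>z'. z' \<in> cycles k (top_of_set (\<Union>p\<in>A. cball p e)) \<and> Poly_Mapping.keys z' \<subseteq> F \<and>
        z' - z \<in> boundaries k (top_of_set (\<Union>p\<in>A. cball p e))"
proof -
  define \<delta> where "\<delta> = e / 4"
  have \<delta>: "\<delta> > 0" using e by (simp add: \<delta>_def)
  let ?Y = "\<Union>p\<in>A. cball p e"
  obtain G where G: "finite G" "G \<subseteq> A" "A \<subseteq> (\<Union>x\<in>G. ball x \<delta>)"
    using compactE_image[OF A, of A "\<lambda>x. ball x \<delta>"] \<delta> by (metis UN_I centre_in_ball open_ball subsetI)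
  have "\<exists>g. y \<in> A \<longrightarrow> g \<in> G \<and> dist g y < \<delta>" for y
  proof (cases "y \<in> A")
    case True
    then obtain g where "g \<in> G" "y \<in> ball g \<delta>" using G(3) by blast
    then show ?thesis by (intro exI[of _ g]) (simp add: mem_ball)
  qed simp
  then obtain \<gamma> where \<gamma>: "\<And>y. y \<in> A \<Longrightarrow> \<gamma> y \<in> G \<and> dist (\<gamma> y) y < \<delta>" by metis
  define F where "F = affine_simplex k ` ({..k} \<rightarrow>\<^sub>E G)"
  define a where "a = (\<lambda>p f. affine_simplex p (\<lambda>i. \<gamma> (f (vertex i))))"
  show thesis
  proof (rule that[of F])
    show "finite F" unfolding F_def using G(1) by (intro finite_imageI finite_PiE) auto
    fix z :: "('a, 'k) field_chain" assume z: "z \<in> cycles k (top_of_set A)"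
    let ?C = "(\<lambda>x. A \<inter> ball x \<delta>) ` A"
    obtain z' where z': "z' \<in> cycles k (top_of_set A)" "z' - z \<in> boundaries k (top_of_set A)"
      "\<And>f. f \<in> Poly_Mapping.keys z' \<Longrightarrow> \<exists>V\<in>?C. f \<in> standard_simplex k \<rightarrow> V"
    proof (rule small_cycle_exists[OF z, of ?C])
      show "\<And>U. U \<in> ?C \<Longrightarrow> openin (top_of_set A) U" by auto
      show "topspace (top_of_set A) \<subseteq> \<Union>?C" using \<delta> by auto
    qed (rule that)
    have key: "continuous_on (standard_simplex k) f" "f ` standard_simplex k \<subseteq> A" "f \<in> extensional (standard_simplex k)"
      if "f \<in> Poly_Mapping.keys z'" for f
      using z'(1) that by (auto simp: cycles_def field_chains_def continuous_on_simplex_iff dest!: subsetD)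
    have close: "dist (a k f x) (f x) \<le> e" if f: "f \<in> Poly_Mapping.keys z'" and x: "x \<in> standard_simplex k" for f x
      unfolding a_def
    proof (rule dist_affine_simplex[OF x])
      fix i assume "i \<le> k"
      then have v: "vertex i \<in> standard_simplex k" by (simp add: vertex_def)
      obtain c where c: "f \<in> standard_simplex k \<rightarrow> ball c \<delta>" using z'(3)[OF f] by blast
      have "dist c (f (vertex i)) < \<delta>" "dist c (f x) < \<delta>" using c v x by auto
      moreover have "dist (\<gamma> (f (vertex i))) (f (vertex i)) < \<delta>" using \<gamma> key(2)[OF f] v by auto
      ultimately have "dist (\<gamma> (f (vertex i))) (f x) < \<delta> + \<delta> + \<delta>"
        by (smt (verit) dist_commute dist_triangle2 dist_triangle)
      then show "dist (\<gamma> (f (vertex i))) (f x) \<le> e" using \<delta>_def e by simp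
    qed
    let ?z = "chain_extend (\<lambda>f. Poly_Mapping.single (a k f) 1) z'"
    have hom: "?z - chain_extend (\<lambda>f. Poly_Mapping.single f 1) z' \<in> boundaries k (top_of_set ?Y)"
    proof (rule simplexwise_homotopy[where a = "\<lambda>k f. f" and b = a])
      show "field_boundary k z' = 0" using z'(1) by (simp add: cycles_def)
      fix f assume f: "f \<in> Poly_Mapping.keys z'"
      show "continuous_on (standard_simplex k) f \<and> f \<in> extensional (standard_simplex k)" using key[OF f] by simp
      show "continuous_on (standard_simplex k) (a k f) \<and> a k f \<in> extensional (standard_simplex k)"
        unfolding a_def using continuous_on_affine_simplex by (auto simp: affine_simplex_def)
      show "singular_face k j (a k f) = a (k - 1) (singular_face k j f)" if "j \<le> k" "0 < k" for j
        unfolding a_def using that singular_face_affine[of j "k - 1" \<gamma> f] by (cases k) auto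
      show "singular_face k j f = singular_face k j f" for j by (rule refl)
      fix x assume x: "x \<in> standard_simplex k"
      have "f x \<in> A" using key(2)[OF f] x by auto
      moreover have "closed_segment (f x) (a k f x) \<subseteq> cball (f x) e"
        using close[OF f x] e by (intro closed_segment_subset) (auto simp: dist_commute)
      ultimately show "closed_segment (f x) (a k f x) \<subseteq> ?Y" by blast
    qed
    have AY: "A \<subseteq> ?Y" using e by (auto intro!: bexI[of _ x for x])
    have "z' - z \<in> boundaries k (top_of_set ?Y)" using z'(2) boundaries_mono[OF AY] by blast
    from boundaries_closed(2)[OF hom[unfolded chain_extend_id] this]
    have bd: "?z - z \<in> boundaries k (top_of_set ?Y)" by simp
    moreover have "?z \<in> cycles k (top_of_set ?Y)"
      using cycles_closed(2)[OF subsetD[OF boundaries_subset_cycles bd] subsetD[OF cycles_mono[OF AY] z]] by simp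
    moreover have "Poly_Mapping.keys ?z \<subseteq> F"
    proof
      fix g assume "g \<in> Poly_Mapping.keys ?z"
      then obtain f where f: "f \<in> Poly_Mapping.keys z'" "g = a k f"
        using keys_chain_extend[of "\<lambda>f. Poly_Mapping.single (a k f) 1" z'] by (auto split: if_splits)
      let ?v = "restrict (\<lambda>i. \<gamma> (f (vertex i))) {..k}"
      have "vertex i \<in> standard_simplex k" if "i \<le> k" for i using that by (simp add: vertex_def)
      then have "?v \<in> {..k} \<rightarrow>\<^sub>E G" using \<gamma> key(2)[OF f(1)] by auto
      moreover have "g = affine_simplex k ?v" unfolding f(2) a_def affine_simplex_def
        by (intro restrict_ext sum.cong) auto
      ultimately show "g \<in> F" unfolding F_def by blast
    qed
    ultimately show "\<exists>z'. z' \<in> cycles k (top_of_set ?Y) \<and> Poly_Mapping.keys z' \<subseteq> F \<and> z' - z \<in> boundaries k (top_of_set ?Y)"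
      by blast
  qed
qed


section \<open>Deformation along descending directions\<close>

definition homology_iso :: "'k::field itself \<Rightarrow> nat \<Rightarrow> 'a::topological_space set \<Rightarrow> 'a set \<Rightarrow> bool" where
  "homology_iso _ k X Y \<longleftrightarrow>
    (\<forall>z :: ('a, 'k) field_chain. z \<in> cycles k (top_of_set Y) \<longrightarrow>
      (\<exists>z'\<in>cycles k (top_of_set X). z - z' \<in> boundaries k (top_of_set Y))) \<and>
    (\<forall>z :: ('a, 'k) field_chain. z \<in> cycles k (top_of_set X) \<longrightarrow>
      z \<in> boundaries k (top_of_set Y) \<longrightarrow> z \<in> boundaries k (top_of_set X))"

definition descent_map :: "'k::field itself \<Rightarrow> nat \<Rightarrow> ('a::euclidean_space \<Rightarrow> real) \<Rightarrow> real \<Rightarrow> ('a \<Rightarrow> 'a) \<Rightarrow> bool" where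
  "descent_map _ k F m T \<longleftrightarrow> continuous_on UNIV T \<and> (\<forall>y. F (T y) \<le> F y - m * dist (T y) y \<and> (F (T y) < F y \<or> T y = y)) \<and>
    (\<forall>c. \<forall>z :: ('a, 'k) field_chain. z \<in> cycles k (top_of_set {x. F x \<le> c}) \<longrightarrow>
      push_chain k T z - z \<in> boundaries k (top_of_set {x. F x \<le> c}))"

definition descends_locally :: "('a::euclidean_space \<Rightarrow> real) \<Rightarrow> real \<Rightarrow> 'a \<Rightarrow> bool" where
  "descends_locally F m x \<longleftrightarrow> (\<exists>w r k. norm w \<le> 1 \<and> 0 < r \<and> 0 < k \<and> m \<le> k \<and>
    (\<forall>y t. dist y x < r \<and> 0 \<le> t \<and> t < r \<longrightarrow> F (y + t *\<^sub>R w) \<le> F y - t * k))"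

lemma descent_map_id:
  fixes K :: "'k::field itself" and F :: "'a::euclidean_space \<Rightarrow> real"
  shows "descent_map K k F m (\<lambda>x. x)"
  unfolding descent_map_def
proof (intro conjI allI impI)
  fix c and z :: "('a, 'k) field_chain"
  assume "z \<in> cycles k (top_of_set {x. F x \<le> c})"
  then have "push_chain k (\<lambda>x. x) z = z" by (intro push_chain_ident) (auto simp: cycles_def)
  then show "push_chain k (\<lambda>x. x) z - z \<in> boundaries k (top_of_set {x. F x \<le> c})"
    by (simp add: boundaries_closed)
qed auto

lemma descent_map_mapsto: "descent_map K k F m T \<Longrightarrow> 0 \<le> m \<Longrightarrow> F y \<le> c \<Longrightarrow> F (T y) \<le> c"
  unfolding descent_map_def by (smt (verit) mult_nonneg_nonneg zero_le_dist)

lemma descent_map_continuous_map: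
  assumes T: "descent_map K k F m T" "0 \<le> m"
  shows "continuous_map (top_of_set {x. F x \<le> c}) (top_of_set {x. F x \<le> c}) T"
proof -
  have "continuous_on {x. F x \<le> c} T"
    using T(1) unfolding descent_map_def by (blast intro: continuous_on_subset)
  then show ?thesis using descent_map_mapsto[OF T] by (auto simp: continuous_map_in_subtopology)
qed

lemma descent_map_compose:
  fixes K :: "'k::field itself" and F :: "'a::euclidean_space \<Rightarrow> real"
  assumes S: "descent_map K k F m S" and T: "descent_map K k F m T" and m: "0 \<le> m"
  shows "descent_map K k F m (\<lambda>x. S (T x))"
  unfolding descent_map_def
proof (intro conjI allI impI)
  have c: "continuous_on UNIV S" "continuous_on UNIV T" using S T by (auto simp: descent_map_def)
  show "continuous_on UNIV (\<lambda>x. S (T x))"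
    by (rule continuous_on_compose2[OF c]) simp
  fix y
  have "F (S (T y)) \<le> F (T y) - m * dist (S (T y)) (T y)" "F (T y) \<le> F y - m * dist (T y) y"
    using S T by (auto simp: descent_map_def)
  moreover have "m * dist (S (T y)) y \<le> m * (dist (S (T y)) (T y) + dist (T y) y)"
    by (intro mult_left_mono dist_triangle m)
  ultimately show "F (S (T y)) \<le> F y - m * dist (S (T y)) y" by (simp add: distrib_left)
  have "F (S y) < F y \<or> S y = y" "F (S (T y)) < F (T y) \<or> S (T y) = T y" "F (T y) < F y \<or> T y = y"
    using S T by (auto simp: descent_map_def)
  then show "F (S (T y)) < F y \<or> S (T y) = y" by force
next
  fix c and z :: "('a, 'k) field_chain"
  assume z: "z \<in> cycles k (top_of_set {x. F x \<le> c})"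
  have z1: "push_chain k T z \<in> cycles k (top_of_set {x. F x \<le> c})"
    by (rule push_chain_cycle[OF descent_map_continuous_map[OF T m] z])
  have "push_chain k S (push_chain k T z) - push_chain k T z \<in> boundaries k (top_of_set {x. F x \<le> c})"
    using S z1 unfolding descent_map_def by blast
  moreover have "push_chain k T z - z \<in> boundaries k (top_of_set {x. F x \<le> c})"
    using T z unfolding descent_map_def by blast
  ultimately have "(push_chain k S (push_chain k T z) - push_chain k T z) + (push_chain k T z - z) \<in> boundaries k (top_of_set {x. F x \<le> c})"
    by (rule boundaries_closed(2))
  then show "push_chain k (\<lambda>x. S (T x)) z - z \<in> boundaries k (top_of_set {x. F x \<le> c})"
    by (simp add: push_chain_compose)
qed

lemma descent_map_bump:
  fixes K :: "'k::field itself" and F :: "'a::euclidean_space \<Rightarrow> real"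
  assumes x: "descends_locally F m x" and m: "0 \<le> m"
  shows "\<exists>r>0. \<exists>T. descent_map K k F m T \<and> (\<forall>y\<in>ball x r. F (T y) < F y)"
proof -
  obtain w r \<kappa> where w: "norm w \<le> 1" "0 < r" "0 < \<kappa>" "m \<le> \<kappa>"
    and F: "\<And>y t. dist y x < r \<Longrightarrow> 0 \<le> t \<Longrightarrow> t < r \<Longrightarrow> F (y + t *\<^sub>R w) \<le> F y - t * \<kappa>"
    using x unfolding descends_locally_def by blast
  define l where "l = (\<lambda>y. max 0 ((r - dist y x) / 2))"
  define T where "T = (\<lambda>y. y + l y *\<^sub>R w)"
  have l: "0 \<le> l y" "l y < r" for y using w(2) zero_le_dist[of y x] by (auto simp: l_def max_def field_simps intro: add_pos_nonneg)
  have out: "l y = 0" if "\<not> dist y x < r" for y using that by (simp add: l_def)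
  have down: "F (y + (u * l y) *\<^sub>R w) \<le> F y - (u * l y) * \<kappa>" if "0 \<le> u" "u \<le> 1" for u y
  proof (cases "dist y x < r")
    case True
    have "u * l y \<le> 1 * l y" by (intro mult_right_mono that l)
    then show ?thesis using F[OF True, of "u * l y"] l[of y] that by simp
  qed (simp add: out)
  have cT: "continuous_on UNIV T" unfolding T_def l_def by (intro continuous_intros) auto
  have "descent_map K k F m T" unfolding descent_map_def
  proof (intro conjI allI impI cT)
    fix y
    have "dist (T y) y \<le> l y" using l[of y] w(1) by (simp add: T_def dist_norm mult_left_le)
    then have "m * dist (T y) y \<le> \<kappa> * l y" using m w by (intro mult_mono l) auto
    then show "F (T y) \<le> F y - m * dist (T y) y" using down[of 1 y] by (simp add: T_def mult.commute)
    show "F (T y) < F y \<or> T y = y"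
    proof (cases "l y = 0")
      case False
      then have "0 < l y * \<kappa>" using l[of y] w by simp
      then show ?thesis using down[of 1 y] by (simp add: T_def)
    qed (simp add: T_def)
  next
    fix c and z :: "('a, 'k) field_chain"
    assume z: "z \<in> cycles k (top_of_set {x. F x \<le> c})"
    have "push_chain k T z - push_chain k (\<lambda>y. y) z \<in> boundaries k (top_of_set {x. F x \<le> c})"
    proof (rule straight_line_homologous[OF z])
      show "continuous_on {x. F x \<le> c} (\<lambda>y. y)" by simp
      show "continuous_on {x. F x \<le> c} T" by (rule continuous_on_subset[OF cT]) simp
      fix y assume y: "y \<in> {x. F x \<le> c}"
      show "closed_segment y (T y) \<subseteq> {x. F x \<le> c}"
      proof
        fix p assume "p \<in> closed_segment y (T y)"
        then obtain u where u: "0 \<le> u" "u \<le> 1" "p = (1 - u) *\<^sub>R y + u *\<^sub>R T y" unfolding closed_segment_def by blast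
        have p: "p = y + (u * l y) *\<^sub>R w" using u(3) by (simp add: T_def algebra_simps)
        have "0 \<le> (u * l y) * \<kappa>" using u l[of y] w by simp
        then show "p \<in> {x. F x \<le> c}" using down[OF u(1,2), of y] y p by simp
      qed
    qed
    moreover have "push_chain k (\<lambda>x. x) z = z" using z by (intro push_chain_ident) (auto simp: cycles_def)
    ultimately show "push_chain k T z - z \<in> boundaries k (top_of_set {x. F x \<le> c})" by simp
  qed
  moreover have "F (T y) < F y" if "y \<in> ball x r" for y
  proof -
    have "0 < l y" using that by (simp add: l_def dist_commute)
    then have "0 < l y * \<kappa>" using w by simp
    then show ?thesis using down[of 1 y] by (simp add: T_def)
  qed
  ultimately show ?thesis using w(2) by blast
qed

lemma descent_map_finite:
  assumes "finite I" and m: "0 \<le> m"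
    and "\<And>x. x \<in> I \<Longrightarrow> \<exists>T. descent_map K k F m T \<and> (\<forall>y\<in>U x. F (T y) < F y)"
  shows "\<exists>T. descent_map K k F m T \<and> (\<forall>y\<in>(\<Union>x\<in>I. U x). F (T y) < F y)"
  using assms(1,3)
proof (induction I)
  case empty
  show ?case by (intro exI[of _ "\<lambda>x. x"]) (simp add: descent_map_id)
next
  case (insert x I)
  obtain S where S: "descent_map K k F m S" "\<forall>y\<in>(\<Union>x\<in>I. U x). F (S y) < F y" using insert by blast
  obtain T where T: "descent_map K k F m T" "\<forall>y\<in>U x. F (T y) < F y" using insert.prems[of x] by blast
  have ST: "F (S (T y)) \<le> F (T y)" "F (T y) \<le> F y" for y
    using descent_map_mapsto[OF S(1) m, of "T y" "F (T y)"] descent_map_mapsto[OF T(1) m, of y "F y"] by simp_all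
  show ?case
  proof (intro exI conjI ballI)
    show "descent_map K k F m (\<lambda>y. S (T y))" by (rule descent_map_compose[OF S(1) T(1) m])
    fix y assume y: "y \<in> (\<Union>x\<in>insert x I. U x)"
    show "F (S (T y)) < F y"
    proof (cases "F (T y) < F y")
      case True
      then show ?thesis using ST(1)[of y] by simp
    next
      case False
      then have "y \<in> (\<Union>x\<in>I. U x)" "T y = y" using y T by (auto simp: descent_map_def)
      then show ?thesis using S(2) by (simp only: Ball_def)
    qed
  qed
qed

lemma descent_map_band:
  fixes K :: "'k::field itself" and F :: "'a::euclidean_space \<Rightarrow> real"
  assumes F: "continuous_on UNIV F" "compact {x. F x \<le> b}" and m: "0 \<le> m"
    and desc: "\<And>x. a \<le> F x \<Longrightarrow> F x \<le> b \<Longrightarrow> descends_locally F m x"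
  shows "\<exists>T. descent_map K k F m T \<and> (\<forall>y. F y \<le> b \<longrightarrow> F (T y) \<le> a)"
proof -
  let ?B = "{x. a \<le> F x \<and> F x \<le> b}"
  have "closed {x. a \<le> F x}" using closed_Collect_le[of "\<lambda>x. a" F] F(1) by simp
  then have K: "compact ?B" using compact_Int_closed[OF F(2) \<open>closed {x. a \<le> F x}\<close>] by (simp add: Int_def conj_commute)
  have "\<exists>r>0. \<exists>T. descent_map K k F m T \<and> (\<forall>y\<in>ball x r. F (T y) < F y)" if "x \<in> ?B" for x
    using descent_map_bump[OF desc m] that by blast
  then obtain r where r: "\<And>x. x \<in> ?B \<Longrightarrow> 0 < r x"
    "\<And>x. x \<in> ?B \<Longrightarrow> \<exists>T. descent_map K k F m T \<and> (\<forall>y\<in>ball x (r x). F (T y) < F y)" by (metis (no_types, lifting))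
  obtain I where I: "I \<subseteq> ?B" "finite I" "?B \<subseteq> (\<Union>x\<in>I. ball x (r x))"
  proof (rule compactE_image[OF K, of ?B "\<lambda>x. ball x (r x)"])
    show "?B \<subseteq> (\<Union>x\<in>?B. ball x (r x))" using r(1) by force
  qed auto
  obtain S where S: "descent_map K k F m S" "\<forall>y\<in>(\<Union>x\<in>I. ball x (r x)). F (S y) < F y"
    using descent_map_finite[OF I(2) m, of K k F "\<lambda>x. ball x (r x)"] r(2) I(1) by blast
  show ?thesis
  proof (cases "?B = {}")
    case True
    have "F y \<le> a" if "F y \<le> b" for y
    proof -
      have "\<not> (a \<le> F y \<and> F y \<le> b)" using True by blast
      then show ?thesis using that by linarith
    qed
    then show ?thesis using descent_map_id by (intro exI[of _ "\<lambda>x. x"]) simp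
  next
    case False
    have cS: "continuous_on UNIV S" using S(1) by (simp add: descent_map_def)
    have "continuous_on ?B (\<lambda>y. F y - F (S y))"
      by (intro continuous_on_diff continuous_on_subset[OF F(1)] continuous_on_subset[OF continuous_on_compose2[OF F(1) cS]]) auto
    from continuous_attains_inf[OF K False this] obtain y0 where y0: "y0 \<in> ?B" "\<And>y. y \<in> ?B \<Longrightarrow> F y0 - F (S y0) \<le> F y - F (S y)" by blast
    define c where "c = F y0 - F (S y0)"
    have c: "0 < c" using S(2) y0(1) I(3) unfolding c_def by (metis (no_types, lifting) diff_gt_0_iff_gt subsetD)
    have le: "F (S y) \<le> F y" for y using descent_map_mapsto[OF S(1) m, of y "F y"] by simp
    have "\<exists>T. descent_map K k F m T \<and> (\<forall>y. F y \<le> b \<longrightarrow> F (T y) \<le> max a (b - real n * c))" for n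
    proof (induction n)
      case 0
      show ?case by (intro exI[of _ "\<lambda>x. x"]) (auto simp: descent_map_id)
    next
      case (Suc n)
      then obtain T where T: "descent_map K k F m T" "\<And>y. F y \<le> b \<Longrightarrow> F (T y) \<le> max a (b - real n * c)" by blast
      show ?case
      proof (intro exI conjI allI impI)
        show "descent_map K k F m (\<lambda>y. S (T y))" by (rule descent_map_compose[OF S(1) T(1) m])
        fix y assume y: "F y \<le> b"
        show "F (S (T y)) \<le> max a (b - real (Suc n) * c)"
        proof (cases "a \<le> F (T y)")
          case True
          have "F (T y) \<le> b" using descent_map_mapsto[OF T(1) m y] .
          then have "c \<le> F (T y) - F (S (T y))" using y0(2)[of "T y"] True by (simp add: c_def)
          then show ?thesis using T(2)[OF y] le[of "T y"] by (simp add: algebra_simps max_def split: if_splits)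
        next
          case False
          then show ?thesis using le[of "T y"] by simp
        qed
      qed
    qed
    moreover obtain n where "b - a < real n * c" using reals_Archimedean3[OF c] by blast
    ultimately have "\<exists>T. descent_map K k F m T \<and> (\<forall>y. F y \<le> b \<longrightarrow> F (T y) \<le> max a (b - real n * c))" by blast
    then show ?thesis using \<open>b - a < real n * c\<close> by (simp add: max_def split: if_splits)
  qed
qed

lemma homology_iso_refl: "homology_iso K k X X"
  unfolding homology_iso_def by (auto intro!: bexI[of _ z for z] simp: boundaries_closed)

lemma homology_iso_trans:
  fixes K :: "'k::field itself" and X :: "'a::topological_space set"
  assumes XY: "homology_iso K k X Y" and YW: "homology_iso K k Y W" and sub: "X \<subseteq> Y" "Y \<subseteq> W"
  shows "homology_iso K k X W"
  unfolding homology_iso_def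
proof (intro conjI allI impI)
  fix z :: "('a, 'k) field_chain" assume z: "z \<in> cycles k (top_of_set W)"
  obtain z1 where z1: "z1 \<in> cycles k (top_of_set Y)" "z - z1 \<in> boundaries k (top_of_set W)"
    using YW z unfolding homology_iso_def by blast
  obtain z2 where z2: "z2 \<in> cycles k (top_of_set X)" "z1 - z2 \<in> boundaries k (top_of_set Y)"
    using XY z1 unfolding homology_iso_def by blast
  have "z1 - z2 \<in> boundaries k (top_of_set W)" using z2(2) boundaries_mono[OF sub(2)] by blast
  from boundaries_closed(2)[OF z1(2) this] show "\<exists>z'\<in>cycles k (top_of_set X). z - z' \<in> boundaries k (top_of_set W)"
    using z2(1) by (intro bexI[of _ z2]) simp_all
next
  fix z :: "('a, 'k) field_chain" assume z: "z \<in> cycles k (top_of_set X)" "z \<in> boundaries k (top_of_set W)"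
  have "z \<in> cycles k (top_of_set Y)" using z(1) cycles_mono[OF sub(1)] by blast
  then show "z \<in> boundaries k (top_of_set X)" using XY YW z unfolding homology_iso_def by blast
qed

lemma homology_iso_push:
  fixes K :: "'k::field itself" and X :: "'a::topological_space set"
  assumes T: "continuous_on Y T" "T ` Y \<subseteq> X"
    and Y: "\<And>z :: ('a, 'k) field_chain. z \<in> cycles k (top_of_set Y) \<Longrightarrow> push_chain k T z - z \<in> boundaries k (top_of_set Y)"
    and X: "\<And>z :: ('a, 'k) field_chain. z \<in> cycles k (top_of_set X) \<Longrightarrow> push_chain k T z - z \<in> boundaries k (top_of_set X)"
  shows "homology_iso K k X Y"
proof -
  have T': "continuous_map (top_of_set Y) (top_of_set X) T" using T by (auto simp: continuous_map_in_subtopology)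
  show ?thesis unfolding homology_iso_def
  proof (intro conjI allI impI)
    fix z :: "('a, 'k) field_chain" assume z: "z \<in> cycles k (top_of_set Y)"
    show "\<exists>z'\<in>cycles k (top_of_set X). z - z' \<in> boundaries k (top_of_set Y)"
      using push_chain_cycle[OF T' z] boundaries_minus[OF Y[OF z]] by (intro bexI[of _ "push_chain k T z"]) simp_all
  next
    fix z :: "('a, 'k) field_chain" assume z: "z \<in> cycles k (top_of_set X)" "z \<in> boundaries k (top_of_set Y)"
    have "push_chain k T z - (push_chain k T z - z) \<in> boundaries k (top_of_set X)"
      by (intro boundaries_diff push_chain_boundaries[OF T'] X z)
    then show "z \<in> boundaries k (top_of_set X)" by simp
  qed
qed

lemma homology_iso_band:
  fixes K :: "'k::field itself" and F :: "'a::euclidean_space \<Rightarrow> real"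
  assumes F: "continuous_on UNIV F" "compact {x. F x \<le> b}"
    and desc: "\<And>x. a \<le> F x \<Longrightarrow> F x \<le> b \<Longrightarrow> descends_locally F 0 x"
  shows "homology_iso K k {x. F x \<le> a} {x. F x \<le> b}"
proof -
  obtain T where T: "descent_map K k F 0 T" "\<forall>y. F y \<le> b \<longrightarrow> F (T y) \<le> a"
    using descent_map_band[OF F order.refl desc] by blast
  have "continuous_on UNIV T" using T(1) by (simp add: descent_map_def)
  then have "continuous_on {x. F x \<le> b} T" by (rule continuous_on_subset) simp
  then show ?thesis using T by (intro homology_iso_push[of _ T]) (auto simp: descent_map_def)
qed

lemma homology_iso_limit:
  fixes K :: "'k::field itself" and F :: "'a::euclidean_space \<Rightarrow> real"
  assumes F: "continuous_on UNIV F" "\<And>x. 0 \<le> F x" "compact {x. F x \<le> b}" "0 < b"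
    and desc: "\<And>x. 0 < F x \<Longrightarrow> F x \<le> b \<Longrightarrow> descends_locally F 1 x"
  shows "homology_iso K k {x. F x \<le> 0} {x. F x \<le> b}"
proof -
  let ?V = "\<lambda>c. {x. F x \<le> c}"
  have "\<exists>T. descent_map K k F 1 T \<and> (\<forall>y. F y \<le> b / 2 ^ n \<longrightarrow> F (T y) \<le> b / 2 ^ Suc n)" for n
  proof (rule descent_map_band[OF F(1)])
    have "b / 2 ^ n \<le> b" using F(4) by (simp add: divide_le_eq)
    then have "?V (b / 2 ^ n) = ?V b \<inter> ?V (b / 2 ^ n)" by auto
    moreover have "closed (?V (b / 2 ^ n))" using closed_Collect_le[OF F(1), of "\<lambda>x. b / 2 ^ n"] by simp
    ultimately show "compact (?V (b / 2 ^ n))" using compact_Int_closed[OF F(3)] by metis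
    fix x assume "b / 2 ^ Suc n \<le> F x" "F x \<le> b / 2 ^ n"
    moreover have "0 < b / 2 ^ Suc n" using F(4) by simp
    ultimately show "descends_locally F 1 x" using \<open>b / 2 ^ n \<le> b\<close> by (intro desc) linarith+
  qed simp
  then obtain T where T: "\<And>n. descent_map K k F 1 (T n)" "\<And>n y. F y \<le> b / 2 ^ n \<Longrightarrow> F (T n y) \<le> b / 2 ^ Suc n" by metis
  define R where "R = rec_nat (\<lambda>x. x) (\<lambda>n R x. T n (R x))"
  have R: "R 0 = (\<lambda>x. x)" "\<And>n. R (Suc n) = (\<lambda>x. T n (R n x))" by (simp_all add: R_def)
  have dR: "descent_map K k F 1 (R n)" for n
  proof (induction n)
    case 0
    show ?case unfolding R(1) by (rule descent_map_id)
  next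
    case (Suc n)
    show ?case unfolding R(2) by (rule descent_map_compose[OF T(1) Suc]) simp
  qed
  have FR: "F (R n y) \<le> b / 2 ^ n" if "F y \<le> b" for n y
    by (induction n) (use that T(2) R in auto)
  have step: "dist (R m y) (R n y) \<le> F (R n y) - F (R m y)" if "n \<le> m" for m n y
    using that
  proof (induction m rule: dec_induct)
    case base
    show ?case by simp
  next
    case (step m)
    have "F (R (Suc m) y) \<le> F (R m y) - 1 * dist (R (Suc m) y) (R m y)"
      unfolding R(2) using T(1)[of m] unfolding descent_map_def by blast
    then show ?case using step.IH dist_triangle[of "R (Suc m) y" "R n y" "R m y"] by simp
  qed
  have small: "dist (R m y) (R n y) \<le> b / 2 ^ n" if "F y \<le> b" "n \<le> m" for m n y
    using step[OF that(2), of y] FR[OF that(1), of n] F(2)[of "R m y"] by simp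
  have lim0: "(\<lambda>n. b / 2 ^ n) \<longlonglongrightarrow> 0" by real_asymp
  have cauchy: "Cauchy (\<lambda>n. R n y)" if "F y \<le> b" for y
  proof (rule CauchyI')
    fix e :: real assume e: "0 < e"
    obtain n where n: "b / 2 ^ n < e" using order_tendstoD(2)[OF lim0 e] by (auto simp: eventually_sequentially)
    show "\<exists>M. \<forall>m\<ge>M. \<forall>n>m. dist (R m y) (R n y) < e"
    proof (intro exI allI impI)
      fix m m' :: nat assume m: "n \<le> m" "m < m'"
      have "b / 2 ^ m \<le> b / 2 ^ n" using F(4) m by (intro divide_left_mono) simp_all
      then show "dist (R m y) (R m' y) < e" using small[OF that, of m m'] m n by (simp add: dist_commute)
    qed
  qed
  have "\<exists>l. (\<lambda>n. R n y) \<longlonglongrightarrow> l" if "F y \<le> b" for y using cauchy[OF that] by (simp add: Cauchy_convergent_iff convergent_def)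
  then obtain r where r: "\<And>y. F y \<le> b \<Longrightarrow> (\<lambda>n. R n y) \<longlonglongrightarrow> r y" by metis
  have rd: "dist (r y) (R n y) \<le> b / 2 ^ n" if "F y \<le> b" for y n
  proof (rule tendsto_upperbound)
    show "(\<lambda>m. dist (R m y) (R n y)) \<longlonglongrightarrow> dist (r y) (R n y)" by (intro tendsto_intros r that)
    show "\<forall>\<^sub>F m in sequentially. dist (R m y) (R n y) \<le> b / 2 ^ n"
      using small[OF that] by (auto simp: eventually_sequentially)
  qed simp
  have Fr: "F (r y) \<le> 0" if "F y \<le> b" for y
  proof (rule tendsto_le[OF _ lim0])
    have "isCont F (r y)" using F(1) by (simp add: continuous_on_eq_continuous_at)
    then show "(\<lambda>n. F (R n y)) \<longlonglongrightarrow> F (r y)" by (rule isCont_tendsto_compose[OF _ r[OF that]])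
    show "\<forall>\<^sub>F n in sequentially. F (R n y) \<le> b / 2 ^ n" using FR[OF that] by simp
  qed simp
  have rfix: "r y = y" if "F y \<le> 0" for y
  proof -
    have "R n y = y" for n
    proof -
      have "F (R n y) \<le> F y - 1 * dist (R n y) y" using dR[of n] unfolding descent_map_def by blast
      then have "dist (R n y) y \<le> 0" using F(2)[of "R n y"] that by linarith
      then show ?thesis by simp
    qed
    then have "(\<lambda>n. y) \<longlonglongrightarrow> r y" using r[of y] that F(4) by simp
    then show ?thesis by (simp add: LIMSEQ_const_iff)
  qed
  have cR: "continuous_on (?V b) (R n)" for n
    using dR[of n] unfolding descent_map_def by (blast intro: continuous_on_subset)
  have cr: "continuous_on (?V b) r"
  proof (rule uniform_limit_theorem)
    show "uniform_limit (?V b) R r sequentially"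
    proof (rule uniform_limitI)
      fix e :: real assume "0 < e"
      from order_tendstoD(2)[OF lim0 this] show "\<forall>\<^sub>F n in sequentially. \<forall>x\<in>?V b. dist (R n x) (r x) < e"
      proof eventually_elim
        case (elim n)
        then show ?case using rd[of _ n] by (force simp: dist_commute simp del: power_Suc)
      qed
    qed
  qed (use cR in auto)
  have "closed (?V 0)" using closed_Collect_le[OF F(1), of "\<lambda>x. 0"] by simp
  then have "compact (?V b \<inter> ?V 0)" by (rule compact_Int_closed[OF F(3)])
  moreover have "?V b \<inter> ?V 0 = ?V 0" using F(4) by auto
  ultimately have A: "compact (?V 0)" by simp
  have "open {x. F x < b}" using open_Collect_less[OF F(1), of "\<lambda>x. b"] by simp
  moreover have "?V 0 \<subseteq> {x. F x < b}" using F(4) by auto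
  ultimately obtain e where e: "0 < e" "(\<Union>x\<in>?V 0. ball x e) \<subseteq> {x. F x < b}"
    using compact_subset_open_imp_ball_epsilon_subset[OF A] by blast
  obtain n where n: "b / 2 ^ n < e" using order_tendstoD(2)[OF lim0 e(1)] by (auto simp: eventually_sequentially)
  show ?thesis
  proof (rule homology_iso_push[OF cr])
    show "r ` ?V b \<subseteq> ?V 0" using Fr by auto
    show "push_chain k r z - z \<in> boundaries k (top_of_set (?V 0))" if z: "z \<in> cycles k (top_of_set (?V 0))" for z :: "('a, 'k) field_chain"
    proof -
      have "push_chain k r z = z" using z rfix by (intro push_chain_ident) (auto simp: cycles_def)
      then show ?thesis by (simp add: boundaries_closed)
    qed
    show "push_chain k r z - z \<in> boundaries k (top_of_set (?V b))" if z: "z \<in> cycles k (top_of_set (?V b))" for z :: "('a, 'k) field_chain"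
    proof -
      have "push_chain k r z - push_chain k (R n) z \<in> boundaries k (top_of_set (?V b))"
      proof (rule straight_line_homologous[OF z cR cr])
        fix y assume "y \<in> ?V b"
        then have y: "F y \<le> b" by simp
        have "closed_segment (R n y) (r y) \<subseteq> ball (r y) e"
          using rd[OF y, of n] n e(1) by (intro closed_segment_subset) auto
        then show "closed_segment (R n y) (r y) \<subseteq> ?V b" using Fr[OF y] e(2) by fastforce
      qed
      moreover have "push_chain k (R n) z - z \<in> boundaries k (top_of_set (?V b))"
        using dR[of n] z unfolding descent_map_def by blast
      ultimately have "(push_chain k r z - push_chain k (R n) z) + (push_chain k (R n) z - z) \<in> boundaries k (top_of_set (?V b))"
        by (rule boundaries_closed(2))
      then show ?thesis by simp
    qed
  qed
qed

definition thicken :: "'a::euclidean_space set \<Rightarrow> real \<Rightarrow> 'a set" where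
  "thicken A e = (\<Union>p\<in>A. cball p e)"

definition critical_free :: "'a::euclidean_space set \<Rightarrow> real \<Rightarrow> bool" where
  "critical_free A e \<longleftrightarrow> (\<forall>x. 0 < infdist x A \<and> infdist x A < e \<longrightarrow> (\<exists>c>0. descends A x c))"

lemma thicken_eq_infdist:
  assumes "compact A" "A \<noteq> {}"
  shows "thicken A e = {x. infdist x A \<le> e}"
proof (intro equalityI subsetI CollectI)
  fix x assume "x \<in> thicken A e"
  then obtain p where "p \<in> A" "dist x p \<le> e" by (auto simp: thicken_def dist_commute)
  then show "infdist x A \<le> e" using infdist_le[of p A x] by linarith
next
  fix x assume "x \<in> {x. infdist x A \<le> e}"
  moreover obtain p where "p \<in> A" "dist x p = infdist x A" using nearest_point[OF assms, of x] by auto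
  ultimately show "x \<in> thicken A e" unfolding thicken_def by (intro UN_I[of p]) (simp_all add: dist_commute)
qed

lemma thicken_0 [simp]: "thicken A 0 = A"
  by (simp add: thicken_def)

lemma thicken_subset: "A \<subseteq> B \<Longrightarrow> d \<le> e \<Longrightarrow> thicken A d \<subseteq> thicken B e"
  by (force simp: thicken_def)

lemma subset_thicken: "0 \<le> e \<Longrightarrow> A \<subseteq> thicken A e"
  using thicken_subset[of A A 0 e] by simp

lemma thicken_thicken: "thicken (thicken A d) e \<subseteq> thicken A (d + e)"
proof
  fix x assume "x \<in> thicken (thicken A d) e"
  then obtain p q where pq: "p \<in> A" "dist p q \<le> d" "dist q x \<le> e" by (auto simp: thicken_def)
  then have "dist p x \<le> d + e" using dist_triangle[of p x q] by linarith
  then show "x \<in> thicken A (d + e)" using pq(1) by (auto simp: thicken_def)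
qed

lemma critical_free_mono: "critical_free A e \<Longrightarrow> d \<le> e \<Longrightarrow> critical_free A d"
  unfolding critical_free_def by (meson less_le_trans)

lemma descends_locally_infdist:
  assumes A: "compact A" "A \<noteq> {}" and x: "0 < infdist x A" and d: "descends A x c" "0 < c"
  shows "descends_locally (\<lambda>x. infdist x A) 0 x"
proof -
  obtain w where w: "norm w \<le> 1" "\<And>p. p \<in> A \<Longrightarrow> dist x p = infdist x A \<Longrightarrow> w \<bullet> (x - p) \<le> - c"
    using d(1) unfolding descends_def by blast
  have "0 < c / infdist x A" using x d(2) by simp
  from dense[OF this] obtain k where k: "0 < k" "k < c / infdist x A" by blast
  obtain r where "0 < r" "\<forall>y t. dist y x < r \<and> 0 \<le> t \<and> t < r \<longrightarrow> infdist (y + t *\<^sub>R w) A \<le> infdist y A - t * k"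
    using infdist_descent[OF A refl x w k(2)] by blast
  then show ?thesis unfolding descends_locally_def using w(1) k(1) less_imp_le by blast
qed

lemma homology_iso_thicken:
  fixes K :: "'k::field itself"
  assumes A: "compact A" and cf: "critical_free A e" and s: "0 < s" "s \<le> t" "t < e"
  shows "homology_iso K k (thicken A s) (thicken A t)"
proof (cases "A = {}")
  case True
  then show ?thesis by (simp add: thicken_def homology_iso_refl)
next
  case False
  show ?thesis unfolding thicken_eq_infdist[OF A False]
  proof (rule homology_iso_band)
    show "continuous_on UNIV (\<lambda>x. infdist x A)" by (intro continuous_intros)
    show "compact {x. infdist x A \<le> t}" by (rule compact_infdist_level[OF A False])
    fix x assume x: "s \<le> infdist x A" "infdist x A \<le> t"
    then have "\<exists>c>0. descends A x c" using cf s unfolding critical_free_def by (meson le_less_trans less_le_trans)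
    then show "descends_locally (\<lambda>x. infdist x A) 0 x" using descends_locally_infdist[OF A False] x(1) s(1) by (meson less_le_trans)
  qed
qed

lemma descends_locally_reparametrised:
  fixes l l' :: "real \<Rightarrow> real" and A :: "'a::euclidean_space set"
  assumes A: "compact A" "A \<noteq> {}" and x: "infdist x A = s" "0 < s" "s < e"
    and l: "\<And>s. 0 < s \<Longrightarrow> s < e \<Longrightarrow> (l has_real_derivative l' s) (at s) \<and> isCont l' s \<and> 1 \<le> l' s"
    and d: "descends A x (3 / 4 * (s / l' s))"
    and F: "\<And>y. 0 < infdist y A \<Longrightarrow> infdist y A < e \<Longrightarrow> F y = 2 * l (infdist y A)"
  shows "descends_locally F 1 x"
proof -
  have l's: "1 \<le> l' s" using l x by blast
  obtain w where w: "norm w \<le> 1" "\<And>p. p \<in> A \<Longrightarrow> dist x p = infdist x A \<Longrightarrow> w \<bullet> (x - p) \<le> - (3 / 4 * (s / l' s))"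
    using d unfolding descends_def by blast
  define k where "k = 5 / 8 / l' s"
  have k: "0 < k" "k < 3 / 4 * (s / l' s) / s" using x l's by (simp_all add: k_def field_simps)
  obtain r1 where r1: "0 < r1" "\<And>y t. dist y x < r1 \<Longrightarrow> 0 \<le> t \<Longrightarrow> t < r1 \<Longrightarrow> infdist (y + t *\<^sub>R w) A \<le> infdist y A - t * k"
    using infdist_descent[OF A x(1,2) w k(2)] by blast
  have "(l' \<longlongrightarrow> l' s) (nhds s)" using l x by (simp add: isCont_def tendsto_at_iff_tendsto_nhds)
  from order_tendstoD(1)[OF this, of "4 / 5 * l' s"] have "\<forall>\<^sub>F u in nhds s. 4 / 5 * l' s < l' u" using l's by simp
  then obtain r2 where r2: "0 < r2" "\<And>u. \<bar>u - s\<bar> < r2 \<Longrightarrow> 4 / 5 * l' s < l' u"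
    unfolding eventually_nhds_metric by (auto simp: dist_real_def)
  define r where "r = Min {r1, r2 / 2, s / 2, (e - s) / 2}"
  have r: "0 < r" "r \<le> r1" "r \<le> r2 / 2" "r \<le> s / 2" "r \<le> (e - s) / 2"
    using r1(1) r2(1) x(2,3) unfolding r_def by (simp, (intro Min_le; simp)+)
  have "F (y + t *\<^sub>R w) \<le> F y - t * 1" if y: "dist y x < r" "0 \<le> t" "t < r" for y t
  proof -
    let ?a = "infdist (y + t *\<^sub>R w) A" and ?b = "infdist y A"
    have ab: "?a \<le> ?b - t * k" using r1(2) y r(2) by simp
    have "dist (y + t *\<^sub>R w) y \<le> t" using y w(1) by (simp add: dist_norm mult_left_le)
    then have "dist (y + t *\<^sub>R w) x < 2 * r" using y dist_triangle[of "y + t *\<^sub>R w" x y] by linarith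
    then have near: "\<bar>?a - s\<bar> < 2 * r" "\<bar>?b - s\<bar> < 2 * r"
      using infdist_triangle_abs[of "y + t *\<^sub>R w" A x] infdist_triangle_abs[of y A x] y x(1) by linarith+
    have "2 * r \<le> s" "2 * r \<le> e - s" using r(4,5) by auto
    then have in_e: "0 < ?a" "?a < e" "0 < ?b" "?b < e" using near unfolding abs_less_iff by linarith+
    have "l ?b - l ?a \<ge> 4 / 5 * l' s * (?b - ?a)"
    proof (cases "?a = ?b")
      case False
      then have lt: "?a < ?b" using ab k(1) y(2) by (smt (verit) mult_nonneg_nonneg)
      obtain u where u: "?a < u" "u < ?b" "l ?b - l ?a = (?b - ?a) * l' u"
      proof (rule exE[OF MVT2[OF lt, of l l']])
        show "(l has_real_derivative l' u) (at u)" if "?a \<le> u" "u \<le> ?b" for u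
          using l[of u] that in_e by simp
      qed (blast intro: that)
      have "4 / 5 * l' s < l' u" using u near r(3) by (intro r2(2)) linarith
      then show ?thesis using u(3) lt by (simp add: mult.commute)
    qed simp
    moreover have "4 / 5 * l' s * (t * k) \<le> 4 / 5 * l' s * (?b - ?a)" using ab l's by (intro mult_left_mono) auto
    moreover have "4 / 5 * l' s * (t * k) = t / 2" using l's by (simp add: k_def)
    ultimately have "t / 2 \<le> l ?b - l ?a" by linarith
    then show ?thesis using F[OF in_e(1,2)] F[OF in_e(3,4)] by simp
  qed
  then show ?thesis unfolding descends_locally_def using w(1) r(1) by (intro exI[of _ w] exI[of _ r] exI[of _ 1]) auto
qed

context o_minimal_structure
begin

lemma distance_deformation:
  fixes A :: "'a::euclidean_space set" and K :: "'k::field itself"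
  assumes A: "definable (\<lambda>x. x \<in> A)" "compact A"
  shows "\<exists>e>0. critical_free A e \<and> (\<forall>s. 0 < s \<and> s < e \<longrightarrow> homology_iso K k A (thicken A s))"
proof (cases "A = {}")
  case True
  then show ?thesis by (intro exI[of _ 1]) (simp add: thicken_def homology_iso_refl critical_free_def infdist_def)
next
  case ne: False
  obtain e l l' where e: "0 < e"
    and l: "\<And>s. 0 < s \<Longrightarrow> s < e \<Longrightarrow> (l has_real_derivative l' s) (at s) \<and> isCont l' s \<and> 1 \<le> l' s"
    and l0: "(l \<longlongrightarrow> 0) (at_right 0)"
    and desc: "\<And>y s c. 0 < s \<Longrightarrow> s < e \<Longrightarrow> infdist y A = s \<Longrightarrow> c < s / l' s \<Longrightarrow> descends A y c"
    using distance_KL[OF A ne] by metis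
  have desc': "descends A y (3 / 4 * (s / l' s))" "0 < 3 / 4 * (s / l' s)" if "0 < s" "s < e" "infdist y A = s" for y s
  proof -
    have "0 < s / l' s" using l[OF that(1,2)] that(1) by simp
    then show "descends A y (3 / 4 * (s / l' s))" "0 < 3 / 4 * (s / l' s)" by (intro desc[OF that] | simp)+
  qed
  have cf: "critical_free A e" unfolding critical_free_def using desc' by blast
  have mono: "l s < l t" if "0 < s" "s < t" "t < e" for s t
  proof (rule DERIV_pos_imp_increasing[OF that(2)])
    fix u assume "s \<le> u" "u \<le> t"
    then have "(l has_real_derivative l' u) (at u)" "1 \<le> l' u" using l[of u] that by auto
    then show "\<exists>d. (l has_real_derivative d) (at u) \<and> 0 < d" by (intro exI[of _ "l' u"]) simp
  qed
  have pos: "0 < l s" if "0 < s" "s < e" for s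
  proof -
    have "0 \<le> l (s / 2)"
    proof (rule tendsto_upperbound[OF l0])
      show "\<forall>\<^sub>F u in at_right 0. l u \<le> l (s / 2)"
        using that by (intro eventually_at_rightI[of 0 "s / 2"]) (auto intro!: less_imp_le mono)
    qed simp
    then show ?thesis using mono[of "s / 2" s] that by simp
  qed
  have "homology_iso K k A (thicken A s)" if s: "0 < s" "s < e" for s
  proof -
    define s2 where "s2 = (s + e) / 2"
    have s2: "s < s2" "s2 < e" using s by (simp_all add: s2_def)
    define L where "L = (\<lambda>u. if u \<le> 0 then 0 else l (min u s2))"
    define F where "F = (\<lambda>x. 2 * L (infdist x A))"
    have cL: "isCont L u" for u
    proof -
      consider "u < 0" | "u = 0" | "0 < u" by linarith
      then show ?thesis
      proof cases
        case 1
        have "\<forall>\<^sub>F v in nhds u. L v = 0"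
          using eventually_nhds_in_open[of "{..<0}" u] 1 by (auto simp: L_def elim!: eventually_mono)
        then have "isCont L u = isCont (\<lambda>v. 0 :: real) u" by (rule isCont_cong)
        then show ?thesis by simp
      next
        case 2
        have "\<forall>\<^sub>F v in at_right 0. l v = L v"
          using s2 s by (intro eventually_at_rightI[of 0 s2]) (auto simp: L_def)
        then have "(L \<longlongrightarrow> 0) (at_right 0)" using l0 by (simp add: tendsto_cong)
        moreover have "\<forall>\<^sub>F v in at_left 0. L v = 0"
          by (intro eventually_at_leftI[of "-1"]) (auto simp: L_def)
        then have "(L \<longlongrightarrow> 0) (at_left 0)" by (rule tendsto_eventually)
        ultimately have "(L \<longlongrightarrow> 0) (at 0)" by (simp add: filterlim_at_split)
        then show ?thesis unfolding 2 isCont_def by (simp add: L_def)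
      next
        case 3
        have ev: "\<forall>\<^sub>F v in nhds u. L v = l (min v s2)"
          using eventually_nhds_in_open[of "{0<..}" u] 3 by (auto simp: L_def elim!: eventually_mono)
        have "isCont l (min u s2)" using l[of "min u s2"] 3 s s2 by (auto intro: DERIV_isCont simp: min_def)
        moreover have "isCont (\<lambda>v. min v s2) u" by (intro continuous_intros)
        ultimately have "isCont (\<lambda>v. l (min v s2)) u" by (rule isCont_o2[rotated])
        then show ?thesis using isCont_cong[OF ev] by simp
      qed
    qed
    have "continuous_on UNIV L" using cL by (simp add: continuous_at_imp_continuous_on)
    from continuous_on_compose2[OF this continuous_on_infdist[OF continuous_on_id]]
    have cF: "continuous_on UNIV F" unfolding F_def by (intro continuous_on_mult_left) simp
    have Lpos: "0 < L u" if "0 < u" for u using that s s2 by (auto simp: L_def min_def intro: pos)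
    have F0: "F x \<le> 0 \<longleftrightarrow> infdist x A \<le> 0" for x
    proof (cases "infdist x A \<le> 0")
      case False
      then show ?thesis using Lpos[of "infdist x A"] by (simp add: F_def)
    qed (simp add: F_def L_def)
    have Fs: "F x \<le> 2 * l s \<longleftrightarrow> infdist x A \<le> s" for x
    proof
      assume le: "F x \<le> 2 * l s"
      show "infdist x A \<le> s"
      proof (rule ccontr)
        assume "\<not> infdist x A \<le> s"
        then have "l s < L (infdist x A)" using mono[of s "min (infdist x A) s2"] s s2 by (auto simp: L_def)
        then show False using le by (simp add: F_def)
      qed
    next
      assume "infdist x A \<le> s"
      moreover have "infdist x A < s \<Longrightarrow> 0 < infdist x A \<Longrightarrow> l (infdist x A) < l s" using mono s by blast
      ultimately show "F x \<le> 2 * l s" using pos[OF s] s s2 by (auto simp: F_def L_def le_less)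
    qed
    have "homology_iso K k {x. F x \<le> 0} {x. F x \<le> 2 * l s}"
    proof (rule homology_iso_limit[OF cF])
      show "0 \<le> F x" for x using Lpos[of "infdist x A"] infdist_nonneg[of x A] by (auto simp: F_def L_def le_less)
      show "compact {x. F x \<le> 2 * l s}" unfolding Fs by (rule compact_infdist_level[OF A(2) ne])
      show "0 < 2 * l s" using pos[OF s] by simp
      fix x assume x: "0 < F x" "F x \<le> 2 * l s"
      then have i: "0 < infdist x A" "infdist x A \<le> s" using Fs[of x] F0[of x] by auto
      show "descends_locally F 1 x"
      proof (rule descends_locally_reparametrised[OF A(2) ne refl i(1)])
        show "infdist x A < s2" using i s2 by simp
        show "(l has_real_derivative l' u) (at u) \<and> isCont l' u \<and> 1 \<le> l' u" if "0 < u" "u < s2" for u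
          using l that s2 by simp
        show "descends A x (3 / 4 * (infdist x A / l' (infdist x A)))" using i s by (intro desc') auto
        show "F y = 2 * l (infdist y A)" if "0 < infdist y A" "infdist y A < s2" for y
          using that by (simp add: F_def L_def)
      qed
    qed
    then show ?thesis unfolding Fs F0 using thicken_eq_infdist[OF A(2) ne] thicken_0[of A] by metis
  qed
  then show ?thesis using e cf by blast
qed

lemma homology_iso_thicken_0:
  fixes A :: "'a::euclidean_space set" and K :: "'k::field itself"
  assumes A: "definable (\<lambda>x. x \<in> A)" "compact A" and cf: "critical_free A e" and s: "0 \<le> s" "s \<le> t" "t < e"
  shows "homology_iso K k (thicken A s) (thicken A t)"
proof (cases "0 < s")
  case True
  then show ?thesis using homology_iso_thicken[OF A(2) cf] s by blast
next
  case False
  then have s0: "s = 0" using s by simp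
  show ?thesis
  proof (cases "t = 0")
    case False
    then have t: "0 < t" using s by simp
    obtain d where d: "0 < d" "\<And>u. 0 < u \<Longrightarrow> u < d \<Longrightarrow> homology_iso K k A (thicken A u)"
      using distance_deformation[OF A, of K k] by blast
    define u where "u = min (d / 2) t"
    have u: "0 < u" "u < d" "u \<le> t" using d t by (auto simp: u_def)
    have "homology_iso K k A (thicken A t)"
    proof (rule homology_iso_trans[OF d(2)[OF u(1,2)] homology_iso_thicken[OF A(2) cf u(1,3) s(3)]])
      show "A \<subseteq> thicken A u" by (rule subset_thicken) (use u in simp)
      show "thicken A u \<subseteq> thicken A t" by (rule thicken_subset) (use u in simp_all)
    qed
    then show ?thesis by (simp add: s0)
  qed (simp add: s0 homology_iso_refl)
qed

lemma critical_free_exists: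
  assumes "definable (\<lambda>x. x \<in> A)" "compact A"
  shows "\<exists>e>0. critical_free A e"
  using distance_deformation[OF assms, of "TYPE(real)" 0] by blast

end


section \<open>One-parameter families of compact sets\<close>

definition hausdorff_continuous_at :: "(real \<Rightarrow> 'a::euclidean_space set) \<Rightarrow> real \<Rightarrow> bool" where
  "hausdorff_continuous_at A t \<longleftrightarrow> (\<forall>e. 0 < e \<longrightarrow> (\<exists>d. 0 < d \<and> (\<forall>u. dist u t < d \<longrightarrow>
     A u \<subseteq> thicken (A t) e \<and> A t \<subseteq> thicken (A u) e)))"

definition uniformly_critical_free_at :: "(real \<Rightarrow> 'a::euclidean_space set) \<Rightarrow> real \<Rightarrow> bool" where
  "uniformly_critical_free_at A t \<longleftrightarrow> (\<exists>e d. 0 < e \<and> 0 < d \<and> (\<forall>u. dist u t < d \<longrightarrow> critical_free (A u) e))"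

definition regular_value :: "(real \<Rightarrow> 'a::euclidean_space set) \<Rightarrow> real \<Rightarrow> bool" where
  "regular_value A t \<longleftrightarrow> hausdorff_continuous_at A t \<and> uniformly_critical_free_at A t"

lemma mem_thicken: "x \<in> thicken A e \<longleftrightarrow> (\<exists>p. p \<in> A \<and> dist p x \<le> e)"
  by (auto simp: thicken_def)

lemma critical_free_iff:
  assumes "compact A"
  shows "critical_free A e \<longleftrightarrow> (\<forall>x s. 0 < s \<and> s < e \<and> (\<exists>p. p \<in> A \<and> dist x p = s) \<and> (\<forall>p. p \<in> A \<longrightarrow> s \<le> dist x p) \<longrightarrow>
    (\<exists>c w. 0 < c \<and> norm w \<le> 1 \<and> (\<forall>p. p \<in> A \<longrightarrow> dist x p = s \<longrightarrow> w \<bullet> (x - p) \<le> - c)))"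
proof (cases "A = {}")
  case True
  then show ?thesis by (simp add: critical_free_def infdist_def)
next
  case False
  show ?thesis unfolding infdist_eq_iff[OF assms False, symmetric] critical_free_def descends_def Ball_def
    by auto
qed

lemma homology_iso_interleaved:
  fixes K :: "'k::field itself" and X :: "'a::topological_space set"
  assumes XQ: "homology_iso K k X Q" and PR: "homology_iso K k P R" and sub: "X \<subseteq> P" "P \<subseteq> Q" "Q \<subseteq> R"
  shows "homology_iso K k X P"
  unfolding homology_iso_def
proof (intro conjI allI impI)
  fix z :: "('a, 'k) field_chain" assume z: "z \<in> cycles k (top_of_set P)"
  have "z \<in> cycles k (top_of_set Q)" using z cycles_mono[OF sub(2)] by blast
  then obtain z' where z': "z' \<in> cycles k (top_of_set X)" "z - z' \<in> boundaries k (top_of_set Q)"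
    using XQ unfolding homology_iso_def by blast
  have "z - z' \<in> boundaries k (top_of_set R)" using z'(2) boundaries_mono[OF sub(3)] by blast
  moreover have "z - z' \<in> cycles k (top_of_set P)" using z z'(1) cycles_mono[OF sub(1)] by (blast intro: cycles_diff)
  ultimately show "\<exists>z'\<in>cycles k (top_of_set X). z - z' \<in> boundaries k (top_of_set P)"
    using PR z'(1) unfolding homology_iso_def by blast
next
  fix z :: "('a, 'k) field_chain" assume z: "z \<in> cycles k (top_of_set X)" "z \<in> boundaries k (top_of_set P)"
  then show "z \<in> boundaries k (top_of_set X)" using XQ boundaries_mono[OF sub(2)] unfolding homology_iso_def by blast
qed

lemma homology_iso_cancel:
  fixes K :: "'k::field itself" and X :: "'a::topological_space set"
  assumes "homology_iso K k X W" "homology_iso K k Y W" "X \<subseteq> Y" "Y \<subseteq> W"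
  shows "homology_iso K k X Y"
  using homology_iso_interleaved[OF assms(1,2,3,4)] by simp

context o_minimal_structure
begin

lemma definable_cofinite_locally_constant:
  assumes P: "definable (P :: real \<Rightarrow> bool)"
  shows "finite {t. \<not> (\<exists>d. 0 < d \<and> (\<forall>u. dist u t < d \<longrightarrow> P u = P t))}"
proof (rule definable_dense_cofinite)
  show "definable (\<lambda>t. \<exists>d. 0 < d \<and> (\<forall>u. dist u t < d \<longrightarrow> P u = P t))"
    by (intro definable_intros definable_compose[OF P])
  fix a b :: real assume ab: "a < b"
  have "\<exists>c>a. (\<forall>u. a < u \<and> u < c \<longrightarrow> P u) \<or> (\<forall>u. a < u \<and> u < c \<longrightarrow> \<not> P u)"
    using definable_eventually_right[OF P, of a] by (auto simp: eventually_at_right_field)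
  then obtain c where c: "a < c" "\<And>u v. a < u \<Longrightarrow> u < c \<Longrightarrow> a < v \<Longrightarrow> v < c \<Longrightarrow> P u = P v" by metis
  define t where "t = (a + min b c) / 2"
  define d where "d = (min b c - a) / 2"
  have t: "a < t" "t < b" "t < c" and d: "0 < d" "t - d = a" "t + d \<le> c" using ab c(1) by (auto simp: t_def d_def min_def field_simps)
  have "P u = P t" if "dist u t < d" for u using that t d by (intro c(2)) (auto simp: dist_real_def)
  then show "\<exists>x>a. x < b \<and> (\<exists>d. 0 < d \<and> (\<forall>u. dist u x < d \<longrightarrow> P u = P x))" using t d(1) by blast
qed

lemma definable_hausdorff_continuous_at:
  fixes B :: "'p::euclidean_space \<Rightarrow> real \<Rightarrow> 'a::euclidean_space set"
  assumes dB: "definable (\<lambda>z. snd z \<in> B (fst (fst z)) (snd (fst z)))"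
  shows "definable (\<lambda>z. hausdorff_continuous_at (B (fst z)) (snd z))"
proof -
  have mem: "definable (\<lambda>z. h z \<in> B (f z) (g z))"
    if "definable_fun f" "definable_fun g" "definable_fun h" for f :: "'c::euclidean_space \<Rightarrow> _" and g h
    using definable_compose[OF dB definable_fun_Pair[OF definable_fun_Pair[OF that(1,2)] that(3)]] by simp
  show ?thesis unfolding hausdorff_continuous_at_def subset_iff mem_thicken
    by (intro definable_intros mem)
qed

lemma definable_uniformly_critical_free_at:
  fixes B :: "'p::euclidean_space \<Rightarrow> real \<Rightarrow> 'a::euclidean_space set"
  assumes dB: "definable (\<lambda>z. snd z \<in> B (fst (fst z)) (snd (fst z)))" and B: "\<And>p t. compact (B p t)"
  shows "definable (\<lambda>z. uniformly_critical_free_at (B (fst z)) (snd z))"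
proof -
  have mem: "definable (\<lambda>z. h z \<in> B (f z) (g z))"
    if "definable_fun f" "definable_fun g" "definable_fun h" for f :: "'c::euclidean_space \<Rightarrow> _" and g h
    using definable_compose[OF dB definable_fun_Pair[OF definable_fun_Pair[OF that(1,2)] that(3)]] by simp
  show ?thesis unfolding uniformly_critical_free_at_def critical_free_iff[OF B]
    by (intro definable_intros mem definable_fun_uminus)
qed

lemma cofinite_hausdorff_continuous:
  fixes A :: "real \<Rightarrow> 'a::euclidean_space set"
  assumes dA: "definable (\<lambda>z. snd z \<in> A (fst z))" and C: "compact C" "\<And>t. A t \<subseteq> C"
  shows "finite {t. \<not> hausdorff_continuous_at A t}"
proof (rule definable_dense_cofinite)
  have memA: "definable (\<lambda>z. h z \<in> A (f z))"
    if "definable_fun f" "definable_fun h" for f :: "'c::euclidean_space \<Rightarrow> _" and h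
    using definable_compose[OF dA definable_fun_Pair[OF that]] by simp
  show "definable (hausdorff_continuous_at A)"
    unfolding hausdorff_continuous_at_def[abs_def] subset_iff mem_thicken by (intro definable_intros memA)
  let ?meets = "\<lambda>g r t. \<exists>x. x \<in> A t \<and> dist g x < r"
  have "\<exists>G. finite G \<and> C \<subseteq> (\<Union>g\<in>G. ball g (1 / Suc n))" for n :: nat
    using C(1) unfolding compact_eq_totally_bounded by (meson of_nat_0_less_iff zero_less_Suc zero_less_divide_1_iff)
  then obtain G where G: "\<And>n. finite (G n)" "\<And>n. C \<subseteq> (\<Union>g\<in>G n. ball g (1 / Suc n))" by metis
  let ?E = "\<lambda>g r. {t. \<not> (\<exists>d. 0 < d \<and> (\<forall>u. dist u t < d \<longrightarrow> ?meets g r u = ?meets g r t))}"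
  have "definable (?meets g r)" for g r
    by (intro definable_intros memA)
  then have fin: "finite (?E g r)" for g r by (rule definable_cofinite_locally_constant)
  define X where "X = (\<Union>n. \<Union>g\<in>G n. ?E g (1 / Suc n))"
  have cX: "countable X" unfolding X_def by (intro countable_UN countableI_type) (use G(1) fin in \<open>auto intro: countable_finite\<close>)
  fix a b :: real assume "a < b"
  then have "uncountable {a<..<b}" by (simp add: uncountable_open_interval)
  then have "\<not> {a<..<b} \<subseteq> X" using cX countable_subset by metis
  then obtain t where "t \<in> {a<..<b}" and tX: "t \<notin> X" by blast
  then have t: "a < t" "t < b" by auto
  have "hausdorff_continuous_at A t" unfolding hausdorff_continuous_at_def
  proof (intro allI impI)
    fix e :: real assume "0 < e"
    then obtain n where n: "1 / Suc n < e / 2" using reals_Archimedean[of "e / 2"] by (auto simp: inverse_eq_divide)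
    have "\<exists>d. 0 < d \<and> (\<forall>u. dist u t < d \<longrightarrow> ?meets g (1 / Suc n) u = ?meets g (1 / Suc n) t)" if "g \<in> G n" for g
      using tX that unfolding X_def by blast
    then obtain d where d: "\<And>g. g \<in> G n \<Longrightarrow> 0 < d g"
      "\<And>g u. g \<in> G n \<Longrightarrow> dist u t < d g \<Longrightarrow> ?meets g (1 / Suc n) u = ?meets g (1 / Suc n) t" by metis
    define D where "D = Min (insert 1 (d ` G n))"
    have D: "0 < D" "\<And>g. g \<in> G n \<Longrightarrow> D \<le> d g" using G(1) d(1) by (auto simp: D_def)
    have half: "A u \<subseteq> thicken (A u') e" if meets: "\<And>g. g \<in> G n \<Longrightarrow> ?meets g (1 / Suc n) u = ?meets g (1 / Suc n) u'" for u u'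
    proof
      fix x assume x: "x \<in> A u"
      then obtain g where g: "g \<in> G n" "dist g x < 1 / Suc n" using G(2)[of n] C(2)[of u] by (auto simp: subset_iff)
      then obtain p where p: "p \<in> A u'" "dist g p < 1 / Suc n" using meets[OF g(1)] x by blast
      have "dist p x \<le> e" using dist_triangle[of p x g] g(2) p(2) n by (simp add: dist_commute)
      then show "x \<in> thicken (A u') e" using p(1) by (auto simp: mem_thicken)
    qed
    show "\<exists>d. 0 < d \<and> (\<forall>u. dist u t < d \<longrightarrow> A u \<subseteq> thicken (A t) e \<and> A t \<subseteq> thicken (A u) e)"
    proof (intro exI[of _ D] conjI allI impI D(1))
      fix u assume u: "dist u t < D"
      have "?meets g (1 / Suc n) u = ?meets g (1 / Suc n) t" if "g \<in> G n" for g
        using d(2)[OF that] D(2)[OF that] u by simp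
      then show "A u \<subseteq> thicken (A t) e" "A t \<subseteq> thicken (A u) e" by (intro half; simp)+
    qed
  qed
  then show "\<exists>x>a. x < b \<and> hausdorff_continuous_at A x" using t by blast
qed

lemma cofinite_uniformly_critical_free:
  fixes A :: "real \<Rightarrow> 'a::euclidean_space set"
  assumes dA: "definable (\<lambda>z. snd z \<in> A (fst z))" and A: "\<And>t. compact (A t)"
  shows "finite {t. \<not> uniformly_critical_free_at A t}"
proof (rule definable_dense_cofinite)
  have memA: "definable (\<lambda>z. h z \<in> A (f z))"
    if "definable_fun f" "definable_fun h" for f :: "'c::euclidean_space \<Rightarrow> _" and h
    using definable_compose[OF dA definable_fun_Pair[OF that]] by simp
  show "definable (uniformly_critical_free_at A)"
    unfolding uniformly_critical_free_at_def[abs_def] critical_free_iff[OF A]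
    by (intro definable_intros memA definable_fun_uminus)
  fix a b :: real assume ab: "a < b"
  obtain n c d where n: "a \<le> c" "c < d" "d \<le> b" "\<And>t. c < t \<Longrightarrow> t < d \<Longrightarrow> critical_free (A t) (1 / Suc n)"
  proof (rule definable_countable_union[OF ab, of "\<lambda>n t. critical_free (A t) (1 / Suc n)"])
    fix t :: real
    have "definable (\<lambda>x. x \<in> A t)" by (intro memA definable_intros)
    then obtain e where e: "0 < e" "critical_free (A t) e" using critical_free_exists[OF _ A] by blast
    obtain n where "1 / Suc n < e" using reals_Archimedean[OF e(1)] by (auto simp: inverse_eq_divide)
    then show "\<exists>n. critical_free (A t) (1 / Suc n)" using critical_free_mono[OF e(2)] by (meson less_imp_le)
  next
    show "definable (\<lambda>t. critical_free (A t) (1 / Suc n))" for n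
      unfolding critical_free_iff[OF A] by (intro definable_intros memA definable_fun_uminus)
  qed (rule that)
  define t where "t = (c + d) / 2"
  define r where "r = (d - c) / 2"
  have t: "a < t" "t < b" "0 < r" using n by (auto simp: t_def r_def)
  have "critical_free (A u) (1 / Suc n)" if "dist u t < r" for u
    using that by (intro n(4)) (auto simp: t_def r_def dist_real_def abs_less_iff field_simps)
  then have "uniformly_critical_free_at A t" unfolding uniformly_critical_free_at_def
    using t(3) by (intro exI[of _ "1 / Suc n"] exI[of _ r]) simp
  then show "\<exists>x>a. x < b \<and> uniformly_critical_free_at A x" using t by blast
qed

lemma finite_family_singular_values:
  fixes B :: "'p::euclidean_space \<Rightarrow> real \<Rightarrow> 'a::euclidean_space set"
  assumes dB: "definable (\<lambda>z. snd z \<in> B (fst (fst z)) (snd (fst z)))" and B: "\<And>p t. compact (B p t)"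
    and C: "compact C" "\<And>p t. B p t \<subseteq> C"
  shows "finite_family (\<lambda>p t. \<not> regular_value (B p) t)"
  unfolding finite_family_def
proof (intro conjI allI)
  show "definable (\<lambda>z. \<not> regular_value (B (fst z)) (snd z))"
    unfolding regular_value_def
    by (intro definable_not definable_conj definable_hausdorff_continuous_at[OF dB] definable_uniformly_critical_free_at[OF dB B])
  fix p :: 'p
  have "definable_fun (\<lambda>z::real \<times> 'a. ((p, fst z), snd z))" by (intro definable_intros)
  from definable_compose[OF dB this] have d: "definable (\<lambda>z. snd z \<in> B p (fst z))" by simp
  have "finite ({t. \<not> hausdorff_continuous_at (B p) t} \<union> {t. \<not> uniformly_critical_free_at (B p) t})"
    using cofinite_hausdorff_continuous[OF d C] cofinite_uniformly_critical_free[OF d B] by simp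
  moreover have "{t. \<not> regular_value (B p) t} = {t. \<not> hausdorff_continuous_at (B p) t} \<union> {t. \<not> uniformly_critical_free_at (B p) t}"
    by (auto simp: regular_value_def)
  ultimately show "finite {t. \<not> regular_value (B p) t}" by simp
qed

lemma regular_value_homology:
  fixes A :: "real \<Rightarrow> 'a::euclidean_space set"
  assumes dA: "\<And>t. definable (\<lambda>x. x \<in> A t)" and A: "\<And>t. compact (A t)" and t: "regular_value A t"
  shows "\<exists>d W. 0 < d \<and> (\<forall>u. dist u t < d \<longrightarrow> A u \<subseteq> W \<and> homology_iso (K :: 'k::field itself) k (A u) W)"
proof -
  obtain e d1 where e: "0 < e" "0 < d1" "\<And>u. dist u t < d1 \<Longrightarrow> critical_free (A u) e"
    using t unfolding regular_value_def uniformly_critical_free_at_def by blast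
  define r where "r = e / 4"
  have r: "0 < r" "3 * r < e" using e(1) by (simp_all add: r_def)
  obtain d2 where d2: "0 < d2" "\<And>u. dist u t < d2 \<Longrightarrow> A u \<subseteq> thicken (A t) r \<and> A t \<subseteq> thicken (A u) r"
    using t r(1) unfolding regular_value_def hausdorff_continuous_at_def by blast
  show ?thesis
  proof (intro exI[of _ "min d1 d2"] exI[of _ "thicken (A t) r"] conjI allI impI)
    show "0 < min d1 d2" using e d2 by simp
    fix u assume u: "dist u t < min d1 d2"
    show sub: "A u \<subseteq> thicken (A t) r" using d2 u by simp
    show "homology_iso K k (A u) (thicken (A t) r)"
    proof (rule homology_iso_interleaved)
      show "homology_iso K k (A u) (thicken (A u) (2 * r))"
        using homology_iso_thicken_0[OF dA A e(3), of u 0 "2 * r" K k] u r by simp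
      show "homology_iso K k (thicken (A t) r) (thicken (A t) (3 * r))"
        using homology_iso_thicken_0[OF dA A e(3), of t r "3 * r" K k] e(2) r by simp
      have "thicken (A t) r \<subseteq> thicken (thicken (A u) r) r" using d2 u by (intro thicken_subset) auto
      also have "\<dots> \<subseteq> thicken (A u) (r + r)" by (rule thicken_thicken)
      finally show "thicken (A t) r \<subseteq> thicken (A u) (2 * r)" by simp
      have "thicken (A u) (2 * r) \<subseteq> thicken (thicken (A t) r) (2 * r)" using sub by (intro thicken_subset) auto
      also have "\<dots> \<subseteq> thicken (A t) (r + 2 * r)" by (rule thicken_thicken)
      finally show "thicken (A u) (2 * r) \<subseteq> thicken (A t) (3 * r)" by simp
    qed (rule sub)
  qed
qed

lemma regular_interval_homology_iso:
  fixes A :: "real \<Rightarrow> 'a::euclidean_space set"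
  assumes dA: "\<And>t. definable (\<lambda>x. x \<in> A t)" and A: "\<And>t. compact (A t)" and mono: "\<And>s t. s \<le> t \<Longrightarrow> A s \<subseteq> A t"
    and reg: "\<And>u. s \<le> u \<Longrightarrow> u \<le> t \<Longrightarrow> regular_value A u" and st: "s \<le> t"
  shows "homology_iso (K :: 'k::field itself) k (A s) (A t)"
  using st
proof (rule Bolzano)
  fix a b c assume "homology_iso K k (A a) (A b)" "homology_iso K k (A b) (A c)" "a \<le> b" "b \<le> c"
  then show "homology_iso K k (A a) (A c)" by (intro homology_iso_trans[of K k "A a" "A b" "A c"] mono)
next
  fix x assume x: "s \<le> x" "x \<le> t"
  obtain d W where d: "0 < d" "\<And>u. dist u x < d \<Longrightarrow> A u \<subseteq> W \<and> homology_iso K k (A u) W"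
    using regular_value_homology[OF dA A reg[OF x], of K k] by blast
  show "\<exists>d>0. \<forall>a b. a \<le> x \<and> x \<le> b \<and> b - a < d \<longrightarrow> homology_iso K k (A a) (A b)"
  proof (intro exI[of _ d] conjI allI impI d(1))
    fix a b assume ab: "a \<le> x \<and> x \<le> b \<and> b - a < d"
    then have "dist a x < d" "dist b x < d" by (auto simp: dist_real_def)
    then show "homology_iso K k (A a) (A b)" using d(2) ab by (intro homology_iso_cancel[of K k "A a" W "A b"] mono) auto
  qed
qed

text \<open>Only the half-open interval has to be regular, because the family is continuous from the right.\<close>

lemma right_continuous_homology_iso:
  fixes A :: "real \<Rightarrow> 'a::euclidean_space set"
  assumes dA: "\<And>t. definable (\<lambda>x. x \<in> A t)" and A: "\<And>t. compact (A t)" and mono: "\<And>s t. s \<le> t \<Longrightarrow> A s \<subseteq> A t"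
    and right: "\<And>s. (\<Inter>t\<in>{s<..}. A t) \<subseteq> A s"
    and reg: "\<And>u. s < u \<Longrightarrow> u \<le> t \<Longrightarrow> regular_value A u" and st: "s \<le> t"
  shows "homology_iso (K :: 'k::field itself) k (A s) (A t)"
proof (cases "s = t")
  case True
  then show ?thesis by (simp add: homology_iso_refl)
next
  case False
  then have st: "s < t" using st by simp
  obtain e where e: "0 < e" "critical_free (A s) e" using critical_free_exists[OF dA A] by blast
  obtain h where h: "0 < h" "critical_free (A t) h" using critical_free_exists[OF dA A] by blast
  define r where "r = min e h / 2"
  have r: "0 < r" "r < e" "r < h" using e h by (auto simp: r_def)
  have Xr: "homology_iso K k (A s) (thicken (A s) r)"
    using homology_iso_thicken_0[OF dA A e(2), of 0 r K k] r by simp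
  have Tr: "homology_iso K k (A t) (thicken (A t) r)"
    using homology_iso_thicken_0[OF dA A h(2), of 0 r K k] r by simp
  obtain u where u: "s < u" "u \<le> t" "A u \<subseteq> thicken (A s) r"
  proof -
    let ?O = "\<Union>p\<in>A s. ball p r"
    have "\<exists>u. s < u \<and> A u \<subseteq> ?O"
    proof (rule ccontr)
      assume "\<nexists>u. s < u \<and> A u \<subseteq> ?O"
      then have ne: "A u - ?O \<noteq> {}" if "s < u" for u using that by blast
      have "\<Inter>((\<lambda>u. A u - ?O) ` {s<..}) \<noteq> {}"
      proof (rule compact_chain)
        show "compact S" if "S \<in> (\<lambda>u. A u - ?O) ` {s<..}" for S
          using that A by (auto intro!: compact_diff open_UN)
        show "{} \<notin> (\<lambda>u. A u - ?O) ` {s<..}" using ne by fastforce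
        show "S \<subseteq> T \<or> T \<subseteq> S" if "S \<in> (\<lambda>u. A u - ?O) ` {s<..} \<and> T \<in> (\<lambda>u. A u - ?O) ` {s<..}" for S T
        proof -
          from that obtain u u' where uu: "S = A u - ?O" "T = A u' - ?O" by blast
          show ?thesis unfolding uu using mono[of u u'] mono[of u' u] by (cases "u \<le> u'") auto
        qed
      qed
      then obtain x where "x \<in> \<Inter>((\<lambda>u. A u - ?O) ` {s<..})" by blast
      then have x: "x \<in> A u - ?O" if "s < u" for u using that by blast
      have "x \<notin> ?O" using x[of "s + 1"] by simp
      moreover have "x \<in> A s" using right x by blast
      ultimately show False using r(1) by force
    qed
    then obtain u where "s < u" "A u \<subseteq> ?O" by blast
    moreover have "?O \<subseteq> thicken (A s) r" by (force simp: mem_thicken)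
    ultimately show thesis using mono[of "min u t" u] st by (intro that[of "min u t"]) auto
  qed
  have ut: "homology_iso K k (A u) (A t)"
    by (rule regular_interval_homology_iso[OF dA A mono reg u(2)]) (use u in auto)
  have mono2: "thicken (A s) r \<subseteq> thicken (A t) r" using mono[of s t] st by (intro thicken_subset) auto
  show ?thesis unfolding homology_iso_def
  proof (intro conjI allI impI)
    fix z :: "('a, 'k) field_chain" assume z: "z \<in> cycles k (top_of_set (A t))"
    then obtain z1 where z1: "z1 \<in> cycles k (top_of_set (A u))" "z - z1 \<in> boundaries k (top_of_set (A t))"
      using ut unfolding homology_iso_def by blast
    have "z1 \<in> cycles k (top_of_set (thicken (A s) r))" using z1(1) cycles_mono[OF u(3)] by blast
    then obtain z2 where z2: "z2 \<in> cycles k (top_of_set (A s))" "z1 - z2 \<in> boundaries k (top_of_set (thicken (A s) r))"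
      using Xr unfolding homology_iso_def by blast
    have "z1 - z2 \<in> cycles k (top_of_set (A t))"
      using z1(1) z2(1) cycles_mono[OF mono[OF u(2)]] cycles_mono[OF mono[of s t]] st by (blast intro: cycles_diff less_imp_le)
    moreover have "z1 - z2 \<in> boundaries k (top_of_set (thicken (A t) r))" using z2(2) boundaries_mono[OF mono2] by blast
    ultimately have "z1 - z2 \<in> boundaries k (top_of_set (A t))" using Tr unfolding homology_iso_def by blast
    from boundaries_closed(2)[OF z1(2) this] show "\<exists>z'\<in>cycles k (top_of_set (A s)). z - z' \<in> boundaries k (top_of_set (A t))"
      using z2(1) by (intro bexI[of _ z2]) simp_all
  next
    fix z :: "('a, 'k) field_chain" assume z: "z \<in> cycles k (top_of_set (A s))" "z \<in> boundaries k (top_of_set (A t))"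
    have "z \<in> cycles k (top_of_set (A u))" using z(1) cycles_mono[OF mono[of s u]] u by (blast intro: less_imp_le)
    then have "z \<in> boundaries k (top_of_set (A u))" using ut z(2) unfolding homology_iso_def by blast
    then have "z \<in> boundaries k (top_of_set (thicken (A s) r))" using boundaries_mono[OF u(3)] by blast
    then show "z \<in> boundaries k (top_of_set (A s))" using Xr z(1) unfolding homology_iso_def by blast
  qed
qed

end


section \<open>Relative dimension and ranks of inclusions\<close>

locale relative_vector_space = vector_space
begin

text \<open>A basis of \<open>Z / (Z \<inter> B)\<close>, lifted to \<open>Z\<close>.\<close>

definition relative_basis :: "'b set \<Rightarrow> 'b set \<Rightarrow> 'b set \<Rightarrow> bool" where
  "relative_basis B Z S \<longleftrightarrow> finite S \<and> S \<subseteq> Z \<and> independent S \<and> span S \<inter> B \<subseteq> {0} \<and>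
     (\<forall>z\<in>Z. \<exists>y\<in>span S. z - y \<in> B)"

definition relative_dim :: "'b set \<Rightarrow> 'b set \<Rightarrow> nat" where
  "relative_dim B Z = card (SOME S. relative_basis B Z S)"

lemma independent_Un_disjoint_span:
  assumes "finite T" "independent T" "independent F" "span T \<inter> span F \<subseteq> {0}"
  shows "independent (T \<union> F)"
  using assms
proof (induction T)
  case (insert t T)
  have "independent T" using insert.prems(1) independent_mono by blast
  moreover have "span T \<subseteq> span (insert t T)" by (rule span_mono) blast
  ultimately have ind: "independent (T \<union> F)" using insert by blast
  have "t \<notin> span T" using insert.prems(1) insert.hyps independent_insert by auto
  have "t \<notin> span (T \<union> F)"
  proof
    assume "t \<in> span (T \<union> F)"
    then obtain y f where yf: "t = y + f" "y \<in> span T" "f \<in> span F" by (auto simp: span_Un)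
    have "t - y \<in> span (insert t T)"
      using yf(2) \<open>span T \<subseteq> span (insert t T)\<close> by (intro span_diff) (auto intro: span_base)
    then have "f \<in> span (insert t T) \<inter> span F" using yf by simp
    then have "f = 0" using insert.prems(3) by blast
    then show False using yf \<open>t \<notin> span T\<close> by simp
  qed
  then show ?case using ind independent_insert[of t "T \<union> F"] by auto
qed simp

lemma zero_notin_independent: "independent T \<Longrightarrow> 0 \<notin> T"
  using dependent_zero by blast

lemma relative_exchange:
  assumes B: "subspace B" and T: "finite T" "independent T" "span T \<inter> B \<subseteq> {0}"
    and S: "finite S" "\<And>t. t \<in> T \<Longrightarrow> \<exists>y\<in>span S. t - y \<in> B"
  shows "card T \<le> card S"
proof -
  obtain f where f: "\<And>t. t \<in> T \<Longrightarrow> f t \<in> span S" "\<And>t. t \<in> T \<Longrightarrow> t - f t \<in> B" using S(2) by metis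
  define F where "F = (\<lambda>t. t - f t) ` T"
  have F: "finite F" "F \<subseteq> B" using T(1) f by (auto simp: F_def)
  obtain F' where F': "F' \<subseteq> F" "independent F'" "F \<subseteq> span F'" using maximal_independent_subset[of F] by blast
  have fin: "finite F'" using F'(1) F(1) finite_subset by blast
  have sB: "span F' \<subseteq> B" using F'(1) F(2) B by (intro span_minimal) auto
  have "independent (T \<union> F')"
    using T sB by (intro independent_Un_disjoint_span F'(2)) auto
  moreover have "T \<union> F' \<subseteq> span (S \<union> F')"
  proof
    fix x assume "x \<in> T \<union> F'"
    then show "x \<in> span (S \<union> F')"
    proof
      assume x: "x \<in> T"
      have "x - f x \<in> span F'" using x F'(3) by (auto simp: F_def)
      then have "f x + (x - f x) \<in> span (S \<union> F')"
        using f(1)[OF x] span_mono[of S "S \<union> F'"] span_mono[of F' "S \<union> F'"] by (intro span_add) auto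
      then show ?thesis by simp
    qed (auto intro: span_base)
  qed
  ultimately have "card (T \<union> F') \<le> card (S \<union> F')"
    using independent_span_bound[of "S \<union> F'" "T \<union> F'"] S(1) fin by simp
  also have "\<dots> \<le> card S + card F'" by (rule card_Un_le)
  finally have "card (T \<union> F') \<le> card S + card F'" .
  moreover have "T \<inter> F' = {}"
  proof -
    have "T \<inter> F' \<subseteq> span T \<inter> B" using F'(1) F(2) span_base by blast
    then show ?thesis using T(3) zero_notin_independent[OF T(2)] by blast
  qed
  ultimately show ?thesis using T(1) fin by (simp add: card_Un_disjoint)
qed

lemma relative_basis_mono_card:
  assumes B: "subspace B" and S: "relative_basis B Z S" and S': "relative_basis B Z' S'" and Z: "Z \<subseteq> Z'"
  shows "card S \<le> card S'"
  using S S' Z unfolding relative_basis_def by (intro relative_exchange[OF B]) auto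

lemma relative_dim_eq:
  assumes "subspace B" "relative_basis B Z S"
  shows "relative_dim B Z = card S"
proof -
  have "relative_basis B Z (SOME S. relative_basis B Z S)" using assms(2) by (rule someI)
  then show ?thesis unfolding relative_dim_def
    using relative_basis_mono_card[OF assms(1)] assms(2) by (intro antisym) auto
qed

lemma relative_basis_exists:
  assumes B: "subspace B" and G: "finite G" "\<And>z. z \<in> Z \<Longrightarrow> \<exists>y\<in>span G. z - y \<in> B"
  shows "\<exists>S. relative_basis B Z S"
proof -
  let ?P = "\<lambda>S. finite S \<and> S \<subseteq> Z \<and> independent S \<and> span S \<inter> B \<subseteq> {0}"
  have bound: "card S \<le> card G" if "?P S" for S
    using that G by (intro relative_exchange[OF B]) auto
  obtain n where n: "(\<exists>S. ?P S \<and> card S = n) \<and> (\<forall>m. (\<exists>S. ?P S \<and> card S = m) \<longrightarrow> m \<le> n)"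
  proof (rule Nat.ex_has_greatest_nat[where b = "card G", THEN exE])
    show "\<exists>S. ?P S \<and> card S = 0" by (intro exI[of _ "{}"]) (simp add: local.independent_empty)
    show "\<forall>m. (\<exists>S. ?P S \<and> card S = m) \<longrightarrow> m \<le> card G" using bound by blast
  qed (rule that)
  obtain S where S: "?P S" and card: "card S = n" using conjunct1[OF n] by (elim exE conjE) (rule that; simp)
  have max: "card S' \<le> card S" if "?P S'" for S' using conjunct2[OF n] that card by metis
  have "\<exists>y\<in>span S. z - y \<in> B" if z: "z \<in> Z" for z
  proof (rule ccontr)
    assume "\<not> (\<exists>y\<in>span S. z - y \<in> B)"
    then have no: "z - y \<notin> B" if "y \<in> span S" for y using that by blast
    have zS: "z \<notin> span S" using no[of z] subspace_0[OF B] by auto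
    then have "z \<notin> S" using span_base by blast
    have "?P (insert z S)"
    proof (intro conjI)
      show "finite (insert z S)" "insert z S \<subseteq> Z" using S z by auto
      show "independent (insert z S)" using S zS by (simp add: independent_insert)
      show "span (insert z S) \<inter> B \<subseteq> {0}"
      proof
        fix x assume x: "x \<in> span (insert z S) \<inter> B"
        then obtain k where k: "x - scale k z \<in> span S" by (auto simp: span_insert)
        show "x \<in> {0}"
        proof (cases "k = 0")
          case True
          then show ?thesis using k x S by auto
        next
          case False
          have "scale (- inverse k) (x - scale k z) \<in> span S" using k by (rule span_scale)
          then have "z - scale (- inverse k) (x - scale k z) \<notin> B" by (rule no)
          moreover have "z - scale (- inverse k) (x - scale k z) = scale (inverse k) x"
            using False by (simp add: scale_right_diff_distrib)
          ultimately show ?thesis using x subspace_scale[OF B] by auto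
        qed
      qed
    qed
    from max[OF this] show False using S \<open>z \<notin> S\<close> by simp
  qed
  then show ?thesis using S unfolding relative_basis_def by blast
qed

lemma relative_basis_exists_subset:
  assumes B: "subspace B" and S: "relative_basis B Z S" and Z': "Z' \<subseteq> Z"
  shows "\<exists>S'. relative_basis B Z' S'"
  using S[unfolded relative_basis_def] Z' by (intro relative_basis_exists[OF B, of S]) auto

lemma relative_dim_mono:
  assumes "subspace B" "relative_basis B Z' S'" "Z \<subseteq> Z'"
  shows "relative_dim B Z \<le> relative_dim B Z'"
  using relative_basis_exists_subset[OF assms] relative_dim_eq[OF assms(1)]
    relative_basis_mono_card[OF assms(1) _ assms(2,3)] assms(2) by auto

lemma relative_basis_Int:
  assumes B: "subspace B" and B': "subspace B'" and Z: "subspace Z" and sub: "B \<subseteq> B'"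
    and S1: "relative_basis B' Z S1" and S2: "relative_basis B (Z \<inter> B') S2"
  shows "relative_basis B Z (S1 \<union> S2)" "S1 \<inter> S2 = {}"
proof -
  have S1': "finite S1" "S1 \<subseteq> Z" "independent S1" "span S1 \<inter> B' \<subseteq> {0}" "\<And>z. z \<in> Z \<Longrightarrow> \<exists>y\<in>span S1. z - y \<in> B'"
    and S2': "finite S2" "S2 \<subseteq> Z \<inter> B'" "independent S2" "span S2 \<inter> B \<subseteq> {0}" "\<And>z. z \<in> Z \<inter> B' \<Longrightarrow> \<exists>y\<in>span S2. z - y \<in> B"
    using S1 S2 unfolding relative_basis_def by auto
  have sp1: "span S1 \<subseteq> Z" using S1'(2) Z by (intro span_minimal)
  have sp2: "span S2 \<subseteq> B'" using S2'(2) B' by (intro span_minimal) auto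
  have disj: "span S1 \<inter> span S2 \<subseteq> {0}" using S1'(4) sp2 by blast
  show "relative_basis B Z (S1 \<union> S2)" unfolding relative_basis_def
  proof (intro conjI ballI)
    show "finite (S1 \<union> S2)" "S1 \<union> S2 \<subseteq> Z" using S1' S2' by auto
    show "independent (S1 \<union> S2)" by (rule independent_Un_disjoint_span[OF S1'(1,3) S2'(3) disj])
    show "span (S1 \<union> S2) \<inter> B \<subseteq> {0}"
    proof
      fix x assume x: "x \<in> span (S1 \<union> S2) \<inter> B"
      then obtain y1 y2 where y: "x = y1 + y2" "y1 \<in> span S1" "y2 \<in> span S2" by (auto simp: span_Un)
      have "x - y2 \<in> B'" using x y sub sp2 by (intro subspace_diff[OF B']) auto
      then have "y1 = 0" using y S1'(4) by auto
      then show "x \<in> {0}" using x y S2'(4) by auto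
    qed
    fix z assume z: "z \<in> Z"
    obtain y1 where y1: "y1 \<in> span S1" "z - y1 \<in> B'" using S1'(5)[OF z] by blast
    have "z - y1 \<in> Z \<inter> B'" using y1 sp1 z subspace_diff[OF Z] by auto
    then obtain y2 where y2: "y2 \<in> span S2" "z - y1 - y2 \<in> B" using S2'(5) by blast
    have "y1 + y2 \<in> span (S1 \<union> S2)" using y1(1) y2(1) span_mono[of S1 "S1 \<union> S2"] span_mono[of S2 "S1 \<union> S2"]
      by (intro span_add) auto
    then show "\<exists>y\<in>span (S1 \<union> S2). z - y \<in> B" using y2(2) by (intro bexI[of _ "y1 + y2"]) (simp_all add: diff_diff_eq)
  qed
  have "S1 \<inter> S2 \<subseteq> span S1 \<inter> span S2" using span_base by blast
  then show "S1 \<inter> S2 = {}" using disj zero_notin_independent[OF S1'(3)] by blast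
qed

lemma relative_basis_weaken:
  assumes B: "subspace B" and B': "subspace B'" and sub: "B \<subseteq> B'" and S: "relative_basis B Z S"
  shows "\<exists>S'. relative_basis B' Z S'"
  using S[unfolded relative_basis_def] sub by (intro relative_basis_exists[OF B', of S]) blast+

lemma relative_dim_Int:
  assumes B: "subspace B" and B': "subspace B'" and Z: "subspace Z" and sub: "B \<subseteq> B'" and S: "relative_basis B Z S"
  shows "relative_dim B Z = relative_dim B' Z + relative_dim B (Z \<inter> B')"
proof -
  obtain S1 where S1: "relative_basis B' Z S1" using relative_basis_weaken[OF B B' sub S] by blast
  obtain S2 where S2: "relative_basis B (Z \<inter> B') S2" using relative_basis_exists_subset[OF B S, of "Z \<inter> B'"] by blast
  note U = relative_basis_Int[OF B B' Z sub S1 S2]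
  have "finite S1" "finite S2" using S1 S2 by (auto simp: relative_basis_def)
  then show ?thesis using relative_dim_eq[OF B U(1)] relative_dim_eq[OF B' S1] relative_dim_eq[OF B S2] U(2)
    by (simp add: card_Un_disjoint)
qed

text \<open>The inclusion-exclusion expression that counts persistence pairs in a box is the difference of
  the two outer correction terms.\<close>

lemma relative_dim_box:
  assumes B: "subspace B" and B': "subspace B'" and Z: "subspace Z" "subspace Z'" and sub: "B \<subseteq> B'" "Z \<subseteq> Z'"
    and S: "relative_basis B Z' S"
  shows "relative_dim B Z + relative_dim B' Z' \<le> relative_dim B Z' + relative_dim B' Z"
proof -
  obtain S' where S': "relative_basis B Z S'" using relative_basis_exists_subset[OF B S sub(2)] by blast
  obtain S2 where S2: "relative_basis B (Z' \<inter> B') S2" using relative_basis_exists_subset[OF B S, of "Z' \<inter> B'"] by blast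
  have "relative_dim B (Z \<inter> B') \<le> relative_dim B (Z' \<inter> B')"
    using sub(2) by (intro relative_dim_mono[OF B S2]) auto
  then show ?thesis
    using relative_dim_Int[OF B B' Z(1) sub(1) S'] relative_dim_Int[OF B B' Z(2) sub(1) S] by simp
qed

lemma relative_basis_enlarge:
  assumes B: "subspace B" and S: "relative_basis B Z S" and Z: "Z \<subseteq> Z'" "\<And>z. z \<in> Z' \<Longrightarrow> \<exists>y\<in>Z. z - y \<in> B"
  shows "relative_basis B Z' S"
  unfolding relative_basis_def
proof (intro conjI ballI)
  fix z assume "z \<in> Z'"
  then obtain y where y: "y \<in> Z" "z - y \<in> B" using Z(2) by blast
  then obtain x where x: "x \<in> span S" "y - x \<in> B" using S unfolding relative_basis_def by blast
  from subspace_add[OF B y(2) x(2)] show "\<exists>y\<in>span S. z - y \<in> B" using x(1) by (intro bexI[of _ x]) simp_all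
qed (use S Z(1) in \<open>auto simp: relative_basis_def\<close>)

lemma relative_basis_cong:
  assumes Z: "subspace Z" and S: "relative_basis B Z S" and eq: "\<And>z. z \<in> Z \<Longrightarrow> z \<in> B \<longleftrightarrow> z \<in> B'"
  shows "relative_basis B' Z S"
proof -
  have sp: "span S \<subseteq> Z" using S Z unfolding relative_basis_def by (intro span_minimal) auto
  show ?thesis unfolding relative_basis_def
  proof (intro conjI ballI)
    show "span S \<inter> B' \<subseteq> {0}" using S sp eq unfolding relative_basis_def by blast
    fix z assume z: "z \<in> Z"
    then obtain y where y: "y \<in> span S" "z - y \<in> B" using S unfolding relative_basis_def by blast
    then have "z - y \<in> B'" using eq[of "z - y"] subspace_diff[OF Z z] sp by blast
    then show "\<exists>y\<in>span S. z - y \<in> B'" using y by blast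
  qed (use S in \<open>auto simp: relative_basis_def\<close>)
qed

end

global_interpretation chain_space: relative_vector_space "chain_scale :: 'k::field \<Rightarrow> ('a, 'k) field_chain \<Rightarrow> _"
  by unfold_locales (simp_all add: chain_scale_simps)

lemma subspace_cycles: "chain_space.subspace (cycles k X)"
  by (rule chain_space.subspaceI) (auto intro: cycles_closed)

lemma subspace_boundaries: "chain_space.subspace (boundaries k X)"
  by (rule chain_space.subspaceI) (auto intro: boundaries_closed)

definition inclusion_rank :: "'k::field itself \<Rightarrow> nat \<Rightarrow> 'a::topological_space set \<Rightarrow> 'a set \<Rightarrow> nat" where
  "inclusion_rank _ k X Y =
     chain_space.relative_dim (boundaries k (top_of_set Y)) (cycles k (top_of_set X) :: ('a, 'k) field_chain set)"

definition finite_rank :: "'k::field itself \<Rightarrow> nat \<Rightarrow> 'a::topological_space set \<Rightarrow> 'a set \<Rightarrow> bool" where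
  "finite_rank _ k X Y \<longleftrightarrow>
     (\<exists>S. chain_space.relative_basis (boundaries k (top_of_set Y)) (cycles k (top_of_set X) :: ('a, 'k) field_chain set) S)"

lemma finite_rank_weaken: "finite_rank K k X Y \<Longrightarrow> Y \<subseteq> Y' \<Longrightarrow> finite_rank K k X Y'"
  unfolding finite_rank_def
  using chain_space.relative_basis_weaken[OF subspace_boundaries subspace_boundaries boundaries_mono] by blast

lemma inclusion_rank_mono_left: "finite_rank K k X' Y \<Longrightarrow> X \<subseteq> X' \<Longrightarrow> inclusion_rank K k X Y \<le> inclusion_rank K k X' Y"
  unfolding finite_rank_def inclusion_rank_def
  using chain_space.relative_dim_mono[OF subspace_boundaries _ cycles_mono] by blast

lemma inclusion_rank_mono_right:
  assumes "finite_rank K k X Y" "Y \<subseteq> Y'" shows "inclusion_rank K k X Y' \<le> inclusion_rank K k X Y"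
  using assms unfolding finite_rank_def inclusion_rank_def
  using chain_space.relative_dim_Int[OF subspace_boundaries subspace_boundaries subspace_cycles boundaries_mono]
  by (metis le_add1)

lemma inclusion_rank_box:
  assumes "finite_rank K k X' Y" "X \<subseteq> X'" "Y \<subseteq> Y'"
  shows "inclusion_rank K k X Y + inclusion_rank K k X' Y' \<le> inclusion_rank K k X' Y + inclusion_rank K k X Y'"
  using assms unfolding finite_rank_def inclusion_rank_def
  using chain_space.relative_dim_box[OF subspace_boundaries subspace_boundaries subspace_cycles subspace_cycles boundaries_mono cycles_mono]
  by blast

lemma inclusion_rank_iso_left:
  fixes K :: "'k::field itself" and X :: "'a::topological_space set"
  assumes fin: "finite_rank K k X Y" and iso: "homology_iso K k X X'" and sub: "X \<subseteq> X'" "X' \<subseteq> Y"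
  shows "inclusion_rank K k X Y = inclusion_rank K k X' Y"
proof -
  let ?B = "boundaries k (top_of_set Y) :: ('a, 'k) field_chain set"
  obtain S where S: "chain_space.relative_basis ?B (cycles k (top_of_set X)) S" using fin unfolding finite_rank_def by blast
  have "chain_space.relative_basis ?B (cycles k (top_of_set X')) S"
  proof (rule chain_space.relative_basis_enlarge[OF subspace_boundaries S cycles_mono[OF sub(1)]])
    fix z :: "('a, 'k) field_chain" assume "z \<in> cycles k (top_of_set X')"
    then show "\<exists>y\<in>cycles k (top_of_set X). z - y \<in> ?B"
      using iso boundaries_mono[OF sub(2)] unfolding homology_iso_def by blast
  qed
  then show ?thesis unfolding inclusion_rank_def
    using chain_space.relative_dim_eq[OF subspace_boundaries] S by metis
qed

lemma inclusion_rank_iso_right: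
  fixes K :: "'k::field itself" and X :: "'a::topological_space set"
  assumes fin: "finite_rank K k X Y" and iso: "homology_iso K k Y Y'" and sub: "X \<subseteq> Y" "Y \<subseteq> Y'"
  shows "inclusion_rank K k X Y = inclusion_rank K k X Y'"
proof -
  obtain S where S: "chain_space.relative_basis (boundaries k (top_of_set Y)) (cycles k (top_of_set X) :: ('a, 'k) field_chain set) S"
    using fin unfolding finite_rank_def by blast
  have "chain_space.relative_basis (boundaries k (top_of_set Y')) (cycles k (top_of_set X)) S"
  proof (rule chain_space.relative_basis_cong[OF subspace_cycles S])
    fix z :: "('a, 'k) field_chain" assume "z \<in> cycles k (top_of_set X)"
    then have "z \<in> cycles k (top_of_set Y)" using cycles_mono[OF sub(1)] by blast
    then show "z \<in> boundaries k (top_of_set Y) \<longleftrightarrow> z \<in> boundaries k (top_of_set Y')"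
      using iso boundaries_mono[OF sub(2)] unfolding homology_iso_def by blast
  qed
  then show ?thesis unfolding inclusion_rank_def
    using chain_space.relative_dim_eq[OF subspace_boundaries] S by metis
qed

lemma inclusion_rank_empty:
  fixes K :: "'k::field itself" and Y :: "'a::topological_space set"
  shows "inclusion_rank K k {} Y = 0"
proof -
  have "cycles k (top_of_set {}) = {0 :: ('a, 'k) field_chain}"
  proof (intro equalityI subsetI)
    fix z :: "('a, 'k) field_chain" assume "z \<in> cycles k (top_of_set {})"
    moreover have "singular_simplex_set k (top_of_set ({} :: 'a set)) = {}"
      using nonempty_standard_simplex[of k] by (auto simp: singular_simplex_def continuous_map_def)
    ultimately have "Poly_Mapping.keys z = {}" unfolding cycles_def field_chains_def by blast
    then show "z \<in> {0}" by simp
  qed (simp add: cycles_closed)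
  moreover have "chain_space.relative_basis (boundaries k (top_of_set Y)) {0 :: ('a, 'k) field_chain} {}"
    unfolding chain_space.relative_basis_def by (simp add: boundaries_closed chain_space.independent_empty)
  ultimately show ?thesis unfolding inclusion_rank_def
    using chain_space.relative_dim_eq[OF subspace_boundaries] by fastforce
qed

context o_minimal_structure
begin

lemma finite_rank_definable:
  fixes X :: "'a::euclidean_space set" and K :: "'k::field itself"
  assumes X: "definable (\<lambda>x. x \<in> X)" "compact X" and Y: "X \<subseteq> Y"
  shows "finite_rank K k X Y"
proof -
  obtain e where e: "0 < e" "critical_free X e" using critical_free_exists[OF X] by blast
  let ?N = "\<Union>p\<in>X. cball p (e / 2)"
  let ?B = "boundaries k (top_of_set ?N) :: ('a, 'k) field_chain set"
  have iso: "homology_iso K k X ?N"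
    using homology_iso_thicken_0[OF X e(2), of 0 "e / 2" K k] e(1) by (simp add: thicken_def)
  have "X \<subseteq> ?N" using subset_thicken[of "e / 2" X] e(1) by (simp add: thicken_def)
  obtain F :: "((nat \<Rightarrow> real) \<Rightarrow> 'a) set" where F: "finite F"
    "\<And>z :: ('a, 'k) field_chain. z \<in> cycles k (top_of_set X) \<Longrightarrow>
      \<exists>z'. z' \<in> cycles k (top_of_set ?N) \<and> Poly_Mapping.keys z' \<subseteq> F \<and> z' - z \<in> ?B"
    by (rule finitely_many_simplices_suffice[OF X(2) half_gt_zero[OF e(1)]]) (rule that)
  have "\<exists>S. chain_space.relative_basis ?B (cycles k (top_of_set X)) S"
  proof (rule chain_space.relative_basis_exists[OF subspace_boundaries])
    let ?G = "(\<lambda>f. Poly_Mapping.single f (1 :: 'k)) ` F"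
    show "finite ?G" using F(1) by simp
    fix z :: "('a, 'k) field_chain" assume "z \<in> cycles k (top_of_set X)"
    then obtain z' where z': "Poly_Mapping.keys z' \<subseteq> F" "z' - z \<in> ?B" using F(2) by blast
    have "chain_extend (\<lambda>f. Poly_Mapping.single f 1) z' \<in> chain_space.span ?G"
      unfolding chain_extend_def using z'(1) by (intro chain_space.span_sum chain_space.span_scale chain_space.span_base) auto
    then have "z' \<in> chain_space.span ?G" by simp
    then show "\<exists>y\<in>chain_space.span ?G. z - y \<in> ?B" using boundaries_minus[OF z'(2)] by (intro bexI[of _ z']) simp_all
  qed
  then obtain S where S: "chain_space.relative_basis ?B (cycles k (top_of_set X)) S" by blast
  have "chain_space.relative_basis (boundaries k (top_of_set X)) (cycles k (top_of_set X)) S"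
  proof (rule chain_space.relative_basis_cong[OF subspace_cycles S])
    fix z :: "('a, 'k) field_chain" assume "z \<in> cycles k (top_of_set X)"
    then show "z \<in> ?B \<longleftrightarrow> z \<in> boundaries k (top_of_set X)"
      using iso boundaries_mono[OF \<open>X \<subseteq> ?N\<close>] unfolding homology_iso_def by blast
  qed
  then have "finite_rank K k X X" unfolding finite_rank_def by blast
  then show ?thesis by (rule finite_rank_weaken[OF _ Y])
qed

end

subsection \<open>Comparison with the quotient vector spaces\<close>

lemma induced_image_simps:
  fixes X :: "'a::topological_space set" and k :: nat
  assumes "X \<subseteq> Y"
  defines "V \<equiv> induced_image k (top_of_set X) (top_of_set Y) :: ('k::field, ('a, 'k) field_chain set) module"
    and "cl \<equiv> homology_class k (top_of_set Y)"
  shows "carrier V = cl ` cycles k (top_of_set X)" "\<zero>\<^bsub>V\<^esub> = cl 0"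
    "cl c \<oplus>\<^bsub>V\<^esub> cl d = cl (c + d)" "a \<odot>\<^bsub>V\<^esub> cl c = cl (chain_scale a c)"
proof -
  have X: "top_of_set X = subtopology (top_of_set Y) X"
    using assms(1) by (simp add: subtopology_subtopology Int_absorb1)
  have ic: "induced_by_inclusion k (top_of_set Y) (homology_class k (top_of_set X) c) = cl c" for c
    using induced_by_inclusion_class[of k "top_of_set Y" X c] unfolding cl_def by (simp flip: X)
  show "carrier V = cl ` cycles k (top_of_set X)"
    unfolding V_def induced_image_def by (simp add: homology_space_carrier image_image ic)
  have *: "\<zero>\<^bsub>V\<^esub> = \<zero>\<^bsub>homology_space k (top_of_set Y) :: ('k, _) module\<^esub>"
    "add V = add (homology_space k (top_of_set Y))" "smult V = smult (homology_space k (top_of_set Y))"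
    by (simp_all add: V_def induced_image_def)
  show "\<zero>\<^bsub>V\<^esub> = cl 0" "cl c \<oplus>\<^bsub>V\<^esub> cl d = cl (c + d)" "a \<odot>\<^bsub>V\<^esub> cl c = cl (chain_scale a c)"
    unfolding * cl_def by (simp_all add: homology_space_simps homology_space_smult)
qed

lemma vectorspace_induced_image:
  fixes X :: "'a::topological_space set"
  assumes XY: "X \<subseteq> Y"
  shows "vectorspace (field_ring :: 'k::field ring) (induced_image k (top_of_set X) (top_of_set Y))"
proof -
  let ?V = "induced_image k (top_of_set X) (top_of_set Y) :: ('k, ('a, 'k) field_chain set) module"
  note V = induced_image_simps[OF XY, of k, where 'k = 'k]
  have "abelian_group ?V"
  proof (rule abelian_groupI)
    fix C assume "C \<in> carrier ?V"
    then obtain c where c: "c \<in> cycles k (top_of_set X)" "C = homology_class k (top_of_set Y) c"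
      by (auto simp: V)
    show "\<exists>D\<in>carrier ?V. D \<oplus>\<^bsub>?V\<^esub> C = \<zero>\<^bsub>?V\<^esub>"
      using c cycles_closed(3)[OF c(1), of "- 1"]
      by (intro bexI[of _ "homology_class k (top_of_set Y) (- c)"]) (auto simp: V chain_scale_simps)
  qed (auto simp: V cycles_closed ac_simps)
  then have "module (field_ring :: 'k ring) ?V"
  proof (intro moduleI fieldE(1)[OF field_field_ring])
    fix a b :: 'k and C D assume "C \<in> carrier ?V" "D \<in> carrier ?V"
    then obtain c d where c: "c \<in> cycles k (top_of_set X)" "C = homology_class k (top_of_set Y) c"
      "D = homology_class k (top_of_set Y) d" by (auto simp: V)
    show "a \<odot>\<^bsub>?V\<^esub> C \<in> carrier ?V" unfolding c V using c(1) by (intro imageI cycles_closed)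
    show "(a \<oplus>\<^bsub>field_ring\<^esub> b) \<odot>\<^bsub>?V\<^esub> C = a \<odot>\<^bsub>?V\<^esub> C \<oplus>\<^bsub>?V\<^esub> b \<odot>\<^bsub>?V\<^esub> C"
      "a \<odot>\<^bsub>?V\<^esub> (C \<oplus>\<^bsub>?V\<^esub> D) = a \<odot>\<^bsub>?V\<^esub> C \<oplus>\<^bsub>?V\<^esub> a \<odot>\<^bsub>?V\<^esub> D"
      "(a \<otimes>\<^bsub>field_ring\<^esub> b) \<odot>\<^bsub>?V\<^esub> C = a \<odot>\<^bsub>?V\<^esub> (b \<odot>\<^bsub>?V\<^esub> C)" "\<one>\<^bsub>field_ring\<^esub> \<odot>\<^bsub>?V\<^esub> C = C"
      unfolding c V monoid.simps ring_record_simps by (simp_all only: chain_scale_simps V)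
  qed
  then show ?thesis by (intro vectorspace.intro field_field_ring)
qed

lemma inclusion_rank_eq_inclusion_rank:
  fixes X :: "'a::topological_space set" and K :: "'k::field itself"
  assumes XY: "X \<subseteq> Y" and fin: "finite_rank K k X Y"
  shows "inclusion_rank_eq K k (top_of_set X) (top_of_set Y) n \<longleftrightarrow> n = inclusion_rank K k X Y"
proof -
  let ?V = "induced_image k (top_of_set X) (top_of_set Y) :: ('k, ('a, 'k) field_chain set) module"
  let ?cl = "homology_class k (top_of_set Y) :: ('a, 'k) field_chain \<Rightarrow> _"
  let ?Z = "cycles k (top_of_set X) :: ('a, 'k) field_chain set"
  let ?B = "boundaries k (top_of_set Y) :: ('a, 'k) field_chain set"
  note V = induced_image_simps[OF XY, of k, where 'k = 'k]
  interpret V: vectorspace "field_ring :: 'k ring" ?V by (rule vectorspace_induced_image[OF XY])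
  obtain S where S: "chain_space.relative_basis ?B ?Z S" using fin unfolding finite_rank_def by blast
  then have S': "finite S" "S \<subseteq> ?Z" "chain_space.independent S" "chain_space.span S \<inter> ?B \<subseteq> {0}"
    "\<And>z. z \<in> ?Z \<Longrightarrow> \<exists>y\<in>chain_space.span S. z - y \<in> ?B"
    by (auto simp: chain_space.relative_basis_def)
  have inj: "inj_on ?cl S"
  proof (rule inj_onI)
    fix c d assume cd: "c \<in> S" "d \<in> S" "?cl c = ?cl d"
    have "c - d \<in> chain_space.span S" using cd by (intro chain_space.span_diff chain_space.span_base)
    moreover have "c - d \<in> ?B" using cd(3) by (simp add: homology_class_eq_iff)
    ultimately show "c = d" using S'(4) by auto
  qed
  have lin: "V.module.lincomb a (?cl ` T) = ?cl (\<Sum>c\<in>T. chain_scale (a (?cl c)) c)"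
    if "finite T" "T \<subseteq> S" for a T
    using that
  proof (induction T)
    case empty
    show ?case by (simp add: V.module.lincomb_def V)
  next
    case (insert t T)
    have "?cl t \<notin> ?cl ` T" using insert.hyps insert.prems inj by (auto simp: inj_on_def)
    then have "V.module.lincomb a (?cl ` T \<union> {?cl t}) = a (?cl t) \<odot>\<^bsub>?V\<^esub> ?cl t \<oplus>\<^bsub>?V\<^esub> V.module.lincomb a (?cl ` T)"
      using insert S'(2) by (intro V.module.lincomb_insert) (auto simp: V)
    then show ?case using insert by (simp add: V)
  qed
  have sub: "?cl ` S \<subseteq> carrier ?V" using S'(2) by (auto simp: V)
  have comb: "(\<Sum>c\<in>S. chain_scale (a c) c) \<in> chain_space.span S" for a
    by (intro chain_space.span_sum chain_space.span_scale chain_space.span_base)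
  have "V.lin_indpt (?cl ` S)"
  proof (rule V.module.finite_lin_indpt2)
    fix a assume a: "V.module.lincomb a (?cl ` S) = \<zero>\<^bsub>?V\<^esub>"
    let ?c = "\<Sum>c\<in>S. chain_scale (a (?cl c)) c"
    have "?cl ?c = ?cl 0" using a lin[OF S'(1) order.refl, of a] by (simp add: V)
    then have "?c \<in> ?B" by (simp add: homology_class_eq_iff)
    then have "?c = 0" using S'(4) comb[of "\<lambda>c. a (?cl c)"] by auto
    then have "a (?cl c) = 0" if "c \<in> S" for c
      using chain_space.independentD[OF S'(3,1) order.refl _ that, of "\<lambda>c. a (?cl c)"] by simp
    then show "\<forall>v\<in>?cl ` S. a v = \<zero>\<^bsub>field_ring\<^esub>" by simp
  qed (use S'(1) sub in auto)
  moreover have "V.gen_set (?cl ` S)"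
  proof (intro equalityI)
    show "V.span (?cl ` S) \<subseteq> carrier ?V" by (rule V.module.span_is_subset2[OF sub])
    show "carrier ?V \<subseteq> V.span (?cl ` S)"
    proof
      fix C assume "C \<in> carrier ?V"
      then obtain z where z: "z \<in> ?Z" "C = ?cl z" by (auto simp: V)
      obtain y where y: "y \<in> chain_space.span S" "z - y \<in> ?B" using S'(5)[OF z(1)] by blast
      obtain u where u: "y = (\<Sum>c\<in>S. chain_scale (u c) c)" using y(1) chain_space.span_finite[OF S'(1)] by auto
      let ?a = "\<lambda>C. u (the_inv_into S ?cl C)"
      have "V.module.lincomb ?a (?cl ` S) = ?cl y"
        unfolding lin[OF S'(1) order.refl] u using the_inv_into_f_f[OF inj] by (intro arg_cong[of _ _ ?cl] sum.cong) auto
      moreover have "C = ?cl y" using y(2) z(2) by (simp add: homology_class_eq_iff)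
      ultimately show "C \<in> V.span (?cl ` S)" unfolding V.module.span_def using S'(1) by force
    qed
  qed
  ultimately have basis: "V.basis (?cl ` S)" using sub by (simp add: V.basis_def)
  have "V.fin_dim" unfolding V.fin_dim_def using basis S'(1) by (auto simp: V.basis_def)
  moreover have "V.dim = card S" using V.dim_basis[OF _ basis] S'(1) card_image[OF inj] by simp
  moreover have "inclusion_rank K k X Y = card S"
    unfolding inclusion_rank_def by (rule chain_space.relative_dim_eq[OF subspace_boundaries S])
  ultimately show ?thesis by (auto simp: inclusion_rank_eq_def)
qed


section \<open>Persistence diagrams of rank functions\<close>

definition quadrant_count :: "(ereal \<times> ereal) multiset \<Rightarrow> real \<Rightarrow> real \<Rightarrow> nat" where
  "quadrant_count D s t = size {#(b, e) \<in># D. b \<le> ereal s \<and> ereal t < e#}"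

definition diagram_of :: "(real \<Rightarrow> real \<Rightarrow> nat) \<Rightarrow> (ereal \<times> ereal) multiset \<Rightarrow> bool" where
  "diagram_of R D \<longleftrightarrow> (\<forall>(b, e) \<in># D. b < e) \<and> (\<forall>s t. s \<le> t \<longrightarrow> quadrant_count D s t = R s t)"

lemma size_filter_sum: "size (filter_mset P (sum f A)) = (\<Sum>a\<in>A. size (filter_mset P (f a)))"
  by (induction A rule: infinite_finite_induct) simp_all

lemma size_filter_replicate: "size (filter_mset P (replicate_mset n p)) = (if P p then n else 0)"
  by (induction n) simp_all

lemma size_filter_minus_Int: "size (filter_mset P D) = size (filter_mset P (D - D')) + size (filter_mset P (D \<inter># D'))"
proof -
  have "D = (D - D') + (D \<inter># D')" by (rule multiset_eqI) simp
  then have "filter_mset P D = filter_mset P (D - D') + filter_mset P (D \<inter># D')" by (metis filter_union_mset)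
  from arg_cong[where f = size, OF this] show ?thesis by (simp only: size_union)
qed

lemma isolating_quadrant:
  fixes U :: "(ereal \<times> ereal) set"
  assumes U: "finite U" "U \<noteq> {}" "\<And>b e. (b, e) \<in> U \<Longrightarrow> b < e"
  shows "\<exists>P\<in>U. \<exists>s t. s \<le> t \<and> (\<forall>p\<in>U. fst p \<le> ereal s \<and> ereal t < snd p \<longleftrightarrow> p = P)"
proof -
  define e where "e = Max (snd ` U)"
  have e: "e \<in> snd ` U" "\<And>p. p \<in> U \<Longrightarrow> snd p \<le> e" using U by (auto simp: e_def)
  let ?V = "{p\<in>U. snd p = e}"
  define b where "b = Min (fst ` ?V)"
  have V: "finite (fst ` ?V)" "fst ` ?V \<noteq> {}" using U(1) e(1) by auto
  then have "b \<in> fst ` ?V" unfolding b_def by (rule Min_in)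
  then have P: "(b, e) \<in> U" by auto
  have b: "b \<le> fst p" if "p \<in> U" "snd p = e" for p
    unfolding b_def using that V by (intro Min_le) auto
  define y where "y = Max (insert b {x \<in> snd ` U. x < e})"
  have y: "b \<le> y" "\<And>p. p \<in> U \<Longrightarrow> snd p < e \<Longrightarrow> snd p \<le> y" "y < e"
    using U(1) U(3)[OF P] by (auto simp: y_def)
  obtain t where t: "y < ereal t" "ereal t < e" using ereal_dense2[OF y(3)] by blast
  define z where "z = Min (insert (ereal t) {x \<in> fst ` U. b < x})"
  have z: "z \<le> ereal t" "\<And>p. p \<in> U \<Longrightarrow> b < fst p \<Longrightarrow> z \<le> fst p" "b < z"
    using U(1) t(1) y(1) by (auto simp: z_def)
  obtain s where s: "b < ereal s" "ereal s < z" using ereal_dense2[OF z(3)] by blast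
  show ?thesis
  proof (rule bexI[OF _ P], rule exI[of _ s], rule exI[of _ t], intro conjI ballI)
    show "s \<le> t" using s(2) z(1) by (metis ereal_less_eq(3) less_imp_le less_le_trans)
    fix p assume p: "p \<in> U"
    show "fst p \<le> ereal s \<and> ereal t < snd p \<longleftrightarrow> p = (b, e)"
    proof
      assume a: "fst p \<le> ereal s \<and> ereal t < snd p"
      have "\<not> snd p < e" using y(2)[OF p] t(1) a by (meson leD less_trans le_less_trans)
      then have "snd p = e" using e(2)[OF p] by simp
      moreover have "\<not> b < fst p" using z(2)[OF p] s(2) a by (meson leD le_less_trans)
      then have "fst p = b" using b[OF p \<open>snd p = e\<close>] by simp
      ultimately show "p = (b, e)" by (simp add: prod_eq_iff)
    qed (use s t in auto)
  qed
qed

lemma diagram_of_unique: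
  assumes "diagram_of R D" "diagram_of R D'"
  shows "D = D'"
proof (rule ccontr)
  assume ne: "D \<noteq> D'"
  let ?E = "D - D'" and ?E' = "D' - D"
  let ?U = "set_mset ?E \<union> set_mset ?E'"
  have "?U \<noteq> {}"
  proof
    assume "?U = {}"
    then have "?E = {#}" "?E' = {#}" by auto
    then show False using ne by (simp add: Diff_eq_empty_iff_mset)
  qed
  moreover have "b < e" if "(b, e) \<in> ?U" for b e
    using assms that unfolding diagram_of_def by (auto dest: in_diffD)
  ultimately obtain P s t where P: "P \<in> ?U" and st: "s \<le> t"
    and iso: "\<And>p. p \<in> ?U \<Longrightarrow> fst p \<le> ereal s \<and> ereal t < snd p \<longleftrightarrow> p = P"
    using isolating_quadrant[of ?U] by (metis (lifting) finite_UnI finite_set_mset)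
  let ?Q = "\<lambda>(b, e). b \<le> ereal s \<and> ereal t < e"
  have filt: "filter_mset ?Q E = filter_mset (\<lambda>p. p = P) E" if "set_mset E \<subseteq> ?U" for E
    using iso that by (intro filter_mset_cong refl) (auto simp: case_prod_beta)
  have "size (filter_mset ?Q D) = size (filter_mset ?Q D')"
    using assms st by (auto simp: diagram_of_def quadrant_count_def)
  then have "size (filter_mset ?Q ?E) = size (filter_mset ?Q ?E')"
    using size_filter_minus_Int[of ?Q D D'] size_filter_minus_Int[of ?Q D' D, unfolded subset_mset.inf_commute[of D' D]] by linarith
  then have "size (filter_mset (\<lambda>p. p = P) ?E) = size (filter_mset (\<lambda>p. p = P) ?E')"
    using filt[of ?E] filt[of ?E'] by simp
  then have "count ?E P = count ?E' P" by (simp add: filter_eq_replicate_mset)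
  then show False using P by (simp flip: count_greater_zero_iff)
qed

lemma sum_telescope_down:
  fixes f :: "nat \<Rightarrow> int"
  shows "b \<le> n \<Longrightarrow> (\<Sum>j\<in>{b<..n}. f (j - 1) - f j) = f b - f n"
proof (induction n rule: dec_induct)
  case (step n)
  then have "{b<..Suc n} = insert (Suc n) {b<..n}" by auto
  then show ?case using step by simp
qed simp

lemma finite_set_enumeration:
  fixes C :: "real set"
  assumes "finite C"
  obtains c where "\<And>i j. 1 \<le> i \<Longrightarrow> i < j \<Longrightarrow> j \<le> card C \<Longrightarrow> c i < c j" "C = c ` {1..card C}"
proof -
  let ?l = "sorted_list_of_set C"
  have l: "set ?l = C" "length ?l = card C" "sorted_wrt (<) ?l" using assms by auto
  show thesis
  proof (rule that[of "\<lambda>i. ?l ! (i - 1)"])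
    fix i j :: nat assume "1 \<le> i" "i < j" "j \<le> card C"
    then show "?l ! (i - 1) < ?l ! (j - 1)" using l by (intro sorted_wrt_nth_less[of "(<)"]) auto
  next
    show "C = (\<lambda>i. ?l ! (i - 1)) ` {1..card C}"
    proof (intro equalityI subsetI)
      fix x assume "x \<in> C"
      then obtain i where "i < card C" "x = ?l ! i" using l by (metis in_set_conv_nth)
      then show "x \<in> (\<lambda>i. ?l ! (i - 1)) ` {1..card C}" by (intro image_eqI[of _ _ "Suc i"]) auto
    next
      fix x assume "x \<in> (\<lambda>i. ?l ! (i - 1)) ` {1..card C}"
      then obtain i where i: "1 \<le> i" "i \<le> card C" "x = ?l ! (i - 1)" by auto
      then have "x \<in> set ?l" using l(2) by (simp del: set_sorted_list_of_set)
      then show "x \<in> C" using l(1) by simp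
    qed
  qed
qed

text \<open>The multiplicities are obtained from the ranks at the critical values by inclusion-exclusion.\<close>

lemma diagram_of_exists:
  fixes R :: "real \<Rightarrow> real \<Rightarrow> nat"
  assumes C: "finite C"
    and left: "\<And>s s' t. s \<le> s' \<Longrightarrow> s' \<le> t \<Longrightarrow> {s<..s'} \<inter> C = {} \<Longrightarrow> R s t = R s' t"
    and right: "\<And>s t t'. s \<le> t \<Longrightarrow> t \<le> t' \<Longrightarrow> {t<..t'} \<inter> C = {} \<Longrightarrow> R s t = R s t'"
    and zero: "\<And>s t. s \<le> a0 \<Longrightarrow> s \<le> t \<Longrightarrow> R s t = 0"
    and mono: "\<And>s s' t. s \<le> s' \<Longrightarrow> s' \<le> t \<Longrightarrow> R s t \<le> R s' t"
    and box: "\<And>s s' t t'. s \<le> s' \<Longrightarrow> s' \<le> t \<Longrightarrow> t \<le> t' \<Longrightarrow> R s t + R s' t' \<le> R s' t + R s t'"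
    and bound: "\<And>s. R s s \<le> N"
  shows "\<exists>D. diagram_of R D \<and> size D \<le> card C * N"
proof -
  let ?m = "card C"
  obtain c where c: "\<And>i j. 1 \<le> i \<Longrightarrow> i < j \<Longrightarrow> j \<le> ?m \<Longrightarrow> c i < c j" "C = c ` {1..?m}"
    by (rule finite_set_enumeration[OF C]) (rule that; blast)
  have c_le: "c i \<le> c j" if "1 \<le> i" "i \<le> j" "j \<le> ?m" for i j using c(1)[of i j] that by (cases "i = j") auto
  have C_E: "\<exists>i. 1 \<le> i \<and> i \<le> ?m \<and> x = c i" if "x \<in> C" for x
    using that by (subst (asm) c(2)) auto
  have idx: "\<exists>a\<le>?m. (\<forall>i. 1 \<le> i \<and> i \<le> ?m \<longrightarrow> (c i \<le> s \<longleftrightarrow> i \<le> a))" for s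
  proof -
    define a where "a = Max (insert 0 {i. 1 \<le> i \<and> i \<le> ?m \<and> c i \<le> s})"
    have fin: "finite (insert 0 {i. 1 \<le> i \<and> i \<le> ?m \<and> c i \<le> s})" by simp
    have a: "a \<in> insert 0 {i. 1 \<le> i \<and> i \<le> ?m \<and> c i \<le> s}" unfolding a_def by (rule Max_in[OF fin]) simp
    have "c i \<le> s \<longleftrightarrow> i \<le> a" if i: "1 \<le> i" "i \<le> ?m" for i
    proof
      assume "c i \<le> s"
      then show "i \<le> a" unfolding a_def using i by (intro Max_ge[OF fin]) auto
    next
      assume "i \<le> a"
      then show "c i \<le> s" using a i c_le[of i a] by auto
    qed
    then show ?thesis using a by (intro exI[of _ a]) auto
  qed
  have low: "R s t = 0" if "s \<le> t" "\<And>x. x \<in> C \<Longrightarrow> s < x" for s t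
  proof -
    have "R (min a0 s) t = R s t" using that by (intro left) force+
    then show ?thesis using zero[of "min a0 s" t] that by simp
  qed
  define r :: "nat \<Rightarrow> nat \<Rightarrow> int" where
    "r i j = (if i = 0 \<or> j = Suc ?m then 0 else int (R (c i) (c j)))" for i j
  define \<mu> where "\<mu> i j = (r i (j - 1) - r i j) - (r (i - 1) (j - 1) - r (i - 1) j)" for i j
  have \<mu>: "0 \<le> \<mu> i j" if ij: "1 \<le> i" "i < j" "j \<le> Suc ?m" for i j
  proof -
    define s0 where "s0 = (if i = 1 then min a0 (c i) else c (i - 1))"
    have s0: "s0 \<le> c i" using ij c_le[of "i - 1" i] by (auto simp: s0_def)
    have r0: "r (i - 1) l = (if l = Suc ?m then 0 else int (R s0 (c l)))" if "i \<le> l" "l \<le> Suc ?m" for l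
    proof (cases "l = Suc ?m")
      case False
      then have "c i \<le> c l" using that ij c_le[of i l] by simp
      then show ?thesis using zero[of s0 "c l"] ij s0 by (auto simp: r_def s0_def)
    qed (simp add: r_def)
    have ri: "r i l = (if l = Suc ?m then 0 else int (R (c i) (c l)))" for l using ij by (simp add: r_def)
    obtain l where l: "j = Suc l" using ij(2) by (cases j) auto
    have il: "i \<le> l" "1 \<le> l" "l \<le> ?m" using ij unfolding l by auto
    have c1: "c i \<le> c l" by (rule c_le[OF ij(1) il(1,3)])
    have nl: "l \<noteq> Suc ?m" using il(3) by auto
    have rl: "r i l = int (R (c i) (c l))" "r (i - 1) l = int (R s0 (c l))"
      using ri[of l] r0[OF il(1)] il(3) nl by auto
    have \<mu>': "\<mu> i j = (r i l - r i (Suc l)) - (r (i - 1) l - r (i - 1) (Suc l))" by (simp add: \<mu>_def l)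
    show ?thesis
    proof (cases "l = ?m")
      case True
      then show ?thesis using mono[OF s0 c1] unfolding \<mu>' rl by (simp add: r_def)
    next
      case False
      then have lm: "Suc l \<le> ?m" using il(3) by auto
      then have "r i (Suc l) = int (R (c i) (c (Suc l)))" "r (i - 1) (Suc l) = int (R s0 (c (Suc l)))"
        using ri[of "Suc l"] r0[of "Suc l"] il(1) by auto
      moreover have "c l \<le> c (Suc l)" using c_le[OF il(2) _ lm] by simp
      ultimately show ?thesis using box[OF s0 c1, of "c (Suc l)"] unfolding \<mu>' rl by linarith
    qed
  qed
  define pt where "pt i j = (ereal (c i), if j \<le> ?m then ereal (c j) else \<infinity>)" for i j
  define D where "D = (\<Sum>i\<in>{0<..?m}. \<Sum>j\<in>{i<..Suc ?m}. replicate_mset (nat (\<mu> i j)) (pt i j))"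
  have inner: "(\<Sum>j\<in>{b<..Suc ?m}. \<mu> i j) = (r i b - r i (Suc ?m)) - (r (i - 1) b - r (i - 1) (Suc ?m))" if "b \<le> Suc ?m" for i b
    unfolding \<mu>_def sum_subtractf using sum_telescope_down[OF that] by (simp add: sum_subtractf)
  have count: "quadrant_count D s t = R s t" if st: "s \<le> t" for s t
  proof -
    obtain a where a: "a \<le> ?m" "\<And>i. 1 \<le> i \<Longrightarrow> i \<le> ?m \<Longrightarrow> c i \<le> s \<longleftrightarrow> i \<le> a" using idx[of s] by blast
    obtain b where b: "b \<le> ?m" "\<And>i. 1 \<le> i \<Longrightarrow> i \<le> ?m \<Longrightarrow> c i \<le> t \<longleftrightarrow> i \<le> b" using idx[of t] by blast
    have ab: "a \<le> b"
    proof (cases "a = 0")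
      case False
      then show ?thesis using a(2)[of a] b(2)[of a] a(1) st by simp
    qed simp
    have "int (quadrant_count D s t) = (\<Sum>i\<in>{0<..?m}. \<Sum>j\<in>{i<..Suc ?m}. if i \<le> a \<and> b < j then \<mu> i j else 0)"
      unfolding quadrant_count_def D_def size_filter_sum size_filter_replicate of_nat_sum
    proof (intro sum.cong refl)
      fix i j assume "i \<in> {0<..?m}" "j \<in> {i<..Suc ?m}"
      then have ij: "1 \<le> i" "i \<le> ?m" "i < j" "j \<le> Suc ?m" by auto
      have "(case pt i j of (b, e) \<Rightarrow> b \<le> ereal s \<and> ereal t < e) \<longleftrightarrow> i \<le> a \<and> b < j"
      proof (cases "j \<le> ?m")
        case True
        have "1 \<le> j" using ij by linarith
        from b(2)[OF this True] show ?thesis using a(2)[OF ij(1,2)] True by (simp add: pt_def flip: not_le)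
      next
        case False
        then show ?thesis using a(2)[OF ij(1,2)] b(1) by (simp add: pt_def)
      qed
      then show "int (if case pt i j of (b, e) \<Rightarrow> b \<le> ereal s \<and> ereal t < e then nat (\<mu> i j) else 0) =
        (if i \<le> a \<and> b < j then \<mu> i j else 0)" using \<mu>[OF ij(1,3,4)] by simp
    qed
    also have "\<dots> = (\<Sum>i\<in>{0<..a}. \<Sum>j\<in>{b<..Suc ?m}. \<mu> i j)"
    proof (rule sum.mono_neutral_cong_right)
      show "\<forall>i\<in>{0<..?m} - {0<..a}. (\<Sum>j\<in>{i<..Suc ?m}. if i \<le> a \<and> b < j then \<mu> i j else 0) = 0" by auto
      fix i assume "i \<in> {0<..a}"
      then show "(\<Sum>j\<in>{i<..Suc ?m}. if i \<le> a \<and> b < j then \<mu> i j else 0) = (\<Sum>j\<in>{b<..Suc ?m}. \<mu> i j)"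
        using ab by (intro sum.mono_neutral_cong_right) auto
    qed (use a(1) in auto)
    also have "\<dots> = (\<Sum>i\<in>{0<..a}. - (r (i - 1) b) - - (r i b))"
    proof (rule sum.cong[OF refl])
      fix i
      show "(\<Sum>j\<in>{b<..Suc ?m}. \<mu> i j) = - r (i - 1) b - - r i b" using inner[of b i] b(1) by (simp add: r_def)
    qed
    also have "\<dots> = r a b" using sum_telescope_down[of 0 a "\<lambda>i. - r i b"] by (simp add: r_def)
    also have "\<dots> = int (R s t)"
    proof (cases "a = 0")
      case True
      have "R s t = 0" using st a(2) True C_E by (intro low) (force simp flip: not_le)+
      then show ?thesis using True by (simp add: r_def)
    next
      case False
      have cab: "c a \<le> s" "c b \<le> t" "c a \<le> c b" using a b ab False c_le[of a b] by auto
      have "R (c a) (c b) = R (c a) t"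
      proof (rule right[OF cab(3,2)])
        show "{c b<..t} \<inter> C = {}" 
        proof (rule equals0I)
          fix x assume x: "x \<in> {c b<..t} \<inter> C"
          then obtain i where i: "1 \<le> i" "i \<le> ?m" "x = c i" using C_E by blast
          then show False using x b(2)[OF i(1,2)] c_le[of i b] b(1) by simp
        qed
      qed
      also have "\<dots> = R s t"
      proof (rule left[OF cab(1) st])
        show "{c a<..s} \<inter> C = {}" 
        proof (rule equals0I)
          fix x assume x: "x \<in> {c a<..s} \<inter> C"
          then obtain i where i: "1 \<le> i" "i \<le> ?m" "x = c i" using C_E by blast
          then show False using x a(2)[OF i(1,2)] c_le[of i a] a(1) by simp
        qed
      qed
      finally show ?thesis using False b(1) by (simp add: r_def)
    qed
    finally show ?thesis by simp
  qed
  have pts: "b < e" if be: "(b, e) \<in># D" for b e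
  proof -
    obtain i j where ij: "i \<in> {0<..?m}" "j \<in> {i<..Suc ?m}" "(b, e) = pt i j"
      using be by (auto simp: D_def set_mset_sum in_replicate_mset)
    then show ?thesis using c(1)[of i j] by (auto simp: pt_def split: if_splits)
  qed
  have "int (size D) = (\<Sum>i\<in>{0<..?m}. \<Sum>j\<in>{i<..Suc ?m}. int (nat (\<mu> i j)))"
    by (simp add: D_def)
  also have "\<dots> = (\<Sum>i\<in>{0<..?m}. \<Sum>j\<in>{i<..Suc ?m}. \<mu> i j)" using \<mu> by (intro sum.cong refl) auto
  also have "\<dots> \<le> (\<Sum>i\<in>{0<..?m}. int N)"
  proof (rule sum_mono)
    fix i assume i: "i \<in> {0<..?m}"
    have "(\<Sum>j\<in>{i<..Suc ?m}. \<mu> i j) = r i i - r (i - 1) i" using i by (subst inner) (auto simp: r_def)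
    also have "\<dots> \<le> int N" using bound[of "c i"] i by (auto simp: r_def)
    finally show "(\<Sum>j\<in>{i<..Suc ?m}. \<mu> i j) \<le> int N" .
  qed
  finally have "int (size D) \<le> int (?m * N)" by simp
  then have "size D \<le> ?m * N" by linarith
  then show ?thesis using count pts unfolding diagram_of_def by blast
qed


subsection \<open>Matchings between finite diagrams\<close>

lemma labelled_points_finite_diagram:
  "labelled_points (\<lambda>P. enat (count D P)) = (SIGMA P:set_mset D. {..<count D P})"
  by (auto simp: labelled_points_def simp flip: count_greater_zero_iff)

lemma finite_labelled_points: "finite (labelled_points (\<lambda>P. enat (count D P)))"
  by (simp add: labelled_points_finite_diagram)

lemma card_labelled_points: "card {x \<in> labelled_points (\<lambda>P. enat (count D P)). Q (fst x)} = size (filter_mset Q D)"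
proof -
  have "{x \<in> labelled_points (\<lambda>P. enat (count D P)). Q (fst x)} = (SIGMA P:set_mset (filter_mset Q D). {..<count (filter_mset Q D) P})"
    unfolding labelled_points_finite_diagram by auto
  then show ?thesis by (simp add: size_multiset_overloaded_eq)
qed

lemma Dgm_finite_diagram:
  assumes "\<And>b e. (b, e) \<in># D \<Longrightarrow> b < e"
  shows "(\<lambda>P. enat (count D P)) \<in> Dgm"
  unfolding Dgm_def
proof (intro CollectI conjI)
  let ?D = "\<lambda>P. enat (count D P)"
  have supp: "{P. ?D P \<noteq> 0} = set_mset D" by (auto simp: zero_enat_def)
  show "countable {P. ?D P \<noteq> 0}" unfolding supp by (simp add: countable_finite)
  show "\<forall>(b, e)\<in>{P. ?D P \<noteq> 0}. b \<noteq> \<infinity> \<and> e \<noteq> - \<infinity> \<and> b \<le> e"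
    unfolding supp using assms by (force simp: less_imp_le)
  have eq: "{(P, i) \<in> labelled_points ?D. R P} = {x \<in> labelled_points ?D. R (fst x)}" for R by auto
  show "finite {(P, i) \<in> labelled_points ?D. \<not> finite_point P}"
    unfolding eq using finite_labelled_points[of D] by simp
  have "finite {(P, i) \<in> labelled_points ?D. finite_point P}"
    unfolding eq using finite_labelled_points[of D] by simp
  moreover have "e2ennreal (snd P - fst P) < \<infinity>" if "finite_point P" for P :: "ereal \<times> ereal"
  proof -
    obtain b e where "fst P = ereal b" "snd P = ereal e" using \<open>finite_point P\<close> unfolding finite_point_def by (metis abs_neq_infinity_cases)
    then show ?thesis by simp
  qed
  ultimately show "(\<Sum>\<^sub>\<infinity>(P, i)\<in>{(P, i) \<in> labelled_points ?D. finite_point P}. e2ennreal (snd P - fst P)) < \<infinity>"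
    by (subst infsum_finite) (auto simp: case_prod_beta)
qed

lemma matching_exists:
  fixes D D' :: "(ereal \<times> ereal) multiset" and q :: "ereal \<times> ereal \<Rightarrow> 'c"
  defines "B \<equiv> \<lambda>P. enat (count D P)" and "B' \<equiv> \<lambda>P. enat (count D' P)"
  assumes far: "\<And>c. c \<in> F \<Longrightarrow> size {#p \<in># D. q p = c#} = size {#p \<in># D'. q p = c#}"
    and near: "\<And>p. p \<in># D + D' \<Longrightarrow> q p \<notin> F \<Longrightarrow> finite_point p \<and> point_dist p (diagonal_image p) \<le> \<delta>"
    and close: "\<And>p p'. p \<in># D \<Longrightarrow> p' \<in># D' \<Longrightarrow> q p = q p' \<Longrightarrow> q p \<in> F \<Longrightarrow>
      point_dist p p' \<le> \<delta> \<and> (fst p = - \<infinity> \<longleftrightarrow> fst p' = - \<infinity>) \<and> (snd p = \<infinity> \<longleftrightarrow> snd p' = \<infinity>)"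
  shows "\<exists>\<sigma>. is_matching B B' \<sigma> \<and> finite (completed_matching B B' \<sigma>) \<and>
    card (completed_matching B B' \<sigma>) \<le> size D + size D' \<and> (\<forall>x\<in>completed_matching B B' \<sigma>. pair_dist x \<le> \<delta>)"
proof -
  let ?L = "labelled_points B" and ?L' = "labelled_points B'"
  have fin: "finite ?L" "finite ?L'" unfolding B_def B'_def by (rule finite_labelled_points)+
  have inD: "fst x \<in># D" if "x \<in> ?L" for x using that unfolding B_def labelled_points_finite_diagram by auto
  have inD': "fst x \<in># D'" if "x \<in> ?L'" for x using that unfolding B'_def labelled_points_finite_diagram by auto
  have "\<exists>g. bij_betw g {x \<in> ?L. q (fst x) = c} {x \<in> ?L'. q (fst x) = c}" if c: "c \<in> F" for c
  proof (rule finite_same_card_bij)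
    show "card {x \<in> ?L. q (fst x) = c} = card {x \<in> ?L'. q (fst x) = c}"
      using far[OF c] card_labelled_points[of D "\<lambda>p. q p = c"] card_labelled_points[of D' "\<lambda>p. q p = c"]
      unfolding B_def B'_def by simp
    show "finite {x \<in> ?L. q (fst x) = c}" "finite {x \<in> ?L'. q (fst x) = c}"
      using fin by (intro finite_Collect_conjI disjI1; simp)+
  qed
  then have "\<forall>c\<in>F. \<exists>g. bij_betw g {x \<in> ?L. q (fst x) = c} {x \<in> ?L'. q (fst x) = c}" by blast
  from bchoice[OF this] obtain g where
    g: "bij_betw (g c) {x \<in> ?L. q (fst x) = c} {x \<in> ?L'. q (fst x) = c}" if "c \<in> F" for c by blast
  define h where "h x = g (q (fst x)) x" for x
  define \<sigma> where "\<sigma> = (\<lambda>x. (x, h x)) ` {x \<in> ?L. q (fst x) \<in> F}"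
  have h: "h x \<in> ?L'" "q (fst (h x)) = q (fst x)" if "x \<in> ?L" "q (fst x) \<in> F" for x
    using bij_betw_apply[OF g[OF that(2)], of x] that(1) by (auto simp: h_def)
  have h_inj: "x = y" if xy: "x \<in> ?L" "q (fst x) \<in> F" "y \<in> ?L" "q (fst y) \<in> F" "h x = h y" for x y
  proof -
    have "q (fst x) = q (fst y)" using h xy by metis
    then show ?thesis using inj_onD[OF bij_betw_imp_inj_on[OF g[OF xy(2)]], of x y] xy by (simp add: h_def)
  qed
  have h_surj: "\<exists>x\<in>?L. q (fst x) \<in> F \<and> h x = y" if y: "y \<in> ?L'" "q (fst y) \<in> F" for y
  proof -
    have "y \<in> g (q (fst y)) ` {x \<in> ?L. q (fst x) = q (fst y)}"
      using g[OF y(2)] y(1) unfolding bij_betw_def by auto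
    then obtain x where "x \<in> ?L" "q (fst x) = q (fst y)" "y = g (q (fst y)) x" by blast
    then show ?thesis using y(2) by (intro bexI[of _ x]) (simp_all add: h_def)
  qed
  have fst: "fst ` \<sigma> = {x \<in> ?L. q (fst x) \<in> F}" by (auto simp: \<sigma>_def image_image)
  have "snd ` \<sigma> = h ` {x \<in> ?L. q (fst x) \<in> F}" by (simp add: \<sigma>_def image_image)
  also have "\<dots> = {y \<in> ?L'. q (fst y) \<in> F}"
  proof (intro equalityI subsetI)
    fix y assume "y \<in> {y \<in> ?L'. q (fst y) \<in> F}"
    then show "y \<in> h ` {x \<in> ?L. q (fst x) \<in> F}" using h_surj[of y] by blast
  qed (use h in auto)
  finally have snd: "snd ` \<sigma> = {y \<in> ?L'. q (fst y) \<in> F}" .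
  have far_dist: "point_dist P Q \<le> \<delta>" "fst P = - \<infinity> \<longleftrightarrow> fst Q = - \<infinity>" "snd P = \<infinity> \<longleftrightarrow> snd Q = \<infinity>"
    if "((P, i), (Q, j)) \<in> \<sigma>" for P i Q j
  proof -
    obtain x where x: "x \<in> ?L" "q (fst x) \<in> F" "(P, i) = x" "(Q, j) = h x" using \<open>_ \<in> \<sigma>\<close> by (auto simp: \<sigma>_def)
    have PQ: "P = fst x" "Q = fst (h x)" using x(3,4) by (metis fst_conv)+
    show "point_dist P Q \<le> \<delta>" "fst P = - \<infinity> \<longleftrightarrow> fst Q = - \<infinity>" "snd P = \<infinity> \<longleftrightarrow> snd Q = \<infinity>"
      unfolding PQ using close[OF inD[OF x(1)] inD'[OF h(1)[OF x(1,2)]] h(2)[OF x(1,2), symmetric] x(2)] by auto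
  qed
  have near1: "finite_point (fst x) \<and> point_dist (fst x) (diagonal_image (fst x)) \<le> \<delta>" if "x \<in> ?L - fst ` \<sigma>" for x
    using that inD near[of "fst x"] unfolding fst by auto
  have near2: "finite_point (fst x) \<and> point_dist (fst x) (diagonal_image (fst x)) \<le> \<delta>" if "x \<in> ?L' - snd ` \<sigma>" for x
    using that inD' near[of "fst x"] unfolding snd by auto
  have inj: "inj_on fst \<sigma>" "inj_on snd \<sigma>"
    using h_inj by (auto simp: inj_on_def \<sigma>_def)
  have match: "is_matching B B' \<sigma>" unfolding is_matching_def
  proof (intro conjI inj)
    show "\<sigma> \<subseteq> ?L \<times> ?L'" using h by (auto simp: \<sigma>_def)
    show "\<forall>((P, i), Q, j)\<in>\<sigma>. (fst P = - \<infinity> \<longleftrightarrow> fst Q = - \<infinity>) \<and> (snd P = \<infinity> \<longleftrightarrow> snd Q = \<infinity>)"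
      using far_dist by blast
    show "\<forall>(P, i)\<in>?L - fst ` \<sigma>. finite_point P" "\<forall>(Q, j)\<in>?L' - snd ` \<sigma>. finite_point Q"
      using near1 near2 by fastforce+
  qed
  let ?C = "completed_matching B B' \<sigma>"
  have fs: "finite \<sigma>" using fin by (simp add: \<sigma>_def)
  have "card ?C \<le> card (map_prod Some Some ` \<sigma>) + card ((\<lambda>I. (Some I, None :: ((ereal \<times> ereal) \<times> nat) option)) ` (?L - fst ` \<sigma>)) +
      card ((\<lambda>J. (None :: ((ereal \<times> ereal) \<times> nat) option, Some J)) ` (?L' - snd ` \<sigma>))"
    unfolding completed_matching_def by (meson add_mono_thms_linordered_semiring(3) card_Un_le order_trans)
  also have "\<dots> \<le> card \<sigma> + card (?L - fst ` \<sigma>) + card (?L' - snd ` \<sigma>)"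
    using fs fin by (intro add_mono card_image_le) auto
  also have "\<dots> \<le> card ?L + card ?L'"
  proof -
    have "card (fst ` \<sigma>) \<le> card ?L" "card (?L - fst ` \<sigma>) = card ?L - card (fst ` \<sigma>)"
      using fin fs fst by (auto intro!: card_mono card_Diff_subset)
    then have "card (?L - fst ` \<sigma>) = card ?L - card \<sigma>" "card \<sigma> \<le> card ?L"
      by (simp_all add: card_image[OF inj(1)])
    moreover have "card (?L' - snd ` \<sigma>) \<le> card ?L'" using fin by (intro card_mono) auto
    ultimately show ?thesis by simp
  qed
  also have "\<dots> = size D + size D'"
    using card_labelled_points[of D "\<lambda>_. True"] card_labelled_points[of D' "\<lambda>_. True"] by (simp add: B_def B'_def)
  finally have card: "card ?C \<le> size D + size D'" .
  have "finite ?C" unfolding completed_matching_def using fs fin by simp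
  moreover have "pair_dist x \<le> \<delta>" if "x \<in> ?C" for x
  proof -
    consider y where "y \<in> \<sigma>" "x = map_prod Some Some y" | I where "I \<in> ?L - fst ` \<sigma>" "x = (Some I, None)"
      | J where "J \<in> ?L' - snd ` \<sigma>" "x = (None, Some J)" using \<open>x \<in> ?C\<close> unfolding completed_matching_def
      by (elim UnE imageE; blast)
    then show ?thesis
    proof cases
      case 1
      then show ?thesis using far_dist(1) by (cases y) auto
    next
      case 2
      then show ?thesis using near1[OF 2(1)] by (cases I) auto
    next
      case 3
      then show ?thesis using near2[OF 3(1)] by (cases J) auto
    qed
  qed
  ultimately show ?thesis using match card by blast
qed

lemma ennreal_powr_le:
  assumes "x \<le> ennreal a" "0 \<le> a" "0 \<le> r"
  shows "ennreal_powr x r \<le> ennreal (a powr r)"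
proof -
  have "x \<noteq> \<infinity>" using assms(1) by (auto simp: top_unique)
  moreover have "enn2real x \<le> a" using assms by (simp add: enn2real_leI)
  ultimately show ?thesis using assms by (simp add: ennreal_powr_def ennreal_leI powr_mono2)
qed

lemma lp_norm_le:
  assumes p: "1 \<le> p" and S: "finite S" "card S \<le> n" and c: "\<And>x. x \<in> S \<Longrightarrow> c x \<le> ennreal \<delta>" and \<delta>: "0 \<le> \<delta>"
  shows "lp_norm p S c \<le> ennreal (real (Suc n) * \<delta>)"
proof (cases "p = \<infinity>")
  case True
  have "\<delta> \<le> real (Suc n) * \<delta>" using \<delta> by (simp add: algebra_simps)
  then have "c x \<le> ennreal (real (Suc n) * \<delta>)" if "x \<in> S" for x using c[OF that] ennreal_leI order_trans by blast
  then show ?thesis using True by (simp add: lp_norm_def SUP_least)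
next
  case False
  define r where "r = enn2real p"
  have "p = ennreal r" using False by (simp add: r_def less_top)
  then have r: "1 \<le> r" using p by simp
  have "(\<Sum>\<^sub>\<infinity>x\<in>S. ennreal_powr (c x) r) = (\<Sum>x\<in>S. ennreal_powr (c x) r)" using S(1) by (rule infsum_finite)
  also have "\<dots> \<le> (\<Sum>x\<in>S. ennreal (\<delta> powr r))" using c \<delta> r by (intro sum_mono ennreal_powr_le) auto
  also have "\<dots> = ennreal (real (card S) * \<delta> powr r)" by (simp add: ennreal_mult ennreal_of_nat_eq_real_of_nat)
  also have "\<dots> \<le> ennreal (real (Suc n) * \<delta> powr r)" using S(2) by (intro ennreal_leI mult_right_mono) auto
  finally have "ennreal_powr (\<Sum>\<^sub>\<infinity>x\<in>S. ennreal_powr (c x) r) (1 / r) \<le> ennreal ((real (Suc n) * \<delta> powr r) powr (1 / r))"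
    using r by (intro ennreal_powr_le) auto
  also have "(real (Suc n) * \<delta> powr r) powr (1 / r) = real (Suc n) powr (1 / r) * \<delta>"
    using \<delta> r by (simp add: powr_mult powr_powr)
  also have "ennreal (real (Suc n) powr (1 / r) * \<delta>) \<le> ennreal (real (Suc n) powr 1 * \<delta>)"
    using r \<delta> by (intro ennreal_leI mult_right_mono powr_mono) auto
  finally show ?thesis using False by (simp add: lp_norm_def r_def)
qed


section \<open>Height functions on a definable set\<close>

definition height_sublevel :: "'a::real_inner set \<Rightarrow> 'a \<Rightarrow> real \<Rightarrow> 'a set" where
  "height_sublevel M v t = {x \<in> M. v \<bullet> x \<le> t}"

definition height_rank :: "'k::field itself \<Rightarrow> nat \<Rightarrow> 'a::real_inner set \<Rightarrow> 'a \<Rightarrow> real \<Rightarrow> real \<Rightarrow> nat" where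
  "height_rank K k M v s t = inclusion_rank K k (height_sublevel M v s) (height_sublevel M v t)"

definition critical_heights :: "'a::euclidean_space set \<Rightarrow> 'a \<Rightarrow> real set" where
  "critical_heights M v = {t. \<not> regular_value (height_sublevel M v) t}"

lemma height_sublevel_mono: "s \<le> t \<Longrightarrow> height_sublevel M v s \<subseteq> height_sublevel M v t"
  by (auto simp: height_sublevel_def)

lemma height_sublevel_perturb:
  assumes "\<And>x. x \<in> M \<Longrightarrow> norm x \<le> \<rho>" "dist w v * \<rho> \<le> \<kappa>" "s + \<kappa> \<le> t"
  shows "height_sublevel M v s \<subseteq> height_sublevel M w t"
proof
  fix x assume x: "x \<in> height_sublevel M v s"
  then have xM: "norm x \<le> \<rho>" using assms(1) by (simp add: height_sublevel_def)
  have "w \<bullet> x - v \<bullet> x \<le> norm (w - v) * norm x" by (simp add: norm_cauchy_schwarz flip: inner_diff_left)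
  also have "\<dots> \<le> dist w v * \<rho>" using xM by (simp add: dist_norm mult_left_mono)
  finally show "x \<in> height_sublevel M w t" using x assms(2,3) by (simp add: height_sublevel_def)
qed

context o_minimal_structure
begin

lemma definable_set_imp_definable:
  fixes M :: "(real ^ 'n) set"
  assumes "definable_set \<O> M"
  shows "definable (\<lambda>x. x \<in> M)"
proof -
  let ?n = "CARD('n)"
  obtain e :: "nat \<Rightarrow> 'n" where e: "bij_betw e {..<?n} UNIV" and A: "(\<lambda>x. map (\<lambda>i. x $ e i) [0..<?n]) ` M \<in> \<O> ?n"
    using assms unfolding definable_set_def by blast
  have "\<exists>j<?n. \<forall>x::real^'n. x $ e i = coords x ! j" for i
  proof -
    have "axis (e i) 1 \<in> (Basis :: (real^'n) set)" by (simp add: axis_in_Basis_iff)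
    then obtain j where "j < DIM(real^'n)" "axis (e i) 1 = (basis_list :: (real^'n) list) ! j" using Basis_eq_nth by blast
    then show ?thesis by (intro exI[of _ j]) (auto simp: coords_nth cart_eq_inner_axis inner_commute)
  qed
  then obtain \<sigma> where \<sigma>: "\<And>i. \<sigma> i < ?n" "\<And>i (x::real^'n). x $ e i = coords x ! \<sigma> i" by metis
  have surj: "\<exists>i<?n. e i = l" for l using e unfolding bij_betw_def by (metis UNIV_I imageE lessThan_iff)
  have "coords ` M = {xs. length xs = ?n \<and> map (\<lambda>i. xs ! \<sigma> i) [0..<?n] \<in> (\<lambda>x. map (\<lambda>i. x $ e i) [0..<?n]) ` M}"
  proof (intro equalityI subsetI)
    fix xs assume "xs \<in> coords ` M"
    then show "xs \<in> {xs. length xs = ?n \<and> map (\<lambda>i. xs ! \<sigma> i) [0..<?n] \<in> (\<lambda>x. map (\<lambda>i. x $ e i) [0..<?n]) ` M}"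
      using \<sigma>(2) by (auto intro!: image_eqI)
  next
    fix xs assume "xs \<in> {xs. length xs = ?n \<and> map (\<lambda>i. xs ! \<sigma> i) [0..<?n] \<in> (\<lambda>x. map (\<lambda>i. x $ e i) [0..<?n]) ` M}"
    then obtain x where x: "length xs = ?n" "x \<in> M" "map (\<lambda>i. xs ! \<sigma> i) [0..<?n] = map (\<lambda>i. x $ e i) [0..<?n]" by auto
    obtain y :: "real^'n" where y: "coords y = xs" using coords_surj[of xs, where 'a = "real^'n"] x(1) by auto
    have "y $ l = x $ l" for l
    proof -
      obtain i where i: "i < ?n" "e i = l" using surj by blast
      have "map (\<lambda>i. xs ! \<sigma> i) [0..<?n] ! i = map (\<lambda>i. x $ e i) [0..<?n] ! i" by (simp only: x(3))
      then show ?thesis using i \<sigma>(2)[of y i] y by simp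
    qed
    then have "y = x" by (simp add: vec_eq_iff)
    then show "xs \<in> coords ` M" using x(2) y by blast
  qed
  also have "\<dots> \<in> \<O> ?n" by (rule reindex_mem[OF A]) (rule \<sigma>(1))
  finally show ?thesis by (simp add: definable_def)
qed

text \<open>Local constancy of the Betti numbers along lines, propagated over the whole parameter space by
  induction on the coordinate directions.\<close>

lemma betti_bounded:
  fixes A :: "'p::euclidean_space \<Rightarrow> 'a::euclidean_space set" and K :: "'k::field itself"
  assumes dA: "definable (\<lambda>z. snd z \<in> A (fst z))" and A: "\<And>u. compact (A u)" "\<And>u. A u \<subseteq> C" and C: "compact C"
  shows "\<exists>N. \<forall>u. inclusion_rank K k (A u) (A u) \<le> N"
proof (rule definable_imp_bounded[where Q = "\<lambda>N. \<exists>A :: 'p \<Rightarrow> 'a set.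
    definable (\<lambda>z. snd z \<in> A (fst z)) \<and> (\<forall>u. compact (A u) \<and> A u \<subseteq> C) \<and> N = (\<lambda>u. inclusion_rank K k (A u) (A u))"])
  fix N and g :: "'p \<Rightarrow> 'p"
  assume "\<exists>A :: 'p \<Rightarrow> 'a set. definable (\<lambda>z. snd z \<in> A (fst z)) \<and> (\<forall>u. compact (A u) \<and> A u \<subseteq> C) \<and>
    N = (\<lambda>u. inclusion_rank K k (A u) (A u))" and g: "definable_fun g"
  then obtain A :: "'p \<Rightarrow> 'a set" where A: "definable (\<lambda>z. snd z \<in> A (fst z))" "\<forall>u. compact (A u) \<and> A u \<subseteq> C"
    "N = (\<lambda>u. inclusion_rank K k (A u) (A u))" by blast
  have "definable_fun (\<lambda>z::'p \<times> 'a. (g (fst z), snd z))"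
    by (intro definable_fun_Pair definable_fun_compose[OF g] definable_intros)
  from definable_compose[OF A(1) this] have "definable (\<lambda>z. snd z \<in> A (g (fst z)))" by simp
  then show "\<exists>A' :: 'p \<Rightarrow> 'a set. definable (\<lambda>z. snd z \<in> A' (fst z)) \<and> (\<forall>u. compact (A' u) \<and> A' u \<subseteq> C) \<and>
    (\<lambda>x. N (g x)) = (\<lambda>u. inclusion_rank K k (A' u) (A' u))"
    using A(2,3) by (intro exI[of _ "\<lambda>u. A (g u)"]) auto
next
  fix N and b :: 'p
  assume "\<exists>A :: 'p \<Rightarrow> 'a set. definable (\<lambda>z. snd z \<in> A (fst z)) \<and> (\<forall>u. compact (A u) \<and> A u \<subseteq> C) \<and>
    N = (\<lambda>u. inclusion_rank K k (A u) (A u))"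
  then obtain A :: "'p \<Rightarrow> 'a set" where A: "definable (\<lambda>z. snd z \<in> A (fst z))" "\<And>u. compact (A u)" "\<And>u. A u \<subseteq> C"
    "N = (\<lambda>u. inclusion_rank K k (A u) (A u))" by blast
  let ?B = "\<lambda>w t. A (w + t *\<^sub>R b)"
  have memA: "definable (\<lambda>z. h z \<in> A (f z))"
    if "definable_fun f" "definable_fun h" for f :: "'c::euclidean_space \<Rightarrow> 'p" and h
    using definable_compose[OF A(1) definable_fun_Pair[OF that]] by simp
  have dB: "definable (\<lambda>z::('p \<times> real) \<times> 'a. snd z \<in> ?B (fst (fst z)) (snd (fst z)))"
    by (intro memA definable_intros)
  have "finite_family (\<lambda>w t. \<not> regular_value (?B w) t)"
    by (rule finite_family_singular_values[OF dB A(2) C A(3)])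
  moreover have "N (w + t *\<^sub>R b) = N (w + t' *\<^sub>R b)"
    if tt': "t \<le> t'" "\<forall>u. t \<le> u \<and> u \<le> t' \<longrightarrow> \<not> \<not> regular_value (?B w) u" for w t t'
  proof (rule locally_constant_imp_constant[OF tt'(1)])
    fix u assume u: "t \<le> u" "u \<le> t'"
    have dBw: "definable (\<lambda>x. x \<in> ?B w s)" for s by (intro memA definable_intros)
    obtain d W where d: "0 < d" "\<And>s. dist s u < d \<Longrightarrow> ?B w s \<subseteq> W \<and> homology_iso K k (?B w s) W"
      using regular_value_homology[of "?B w" u K k, OF dBw A(2)] tt'(2) u by blast
    have "N (w + s *\<^sub>R b) = inclusion_rank K k W W" if "dist s u < d" for s
    proof -
      have W: "?B w s \<subseteq> W" "homology_iso K k (?B w s) W" using d(2)[OF that] by blast+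
      have "inclusion_rank K k (?B w s) (?B w s) = inclusion_rank K k (?B w s) W"
        by (rule inclusion_rank_iso_right[OF finite_rank_definable[OF dBw A(2) order.refl] W(2) order.refl W(1)])
      also have "\<dots> = inclusion_rank K k W W"
        by (rule inclusion_rank_iso_left[OF finite_rank_definable[OF dBw A(2) W(1)] W(2,1) order.refl])
      finally show ?thesis by (simp add: A(4))
    qed
    then show "\<exists>d>0. \<forall>s. dist s u < d \<longrightarrow> N (w + s *\<^sub>R b) = N (w + u *\<^sub>R b)" using d(1) by (metis dist_self)
  qed
  ultimately show "\<exists>D. finite_family D \<and> (\<forall>w t t'. t \<le> t' \<and> (\<forall>u. t \<le> u \<and> u \<le> t' \<longrightarrow> \<not> D w u) \<longrightarrow>
      N (w + t *\<^sub>R b) = N (w + t' *\<^sub>R b))" by blast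
qed (use assms in blast)

context
  fixes M :: "'a::euclidean_space set" and K :: "'k::field itself"
  assumes M: "definable (\<lambda>x. x \<in> M)" "compact M"
begin

lemma definable_height_sublevel:
  "definable (\<lambda>z. snd z \<in> height_sublevel M (fst (fst z)) (snd (fst z)))"
  unfolding height_sublevel_def mem_Collect_eq by (intro definable_intros definable_mem[OF M(1)])

lemma definable_height_sublevel_fixed: "definable (\<lambda>x. x \<in> height_sublevel M v t)"
  unfolding height_sublevel_def mem_Collect_eq by (intro definable_intros definable_mem[OF M(1)])

lemma compact_height_sublevel: "compact (height_sublevel M v t)"
proof -
  have "closed {x. v \<bullet> x \<le> t}" by (rule closed_halfspace_le)
  from compact_Int_closed[OF M(2) this] show ?thesis by (simp add: height_sublevel_def Int_def)
qed

lemma height_sublevel_subset: "height_sublevel M v t \<subseteq> M"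
  by (auto simp: height_sublevel_def)

lemma critical_heights_bounded: "\<exists>c. \<forall>v. finite (critical_heights M v) \<and> card (critical_heights M v) \<le> c"
proof -
  have f: "finite_family (\<lambda>v t. \<not> regular_value (height_sublevel M v) t)"
    by (rule finite_family_singular_values[OF definable_height_sublevel compact_height_sublevel M(2) height_sublevel_subset])
  then have "\<exists>c. \<forall>v\<in>UNIV. card (critical_heights M v) \<le> c"
    using bounded_fibres_UNIV unfolding bounded_fibres_def critical_heights_def by blast
  then show ?thesis using f unfolding finite_family_def critical_heights_def by blast
qed

lemma finite_critical_heights: "finite (critical_heights M v)"
  using critical_heights_bounded by blast

lemma height_sublevel_iso:
  assumes "s \<le> t" "{s<..t} \<inter> critical_heights M v = {}"
  shows "homology_iso K k (height_sublevel M v s) (height_sublevel M v t)"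
proof (rule right_continuous_homology_iso[OF definable_height_sublevel_fixed compact_height_sublevel height_sublevel_mono])
  fix s
  show "(\<Inter>t\<in>{s<..}. height_sublevel M v t) \<subseteq> height_sublevel M v s"
  proof
    fix x assume x: "x \<in> (\<Inter>t\<in>{s<..}. height_sublevel M v t)"
    then have "x \<in> height_sublevel M v (s + 1)" by (rule INT_D) simp
    then have "x \<in> M" by (simp add: height_sublevel_def)
    moreover have "v \<bullet> x \<le> s" by (rule dense_ge) (use x in \<open>auto simp: height_sublevel_def\<close>)
    ultimately show "x \<in> height_sublevel M v s" by (simp add: height_sublevel_def)
  qed
qed (use assms in \<open>auto simp: critical_heights_def\<close>)

lemma finite_height_rank: "height_sublevel M v s \<subseteq> Y \<Longrightarrow> finite_rank K k (height_sublevel M v s) Y"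
  by (rule finite_rank_definable[OF definable_height_sublevel_fixed compact_height_sublevel])

lemma height_rank_left:
  assumes "s \<le> s'" "s' \<le> t" "{s<..s'} \<inter> critical_heights M v = {}"
  shows "height_rank K k M v s t = height_rank K k M v s' t"
  unfolding height_rank_def using assms
  by (intro inclusion_rank_iso_left finite_height_rank height_sublevel_iso height_sublevel_mono) auto

lemma height_rank_right:
  assumes "s \<le> t" "t \<le> t'" "{t<..t'} \<inter> critical_heights M v = {}"
  shows "height_rank K k M v s t = height_rank K k M v s t'"
  unfolding height_rank_def using assms
  by (intro inclusion_rank_iso_right finite_height_rank height_sublevel_iso height_sublevel_mono) auto

lemma bounded_norm: obtains \<rho> where "0 < \<rho>" "\<And>x. x \<in> M \<Longrightarrow> norm x \<le> \<rho>"
  using compact_imp_bounded[OF M(2)] unfolding bounded_pos by blast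

lemma height_rank_zero: "\<exists>a. \<forall>s t. s \<le> a \<longrightarrow> height_rank K k M v s t = 0"
proof -
  obtain \<rho> where \<rho>: "0 < \<rho>" "\<And>x. x \<in> M \<Longrightarrow> norm x \<le> \<rho>" by (rule bounded_norm) (rule that; blast)
  have "height_sublevel M v s = {}" if "s \<le> - (norm v * \<rho>) - 1" for s
  proof -
    have "s < v \<bullet> x" if "x \<in> M" for x
    proof -
      have "- (v \<bullet> x) \<le> norm v * norm x" using norm_cauchy_schwarz[of "- v" x] by simp
      also have "\<dots> \<le> norm v * \<rho>" using \<rho>(2)[OF that] by (intro mult_left_mono) auto
      finally show ?thesis using \<open>s \<le> _\<close> by simp
    qed
    then show ?thesis by (force simp: height_sublevel_def)
  qed
  then have "\<forall>s t. s \<le> - (norm v * \<rho>) - 1 \<longrightarrow> height_rank K k M v s t = 0"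
    by (simp add: height_rank_def inclusion_rank_empty)
  then show ?thesis by blast
qed

lemma height_diagram_exists: "\<exists>L. \<forall>v. \<exists>D. diagram_of (height_rank K k M v) D \<and> size D \<le> L"
proof -
  obtain c where c: "\<And>v. finite (critical_heights M v) \<and> card (critical_heights M v) \<le> c"
    using critical_heights_bounded by blast
  obtain N where N: "\<And>u. inclusion_rank K k (height_sublevel M (fst u) (snd u)) (height_sublevel M (fst u) (snd u)) \<le> N"
    using betti_bounded[OF definable_height_sublevel compact_height_sublevel height_sublevel_subset M(2)] by blast
  have "\<exists>D. diagram_of (height_rank K k M v) D \<and> size D \<le> c * N" for v
  proof -
    obtain a0 where a0: "\<And>s t. s \<le> a0 \<Longrightarrow> height_rank K k M v s t = 0" using height_rank_zero by blast
    have "\<exists>D. diagram_of (height_rank K k M v) D \<and> size D \<le> card (critical_heights M v) * N"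
    proof (rule diagram_of_exists)
      show "height_rank K k M v s t \<le> height_rank K k M v s' t" if "s \<le> s'" "s' \<le> t" for s s' t
        unfolding height_rank_def using that by (intro inclusion_rank_mono_left finite_height_rank height_sublevel_mono)
      show "height_rank K k M v s t + height_rank K k M v s' t' \<le> height_rank K k M v s' t + height_rank K k M v s t'"
        if "s \<le> s'" "s' \<le> t" "t \<le> t'" for s s' t t'
        unfolding height_rank_def using that by (intro inclusion_rank_box finite_height_rank height_sublevel_mono)
      show "height_rank K k M v s s \<le> N" for s using N[of "(v, s)"] by (simp add: height_rank_def)
    qed (use c a0 height_rank_left height_rank_right in auto)
    then show ?thesis using c[of v] by (meson mult_right_mono order_trans zero_le)
  qed
  then show ?thesis by blast
qed

lemma is_persistence_diagram_height:
  "is_persistence_diagram K k M (\<lambda>x. v \<bullet> x) D \<longleftrightarrow> diagram_of (height_rank K k M v) D"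
proof -
  have "inclusion_rank_eq K k (sublevel_space M (\<lambda>x. v \<bullet> x) s) (sublevel_space M (\<lambda>x. v \<bullet> x) t) n \<longleftrightarrow>
      n = height_rank K k M v s t" if "s \<le> t" for s t n
    using inclusion_rank_eq_inclusion_rank[OF height_sublevel_mono[OF that] finite_height_rank[OF height_sublevel_mono[OF that]]]
    unfolding height_rank_def sublevel_space_def height_sublevel_def by simp
  then show ?thesis unfolding is_persistence_diagram_def diagram_of_def quadrant_count_def by simp
qed

lemma PH_height:
  assumes "diagram_of (height_rank K k M v) D"
  shows "PH K k M (\<lambda>x. v \<bullet> x) = (\<lambda>P. enat (count D P))"
proof -
  have "(THE D. is_persistence_diagram K k M (\<lambda>x. v \<bullet> x) D) = D"
    unfolding is_persistence_diagram_height using assms diagram_of_unique by (intro the_equality)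
  then show ?thesis by (simp add: PH_def)
qed

lemma height_rank_stable:
  assumes \<rho>: "\<And>x. x \<in> M \<Longrightarrow> norm x \<le> \<rho>" and w: "dist w v * \<rho> \<le> \<kappa>" and \<kappa>: "0 \<le> \<kappa>" "s + \<kappa> \<le> t - \<kappa>"
    and s: "{s - \<kappa><..s + \<kappa>} \<inter> critical_heights M v = {}" and t: "{t - \<kappa><..t + \<kappa>} \<inter> critical_heights M v = {}"
  shows "height_rank K k M w s t = height_rank K k M v s t"
proof (rule antisym)
  have w': "dist v w * \<rho> \<le> \<kappa>" using w by (simp add: dist_commute)
  have sub: "{a<..b} \<inter> critical_heights M v = {}"
    if "{c<..d} \<inter> critical_heights M v = {}" "c \<le> a" "b \<le> d" for a b c d
    using that by (auto simp: disjoint_iff)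
  let ?S = "height_sublevel M"
  have "?S w s \<subseteq> ?S w t" "?S v (s + \<kappa>) \<subseteq> ?S v (t - \<kappa>)" using \<kappa> by (simp_all add: height_sublevel_mono)
  moreover have "?S v (t - \<kappa>) \<subseteq> ?S w t" "?S v (s - \<kappa>) \<subseteq> ?S w s"
    by (rule height_sublevel_perturb[OF \<rho> w]; simp)+
  moreover have "?S w s \<subseteq> ?S v (s + \<kappa>)" "?S w t \<subseteq> ?S v (t + \<kappa>)"
    by (rule height_sublevel_perturb[OF \<rho> w']; simp)+
  ultimately have inc: "?S w s \<subseteq> ?S w t" "?S w s \<subseteq> ?S v (s + \<kappa>)" "?S v (s + \<kappa>) \<subseteq> ?S v (t - \<kappa>)"
    "?S v (t - \<kappa>) \<subseteq> ?S w t" "?S v (s - \<kappa>) \<subseteq> ?S w s" "?S w t \<subseteq> ?S v (t + \<kappa>)" by blast+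
  have "height_rank K k M w s t \<le> inclusion_rank K k (?S v (s + \<kappa>)) (?S w t)"
    unfolding height_rank_def using inc by (intro inclusion_rank_mono_left finite_height_rank) auto
  also have "\<dots> \<le> height_rank K k M v (s + \<kappa>) (t - \<kappa>)"
    unfolding height_rank_def using inc by (intro inclusion_rank_mono_right finite_height_rank) auto
  also have "\<dots> = height_rank K k M v s (t - \<kappa>)"
    using \<kappa> by (intro height_rank_left[symmetric] sub[OF s]) auto
  also have "\<dots> = height_rank K k M v s t" using \<kappa> by (intro height_rank_right sub[OF t]) auto
  finally show "height_rank K k M w s t \<le> height_rank K k M v s t" .
  have "height_rank K k M v s t = height_rank K k M v s (t + \<kappa>)"
    using \<kappa> by (intro height_rank_right sub[OF t]) auto
  also have "\<dots> = height_rank K k M v (s - \<kappa>) (t + \<kappa>)"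
    using \<kappa> by (intro height_rank_left[symmetric] sub[OF s]) auto
  also have "\<dots> \<le> inclusion_rank K k (?S w s) (?S v (t + \<kappa>))"
    unfolding height_rank_def using inc by (intro inclusion_rank_mono_left finite_height_rank) auto
  also have "\<dots> \<le> height_rank K k M w s t"
    unfolding height_rank_def using inc by (intro inclusion_rank_mono_right finite_height_rank) auto
  finally show "height_rank K k M v s t \<le> height_rank K k M w s t" .
qed

lemma diagram_of_birth_finite:
  assumes D: "diagram_of (height_rank K k M v) D" and p: "(b, e) \<in># D"
  shows "b \<noteq> - \<infinity> \<and> b \<noteq> \<infinity>"
proof -
  have be: "b < e" using D p unfolding diagram_of_def by auto
  obtain a where a: "\<And>s t. s \<le> a \<Longrightarrow> height_rank K k M v s t = 0" using height_rank_zero by blast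
  have "b \<noteq> - \<infinity>"
  proof
    assume b: "b = - \<infinity>"
    obtain t where t: "b < ereal t" "ereal t < e" using ereal_dense2[OF be] by blast
    have "quadrant_count D (min a t) t = 0"
      using D a[of "min a t" t] unfolding diagram_of_def by simp
    moreover have "(b, e) \<in># {#(b, e) \<in># D. b \<le> ereal (min a t) \<and> ereal t < e#}" using p t b by simp
    ultimately show False unfolding quadrant_count_def by auto
  qed
  then show ?thesis using be by auto
qed

end

end

lemma size_filter_Diff:
  assumes "\<And>p. Q p \<Longrightarrow> P p"
  shows "size {#p \<in># D. P p \<and> \<not> Q p#} + size (filter_mset Q D) = size (filter_mset P D)"
  using assms by (induction D) auto

lemma quadrant_count_cells:
  assumes grid: "\<And>s t. s \<in> G \<Longrightarrow> t \<in> G \<Longrightarrow> s < t \<Longrightarrow> quadrant_count D s t = quadrant_count D' s t"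
    and s: "s' \<in> G" "s \<in> G" "s' \<le> s" and t: "t \<in> G" "s < t"
  shows "size {#p \<in># D. ereal s' < fst p \<and> fst p \<le> ereal s \<and> ereal t < snd p#} =
      size {#p \<in># D'. ereal s' < fst p \<and> fst p \<le> ereal s \<and> ereal t < snd p#}"
    and "t' \<in> G \<Longrightarrow> t \<le> t' \<Longrightarrow>
      size {#p \<in># D. ereal s' < fst p \<and> fst p \<le> ereal s \<and> ereal t < snd p \<and> snd p \<le> ereal t'#} =
      size {#p \<in># D'. ereal s' < fst p \<and> fst p \<le> ereal s \<and> ereal t < snd p \<and> snd p \<le> ereal t'#}"
proof -
  let ?strip = "\<lambda>D t. size {#p \<in># D. ereal s' < fst p \<and> fst p \<le> ereal s \<and> ereal t < snd p#}"
  have strip: "size {#p \<in># D. ereal s' < fst p \<and> fst p \<le> ereal s \<and> ereal t < snd p#} + quadrant_count D s' t =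
      quadrant_count D s t" for D and t
  proof -
    have "{#p \<in># D. ereal s' < fst p \<and> fst p \<le> ereal s \<and> ereal t < snd p#} =
        {#p \<in># D. (fst p \<le> ereal s \<and> ereal t < snd p) \<and> \<not> (fst p \<le> ereal s' \<and> ereal t < snd p)#}"
      by (rule filter_mset_cong) (auto simp: not_le)
    then show ?thesis unfolding quadrant_count_def case_prod_beta
      using size_filter_Diff[of "\<lambda>p. fst p \<le> ereal s' \<and> ereal t < snd p" "\<lambda>p. fst p \<le> ereal s \<and> ereal t < snd p" D] s(3)
      by (metis (no_types, lifting) ereal_less_eq(3) order_trans)
  qed
  have eq: "?strip D t = ?strip D' t" if "t \<in> G" "s < t" for t
    using strip[of t D] strip[of t D'] grid[of s t] grid[of s' t] s that by simp
  then show "?strip D t = ?strip D' t" using t by blast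
  assume t': "t' \<in> G" "t \<le> t'"
  have cell: "size {#p \<in># D. ereal s' < fst p \<and> fst p \<le> ereal s \<and> ereal t < snd p \<and> snd p \<le> ereal t'#} + ?strip D t' = ?strip D t" for D
  proof -
    have "{#p \<in># D. ereal s' < fst p \<and> fst p \<le> ereal s \<and> ereal t < snd p \<and> snd p \<le> ereal t'#} =
        {#p \<in># D. (ereal s' < fst p \<and> fst p \<le> ereal s \<and> ereal t < snd p) \<and> \<not> (ereal s' < fst p \<and> fst p \<le> ereal s \<and> ereal t' < snd p)#}"
      by (rule filter_mset_cong) (auto simp: not_le)
    then show ?thesis
      using size_filter_Diff[of "\<lambda>p. ereal s' < fst p \<and> fst p \<le> ereal s \<and> ereal t' < snd p" "\<lambda>p. ereal s' < fst p \<and> fst p \<le> ereal s \<and> ereal t < snd p" D] t'(2)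
      by (metis (no_types, lifting) ereal_less_eq(3) le_less_trans)
  qed
  show "size {#p \<in># D. ereal s' < fst p \<and> fst p \<le> ereal s \<and> ereal t < snd p \<and> snd p \<le> ereal t'#} =
      size {#p \<in># D'. ereal s' < fst p \<and> fst p \<le> ereal s \<and> ereal t < snd p \<and> snd p \<le> ereal t'#}"
    using cell[of D] cell[of D'] eq[OF t] eq[of t'] t t' by simp
qed

lemma coordinate_dist_ereal: "coordinate_dist (ereal x) (ereal y) = ennreal \<bar>x - y\<bar>"
  by (simp add: coordinate_dist_def)

lemma point_dist_ereal:
  "point_dist (ereal b, ereal e) (ereal b', ereal e') = ennreal (max \<bar>b - b'\<bar> \<bar>e - e'\<bar>)"
  "point_dist (ereal b, \<infinity>) (ereal b', \<infinity>) = ennreal \<bar>b - b'\<bar>"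
proof -
  show "point_dist (ereal b, ereal e) (ereal b', ereal e') = ennreal (max \<bar>b - b'\<bar> \<bar>e - e'\<bar>)"
    by (simp add: point_dist_def coordinate_dist_ereal max_def ennreal_le_iff)
  show "point_dist (ereal b, \<infinity>) (ereal b', \<infinity>) = ennreal \<bar>b - b'\<bar>"
    unfolding point_dist_def fst_conv snd_conv coordinate_dist_ereal by (simp add: coordinate_dist_def max_def)
qed

text \<open>Cells of side \<open>\<delta>\<close> away from the diagonal contain equally many points of both diagrams; all other
  points lie within \<open>\<delta>\<close> of the diagonal.\<close>

lemma wasserstein_grid:
  fixes D D' :: "(ereal \<times> ereal) multiset" and \<theta> \<delta> :: real
  assumes \<delta>: "0 < \<delta>" and p: "1 \<le> p"
    and fin: "\<And>b e. (b, e) \<in># D + D' \<Longrightarrow> b \<noteq> - \<infinity> \<and> b \<noteq> \<infinity> \<and> b < e"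
    and grid: "\<And>i j. i < j \<Longrightarrow>
      quadrant_count D (\<theta> + \<delta> * of_int i) (\<theta> + \<delta> * of_int j) =
      quadrant_count D' (\<theta> + \<delta> * of_int i) (\<theta> + \<delta> * of_int j)"
  shows "wasserstein_dist p (\<lambda>P. enat (count D P)) (\<lambda>P. enat (count D' P)) \<le> ennreal (real (Suc (size D + size D')) * \<delta>)"
proof -
  define g where "g i = \<theta> + \<delta> * real_of_int i" for i :: int
  define idx where "idx x = \<lceil>(real_of_ereal x - \<theta>) / \<delta>\<rceil>" for x
  define q where "q P = (idx (fst P), if snd P = \<infinity> then None else Some (idx (snd P)))" for P :: "ereal \<times> ereal"
  define F where "F = range (\<lambda>i. (i, None :: int option)) \<union> {(i, Some j) | i j. i + 2 \<le> j}"
  have g_less: "g i < g j \<longleftrightarrow> i < j" "g i \<le> g j \<longleftrightarrow> i \<le> j" for i j using \<delta> by (simp_all add: g_def)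
  have g_step: "g i = g (i - 1) + \<delta>" "g (i + 1) = g (i - 1) + 2 * \<delta>" for i by (simp_all add: g_def algebra_simps)
  have idx: "idx (ereal x) = i \<longleftrightarrow> g (i - 1) < x \<and> x \<le> g i" for x i
  proof -
    have "idx (ereal x) = i \<longleftrightarrow> real_of_int i - 1 < (x - \<theta>) / \<delta> \<and> (x - \<theta>) / \<delta> \<le> real_of_int i"
      unfolding idx_def real_of_ereal.simps by (rule ceiling_eq_iff)
    then show ?thesis unfolding pos_less_divide_eq[OF \<delta>] pos_divide_le_eq[OF \<delta>] g_def by (auto simp: algebra_simps)
  qed
  have idx_self: "g (idx (ereal x) - 1) < x" "x \<le> g (idx (ereal x))" for x using idx by blast+
  have pt_cases: "(\<exists>b e. P = (ereal b, ereal e) \<and> b < e) \<or> (\<exists>b. P = (ereal b, \<infinity>))" if "P \<in># D + D'" for P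
  proof -
    obtain b e where P: "P = (b, e)" by (cases P)
    then have "b \<noteq> - \<infinity> \<and> b \<noteq> \<infinity> \<and> b < e" using fin that by blast
    then show ?thesis unfolding P by (cases b; cases e) auto
  qed
  have sub: "P \<in># D + D'" if "P \<in># X" "X = D \<or> X = D'" for P X using that by auto
  have G: "quadrant_count D s t = quadrant_count D' s t" if st: "s \<in> range g" "t \<in> range g" "s < t" for s t
  proof -
    obtain i j where ij: "s = g i" "t = g j" using st(1,2) by blast
    then have "i < j" using st(3) g_less by simp
    then show ?thesis unfolding ij g_def by (rule grid)
  qed
  let ?B = "\<lambda>P. enat (count D P)" and ?B' = "\<lambda>P. enat (count D' P)"
  have "\<exists>\<sigma>. is_matching ?B ?B' \<sigma> \<and> finite (completed_matching ?B ?B' \<sigma>) \<and>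
     card (completed_matching ?B ?B' \<sigma>) \<le> size D + size D' \<and> (\<forall>x\<in>completed_matching ?B ?B' \<sigma>. pair_dist x \<le> ennreal \<delta>)"
  proof (rule matching_exists[where q = q and F = F])
    fix c assume "c \<in> F"
    then consider i where "c = (i, None)" | i j where "c = (i, Some j)" "i + 2 \<le> j" unfolding F_def by blast
    then show "size {#P \<in># D. q P = c#} = size {#P \<in># D'. q P = c#}"
    proof cases
      case (1 i)
      define E where "E = insert (g (i + 1)) (real_of_ereal ` snd ` set_mset (D + D'))"
      have "finite E" by (simp add: E_def)
      define j where "j = idx (ereal (Max E))"
      have E: "x \<le> g j" if "x \<in> E" for x
        using Max_ge[OF \<open>finite E\<close> that] idx_self(2)[of "Max E"] unfolding j_def by linarith
      have "g (i + 1) \<le> g j" by (rule E) (simp add: E_def)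
      then have ij: "g i < g j" using g_less by simp
      have cell: "q P = c \<longleftrightarrow> ereal (g (i - 1)) < fst P \<and> fst P \<le> ereal (g i) \<and> ereal (g j) < snd P" if P: "P \<in># D + D'" for P
        using pt_cases[OF P]
      proof (elim disjE exE conjE)
        fix b e assume Pe: "P = (ereal b, ereal e)"
        then have "e \<in> E" using P by (force simp: E_def)
        from E[OF this] show ?thesis using Pe 1 by (simp add: q_def)
      qed (use 1 in \<open>simp add: q_def idx\<close>)
      have filt: "{#P \<in># X. q P = c#} = {#P \<in># X. ereal (g (i - 1)) < fst P \<and> fst P \<le> ereal (g i) \<and> ereal (g j) < snd P#}"
        if "X = D \<or> X = D'" for X by (rule filter_mset_cong[OF refl]) (rule cell[OF sub[OF _ that]])
      show ?thesis unfolding filt[OF disjI1[OF refl]] filt[OF disjI2[OF refl]]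
        by (rule quadrant_count_cells(1)[of "range g"]) (use G ij g_less in auto)
    next
      case (2 i j)
      have cell: "q P = c \<longleftrightarrow> ereal (g (i - 1)) < fst P \<and> fst P \<le> ereal (g i) \<and> ereal (g (j - 1)) < snd P \<and> snd P \<le> ereal (g j)"
        if P: "P \<in># D + D'" for P
        using pt_cases[OF P]
      proof (elim disjE exE conjE)
        fix b e assume Pe: "P = (ereal b, ereal e)"
        show ?thesis using idx[of b i] idx[of e j] 2 by (simp add: Pe q_def)
      qed (use 2 in \<open>simp add: q_def\<close>)
      have filt: "{#P \<in># X. q P = c#} = {#P \<in># X. ereal (g (i - 1)) < fst P \<and> fst P \<le> ereal (g i) \<and> ereal (g (j - 1)) < snd P \<and> snd P \<le> ereal (g j)#}"
        if "X = D \<or> X = D'" for X by (rule filter_mset_cong[OF refl]) (rule cell[OF sub[OF _ that]])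
      show ?thesis unfolding filt[OF disjI1[OF refl]] filt[OF disjI2[OF refl]]
        by (rule quadrant_count_cells(2)[of "range g"]) (use G 2(2) g_less in auto)
    qed
  next
    fix P assume P: "P \<in># D + D'" "q P \<notin> F"
    have "(\<exists>b e. P = (ereal b, ereal e) \<and> b < e)" using pt_cases[OF P(1)] P(2) by (auto simp: q_def F_def)
    then obtain b e where be: "P = (ereal b, ereal e)" "b < e" by blast
    have "idx (ereal e) \<le> idx (ereal b) + 1" using P(2) be by (auto simp: q_def F_def not_le)
    then have "g (idx (ereal e)) \<le> g (idx (ereal b) + 1)" using g_less by simp
    then have "e - b \<le> 2 * \<delta>" using idx_self(2)[of e] idx_self(1)[of b] g_step(2)[of "idx (ereal b)"] by linarith
    then have "\<bar>b - (b + e) / 2\<bar> \<le> \<delta>" "\<bar>e - (b + e) / 2\<bar> \<le> \<delta>" using be(2) unfolding abs_le_iff by (simp_all add: field_simps)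
    moreover have "diagonal_image P = (ereal ((b + e) / 2), ereal ((b + e) / 2))" by (simp add: diagonal_image_def be)
    ultimately show "finite_point P \<and> point_dist P (diagonal_image P) \<le> ennreal \<delta>"
      unfolding be(1) by (simp add: finite_point_def point_dist_ereal ennreal_leI)
  next
    fix P P' assume P: "P \<in># D" "P' \<in># D'" "q P = q P'"
    have near: "\<bar>x - y\<bar> \<le> \<delta>" if "idx (ereal x) = idx (ereal y)" for x y
      using idx_self[of x] idx_self[of y] g_step(1)[of "idx (ereal y)"] unfolding that by linarith
    have "P \<in># D + D'" "P' \<in># D + D'" using P by auto
    from pt_cases[OF this(1)] pt_cases[OF this(2)]
    show "point_dist P P' \<le> ennreal \<delta> \<and> (fst P = - \<infinity> \<longleftrightarrow> fst P' = - \<infinity>) \<and> (snd P = \<infinity> \<longleftrightarrow> snd P' = \<infinity>)"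
      using P(3) near by (elim disjE exE conjE) (auto simp: q_def point_dist_ereal intro!: ennreal_leI)
  qed
  then obtain \<sigma> where \<sigma>: "is_matching ?B ?B' \<sigma>" "finite (completed_matching ?B ?B' \<sigma>)"
     "card (completed_matching ?B ?B' \<sigma>) \<le> size D + size D'"
     "\<forall>x\<in>completed_matching ?B ?B' \<sigma>. pair_dist x \<le> ennreal \<delta>" by blast
  have "lp_norm p (completed_matching ?B ?B' \<sigma>) pair_dist \<le> ennreal (real (Suc (size D + size D')) * \<delta>)"
    by (rule lp_norm_le[OF p \<sigma>(2,3) bspec[OF \<sigma>(4)] less_imp_le[OF \<delta>]])
  then show ?thesis unfolding wasserstein_dist_def
    by (rule INF_lower2[rotated]) (simp add: \<sigma>(1))
qed

lemma grid_avoiding_finite_set: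
  fixes C :: "real set"
  assumes C: "finite C" and \<delta>: "0 < \<delta>"
  obtains \<theta> \<kappa> where "0 < \<kappa>" "\<And>c i. c \<in> C \<Longrightarrow> \<kappa> \<le> \<bar>c - (\<theta> + \<delta> * of_int i)\<bar>"
proof -
  have "countable (\<Union>c\<in>C. range (\<lambda>i::int. c - \<delta> * i))" by (intro countable_UN countable_finite[OF C]) auto
  then have "(\<Union>c\<in>C. range (\<lambda>i::int. c - \<delta> * i)) \<noteq> UNIV" using uncountable_UNIV_real by metis
  then obtain \<theta> where \<theta>: "\<theta> \<notin> (\<Union>c\<in>C. range (\<lambda>i::int. c - \<delta> * i))" by blast
  define S where "S = (+) \<theta> ` (*\<^sub>R) \<delta> ` (\<int> :: real set)"
  have "closed S" unfolding S_def by (intro closed_translation closed_scaling closed_Ints)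
  moreover have "C \<inter> S = {}"
  proof (rule equals0I)
    fix c assume "c \<in> C \<inter> S"
    then obtain i :: int where i: "c \<in> C" "c = \<theta> + \<delta> * i" by (auto simp: S_def elim!: Ints_cases)
    then have "\<theta> = c - \<delta> * i" by simp
    then show False using \<theta> i(1) by blast
  qed
  ultimately obtain \<kappa> where \<kappa>: "0 < \<kappa>" "\<forall>x\<in>C. \<forall>y\<in>S. \<kappa> \<le> dist x y"
    using separate_compact_closed[OF finite_imp_compact[OF C], of S] by blast
  have mem: "\<theta> + \<delta> * of_int i \<in> S" for i :: int unfolding S_def by (intro image_eqI[of _ _ "\<delta> * of_int i"] image_eqI[of _ _ "of_int i"]) auto
  show thesis
  proof (rule that[OF \<kappa>(1)])
    fix c and i :: int assume "c \<in> C"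
    then show "\<kappa> \<le> \<bar>c - (\<theta> + \<delta> * i)\<bar>" using \<kappa>(2) mem[of i] by (auto simp: dist_real_def)
  qed
qed

context o_minimal_structure
begin

lemma PH_continuous_at:
  fixes M :: "'a::euclidean_space set" and K :: "'k::field itself"
  assumes M: "definable (\<lambda>x. x \<in> M)" "compact M" and p: "1 \<le> p" and \<epsilon>: "0 < \<epsilon>"
  shows "\<exists>\<eta>>0. \<forall>w. dist w v < \<eta> \<longrightarrow> wasserstein_dist p (PH K k M (\<lambda>x. v \<bullet> x)) (PH K k M (\<lambda>x. w \<bullet> x)) < \<epsilon>"
proof -
  obtain L where L: "\<And>v. \<exists>D. diagram_of (height_rank K k M v) D \<and> size D \<le> L" using height_diagram_exists[OF M] by blast
  obtain \<rho> where \<rho>: "0 < \<rho>" "\<And>x. x \<in> M \<Longrightarrow> norm x \<le> \<rho>" by (rule bounded_norm[OF M]) (rule that; blast)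
  obtain x where x: "0 < x" "x < \<epsilon>" using dense[OF \<epsilon>] by blast
  define r where "r = enn2real x"
  have "x < \<infinity>" using x(2) by (rule less_le_trans) simp
  then have r: "0 < r" "ennreal r < \<epsilon>" using x by (simp_all add: r_def enn2real_positive_iff)
  define \<delta> where "\<delta> = r / real (Suc (2 * L))"
  have \<delta>: "0 < \<delta>" "real (Suc (2 * L)) * \<delta> = r" using r(1) by (simp_all add: \<delta>_def)
  obtain \<theta> \<kappa>0 where \<kappa>0: "0 < \<kappa>0" "\<And>c i. c \<in> critical_heights M v \<Longrightarrow> \<kappa>0 \<le> \<bar>c - (\<theta> + \<delta> * of_int i)\<bar>"
    by (rule grid_avoiding_finite_set[OF finite_critical_heights[OF M, of v] \<delta>(1)]) (rule that; blast)
  define \<kappa> where "\<kappa> = min (\<kappa>0 / 2) (\<delta> / 2)"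
  have \<kappa>: "0 < \<kappa>" "\<kappa> < \<kappa>0" "2 * \<kappa> \<le> \<delta>" using \<kappa>0(1) \<delta>(1) by (auto simp: \<kappa>_def)
  have gap: "{\<theta> + \<delta> * of_int i - \<kappa><..\<theta> + \<delta> * of_int i + \<kappa>} \<inter> critical_heights M v = {}" for i
    using \<kappa>0(2)[of _ i] \<kappa>(2) by (force simp: disjoint_iff)
  show ?thesis
  proof (intro exI[of _ "\<kappa> / \<rho>"] conjI allI impI)
    show "0 < \<kappa> / \<rho>" using \<kappa> \<rho> by simp
    fix w assume "dist w v < \<kappa> / \<rho>"
    then have w: "dist w v * \<rho> \<le> \<kappa>" using \<rho>(1) by (simp add: pos_less_divide_eq)
    obtain D where D: "diagram_of (height_rank K k M v) D" "size D \<le> L" using L by blast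
    obtain D' where D': "diagram_of (height_rank K k M w) D'" "size D' \<le> L" using L by blast
    have "wasserstein_dist p (\<lambda>P. enat (count D P)) (\<lambda>P. enat (count D' P)) \<le> ennreal (real (Suc (size D + size D')) * \<delta>)"
    proof (rule wasserstein_grid[OF \<delta>(1) p])
      fix b e assume be: "(b, e) \<in># D + D'"
      then have "b < e" using D(1) D'(1) unfolding diagram_of_def by auto
      then show "b \<noteq> - \<infinity> \<and> b \<noteq> \<infinity> \<and> b < e"
        using be diagram_of_birth_finite[OF M D(1), of b e] diagram_of_birth_finite[OF M D'(1), of b e] by auto
    next
      fix i j :: int assume ij: "i < j"
      then have "\<delta> * (real_of_int i + 1) \<le> \<delta> * real_of_int j" using \<delta>(1) by (intro mult_left_mono) auto
      then have sep: "\<theta> + \<delta> * i + \<kappa> \<le> \<theta> + \<delta> * j - \<kappa>" using \<kappa>(3) by (simp add: algebra_simps)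
      then have le: "\<theta> + \<delta> * i \<le> \<theta> + \<delta> * j" using \<kappa>(1) by linarith
      have "height_rank K k M w (\<theta> + \<delta> * i) (\<theta> + \<delta> * j) = height_rank K k M v (\<theta> + \<delta> * i) (\<theta> + \<delta> * j)"
        by (rule height_rank_stable[OF M \<rho>(2) w _ sep gap gap]) (use \<kappa> in auto)
      then show "quadrant_count D (\<theta> + \<delta> * i) (\<theta> + \<delta> * j) = quadrant_count D' (\<theta> + \<delta> * i) (\<theta> + \<delta> * j)"
        using D(1) D'(1) le unfolding diagram_of_def by simp
    qed
    also have "\<dots> \<le> ennreal (real (Suc (2 * L)) * \<delta>)" using D(2) D'(2) \<delta>(1) by (intro ennreal_leI mult_right_mono) auto
    also have "\<dots> < \<epsilon>" unfolding \<delta>(2) by (rule r(2))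
    finally show "wasserstein_dist p (PH K k M (\<lambda>x. v \<bullet> x)) (PH K k M (\<lambda>x. w \<bullet> x)) < \<epsilon>"
      by (simp add: PH_height[OF M D(1)] PH_height[OF M D'(1)])
  qed
qed

lemma PH_in_Dgm:
  fixes M :: "'a::euclidean_space set" and K :: "'k::field itself"
  assumes M: "definable (\<lambda>x. x \<in> M)" "compact M"
  shows "PH K k M (\<lambda>x. v \<bullet> x) \<in> Dgm"
proof -
  obtain D where D: "diagram_of (height_rank K k M v) D" using height_diagram_exists[OF M] by blast
  show ?thesis unfolding PH_height[OF M D] using D by (intro Dgm_finite_diagram) (auto simp: diagram_of_def)
qed

end


theorem lemma4p8:
  fixes \<O> :: "nat \<Rightarrow> real list set set"
    and M :: "(real ^ 'n) set"
    and p :: ennreal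
  assumes "o_minimal_structure \<O>"
    and "constructible_set \<O> M"
    and "1 \<le> p"
  shows "continuous_map (top_of_set (sphere (0 :: real ^ 'n) 1))
           (product_topology (\<lambda>_. Dgm_topology p) {..<CARD('n)})
           (PHT TYPE('k :: field) M)"
proof -
  interpret o_minimal_structure \<O> by (rule assms(1))
  have M: "definable (\<lambda>x. x \<in> M)" "compact M"
    using assms(2) definable_set_imp_definable by (auto simp: constructible_set_def)
  show ?thesis unfolding continuous_map_componentwise
  proof (intro conjI ballI)
    show "PHT TYPE('k) M ` topspace (top_of_set (sphere 0 1)) \<subseteq> extensional {..<CARD('n)}"
      by (auto simp: PHT_def)
    fix k assume "k \<in> {..<CARD('n)}"
    then have PHT: "PHT TYPE('k) M v k = PH TYPE('k) k M (\<lambda>x. v \<bullet> x)" for v by (simp add: PHT_def)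
    show "continuous_map (top_of_set (sphere 0 1)) (Dgm_topology p) (\<lambda>v. PHT TYPE('k) M v k)"
      unfolding continuous_map_def PHT topspace_euclidean_subtopology
    proof (intro conjI allI impI)
      show "(\<lambda>v. PH TYPE('k) k M (\<lambda>x. v \<bullet> x)) \<in> sphere 0 1 \<rightarrow> topspace (Dgm_topology p)"
        by (simp add: PH_in_Dgm[OF M])
      fix U assume U: "openin (Dgm_topology p) U"
      show "openin (top_of_set (sphere 0 1)) {v \<in> sphere 0 1. PH TYPE('k) k M (\<lambda>x. v \<bullet> x) \<in> U}"
        unfolding openin_euclidean_subtopology_iff
      proof (intro conjI ballI)
        fix v assume "v \<in> {v \<in> sphere 0 1. PH TYPE('k) k M (\<lambda>x. v \<bullet> x) \<in> U}"
        then obtain \<epsilon> where \<epsilon>: "0 < \<epsilon>"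
          "\<And>B. B \<in> Dgm \<Longrightarrow> wasserstein_dist p (PH TYPE('k) k M (\<lambda>x. v \<bullet> x)) B < \<epsilon> \<Longrightarrow> B \<in> U"
          using U unfolding openin_Dgm_topology by blast
        obtain \<eta> where "0 < \<eta>" "\<And>w. dist w v < \<eta> \<Longrightarrow>
            wasserstein_dist p (PH TYPE('k) k M (\<lambda>x. v \<bullet> x)) (PH TYPE('k) k M (\<lambda>x. w \<bullet> x)) < \<epsilon>"
          using PH_continuous_at[OF M assms(3) \<epsilon>(1)] by blast
        then show "\<exists>\<eta>>0. \<forall>w\<in>sphere 0 1. dist w v < \<eta> \<longrightarrow> w \<in> {v \<in> sphere 0 1. PH TYPE('k) k M (\<lambda>x. v \<bullet> x) \<in> U}"
          using \<epsilon>(2) PH_in_Dgm[OF M] by blast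
      qed auto
    qed
  qed
qed

end
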